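(* Let $X$ be a smooth projective toric variety over a field $\mathbb{K}$ with total coordinate ring $S$, and let $I=\langle f_1,\ldots,f_s\rangle\subseteq S$ be a nonzero ideal generated by nonzero homogeneous elements $f_i$ of degrees $\mathbf p_i=\deg f_i\in\operatorname{Pic}X$. There exists a degree $\mathbf a\in\operatorname{Pic} X$, depending only on $I$, such that for each integer $n>0$ and each pair of degrees $\mathbf q_1,\mathbf q_2\in\operatorname{Pic} X$ satisfying $\mathbf q_1\geq\mathbf p_i\geq\mathbf q_2$ for all $i$, we have $$ n\mathbf q_1+\mathbf a+\operatorname{reg} S \subseteq \operatorname{reg}(I^n) \subseteq n\mathbf q_2+\operatorname{Nef} X. $$
   Context: $X$ is a smooth projective toric variety over a field $\mathbb{K}$, determined by a fan $\Sigma$. Its total coordinate (Cox) ring $S$ is the polynomial ring over $\mathbb{K}$ with one variable $x_\rho$ for each ray $\rho$ of $\Sigma$, graded by $\operatorname{Pic} X$ with $\deg x_\rho$ the class of the torus-invariant prime divisor $D_\rho$. The irrelevant ideal is $B=\langle \prod_{\rho\not\subset\sigma}x_\rho : \sigma\in\Sigma\rangle\subset S$, and $H^i_B(M)$ is local cohomology with support in $B$. $\operatorname{Nef}X\subset\operatorname{Pic}X$ is the monoid of classes of numerically effective divisors, and $\mathbf C=(\mathbf c_1,\dots,\mathbf c_r)$ are its minimal monoid generators. For $\lambda\in\mathbb{Z}^r$ write $\lambda\cdot\mathbf C=\lambda_1\mathbf c_1+\dots+\lambda_r\mathbf c_r$ and $|\lambda|=\lambda_1+\dots+\lambda_r$.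 For $\mathbf a,\mathbf b\in\operatorname{Pic}X$, $\mathbf a\le\mathbf b$ means $\mathbf b-\mathbf a\in\operatorname{Nef}X$. $\mathbb{N}$ includes $0$. Multigraded regularity: for $\mathbf d\in\operatorname{Pic}X$, a graded $S$-module $M$ is $\mathbf d$-regular if (1) $H^i_B(M)_{\mathbf b}=0$ for all $i>0$ and all $\mathbf b\in\bigcup_{\lambda\in\mathbb{N}^r,\,|\lambda|=i-1}(\mathbf d-\lambda\cdot\mathbf C+\operatorname{Nef}X)$; and (2) $H^0_B(M)_{\mathbf b}=0$ for all $\mathbf b\in\bigcup_j(\mathbf d+\mathbf c_j+\operatorname{Nef}X)$. $\operatorname{reg}M\subseteq\operatorname{Pic}X$ is the set of $\mathbf d$ such that $M$ is $\mathbf d$-regular. "Depending only on $I$" means in particular that $\mathbf a$ does not depend on $n$, $\mathbf q_1$, $\mathbf q_2$. *)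

theory Defs
  imports
    "HOL-Algebra.Ideal_Product"
    "HOL-Library.Poly_Mapping"
    "HOL-Library.Countable_Set"
    Complex_Main
begin

section \<open>Smooth projective fans\<close>

text \<open>
  The lattice of one-parameter subgroups is \<open>\<int>\<^sup>n\<close>, realised as the integer functions on \<open>nat\<close> that
  vanish from \<open>n\<close> on; this includes \<open>n = 0\<close>, where the variety is a point.  The cones of a smooth
  fan are simplicial, so a cone is recorded by its set of rays and its faces are the subsets of
  this set; \<open>ray_gen\<close> gives the primitive lattice generator of each ray.
\<close>

record 'v fan =
  lattice_rank :: nat
  rays :: "'v set"
  ray_gen :: "'v \<Rightarrow> nat \<Rightarrow> int"
  cones :: "'v set set"

definition lattice :: "nat \<Rightarrow> (nat \<Rightarrow> int) set" where
  "lattice n = {x. \<forall>i\<ge>n. x i = 0}"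

definition lattice_basis :: "nat \<Rightarrow> (nat \<Rightarrow> int) set \<Rightarrow> bool" where
  "lattice_basis n B \<longleftrightarrow> finite B \<and> B \<subseteq> lattice n \<and>
     (\<forall>x\<in>lattice n. \<exists>!c. (\<forall>b. b \<notin> B \<longrightarrow> c b = 0) \<and> (\<forall>i. x i = (\<Sum>b\<in>B. c b * b i)))"

definition cone_of :: "'v fan \<Rightarrow> 'v set \<Rightarrow> (nat \<Rightarrow> real) set" where
  "cone_of X \<sigma> = {x. \<exists>c. (\<forall>\<rho>\<in>\<sigma>. c \<rho> \<ge> 0) \<and>
     (\<forall>i. x i = (\<Sum>\<rho>\<in>\<sigma>. c \<rho> * real_of_int (ray_gen X \<rho> i)))}"

definition smooth_fan :: "'v fan \<Rightarrow> bool" where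
  "smooth_fan X \<longleftrightarrow>
     finite (rays X) \<and>
     {} \<in> cones X \<and> (\<forall>\<rho>\<in>rays X. {\<rho>} \<in> cones X) \<and>
     (\<forall>\<sigma>\<in>cones X. \<sigma> \<subseteq> rays X \<and> (\<forall>\<tau>. \<tau> \<subseteq> \<sigma> \<longrightarrow> \<tau> \<in> cones X)) \<and>
     (\<forall>\<sigma>\<in>cones X. inj_on (ray_gen X) \<sigma> \<and>
        (\<exists>B. lattice_basis (lattice_rank X) B \<and> ray_gen X ` \<sigma> \<subseteq> B)) \<and>
     (\<forall>\<sigma>\<in>cones X. \<forall>\<tau>\<in>cones X. cone_of X \<sigma> \<inter> cone_of X \<tau> = cone_of X (\<sigma> \<inter> \<tau>))"

definition complete_fan :: "'v fan \<Rightarrow> bool" where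
  "complete_fan X \<longleftrightarrow> (\<Union>\<sigma>\<in>cones X. cone_of X \<sigma>) = {x. \<forall>i\<ge>lattice_rank X. x i = 0}"

definition max_cones :: "'v fan \<Rightarrow> 'v set set" where
  "max_cones X = {\<sigma>\<in>cones X. \<forall>\<tau>\<in>cones X. \<not> \<sigma> \<subset> \<tau>}"

text \<open>A character of the torus is a vector \<open>m\<close>, of which only the entries below \<open>n\<close> matter.\<close>

definition pairing :: "'v fan \<Rightarrow> (nat \<Rightarrow> int) \<Rightarrow> 'v \<Rightarrow> int" where
  "pairing X m \<rho> = (\<Sum>i<lattice_rank X. m i * ray_gen X \<rho> i)"

text \<open>Torus-invariant divisors \<open>\<Sum>\<^sub>\<rho> a\<^sub>\<rho> D\<^sub>\<rho>\<close>, also used as exponents of Laurent monomials.\<close>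

definition divisors :: "'v fan \<Rightarrow> ('v \<Rightarrow>\<^sub>0 int) set" where
  "divisors X = {D. Poly_Mapping.keys D \<subseteq> rays X}"

text \<open>
  On a complete toric variety, \<open>D\<close> is ample iff its support function, which takes the value
  \<open>- a\<^sub>\<rho>\<close> at the generator of \<open>\<rho>\<close>, is strictly convex (in the convention where it is the minimum
  of its linear pieces \<open>m\<close>).
\<close>

definition ample_divisor :: "'v fan \<Rightarrow> ('v \<Rightarrow>\<^sub>0 int) \<Rightarrow> bool" where
  "ample_divisor X D \<longleftrightarrow> D \<in> divisors X \<and>
     (\<forall>\<sigma>\<in>max_cones X. \<exists>m.
        (\<forall>\<rho>\<in>\<sigma>. pairing X m \<rho> = - Poly_Mapping.lookup D \<rho>) \<and>
        (\<forall>\<rho>\<in>rays X - \<sigma>. pairing X m \<rho> > - Poly_Mapping.lookup D \<rho>))"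

definition smooth_projective_fan :: "'v fan \<Rightarrow> bool" where
  "smooth_projective_fan X \<longleftrightarrow> smooth_fan X \<and> complete_fan X \<and> (\<exists>D. ample_divisor X D)"

section \<open>The Picard group\<close>

text \<open>
  The group \<open>'p\<close> together with the class map \<open>cl\<close> is the Picard group of \<open>X\<close>: the cokernel of
  the map from characters to torus-invariant divisors.
\<close>

definition picard_group :: "'v fan \<Rightarrow> (('v \<Rightarrow>\<^sub>0 int) \<Rightarrow> 'p::ab_group_add) \<Rightarrow> bool" where
  "picard_group X cl \<longleftrightarrow>
     (\<forall>D\<in>divisors X. \<forall>E\<in>divisors X. cl (D + E) = cl D + cl E) \<and>
     cl ` divisors X = UNIV \<and>
     (\<forall>D\<in>divisors X. cl D = 0 \<longleftrightarrow>
        (\<exists>m. \<forall>\<rho>\<in>rays X. Poly_Mapping.lookup D \<rho> = pairing X m \<rho>))"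

definition nat_mult :: "nat \<Rightarrow> 'p::ab_group_add \<Rightarrow> 'p" (infixr \<open>\<odot>\<close> 75) where
  "n \<odot> q = (\<Sum>_<n. q)"

definition ample :: "'v fan \<Rightarrow> (('v \<Rightarrow>\<^sub>0 int) \<Rightarrow> 'p::ab_group_add) \<Rightarrow> 'p \<Rightarrow> bool" where
  "ample X cl d \<longleftrightarrow> (\<exists>D. ample_divisor X D \<and> cl D = d)"

section \<open>The total coordinate ring\<close>

type_synonym ('v, 'k) laurent = "('v \<Rightarrow>\<^sub>0 int) \<Rightarrow>\<^sub>0 'k"

text \<open>
  The Cox ring is the subring of the Laurent polynomials (with multiplication of \<open>poly_mapping\<close>)
  spanned by the monomials in the ray variables with nonnegative exponents.
\<close>

definition cox_ring :: "'v fan \<Rightarrow> ('v, 'k::field) laurent ring" where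
  "cox_ring X = \<lparr>
     carrier = {p. \<forall>m\<in>Poly_Mapping.keys p. m \<in> divisors X \<and> (\<forall>\<rho>. Poly_Mapping.lookup m \<rho> \<ge> 0)},
     mult = (*), one = 1, zero = 0, add = (+)\<rparr>"

definition degree_part ::
  "(('v \<Rightarrow>\<^sub>0 int) \<Rightarrow> 'p) \<Rightarrow> ('v, 'k::field) laurent set \<Rightarrow> 'p \<Rightarrow> ('v, 'k) laurent set" where
  "degree_part cl M d = {p\<in>M. \<forall>m\<in>Poly_Mapping.keys p. cl m = d}"

definition homogeneous_ideal ::
  "'v fan \<Rightarrow> (('v \<Rightarrow>\<^sub>0 int) \<Rightarrow> 'p) \<Rightarrow> ('v, 'k::field) laurent set \<Rightarrow> bool" where
  "homogeneous_ideal X cl I \<longleftrightarrow> ideal I (cox_ring X) \<and>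
     I = genideal (cox_ring X) (\<Union>d. degree_part cl I d)"

text \<open>The generator \<open>\<Prod> x\<^sub>\<rho>\<close> (\<open>\<rho>\<close> not in \<open>\<sigma>\<close>) of the irrelevant ideal.\<close>

definition irrelevant_gen :: "'v fan \<Rightarrow> 'v set \<Rightarrow> ('v, 'k::field) laurent" where
  "irrelevant_gen X \<sigma> =
     (\<Prod>\<rho>\<in>rays X - \<sigma>. Poly_Mapping.single (Poly_Mapping.single \<rho> 1) 1)"

definition irrelevant_ideal :: "'v fan \<Rightarrow> ('v, 'k::field) laurent set" where
  "irrelevant_ideal X = genideal (cox_ring X) (irrelevant_gen X ` cones X)"

section \<open>Curves, intersection numbers and the nef monoid\<close>

text \<open>
  For smooth \<open>X\<close> the irreducible closed subvarieties of \<open>X\<close> correspond to the homogeneous prime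
  ideals of the Cox ring that do not contain the irrelevant ideal (the torus by which one divides
  is connected); the subvariety of \<open>P\<close> is contained in that of \<open>Q\<close> iff \<open>Q \<subseteq> P\<close>.
\<close>

definition subvariety ::
  "'v fan \<Rightarrow> (('v \<Rightarrow>\<^sub>0 int) \<Rightarrow> 'p) \<Rightarrow> ('v, 'k::field) laurent set \<Rightarrow> bool" where
  "subvariety X cl P \<longleftrightarrow> primeideal P (cox_ring X) \<and> homogeneous_ideal X cl P \<and>
     \<not> irrelevant_ideal X \<subseteq> P"

text \<open>A curve is an irreducible closed subvariety of Krull dimension one.\<close>

definition curve ::
  "'v fan \<Rightarrow> (('v \<Rightarrow>\<^sub>0 int) \<Rightarrow> 'p) \<Rightarrow> ('v, 'k::field) laurent set \<Rightarrow> bool" where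
  "curve X cl P \<longleftrightarrow> subvariety X cl P \<and>
     (\<exists>Q. subvariety X cl Q \<and> P \<subset> Q) \<and>
     \<not> (\<exists>Q R. subvariety X cl Q \<and> subvariety X cl R \<and> P \<subset> Q \<and> Q \<subset> R)"

definition dim_over_field :: "('v, 'k::field) laurent set \<Rightarrow> nat" where
  "dim_over_field V = vector_space.dim (\<lambda>c p. Poly_Mapping.single 0 c * p) V"

text \<open>
  \<open>hilbert_function X cl P d\<close> is the dimension of the degree \<open>d\<close> part of the quotient of the Cox
  ring by \<open>P\<close>; the graded parts of the Cox ring of a complete fan are finite-dimensional.
\<close>

definition hilbert_function ::
  "'v fan \<Rightarrow> (('v \<Rightarrow>\<^sub>0 int) \<Rightarrow> 'p) \<Rightarrow> ('v, 'k::field) laurent set \<Rightarrow> 'p \<Rightarrow> int" where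
  "hilbert_function X cl P d =
     int (dim_over_field (degree_part cl (carrier (cox_ring X) :: ('v, 'k) laurent set) d)) -
     int (dim_over_field (degree_part cl P d))"

text \<open>
  The intersection number of the class \<open>d\<close> with the curve \<open>C\<close> defined by \<open>P\<close> is the degree of
  \<open>O(d)\<close> restricted to \<open>C\<close>.  By Riemann-Roch on \<open>C\<close> it equals
  \<open>\<chi>(O\<^sub>C(j A + d)) - \<chi>(O\<^sub>C(j A))\<close> for every \<open>A\<close> and \<open>j\<close>; for ample \<open>A\<close> and large \<open>j\<close>, Serre
  vanishing identifies these Euler characteristics with values of the Hilbert function of \<open>P\<close>.
  So for each curve and each \<open>d\<close> exactly one \<open>k\<close> has the following property.
\<close>

definition intersection_number ::
  "'v fan \<Rightarrow> (('v \<Rightarrow>\<^sub>0 int) \<Rightarrow> 'p::ab_group_add) \<Rightarrow> ('v, 'k::field) laurent set \<Rightarrow>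
     'p \<Rightarrow> int \<Rightarrow> bool" where
  "intersection_number X cl P d k \<longleftrightarrow>
     (\<forall>A. ample X cl A \<longrightarrow>
        (\<forall>\<^sub>F j in sequentially.
           hilbert_function X cl P (j \<odot> A + d) - hilbert_function X cl P (j \<odot> A) = k))"

text \<open>The first argument only carries the type of the ground field.\<close>

definition Nef ::
  "'k::field itself \<Rightarrow> 'v fan \<Rightarrow> (('v \<Rightarrow>\<^sub>0 int) \<Rightarrow> 'p::ab_group_add) \<Rightarrow> 'p set" where
  "Nef K X cl = {d. \<forall>(P :: ('v, 'k) laurent set) k.
     curve X cl P \<and> intersection_number X cl P d k \<longrightarrow> k \<ge> 0}"

definition generated_monoid :: "'p::ab_group_add set \<Rightarrow> 'p set" where
  "generated_monoid C = {\<Sum>c\<in>C. \<mu> c \<odot> c | \<mu>. True}"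

definition minimal_generators :: "'p::ab_group_add list \<Rightarrow> 'p set \<Rightarrow> bool" where
  "minimal_generators cs N \<longleftrightarrow> distinct cs \<and> generated_monoid (set cs) = N \<and>
     (\<forall>C. C \<subset> set cs \<longrightarrow> generated_monoid C \<noteq> N)"

section \<open>Local cohomology\<close>

text \<open>
  Modules are graded submodules \<open>M\<close> of the Laurent polynomial ring, such as ideals of the Cox
  ring.  The localization of \<open>M\<close> at a monomial \<open>g\<close> then lies in the Laurent polynomial ring too.
\<close>

definition localization ::
  "('v, 'k::field) laurent set \<Rightarrow> ('v, 'k) laurent \<Rightarrow> ('v, 'k) laurent set" where
  "localization M g = {p. \<exists>k. g ^ k * p \<in> M}"

text \<open>
  Local cohomology with support in the irrelevant ideal is computed by the Cech complex on its
  generators, \<open>M \<rightarrow> \<Oplus>\<^sub>\<sigma> M[1/x\<^sub>\<sigma>] \<rightarrow> \<Oplus>\<^sub>\<sigma>\<^sub>\<tau> M[1/x\<^sub>\<sigma>x\<^sub>\<tau>] \<rightarrow> \<dots>\<close>, with \<open>M\<close> in cohomological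
  degree 0.  Its summands in degree \<open>i\<close> are indexed by the \<open>i\<close>-element sets of generators; the
  enumeration \<open>to_nat_on\<close> of the cones fixes the signs.
\<close>

definition cochains ::
  "'v fan \<Rightarrow> (('v \<Rightarrow>\<^sub>0 int) \<Rightarrow> 'p) \<Rightarrow> ('v, 'k::field) laurent set \<Rightarrow> nat \<Rightarrow> 'p \<Rightarrow>
     ('v set set \<Rightarrow> ('v, 'k) laurent) set" where
  "cochains X cl M i d = {\<phi>. \<forall>F.
     if F \<subseteq> cones X \<and> card F = i
     then \<phi> F \<in> degree_part cl (localization M (\<Prod>\<sigma>\<in>F. irrelevant_gen X \<sigma>)) d
     else \<phi> F = 0}"

definition coboundary ::
  "'v fan \<Rightarrow> ('v set set \<Rightarrow> ('v, 'k::field) laurent) \<Rightarrow> 'v set set \<Rightarrow> ('v, 'k) laurent" where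
  "coboundary X \<phi> F =
     (if F \<subseteq> cones X
      then \<Sum>\<sigma>\<in>F. (- 1) ^ card {\<tau>\<in>F. to_nat_on (cones X) \<tau> < to_nat_on (cones X) \<sigma>} * \<phi> (F - {\<sigma>})
      else 0)"

definition cocycle_set ::
  "'v fan \<Rightarrow> (('v \<Rightarrow>\<^sub>0 int) \<Rightarrow> 'p) \<Rightarrow> ('v, 'k::field) laurent set \<Rightarrow> nat \<Rightarrow> 'p \<Rightarrow>
     ('v set set \<Rightarrow> ('v, 'k) laurent) set" where
  "cocycle_set X cl M i d = {\<phi>\<in>cochains X cl M i d. coboundary X \<phi> = (\<lambda>_. 0)}"

definition coboundary_set ::
  "'v fan \<Rightarrow> (('v \<Rightarrow>\<^sub>0 int) \<Rightarrow> 'p) \<Rightarrow> ('v, 'k::field) laurent set \<Rightarrow> nat \<Rightarrow> 'p \<Rightarrow>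
     ('v set set \<Rightarrow> ('v, 'k) laurent) set" where
  "coboundary_set X cl M i d =
     (case i of 0 \<Rightarrow> {\<lambda>_. 0} | Suc i' \<Rightarrow> coboundary X ` cochains X cl M i' d)"

text \<open>The degree \<open>d\<close> part of the \<open>i\<close>-th local cohomology of \<open>M\<close> is zero.\<close>

definition local_cohomology_vanishes ::
  "'v fan \<Rightarrow> (('v \<Rightarrow>\<^sub>0 int) \<Rightarrow> 'p) \<Rightarrow> ('v, 'k::field) laurent set \<Rightarrow> nat \<Rightarrow> 'p \<Rightarrow> bool" where
  "local_cohomology_vanishes X cl M i d \<longleftrightarrow> cocycle_set X cl M i d = coboundary_set X cl M i d"

section \<open>Multigraded regularity\<close>

definition regular ::
  "'v fan \<Rightarrow> (('v \<Rightarrow>\<^sub>0 int) \<Rightarrow> 'p::ab_group_add) \<Rightarrow> 'p list \<Rightarrow> ('v, 'k::field) laurent set \<Rightarrow>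
     'p \<Rightarrow> bool" where
  "regular X cl cs M d \<longleftrightarrow>
     (\<forall>i>0. \<forall>l :: nat \<Rightarrow> nat. (\<Sum>j<length cs. l j) = i - 1 \<longrightarrow>
        (\<forall>e\<in>Nef TYPE('k) X cl.
           local_cohomology_vanishes X cl M i (d - (\<Sum>j<length cs. l j \<odot> cs ! j) + e))) \<and>
     (\<forall>j<length cs. \<forall>e\<in>Nef TYPE('k) X cl.
        local_cohomology_vanishes X cl M 0 (d + cs ! j + e))"

definition reg ::
  "'v fan \<Rightarrow> (('v \<Rightarrow>\<^sub>0 int) \<Rightarrow> 'p::ab_group_add) \<Rightarrow> 'p list \<Rightarrow> ('v, 'k::field) laurent set \<Rightarrow>
     'p set" where
  "reg X cl cs M = {d. regular X cl cs M d}"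

end

theory Submission
  imports
    Defs
    "HOL-Computational_Algebra.Polynomial"
    "HOL-Library.Multiset"
begin

text \<open>
  Nef classes are exactly the base-point-free ones.  A class that is nef has nonnegative degree on
  the torus-invariant curves of the walls; walking through the fan across walls along which an
  ample divisor decreases then shows that all its linear pieces are sections.

  Inner bound: the Rees ring \<open>\<Oplus>\<^sub>n I\<^sup>n\<close> is a finitely generated module over the Noetherian ring
  \<open>S[T\<^sub>1, \<dots>, T\<^sub>s]\<close>, and so are its syzygy modules.  The part of \<open>T\<close>-degree \<open>n\<close> of a free module is a sum of
  copies of \<open>S\<close> twisted by \<open>c + \<Sum> p\<^sub>i\<close> with \<open>n - b\<close> summands \<open>p\<^sub>i\<close>, where \<open>(c, b)\<close> ranges over a finite
  set that does not depend on \<open>n\<close>.  As the Cech complex is finite, finitely many steps of dimension shifting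
  reduce the vanishing for \<open>I\<^sup>n\<close> to that for \<open>S\<close>.  By graded Nakayama the degrees of a minimal set of generators
  occur among those of any generators, so \<open>a\<close> can be chosen from \<open>I\<close> alone.

  Outer bound: if \<open>I\<^sup>n\<close> is \<open>d\<close>-regular, the Koszul complex of the monomial sections of a nef class shows that
  the elements of degree \<open>d\<close> generate \<open>I\<^sup>n\<close> along every curve \<open>C\<close>.  By Nakayama some product of \<open>n\<close>
  generators then has a coefficient, of degree \<open>d - \<Sum> p\<^sub>i\<close>, that does not vanish on \<open>C\<close>.
\<close>

text \<open>All modules stay inside Laurent polynomials or functions into them, so graded parts,
  localizations and Cech cochains are concrete sets. Intersection numbers are given only as eventual
  differences of Hilbert functions. Their sign is controlled by one observation: a homogeneous g
  outside the prime P of a curve acts injectively on S/P, so a section of degree e outside P makes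
  the number of e nonnegative. Exact values are computed only for the curves of walls, by counting
  monomials.

  The obstacle in the inner bound is a mismatch of indices. Dimension shifting leads from cohomology
  of I^n in degree i to that of S in degrees j >= i, while the twist \<lambda> has total i - 1 and
  regularity of S offers total j - 1. As generators of the nef monoid are themselves nef, j - i
  copies of one of them can be subtracted and added back. The constant a must make a + c p_0 - e nef
  for the finitely many classes e and T-degrees c of the syzygy generators involved; what remains of
  n q_1 is a sum of differences q_1 - p_i, nef by hypothesis.\<close>

abbreviation lk :: "('a \<Rightarrow>\<^sub>0 'b::zero) \<Rightarrow> 'a \<Rightarrow> 'b" where "lk \<equiv> Poly_Mapping.lookup"
abbreviation ks :: "('a \<Rightarrow>\<^sub>0 'b::zero) \<Rightarrow> 'a set" where "ks \<equiv> Poly_Mapping.keys"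
abbreviation mon :: "'a \<Rightarrow> 'a \<Rightarrow>\<^sub>0 'b::{zero,one}" where "mon u \<equiv> Poly_Mapping.single u 1"

section \<open>Laurent polynomials\<close>

lemma lookup_single_times:
  fixes p :: "'a::ab_group_add \<Rightarrow>\<^sub>0 'k::comm_ring_1"
  shows "lk (Poly_Mapping.single u c * p) v = c * lk p (v - u)"
proof -
  have eq: "(lk p q when v = u + q) = (lk p q when q = v - u)" for q
    by (rule when_cong) (auto simp: algebra_simps)
  have "lk (Poly_Mapping.single u c * p) v = Sum_any (\<lambda>l. (c when u = l) * Sum_any (\<lambda>q. lk p q when v = l + q))"
    by (simp add: lookup_mult lookup_single)
  also have "\<dots> = Sum_any (\<lambda>l. c * Sum_any (\<lambda>q. lk p q when v = l + q) when l = u)"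
    by (simp add: when_mult eq_commute[of u])
  also have "\<dots> = c * Sum_any (\<lambda>q. lk p q when v = u + q)" by (simp only: Sum_any_when_equal)
  also have "\<dots> = c * lk p (v - u)" by (simp only: eq Sum_any_when_equal)
  finally show ?thesis .
qed

lemma lookup_mon_times:
  fixes p :: "'a::ab_group_add \<Rightarrow>\<^sub>0 'k::comm_ring_1"
  shows "lk (mon u * p) v = lk p (v - u)"
  by (simp add: lookup_single_times)

lemma keys_mon_times:
  fixes p :: "'a::ab_group_add \<Rightarrow>\<^sub>0 'k::comm_ring_1"
  shows "ks (mon u * p) = (+) u ` ks p"
proof -
  have "v \<in> ks (mon u * p) \<longleftrightarrow> v - u \<in> ks p" for v
    by (simp add: in_keys_iff lookup_mon_times)
  moreover have "v \<in> (+) u ` ks p \<longleftrightarrow> v - u \<in> ks p" for v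
    by (force simp: image_iff)
  ultimately show ?thesis by blast
qed

lemma mon_mult_mon: "(mon u :: 'a::monoid_add \<Rightarrow>\<^sub>0 'k::semiring_1) * mon v = mon (u + v)"
  by (simp add: mult_single)

lemma mon_inverse:
  "(mon u :: 'a::ab_group_add \<Rightarrow>\<^sub>0 'k::comm_ring_1) * mon (- u) = 1"
  by (simp add: mult_single)

lemma mon_power:
  "(mon u :: 'a::comm_monoid_add \<Rightarrow>\<^sub>0 'k::comm_semiring_1) ^ k = mon (\<Sum>_<k. u)"
  by (induction k) (simp_all add: mult_single add.commute)

lemma mon_prod:
  "(\<Prod>x\<in>A. mon (u x) :: 'a::comm_monoid_add \<Rightarrow>\<^sub>0 'k::comm_semiring_1) = mon (\<Sum>x\<in>A. u x)"
  by (induction A rule: infinite_finite_induct) (simp_all add: mult_single)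

lemma mon_times_cancel:
  fixes p q :: "'a::ab_group_add \<Rightarrow>\<^sub>0 'k::comm_ring_1"
  assumes "mon u * p = mon u * q" shows "p = q"
proof -
  have "mon (- u) * (mon u * p) = mon (- u) * (mon u * q)" using assms by simp
  then show ?thesis by (simp add: mult.assoc[symmetric] mult_single)
qed

lemma poly_mapping_sum_singles:
  "(p :: 'a \<Rightarrow>\<^sub>0 'k::comm_monoid_add) = (\<Sum>m\<in>ks p. Poly_Mapping.single m (lk p m))"
proof (rule poly_mapping_eqI)
  fix k
  have "lk (\<Sum>m\<in>ks p. Poly_Mapping.single m (lk p m)) k = (\<Sum>m\<in>ks p. if k = m then lk p m else 0)"
    by (simp add: lookup_sum lookup_single when_def eq_commute)
  also have "\<dots> = lk p k" by (simp add: sum.delta in_keys_iff)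
  finally show "lk p k = lk (\<Sum>m\<in>ks p. Poly_Mapping.single m (lk p m)) k" by simp
qed

text \<open>Two choices of \<open>E\<close> matter: the exponents of one class, giving the
  homogeneous component \<open>hc\<close>, and \<open>off \<pi>\<close>, giving the normal form
  modulo the monomial prime \<open>mp \<pi>\<close>.\<close>

definition rst :: "'a set \<Rightarrow> ('a \<Rightarrow>\<^sub>0 'k::zero) \<Rightarrow> ('a \<Rightarrow>\<^sub>0 'k)" where
  "rst E p = Poly_Mapping.mapp (\<lambda>m c. if m \<in> E then c else 0) p"

lemma lookup_rst: "lk (rst E p) m = (if m \<in> E then lk p m else 0)"
  by (simp add: rst_def lookup_mapp when_def in_keys_iff)

lemma keys_rst: "ks (rst E p) = ks p \<inter> E"
  by (auto simp: in_keys_iff lookup_rst split: if_splits)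

lemma rst_zero [simp]: "rst E 0 = 0"
  by (rule poly_mapping_eqI) (simp add: lookup_rst)

lemma rst_add: "rst E (p + q) = rst E p + rst E (q :: 'a \<Rightarrow>\<^sub>0 'k::monoid_add)"
  by (rule poly_mapping_eqI) (simp add: lookup_rst lookup_add)

lemma rst_sum: "rst E (sum f A) = (\<Sum>x\<in>A. rst E (f x :: 'a \<Rightarrow>\<^sub>0 'k::comm_monoid_add))"
  by (induction A rule: infinite_finite_induct) (simp_all add: rst_add)

lemma rst_id: "ks p \<subseteq> E \<Longrightarrow> rst E p = p"
  by (rule poly_mapping_eqI) (auto simp: lookup_rst in_keys_iff)

lemma rst_none: "ks p \<inter> E = {} \<Longrightarrow> rst E p = 0"
  by (rule poly_mapping_eqI) (auto simp: lookup_rst in_keys_iff disjoint_iff)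

lemma rst_compl: "(p :: 'a \<Rightarrow>\<^sub>0 'k::comm_monoid_add) = rst E p + rst (- E) p"
  by (rule poly_mapping_eqI) (simp add: lookup_rst lookup_add)

text \<open>Restricting both sets to the elements that maximise some coordinate keeps the pairs of
  maximisers, so that induction on the sizes produces a sum attained only once.\<close>

lemma unique_sum_pair:
  fixes A B :: "('v \<Rightarrow>\<^sub>0 int) set"
  assumes "finite A" "finite B" "A \<noteq> {}" "B \<noteq> {}"
  shows "\<exists>a\<in>A. \<exists>b\<in>B. \<forall>a'\<in>A. \<forall>b'\<in>B. a' + b' = a + b \<longrightarrow> a' = a \<and> b' = b"
  using assms
proof (induction "card A + card B" arbitrary: A B rule: less_induct)
  case less
  show ?case
  proof (cases "\<exists>v. (\<exists>a\<in>A. \<exists>a'\<in>A. lk a v \<noteq> lk a' v) \<or> (\<exists>a\<in>B. \<exists>a'\<in>B. lk a v \<noteq> lk a' v)")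
    case False
    from less.prems obtain a b where "a \<in> A" "b \<in> B" by blast
    moreover from this False have "\<forall>a'\<in>A. a' = a" "\<forall>b'\<in>B. b' = b"
      by (metis poly_mapping_eqI)+
    ultimately show ?thesis by blast
  next
    case True
    then obtain v where v: "(\<exists>a\<in>A. \<exists>a'\<in>A. lk a v \<noteq> lk a' v) \<or> (\<exists>a\<in>B. \<exists>a'\<in>B. lk a v \<noteq> lk a' v)"
      by blast
    define mx where "mx C = {a\<in>C. lk a v = Max ((\<lambda>a. lk a v) ` C)}" for C :: "('v \<Rightarrow>\<^sub>0 int) set"
    have le: "lk c v \<le> Max ((\<lambda>a. lk a v) ` C)" if "finite C" "c \<in> C" for C and c :: "'v \<Rightarrow>\<^sub>0 int"
      using that by simp
    have sub: "mx C \<subseteq> C" for C by (auto simp: mx_def)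
    have ne: "mx C \<noteq> {}" if "finite C" "C \<noteq> {}" for C
    proof -
      have "Max ((\<lambda>a. lk a v) ` C) \<in> (\<lambda>a. lk a v) ` C" using that by (intro Max_in) auto
      then show ?thesis by (auto simp: mx_def)
    qed
    have strict: "mx C \<subset> C" if "\<exists>a\<in>C. \<exists>a'\<in>C. lk a v \<noteq> lk a' v" for C
    proof -
      from that obtain a a' where a: "a \<in> C" "a' \<in> C" "lk a v \<noteq> lk a' v" by blast
      have "\<not> (a \<in> mx C \<and> a' \<in> mx C)" using a(3) by (auto simp: mx_def)
      then show ?thesis using a sub[of C] by blast
    qed
    have "card (mx A) + card (mx B) < card A + card B"
      using v strict[of A] strict[of B] sub[of A] sub[of B] less.prems
      by (meson add_less_le_mono add_le_less_mono card_mono psubset_card_mono)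
    moreover have "finite (mx A)" "finite (mx B)" "mx A \<noteq> {}" "mx B \<noteq> {}"
      using less.prems ne finite_subset[OF sub] by blast+
    ultimately obtain a b where ab: "a \<in> mx A" "b \<in> mx B"
      and u: "\<And>a' b'. a' \<in> mx A \<Longrightarrow> b' \<in> mx B \<Longrightarrow> a' + b' = a + b \<Longrightarrow> a' = a \<and> b' = b"
      using less.hyps[of "mx A" "mx B"] by blast
    have "a' = a \<and> b' = b" if *: "a' \<in> A" "b' \<in> B" "a' + b' = a + b" for a' b'
    proof -
      have "lk a' v + lk b' v = lk a v + lk b v" using *(3) by (metis lookup_add)
      moreover have "lk a' v \<le> lk a v" "lk b' v \<le> lk b v"
        using ab le[OF less.prems(1) *(1)] le[OF less.prems(2) *(2)] by (auto simp: mx_def)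
      ultimately have "lk a' v = lk a v" "lk b' v = lk b v" by linarith+
      then have "a' \<in> mx A" "b' \<in> mx B" using ab * by (auto simp: mx_def)
      then show ?thesis using u * by blast
    qed
    then show ?thesis using ab sub by blast
  qed
qed

text \<open>Some exponent of the product comes from a single pair of exponents
  (\<open>unique_sum_pair\<close>), so its coefficient is one product of nonzero elements; no order
  on the exponents has to be chosen.\<close>

lemma laurent_mult_nonzero:
  fixes p q :: "('v \<Rightarrow>\<^sub>0 int) \<Rightarrow>\<^sub>0 'k::idom"
  assumes "p \<noteq> 0" "q \<noteq> 0"
  shows "p * q \<noteq> 0"
proof -
  have "ks p \<noteq> {}" "ks q \<noteq> {}" using assms by (metis in_keys_iff lookup_zero poly_mapping_eqI empty_iff)+
  then obtain a b where ab: "a \<in> ks p" "b \<in> ks q"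
    and u: "\<And>a' b'. a' \<in> ks p \<Longrightarrow> b' \<in> ks q \<Longrightarrow> a' + b' = a + b \<Longrightarrow> a' = a \<and> b' = b"
    using unique_sum_pair[of "ks p" "ks q"] by auto
  have "p * q = (\<Sum>m\<in>ks p. Poly_Mapping.single m (lk p m)) * q"
    by (simp flip: poly_mapping_sum_singles)
  then have "lk (p * q) (a + b) = (\<Sum>m\<in>ks p. lk p m * lk q (a + b - m))"
    by (simp add: sum_distrib_right lookup_sum lookup_single_times)
  also have "\<dots> = (\<Sum>m\<in>ks p. if m = a then lk p a * lk q b else 0)"
  proof (rule sum.cong)
    fix m assume m: "m \<in> ks p"
    show "lk p m * lk q (a + b - m) = (if m = a then lk p a * lk q b else 0)"
    proof (cases "m = a")
      case False
      then have "a + b - m \<notin> ks q" using u[OF m, of "a + b - m"] by (auto simp: algebra_simps)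
      then show ?thesis using False by (simp add: in_keys_iff)
    qed simp
  qed simp
  also have "\<dots> = lk p a * lk q b" using ab by simp
  also have "\<dots> \<noteq> 0" using ab by (simp add: in_keys_iff)
  finally show ?thesis by auto
qed

section \<open>The Cox ring and its ideals\<close>

definition exps :: "'v fan \<Rightarrow> ('v \<Rightarrow>\<^sub>0 int) set" where
  "exps X = {m \<in> divisors X. \<forall>\<rho>. lk m \<rho> \<ge> 0}"

abbreviation cox :: "'v fan \<Rightarrow> ('v, 'k::field) laurent set" where
  "cox X \<equiv> carrier (cox_ring X)"

lemma cox_iff: "p \<in> cox X \<longleftrightarrow> ks p \<subseteq> exps X"
  by (auto simp: cox_ring_def exps_def)

lemma divisors_zero [simp]: "0 \<in> divisors X" by (simp add: divisors_def)

lemma divisors_add: "a \<in> divisors X \<Longrightarrow> b \<in> divisors X \<Longrightarrow> a + b \<in> divisors X"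
  using keys_add[of a b] by (auto simp: divisors_def)

lemma divisors_uminus: "a \<in> divisors X \<Longrightarrow> - a \<in> divisors X"
  by (auto simp: divisors_def in_keys_iff)

lemma divisors_diff: "a \<in> divisors X \<Longrightarrow> b \<in> divisors X \<Longrightarrow> a - b \<in> divisors X"
  using divisors_add[of a X "- b"] divisors_uminus[of b X] by simp

lemma divisors_sum: "(\<And>x. x \<in> A \<Longrightarrow> f x \<in> divisors X) \<Longrightarrow> sum f A \<in> divisors X"
  by (induction A rule: infinite_finite_induct) (auto intro: divisors_add)

lemma divisors_lookup: "m \<in> divisors X \<Longrightarrow> \<rho> \<notin> rays X \<Longrightarrow> lk m \<rho> = 0"
  by (auto simp: divisors_def in_keys_iff)

lemma exps_zero [simp]: "0 \<in> exps X" by (simp add: exps_def)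

lemma exps_add: "a \<in> exps X \<Longrightarrow> b \<in> exps X \<Longrightarrow> a + b \<in> exps X"
  by (auto simp: exps_def divisors_add lookup_add)

lemma exps_sum: "(\<And>x. x \<in> A \<Longrightarrow> f x \<in> exps X) \<Longrightarrow> sum f A \<in> exps X"
  by (induction A rule: infinite_finite_induct) (auto intro: exps_add)

lemma exps_divisors: "a \<in> exps X \<Longrightarrow> a \<in> divisors X" by (simp add: exps_def)

lemma cox_zero [simp]: "0 \<in> cox X" by (simp add: cox_iff)

lemma cox_one [simp]: "1 \<in> cox X" by (simp add: cox_iff)

lemma cox_add: "p \<in> cox X \<Longrightarrow> q \<in> cox X \<Longrightarrow> p + q \<in> cox X"
  using keys_add[of p q] by (auto simp: cox_iff)

lemma cox_uminus: "p \<in> cox X \<Longrightarrow> - p \<in> cox X"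
  by (auto simp: cox_iff in_keys_iff)

lemma cox_diff: "p \<in> cox X \<Longrightarrow> q \<in> cox X \<Longrightarrow> p - q \<in> cox X"
  using cox_add[of p X "- q"] cox_uminus[of q X] by simp

lemma cox_mult: "p \<in> cox X \<Longrightarrow> q \<in> cox X \<Longrightarrow> p * q \<in> cox X"
  using keys_mult[of p q] exps_add by (fastforce simp: cox_iff)

lemma cox_prod: "(\<And>x. x \<in> A \<Longrightarrow> f x \<in> cox X) \<Longrightarrow> prod f A \<in> cox X"
  by (induction A rule: infinite_finite_induct) (auto intro: cox_mult)

lemma cox_power: "p \<in> cox X \<Longrightarrow> p ^ k \<in> cox X"
  by (induction k) (auto intro: cox_mult)

lemma cox_single: "u \<in> exps X \<Longrightarrow> Poly_Mapping.single u c \<in> cox X"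
  by (auto simp: cox_iff)

lemma cox_rst: "p \<in> cox X \<Longrightarrow> rst E p \<in> cox X"
  by (auto simp: cox_iff keys_rst)

lemma cox_ring_simps [simp]:
  "monoid.mult (cox_ring X) = (*)" "one (cox_ring X) = 1" "zero (cox_ring X) = 0" "add (cox_ring X) = (+)"
  by (simp_all add: cox_ring_def)

lemma cring_cox: "cring (cox_ring X :: ('v, 'k::field) laurent ring)"
proof (rule cringI)
  show "abelian_group (cox_ring X :: ('v, 'k) laurent ring)"
  proof (rule abelian_groupI)
    fix x :: "('v, 'k) laurent" assume "x \<in> cox X"
    then have "- x \<in> cox X" by (rule cox_uminus)
    then show "\<exists>y\<in>cox X. y \<oplus>\<^bsub>cox_ring X\<^esub> x = \<zero>\<^bsub>cox_ring X\<^esub>"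
      by (rule bexI[rotated]) simp
  qed (simp_all add: cox_add add.assoc add.commute)
  show "comm_monoid (cox_ring X :: ('v, 'k) laurent ring)"
    by (rule comm_monoidI) (simp_all add: cox_mult mult.assoc mult.commute)
qed (simp add: distrib_right)

text \<open>Submodules of the Laurent ring rather than ideals: localizations of ideals leave the Cox
  ring but obey the same closure lemmas.\<close>

definition submod :: "'v fan \<Rightarrow> ('v, 'k::field) laurent set \<Rightarrow> bool" where
  "submod X M \<longleftrightarrow> 0 \<in> M \<and> (\<forall>p\<in>M. \<forall>q\<in>M. p + q \<in> M) \<and> (\<forall>s\<in>cox X. \<forall>p\<in>M. s * p \<in> M)"

lemma submod_zero: "submod X M \<Longrightarrow> 0 \<in> M" by (simp add: submod_def)

lemma submod_add: "submod X M \<Longrightarrow> p \<in> M \<Longrightarrow> q \<in> M \<Longrightarrow> p + q \<in> M" by (simp add: submod_def)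

lemma submod_smult: "submod X M \<Longrightarrow> s \<in> cox X \<Longrightarrow> p \<in> M \<Longrightarrow> s * p \<in> M" by (simp add: submod_def)

lemma submod_uminus: "submod X M \<Longrightarrow> p \<in> M \<Longrightarrow> - p \<in> M"
  using submod_smult[of X M "- 1" p] cox_uminus[OF cox_one, of X] by simp

lemma submod_diff: "submod X M \<Longrightarrow> p \<in> M \<Longrightarrow> q \<in> M \<Longrightarrow> p - q \<in> M"
  using submod_add[of X M p "- q"] submod_uminus[of X M q] by simp

lemma submod_sum: "submod X M \<Longrightarrow> (\<And>x. x \<in> A \<Longrightarrow> f x \<in> M) \<Longrightarrow> sum f A \<in> M"
  by (induction A rule: infinite_finite_induct) (auto intro: submod_add submod_zero)

lemma submod_cox: "submod X (cox X)"
  by (simp add: submod_def cox_add cox_mult)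

lemma ideal_cox_iff:
  "ideal I (cox_ring X) \<longleftrightarrow> submod X I \<and> I \<subseteq> (cox X :: ('v, 'k::field) laurent set)"
proof
  assume I: "ideal I (cox_ring X)"
  interpret ideal I "cox_ring X" by (rule I)
  show "submod X I \<and> I \<subseteq> cox X"
    unfolding submod_def
    using additive_subgroup.zero_closed[OF is_additive_subgroup]
      additive_subgroup.a_closed[OF is_additive_subgroup] I_l_closed Icarr by auto
next
  assume *: "submod X I \<and> I \<subseteq> (cox X :: ('v, 'k::field) laurent set)"
  interpret R: cring "cox_ring X :: ('v, 'k::field) laurent ring" by (rule cring_cox)
  show "ideal I (cox_ring X)"
  proof (rule idealI)
    show "ring (cox_ring X :: ('v, 'k::field) laurent ring)" by (rule R.ring_axioms)
    have "subgroup I (add_monoid (cox_ring X))"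
    proof (rule group.subgroupI)
      show "group (add_monoid (cox_ring X :: ('v, 'k::field) laurent ring))"
        by (rule R.add.is_group)
      fix a assume a: "a \<in> I"
      have "- a \<in> I" using a * submod_uminus by blast
      moreover have "inv\<^bsub>add_monoid (cox_ring X)\<^esub> a = - a"
      proof -
        have "- a \<in> cox X" "a \<in> cox X" using a * calculation by auto
        then show ?thesis
          using R.add.inv_equality[of "- a" a] by (simp add: a_inv_def)
      qed
      ultimately show "inv\<^bsub>add_monoid (cox_ring X)\<^esub> a \<in> I" by simp
    qed (use * in \<open>auto simp: submod_def\<close>)
    then show "subgroup I (add_monoid (cox_ring X))" .
  next
    fix a x assume "a \<in> I" "x \<in> carrier (cox_ring X :: ('v, 'k) laurent ring)"
    then have "x * a \<in> I" using * by (auto simp: submod_def)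
    then show "x \<otimes>\<^bsub>cox_ring X\<^esub> a \<in> I" "a \<otimes>\<^bsub>cox_ring X\<^esub> x \<in> I"
      by (simp_all add: mult.commute)
  qed
qed

lemma genideal_minimal_cox:
  "submod X I \<Longrightarrow> I \<subseteq> cox X \<Longrightarrow> G \<subseteq> I \<Longrightarrow> genideal (cox_ring X) G \<subseteq> I"
  using ring.genideal_minimal[OF cring.axioms(1)[OF cring_cox]] ideal_cox_iff by blast

lemma genideal_submod: "G \<subseteq> cox X \<Longrightarrow> submod X (genideal (cox_ring X) G)"
  using ring.genideal_ideal[OF cring.axioms(1)[OF cring_cox]] ideal_cox_iff by blast

lemma genideal_self_cox: "G \<subseteq> genideal (cox_ring X) G"
  by (auto simp: genideal_def)

text \<open>The generators form an indexed family, so that repetitions are harmless and the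
  generators of a power can be indexed by multisets of the original indices.\<close>

definition scomb :: "'v fan \<Rightarrow> 'i set \<Rightarrow> ('i \<Rightarrow> ('v, 'k::field) laurent) \<Rightarrow> ('v, 'k) laurent set" where
  "scomb X E w = {\<Sum>e\<in>E. g e * w e | g. \<forall>e\<in>E. g e \<in> cox X}"

lemma submod_scomb:
  fixes X :: "'v fan" and w :: "'i \<Rightarrow> ('v, 'k::field) laurent"
  shows "submod X (scomb X E w)"
  unfolding submod_def
proof (intro conjI ballI)
  show "0 \<in> scomb X E w"
    unfolding scomb_def by (rule CollectI, rule exI[of _ "\<lambda>_. 0"]) simp
next
  fix p q assume "p \<in> scomb X E w" "q \<in> scomb X E w"
  then obtain g h where "\<forall>e\<in>E. g e \<in> cox X" "\<forall>e\<in>E. h e \<in> cox X"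
    "p = (\<Sum>e\<in>E. g e * w e)" "q = (\<Sum>e\<in>E. h e * w e)" unfolding scomb_def by blast
  then show "p + q \<in> scomb X E w" unfolding scomb_def
    by (intro CollectI exI[of _ "\<lambda>e. g e + h e"])
      (auto simp: distrib_right sum.distrib intro: cox_add)
next
  fix s p :: "('v, 'k) laurent" assume "s \<in> cox X" "p \<in> scomb X E w"
  then obtain g where "\<forall>e\<in>E. g e \<in> cox X" "p = (\<Sum>e\<in>E. g e * w e)" unfolding scomb_def by blast
  then show "s * p \<in> scomb X E w" unfolding scomb_def using \<open>s \<in> cox X\<close>
    by (intro CollectI exI[of _ "\<lambda>e. s * g e"])
      (auto simp: mult.assoc sum_distrib_left intro: cox_mult)
qed

lemma scomb_gen: "finite E \<Longrightarrow> e \<in> E \<Longrightarrow> w e \<in> scomb X E w"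
  unfolding scomb_def
  by (rule CollectI, rule exI[of _ "\<lambda>e'. if e' = e then 1 else 0"])
    (auto simp: if_distrib[of "\<lambda>x. x * _"] sum.delta cong: if_cong)

lemma scomb_minimal: "submod X M \<Longrightarrow> w ` E \<subseteq> M \<Longrightarrow> scomb X E w \<subseteq> M"
  unfolding scomb_def by (auto intro!: submod_sum submod_smult)

lemma scomb_subset_cox: "w ` E \<subseteq> cox X \<Longrightarrow> scomb X E w \<subseteq> cox X"
  by (rule scomb_minimal[OF submod_cox])

lemma genideal_eq_scomb:
  assumes "finite E" "w ` E \<subseteq> cox X"
  shows "genideal (cox_ring X) (w ` E) = scomb X E w"
proof
  show "genideal (cox_ring X) (w ` E) \<subseteq> scomb X E w"
    using assms by (intro genideal_minimal_cox submod_scomb scomb_subset_cox)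
      (auto intro: scomb_gen)
  show "scomb X E w \<subseteq> genideal (cox_ring X) (w ` E)"
    using assms by (intro scomb_minimal genideal_submod genideal_self_cox)
qed

section \<open>Multiples in the Picard group\<close>

lemma nat_mult_0 [simp]: "0 \<odot> q = 0" by (simp add: nat_mult_def)

lemma nat_mult_Suc: "Suc n \<odot> q = q + n \<odot> q" by (simp add: nat_mult_def add.commute)

lemma nat_mult_1 [simp]: "Suc 0 \<odot> q = q" by (simp add: nat_mult_Suc)

lemma nat_mult_add: "(m + n) \<odot> q = m \<odot> q + n \<odot> q"
  by (induction m) (simp_all add: nat_mult_Suc add.assoc)

lemma nat_mult_diff_right: "n \<odot> (p - q) = n \<odot> p - n \<odot> q"
  by (simp add: nat_mult_def sum_subtractf)

lemma nat_mult_zero_right [simp]: "n \<odot> 0 = 0" by (simp add: nat_mult_def)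

section \<open>Smooth complete fans\<close>

text \<open>Basis vectors and their duals form two matrices; the clauses say that these are inverse
  to each other in both orders. Dual vectors are indexed by the basis vectors themselves because the
  basis is a set.\<close>

definition dual_basis :: "nat \<Rightarrow> (nat \<Rightarrow> int) set \<Rightarrow> ((nat \<Rightarrow> int) \<Rightarrow> nat \<Rightarrow> int) \<Rightarrow> bool" where
  "dual_basis n B M \<longleftrightarrow>
     (\<forall>b\<in>B. \<forall>b'\<in>B. (\<Sum>i<n. M b i * b' i) = (if b = b' then 1 else 0)) \<and>
     (\<forall>k<n. \<forall>i. (\<Sum>b\<in>B. M b k * b i) = (if i = k then 1 else 0))"

text \<open>The coordinates of the unit vectors yield \<open>M\<close> and the second clause. For
  the first, the pairings with \<open>b'\<close> and the Kronecker delta are both coordinate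
  families of \<open>b'\<close>, and coordinates are unique.\<close>

lemma lattice_basis_dual:
  assumes "lattice_basis n B"
  obtains M where "dual_basis n B M"
proof -
  have fin: "finite B" and sub: "B \<subseteq> lattice n"
    and ex: "\<And>x. x \<in> lattice n \<Longrightarrow> \<exists>!c. (\<forall>b. b \<notin> B \<longrightarrow> c b = 0) \<and> (\<forall>i. x i = (\<Sum>b\<in>B. c b * b i))"
    using assms by (auto simp: lattice_basis_def)
  have "\<exists>c. \<forall>i. (if i = k then 1 else 0) = (\<Sum>b\<in>B. c b * b i)" if "k < n" for k
  proof -
    have "(\<lambda>i. if i = k then 1 else 0) \<in> lattice n" using that by (auto simp: lattice_def)
    from ex[OF this] show ?thesis by (elim ex1E) blast
  qed
  then obtain c where c: "\<And>k i. k < n \<Longrightarrow> (if i = k then 1 else 0) = (\<Sum>b\<in>B. c k b * b i)"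
    by metis
  define M where "M b k = c k b" for b k
  have e: "(\<Sum>b\<in>B. M b k * b i) = (if i = k then 1 else 0)" if "k < n" for k i
    using c[OF that, of i] by (simp add: M_def)
  have "(\<Sum>i<n. M b i * b' i) = (if b = b' then 1 else 0)" if "b \<in> B" "b' \<in> B" for b b'
  proof -
    define f where "f b = (if b \<in> B then \<Sum>k<n. M b k * b' k else 0)" for b
    define g where "g b = (if b = b' then 1 else 0 :: int)" for b
    have "b' i = (\<Sum>b\<in>B. f b * b i)" for i
    proof -
      have "(\<Sum>b\<in>B. f b * b i) = (\<Sum>b\<in>B. \<Sum>k<n. M b k * b' k * b i)"
        by (simp add: f_def sum_distrib_right)
      also have "\<dots> = (\<Sum>k<n. b' k * (\<Sum>b\<in>B. M b k * b i))"
        by (subst sum.swap) (simp add: sum_distrib_left mult_ac)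
      also have "\<dots> = (\<Sum>k<n. if k = i then b' k else 0)"
        by (rule sum.cong) (auto simp: e)
      also have "\<dots> = b' i"
        using that(2) sub by (auto simp: sum.delta lattice_def)
      finally show ?thesis by simp
    qed
    moreover have "b' i = (\<Sum>b\<in>B. g b * b i)" for i
    proof -
      have "(\<Sum>b\<in>B. g b * b i) = (\<Sum>b\<in>B. if b = b' then b' i else 0)"
        by (rule sum.cong) (auto simp: g_def)
      then show ?thesis using fin that(2) by simp
    qed
    moreover have "\<forall>b. b \<notin> B \<longrightarrow> f b = 0" "\<forall>b. b \<notin> B \<longrightarrow> g b = 0"
      using that by (auto simp: f_def g_def)
    ultimately have "f = g" using ex[of b'] that(2) sub by blast
    then have "f b = g b" by simp
    then show ?thesis using that(1) by (simp add: f_def g_def)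
  qed
  then have "dual_basis n B M" by (simp add: dual_basis_def e)
  then show ?thesis by (rule that)
qed

definition rpair :: "nat \<Rightarrow> (nat \<Rightarrow> int) \<Rightarrow> (nat \<Rightarrow> real) \<Rightarrow> real" where
  "rpair n m x = (\<Sum>i<n. of_int (m i) * x i)"

lemma rpair_add: "rpair n m (\<lambda>i. x i + y i) = rpair n m x + rpair n m y"
  by (simp add: rpair_def distrib_left sum.distrib)

lemma rpair_scale: "rpair n m (\<lambda>i. c * x i) = c * rpair n m x"
  by (simp add: rpair_def sum_distrib_left mult_ac)

lemma rpair_sum: "rpair n m (\<lambda>i. \<Sum>a\<in>A. c a * f a i) = (\<Sum>a\<in>A. c a * rpair n m (f a))"
  unfolding rpair_def by (subst sum.swap[of _ _ "{..<n}"] | simp add: sum_distrib_left mult_ac)+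

lemma dual_basis_expand:
  assumes "dual_basis n B M" "\<forall>i\<ge>n. x i = 0"
  shows "x i = (\<Sum>b\<in>B. rpair n (M b) x * of_int (b i))"
proof -
  have "(\<Sum>b\<in>B. rpair n (M b) x * of_int (b i)) = (\<Sum>b\<in>B. \<Sum>k<n. of_int (M b k) * x k * of_int (b i))"
    by (simp add: rpair_def sum_distrib_right)
  also have "\<dots> = (\<Sum>k<n. x k * of_int (\<Sum>b\<in>B. M b k * b i))"
    by (subst sum.swap) (simp add: sum_distrib_left mult_ac)
  also have "\<dots> = (\<Sum>k<n. if k = i then x k else 0)"
    using assms(1) by (intro sum.cong) (auto simp: dual_basis_def)
  also have "\<dots> = x i" using assms(2) by (auto simp: sum.delta)
  finally show ?thesis by simp
qed

lemma finite_infinite_nonneg: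
  fixes a b :: real
  assumes "infinite {N::nat. real N * a + b \<ge> 0}"
  shows "a \<ge> 0"
proof (rule ccontr)
  assume "\<not> a \<ge> 0"
  then have a: "a < 0" by simp
  obtain K :: nat where K: "real K > b / (- a)" using reals_Archimedean2 by blast
  obtain N where N: "N > K" "real N * a + b \<ge> 0"
    using assms by (metis (mono_tags) finite_nat_set_iff_bounded_le linorder_not_le mem_Collect_eq)
  have "real N > b / (- a)" using N K by linarith
  then have "real N * (- a) > b" using a pos_divide_less_eq[of "- a" b "real N"] by simp
  then show False using N(2) by (simp add: algebra_simps)
qed

locale toric_fan =
  fixes X :: "'v fan"
  assumes spf: "smooth_projective_fan X"
begin

abbreviation "rk \<equiv> lattice_rank X"
abbreviation "ug \<equiv> ray_gen X"
abbreviation "pr \<equiv> pairing X"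
abbreviation "rp \<equiv> rpair rk"
abbreviation uR :: "'v \<Rightarrow> nat \<Rightarrow> real" where "uR \<rho> \<equiv> (\<lambda>i. of_int (ug \<rho> i))"

lemma smooth: "smooth_fan X" and complete: "complete_fan X"
  using spf by (auto simp: smooth_projective_fan_def)

lemma finite_rays [simp]: "finite (rays X)"
  using smooth by (simp add: smooth_fan_def)

lemma cone_rays: "\<sigma> \<in> cones X \<Longrightarrow> \<sigma> \<subseteq> rays X"
  using smooth by (simp add: smooth_fan_def)

lemma cone_face: "\<sigma> \<in> cones X \<Longrightarrow> \<tau> \<subseteq> \<sigma> \<Longrightarrow> \<tau> \<in> cones X"
proof -
  assume a: "\<sigma> \<in> cones X" "\<tau> \<subseteq> \<sigma>"
  have "\<forall>\<sigma>\<in>cones X. \<sigma> \<subseteq> rays X \<and> (\<forall>\<tau>. \<tau> \<subseteq> \<sigma> \<longrightarrow> \<tau> \<in> cones X)"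
    using smooth unfolding smooth_fan_def by (elim conjE)
  with a show ?thesis by blast
qed

lemma cone_finite: "\<sigma> \<in> cones X \<Longrightarrow> finite \<sigma>"
  using cone_rays finite_rays finite_subset by blast

lemma finite_cones [simp]: "finite (cones X)"
  using cone_rays by (intro finite_subset[of "cones X" "Pow (rays X)"]) auto

lemma empty_cone [simp]: "{} \<in> cones X"
  using smooth by (simp add: smooth_fan_def)

lemma ray_cone: "\<rho> \<in> rays X \<Longrightarrow> {\<rho>} \<in> cones X"
  using smooth by (simp add: smooth_fan_def)

lemma cone_inj: "\<sigma> \<in> cones X \<Longrightarrow> inj_on ug \<sigma>"
  using smooth by (simp add: smooth_fan_def)

lemma cone_inter: "\<sigma> \<in> cones X \<Longrightarrow> \<tau> \<in> cones X \<Longrightarrow> cone_of X \<sigma> \<inter> cone_of X \<tau> = cone_of X (\<sigma> \<inter> \<tau>)"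
  using smooth by (simp add: smooth_fan_def)

lemma cone_basis:
  assumes "\<sigma> \<in> cones X"
  obtains B M where "lattice_basis rk B" "ug ` \<sigma> \<subseteq> B" "dual_basis rk B M" "finite B"
proof -
  obtain B where B: "lattice_basis rk B" "ug ` \<sigma> \<subseteq> B"
    using smooth assms by (auto simp: smooth_fan_def)
  obtain M where "dual_basis rk B M" using lattice_basis_dual[OF B(1)] .
  then show ?thesis using that B by (auto simp: lattice_basis_def)
qed

lemma ray_lattice: "\<rho> \<in> rays X \<Longrightarrow> i \<ge> rk \<Longrightarrow> ug \<rho> i = 0"
  by (rule cone_basis[OF ray_cone, of \<rho>]) (auto simp: lattice_basis_def lattice_def)

lemma rp_uR: "rp m (uR \<rho>) = of_int (pr m \<rho>)"
  by (simp add: rpair_def pairing_def)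

lemma pr_dual:
  assumes "dual_basis rk B M" "b \<in> B" "ug \<rho> \<in> B"
  shows "pr (M b) \<rho> = (if b = ug \<rho> then 1 else 0)"
  using assms by (simp add: dual_basis_def pairing_def)

lemma cone_ofE:
  assumes "x \<in> cone_of X \<sigma>"
  obtains c where "\<forall>\<rho>\<in>\<sigma>. c \<rho> \<ge> 0" "x = (\<lambda>i. \<Sum>\<rho>\<in>\<sigma>. c \<rho> * uR \<rho> i)"
  using assms by (auto simp: cone_of_def)

text \<open>In a lattice basis that extends the generators, the coefficients of a point of the cone
  are its dual coordinates, so membership is a sign condition on each. \<open>B\<close> may come
  from a larger cone, so that one basis tests a cone and its faces.\<close>

lemma mem_cone_iff:
  assumes "\<sigma> \<in> cones X" "ug ` \<sigma> \<subseteq> B" "dual_basis rk B M" "finite B"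
  shows "x \<in> cone_of X \<sigma> \<longleftrightarrow> (\<forall>i\<ge>rk. x i = 0) \<and>
    (\<forall>b\<in>B. (b \<in> ug ` \<sigma> \<longrightarrow> rp (M b) x \<ge> 0) \<and> (b \<notin> ug ` \<sigma> \<longrightarrow> rp (M b) x = 0))"
proof
  assume "x \<in> cone_of X \<sigma>"
  then obtain c where c: "\<forall>\<rho>\<in>\<sigma>. c \<rho> \<ge> 0" and x: "x = (\<lambda>i. \<Sum>\<rho>\<in>\<sigma>. c \<rho> * uR \<rho> i)"
    by (rule cone_ofE)
  have 1: "\<forall>i\<ge>rk. x i = 0"
    using cone_rays[OF assms(1)] by (auto simp: x ray_lattice intro!: sum.neutral)
  have rp: "rp (M b) x = (\<Sum>\<rho>\<in>\<sigma>. if b = ug \<rho> then c \<rho> else 0)" if "b \<in> B" for b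
    unfolding x rpair_sum using assms(2) that by (intro sum.cong) (auto simp: rp_uR pr_dual[OF assms(3)])
  have "rp (M b) x \<ge> 0" if "b \<in> B" for b
    using c unfolding rp[OF that] by (intro sum_nonneg) auto
  moreover have "rp (M b) x = 0" if "b \<in> B" "b \<notin> ug ` \<sigma>" for b
    using that unfolding rp[OF that(1)] by (intro sum.neutral) auto
  ultimately show "(\<forall>i\<ge>rk. x i = 0) \<and>
    (\<forall>b\<in>B. (b \<in> ug ` \<sigma> \<longrightarrow> rp (M b) x \<ge> 0) \<and> (b \<notin> ug ` \<sigma> \<longrightarrow> rp (M b) x = 0))" using 1 by blast
next
  assume *: "(\<forall>i\<ge>rk. x i = 0) \<and>
    (\<forall>b\<in>B. (b \<in> ug ` \<sigma> \<longrightarrow> rp (M b) x \<ge> 0) \<and> (b \<notin> ug ` \<sigma> \<longrightarrow> rp (M b) x = 0))"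
  have "x i = (\<Sum>\<rho>\<in>\<sigma>. rp (M (ug \<rho>)) x * uR \<rho> i)" for i
  proof -
    have "x i = (\<Sum>b\<in>B. rp (M b) x * of_int (b i))"
      using dual_basis_expand[OF assms(3)] * by blast
    also have "\<dots> = (\<Sum>b\<in>ug ` \<sigma>. rp (M b) x * of_int (b i))"
      using * assms(2,4) by (intro sum.mono_neutral_right) auto
    also have "\<dots> = (\<Sum>\<rho>\<in>\<sigma>. rp (M (ug \<rho>)) x * uR \<rho> i)"
      using cone_inj[OF assms(1)] by (simp add: sum.reindex)
    finally show ?thesis .
  qed
  moreover have "\<forall>\<rho>\<in>\<sigma>. rp (M (ug \<rho>)) x \<ge> 0" using * assms(2) by blast
  ultimately show "x \<in> cone_of X \<sigma>"
    unfolding cone_of_def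
    by (intro CollectI exI[of _ "\<lambda>\<rho>. rp (M (ug \<rho>)) x"] conjI allI)
qed

text \<open>A point in the relative interior of the cone, left unnormalized so that its coordinates
  in a basis extending the generators are 0 or 1.\<close>

definition bary :: "'v set \<Rightarrow> nat \<Rightarrow> real" where
  "bary \<sigma> i = (\<Sum>\<rho>\<in>\<sigma>. uR \<rho> i)"

lemma rp_bary: "rp m (bary \<sigma>) = (\<Sum>\<rho>\<in>\<sigma>. of_int (pr m \<rho>))"
  using rpair_sum[of rk m "\<lambda>_. 1" uR \<sigma>] by (simp add: bary_def[abs_def] rp_uR)

text \<open>The two cones meet in the cone of their common rays, on which the coordinate of any
  other ray of \<sigma> vanishes, while \<open>bary \<sigma>\<close> has coordinate 1 there.\<close>

lemma bary_in_cone_imp_subset: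
  assumes "\<sigma> \<in> cones X" "\<pi> \<in> cones X" "bary \<sigma> \<in> cone_of X \<pi>"
  shows "\<sigma> \<subseteq> \<pi>"
proof
  fix \<rho> assume \<rho>: "\<rho> \<in> \<sigma>"
  show "\<rho> \<in> \<pi>"
  proof (rule ccontr)
    assume np: "\<rho> \<notin> \<pi>"
    obtain B M where B: "ug ` \<sigma> \<subseteq> B" "dual_basis rk B M" "finite B"
      using cone_basis[OF assms(1)] by metis
    have "bary \<sigma> \<in> cone_of X \<sigma>"
      unfolding cone_of_def bary_def by (intro CollectI exI[of _ "\<lambda>_. 1"]) simp
    then have in_c: "bary \<sigma> \<in> cone_of X (\<sigma> \<inter> \<pi>)" using assms cone_inter by blast
    have c: "\<sigma> \<inter> \<pi> \<in> cones X" using assms cone_face by blast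
    have "ug \<rho> \<notin> ug ` (\<sigma> \<inter> \<pi>)"
      using np \<rho> cone_inj[OF assms(1)] by (auto simp: inj_on_def)
    then have "rp (M (ug \<rho>)) (bary \<sigma>) = 0"
      using in_c mem_cone_iff[OF c _ B(2,3)] B(1) \<rho> by blast
    moreover have "rp (M (ug \<rho>)) (bary \<sigma>) = (\<Sum>\<rho>'\<in>\<sigma>. if \<rho>' = \<rho> then 1 else 0)"
      unfolding rp_bary using \<rho> B(1) cone_inj[OF assms(1)]
      by (intro sum.cong) (auto simp: pr_dual[OF B(2)] inj_on_def image_subset_iff)
    ultimately show False using \<rho> cone_finite[OF assms(1)] by simp
  qed
qed

text \<open>Moves far in the direction of the interior of \<sigma> with a fixed offset z. There are
  finitely many cones, so one of them contains the points for infinitely many N. Its sign conditions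
  are affine in N and pass to the leading term \<open>bary \<sigma>\<close>, which makes \<sigma> a
  face of it.\<close>

lemma star_of_cone:
  fixes z :: "nat \<Rightarrow> int"
  assumes "\<sigma> \<in> cones X" "\<forall>i\<ge>rk. z i = 0"
  obtains \<pi> N where "\<pi> \<in> cones X" "\<sigma> \<subseteq> \<pi>"
    "(\<lambda>i. real N * bary \<sigma> i + of_int (z i)) \<in> cone_of X \<pi>"
proof -
  define x where "x N i = real N * bary \<sigma> i + of_int (z i)" for N i
  have bary0: "\<forall>i\<ge>rk. bary \<sigma> i = 0"
    using cone_rays[OF assms(1)] by (auto simp: bary_def ray_lattice intro!: sum.neutral)
  then have "x N \<in> {x. \<forall>i\<ge>rk. x i = 0}" for N
    using assms(2) by (simp add: x_def)
  then have "\<exists>\<pi>\<in>cones X. x N \<in> cone_of X \<pi>" for N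
    using complete unfolding complete_fan_def by blast
  then obtain f where f: "\<And>N. f N \<in> cones X" "\<And>N. x N \<in> cone_of X (f N)" by metis
  have "finite (f ` UNIV)" using f(1) by (intro finite_subset[OF _ finite_cones]) auto
  then obtain N0 where N0: "infinite {N. f N = f N0}"
    using pigeonhole_infinite[of UNIV f] by auto
  define \<pi> where "\<pi> = f N0"
  have \<pi>: "\<pi> \<in> cones X" using f by (simp add: \<pi>_def)
  obtain B M where B: "ug ` \<pi> \<subseteq> B" "dual_basis rk B M" "finite B"
    using cone_basis[OF \<pi>] by metis
  note mem = mem_cone_iff[OF \<pi> B]
  define zR where "zR = (\<lambda>i. real_of_int (z i))"
  have rx: "rp m (x N) = real N * rp m (bary \<sigma>) + rp m zR" for m N
    unfolding x_def[abs_def] zR_def by (simp add: rpair_add rpair_scale)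
  have mx: "x N \<in> cone_of X \<pi>" if "f N = f N0" for N using f(2)[of N] that by (simp add: \<pi>_def)
  have "bary \<sigma> \<in> cone_of X \<pi>"
    unfolding mem
  proof (intro conjI ballI impI)
    show "\<forall>i\<ge>rk. bary \<sigma> i = 0" by (rule bary0)
  next
    fix b assume b: "b \<in> B" "b \<in> ug ` \<pi>"
    have "{N. f N = f N0} \<subseteq> {N. real N * rp (M b) (bary \<sigma>) + rp (M b) zR \<ge> 0}"
      using mx mem b by (auto simp flip: rx)
    then show "rp (M b) (bary \<sigma>) \<ge> 0"
      using N0 finite_infinite_nonneg infinite_super by blast
  next
    fix b assume b: "b \<in> B" "b \<notin> ug ` \<pi>"
    obtain N1 where "N1 > N0" "f N1 = f N0"
      using N0 by (metis (mono_tags) finite_nat_set_iff_bounded_le linorder_not_le mem_Collect_eq)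
    then have "rp (M b) (x N1) = 0" "rp (M b) (x N0) = 0" "N1 \<noteq> N0"
      using mx mem b by auto
    then have "real N1 * rp (M b) (bary \<sigma>) = real N0 * rp (M b) (bary \<sigma>)" unfolding rx by linarith
    then show "rp (M b) (bary \<sigma>) = 0" using \<open>N1 \<noteq> N0\<close> by simp
  qed
  then have "\<sigma> \<subseteq> \<pi>" using bary_in_cone_imp_subset assms(1) \<pi> by blast
  moreover have "x N0 \<in> cone_of X \<pi>" using mx by blast
  ultimately show ?thesis using that[OF \<pi>, of N0] unfolding x_def[abs_def] by blast
qed

lemma max_cone_cone: "\<sigma> \<in> max_cones X \<Longrightarrow> \<sigma> \<in> cones X"
  by (simp add: max_cones_def)

lemma finite_max_cones [simp]: "finite (max_cones X)"
  by (rule finite_subset[OF _ finite_cones]) (auto simp: max_cones_def)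

lemma cone_subset_max:
  assumes "\<sigma> \<in> cones X" obtains \<mu> where "\<mu> \<in> max_cones X" "\<sigma> \<subseteq> \<mu>"
proof -
  obtain \<mu> where "\<mu> \<in> cones X" "\<sigma> \<subseteq> \<mu>" "\<And>\<tau>. \<tau> \<in> cones X \<Longrightarrow> \<mu> \<subseteq> \<tau> \<Longrightarrow> \<mu> = \<tau>"
    using finite_has_maximal2[OF finite_cones assms] by metis
  then show ?thesis using that[of \<mu>] by (auto simp: max_cones_def)
qed

text \<open>A basis vector \<open>b\<close> outside the generators gives a direction in which to
  leave \<sigma>. The cone reached from the interior of \<sigma> contains \<sigma>, hence equals it
  by maximality, but the \<open>b\<close>-coordinate of the point reached is 1 instead of 0.\<close>

lemma max_cone_basis:
  assumes "\<sigma> \<in> max_cones X" "lattice_basis rk B" "ug ` \<sigma> \<subseteq> B" "dual_basis rk B M"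
  shows "ug ` \<sigma> = B"
proof (rule ccontr)
  assume "ug ` \<sigma> \<noteq> B"
  then obtain b where b: "b \<in> B" "b \<notin> ug ` \<sigma>" using assms(3) by blast
  have \<sigma>: "\<sigma> \<in> cones X" using assms(1) by (rule max_cone_cone)
  have "\<forall>i\<ge>rk. b i = 0" using assms(2) b(1) by (auto simp: lattice_basis_def lattice_def)
  then obtain \<pi> N where \<pi>: "\<pi> \<in> cones X" "\<sigma> \<subseteq> \<pi>"
    and x: "(\<lambda>i. real N * bary \<sigma> i + of_int (b i)) \<in> cone_of X \<pi>"
    using star_of_cone[OF \<sigma>] by metis
  have "\<pi> = \<sigma>" using \<pi> assms(1) by (auto simp: max_cones_def)
  have fin: "finite B" using assms(2) by (simp add: lattice_basis_def)
  have 0: "rp (M b) (\<lambda>i. real N * bary \<sigma> i + of_int (b i)) = 0"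
    using x b mem_cone_iff[OF \<sigma> assms(3,4) fin] unfolding \<open>\<pi> = \<sigma>\<close> by blast
  have "rp (M b) (bary \<sigma>) = 0"
    unfolding rp_bary using b assms(3)
    by (intro sum.neutral) (auto simp: pr_dual[OF assms(4)] image_subset_iff)
  moreover have "rp (M b) (\<lambda>i. of_int (b i)) = 1"
  proof -
    have "rp (M b) (\<lambda>i. of_int (b i)) = of_int (\<Sum>i<rk. M b i * b i)" by (simp add: rpair_def)
    moreover have "(\<Sum>i<rk. M b i * b i) = 1" using assms(4) b(1) by (simp add: dual_basis_def)
    ultimately show ?thesis by simp
  qed
  ultimately show False using 0 by (simp add: rpair_add rpair_scale)
qed

lemma max_cone_dual_exists:
  assumes "\<sigma> \<in> max_cones X"
  shows "\<exists>M. (\<forall>\<rho>\<in>\<sigma>. \<forall>\<rho>'\<in>\<sigma>. pr (M \<rho>) \<rho>' = (if \<rho> = \<rho>' then 1 else 0)) \<and>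
    (\<forall>x. (\<forall>i\<ge>rk. x i = 0) \<longrightarrow> (\<forall>i. x i = (\<Sum>\<rho>\<in>\<sigma>. rp (M \<rho>) x * uR \<rho> i)))"
proof -
  have \<sigma>: "\<sigma> \<in> cones X" using assms by (rule max_cone_cone)
  obtain B M where B: "lattice_basis rk B" "ug ` \<sigma> \<subseteq> B" "dual_basis rk B M" "finite B"
    using cone_basis[OF \<sigma>] .
  have eq: "B = ug ` \<sigma>" using max_cone_basis[OF assms B(1-3)] by simp
  have "x i = (\<Sum>\<rho>\<in>\<sigma>. rp (M (ug \<rho>)) x * uR \<rho> i)" if "\<forall>i\<ge>rk. x i = 0" for x i
    using dual_basis_expand[OF B(3) that, of i] cone_inj[OF \<sigma>] by (simp add: eq sum.reindex)
  moreover have "pr (M (ug \<rho>)) \<rho>' = (if \<rho> = \<rho>' then 1 else 0)" if "\<rho> \<in> \<sigma>" "\<rho>' \<in> \<sigma>" for \<rho> \<rho>'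
    using pr_dual[OF B(3), of "ug \<rho>" \<rho>'] that B(2) cone_inj[OF \<sigma>] by (auto simp: inj_on_def image_subset_iff)
  ultimately show ?thesis by (intro exI[of _ "\<lambda>\<rho>. M (ug \<rho>)"]) blast
qed

text \<open>\<open>dc \<sigma> \<rho>\<close> is the inner normal of the facet of \<sigma> opposite
  to \<rho>, a dual basis vector: the generators of a maximal cone form a lattice basis.\<close>

definition dc :: "'v set \<Rightarrow> 'v \<Rightarrow> nat \<Rightarrow> int" where
  "dc \<sigma> = (SOME M. (\<forall>\<rho>\<in>\<sigma>. \<forall>\<rho>'\<in>\<sigma>. pr (M \<rho>) \<rho>' = (if \<rho> = \<rho>' then 1 else 0)) \<and>
    (\<forall>x. (\<forall>i\<ge>rk. x i = 0) \<longrightarrow> (\<forall>i. x i = (\<Sum>\<rho>\<in>\<sigma>. rp (M \<rho>) x * uR \<rho> i))))"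

lemma pr_dc: "\<sigma> \<in> max_cones X \<Longrightarrow> \<rho> \<in> \<sigma> \<Longrightarrow> \<rho>' \<in> \<sigma> \<Longrightarrow> pr (dc \<sigma> \<rho>) \<rho>' = (if \<rho> = \<rho>' then 1 else 0)"
  and dc_expand: "\<sigma> \<in> max_cones X \<Longrightarrow> \<forall>i\<ge>rk. x i = 0 \<Longrightarrow> x i = (\<Sum>\<rho>\<in>\<sigma>. rp (dc \<sigma> \<rho>) x * uR \<rho> i)"
  using someI_ex[OF max_cone_dual_exists, of \<sigma>, folded dc_def] by blast+

lemma pr_expand:
  assumes "\<sigma> \<in> max_cones X" "\<rho> \<in> rays X"
  shows "pr m \<rho> = (\<Sum>\<kappa>\<in>\<sigma>. pr (dc \<sigma> \<kappa>) \<rho> * pr m \<kappa>)"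
proof -
  have "uR \<rho> = (\<lambda>i. \<Sum>\<kappa>\<in>\<sigma>. rp (dc \<sigma> \<kappa>) (uR \<rho>) * uR \<kappa> i)"
    by (rule ext, rule dc_expand[OF assms(1), of "uR \<rho>"]) (use assms(2) ray_lattice in auto)
  then have "rp m (uR \<rho>) = rp m (\<lambda>i. \<Sum>\<kappa>\<in>\<sigma>. rp (dc \<sigma> \<kappa>) (uR \<rho>) * uR \<kappa> i)"
    by (rule arg_cong)
  also have "\<dots> = (\<Sum>\<kappa>\<in>\<sigma>. rp (dc \<sigma> \<kappa>) (uR \<rho>) * rp m (uR \<kappa>))" by (rule rpair_sum)
  finally have "real_of_int (pr m \<rho>) = of_int (\<Sum>\<kappa>\<in>\<sigma>. pr (dc \<sigma> \<kappa>) \<rho> * pr m \<kappa>)"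
    by (simp add: rp_uR)
  then show ?thesis by (simp only: of_int_eq_iff)
qed

lemma pr_zero_on_max_cone:
  assumes "\<sigma> \<in> max_cones X" "\<rho> \<in> rays X" "\<And>\<kappa>. \<kappa> \<in> \<sigma> \<Longrightarrow> pr m \<kappa> = 0"
  shows "pr m \<rho> = 0"
  by (subst pr_expand[OF assms(1,2)]) (simp add: assms(3))

lemma pr_add: "pr (\<lambda>i. m i + m' i) \<rho> = pr m \<rho> + pr m' \<rho>"
  by (simp add: pairing_def distrib_right sum.distrib)

lemma pr_uminus: "pr (\<lambda>i. - m i) \<rho> = - pr m \<rho>"
  by (simp add: pairing_def sum_negf)

lemma pr_diff: "pr (\<lambda>i. m i - m' i) \<rho> = pr m \<rho> - pr m' \<rho>"
  by (simp add: pairing_def left_diff_distrib sum_subtractf)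

lemma pr_scale: "pr (\<lambda>i. c * m i) \<rho> = c * pr m \<rho>"
  by (simp add: pairing_def sum_distrib_left mult_ac)

lemma pr_sum: "pr (\<lambda>i. \<Sum>a\<in>A. c a * m a i) \<rho> = (\<Sum>a\<in>A. c a * pr (m a) \<rho>)"
  unfolding pairing_def
  by (simp add: sum_distrib_right sum_distrib_left mult_ac) (rule sum.swap)

lemma max_cone_agree:
  assumes "\<sigma> \<in> max_cones X" "\<rho> \<in> rays X" "\<And>\<kappa>. \<kappa> \<in> \<sigma> \<Longrightarrow> pr m \<kappa> = pr m' \<kappa>"
  shows "pr m \<rho> = pr m' \<rho>"
  using pr_zero_on_max_cone[OF assms(1,2), of "\<lambda>i. m i - m' i"] assms(3) by (simp add: pr_diff)

lemma mem_max_cone: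
  assumes "\<sigma> \<in> max_cones X" "\<forall>i\<ge>rk. x i = 0" "\<And>\<rho>. \<rho> \<in> \<sigma> \<Longrightarrow> rp (dc \<sigma> \<rho>) x \<ge> 0"
  shows "x \<in> cone_of X \<sigma>"
  unfolding cone_of_def
  by (intro CollectI exI[of _ "\<lambda>\<rho>. rp (dc \<sigma> \<rho>) x"] conjI ballI allI assms(3) dc_expand[OF assms(1,2)])

text \<open>Crossing the wall \<open>\<sigma> - {k}\<close> replaces k by k'. The value -1 says that
  k' lies beyond the wall and that both cones are unimodular.\<close>

definition adjacent :: "'v set \<Rightarrow> 'v \<Rightarrow> 'v \<Rightarrow> bool" where
  "adjacent \<sigma> k k' \<longleftrightarrow> \<sigma> \<in> max_cones X \<and> k \<in> \<sigma> \<and> k' \<in> rays X - \<sigma> \<and>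
     insert k' (\<sigma> - {k}) \<in> max_cones X \<and> pr (dc \<sigma> k) k' = - 1"

text \<open>Starting in the interior of the wall, one moves in the direction opposite to k. The
  point reached has dual coordinate -1 at k, so the cone containing it has a ray k' beyond the
  wall.\<close>

lemma wall_crossing:
  assumes "\<sigma> \<in> max_cones X" "k \<in> \<sigma>"
  obtains k' where "adjacent \<sigma> k k'"
proof -
  define \<tau> where "\<tau> = \<sigma> - {k}"
  have \<sigma>: "\<sigma> \<in> cones X" using assms(1) by (rule max_cone_cone)
  have \<tau>: "\<tau> \<in> cones X" using \<sigma> by (rule cone_face) (auto simp: \<tau>_def)
  have k: "k \<in> rays X" using cone_rays[OF \<sigma>] assms(2) by blast
  have "\<forall>i\<ge>rk. - ug k i = 0" using ray_lattice[OF k] by simp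
  then obtain \<pi> N where \<pi>: "\<pi> \<in> cones X" "\<tau> \<subseteq> \<pi>"
    and x: "(\<lambda>i. real N * bary \<tau> i + of_int (- ug k i)) \<in> cone_of X \<pi>"
    using star_of_cone[OF \<tau>, of "\<lambda>i. - ug k i"] by metis
  obtain c where c: "\<forall>\<rho>\<in>\<pi>. c \<rho> \<ge> 0"
    "(\<lambda>i. real N * bary \<tau> i + of_int (- ug k i)) = (\<lambda>i. \<Sum>\<rho>\<in>\<pi>. c \<rho> * uR \<rho> i)"
    using x by (rule cone_ofE)
  have "rp (dc \<sigma> k) (\<lambda>i. real N * bary \<tau> i + of_int (- ug k i)) = - 1"
  proof -
    have "rp (dc \<sigma> k) (\<lambda>i. real N * bary \<tau> i + - 1 * uR k i) = - 1"
      unfolding rpair_add rpair_scale rp_bary rp_uR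
      using assms by (auto simp: pr_dc \<tau>_def intro!: sum.neutral split: if_splits)
    then show ?thesis by simp
  qed
  then have "(\<Sum>\<rho>\<in>\<pi>. c \<rho> * of_int (pr (dc \<sigma> k) \<rho>)) = - 1"
    unfolding c(2) rpair_sum rp_uR .
  then have "\<not> (\<Sum>\<rho>\<in>\<pi>. c \<rho> * of_int (pr (dc \<sigma> k) \<rho>)) \<ge> 0" by simp
  then obtain k' where k': "k' \<in> \<pi>" "c k' * of_int (pr (dc \<sigma> k) k') < 0"
    by (meson sum_nonneg not_le)
  then have neg: "pr (dc \<sigma> k) k' < 0"
    using c(1) by (auto simp: mult_less_0_iff dest: bspec)
  have k'rk: "k' \<notin> \<sigma>" using neg assms by (auto simp: pr_dc split: if_splits)
  define \<sigma>' where "\<sigma>' = insert k' \<tau>"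
  have \<sigma>': "\<sigma>' \<in> cones X" using \<pi> k' by (auto intro: cone_face simp: \<sigma>'_def)
  have k'r: "k' \<in> rays X" using \<pi> k' cone_rays by blast
  \<comment> \<open>Characters that vanish on the wall have proportional values at k and k'. This
    yields both the maximality of \<sigma>' and the value -1.\<close>
  have ex: "pr m k' = pr (dc \<sigma> k) k' * pr m k" if "\<And>\<kappa>. \<kappa> \<in> \<tau> \<Longrightarrow> pr m \<kappa> = 0" for m
  proof -
    have "pr m k' = (\<Sum>\<kappa>\<in>\<sigma>. pr (dc \<sigma> \<kappa>) k' * pr m \<kappa>)" by (rule pr_expand[OF assms(1) k'r])
    also have "\<dots> = (\<Sum>\<kappa>\<in>{k}. pr (dc \<sigma> \<kappa>) k' * pr m \<kappa>)"
      using that assms(2) cone_finite[OF \<sigma>] by (intro sum.mono_neutral_right) (auto simp: \<tau>_def)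
    finally show ?thesis by simp
  qed
  have max: "\<sigma>' \<in> max_cones X"
  proof -
    have False if p: "p \<in> cones X" "\<sigma>' \<subset> p" for p
    proof -
      obtain \<rho> where \<rho>: "\<rho> \<in> p" "\<rho> \<notin> \<sigma>'" using p by blast
      obtain B M where B: "ug ` p \<subseteq> B" "dual_basis rk B M" using cone_basis[OF p(1)] by metis
      define m where "m = M (ug \<rho>)"
      have m: "pr m \<kappa> = (if \<kappa> = \<rho> then 1 else 0)" if "\<kappa> \<in> p" for \<kappa>
        unfolding m_def using pr_dual[OF B(2), of "ug \<rho>" \<kappa>] B(1) \<rho> that cone_inj[OF p(1)]
        by (auto simp: inj_on_def image_subset_iff)
      have 0: "pr m \<kappa> = 0" if "\<kappa> \<in> \<sigma>'" for \<kappa>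
      proof -
        have "\<kappa> \<in> p" "\<kappa> \<noteq> \<rho>" using that p(2) \<rho> by blast+
        then show ?thesis using m by simp
      qed
      then have "pr m k' = pr (dc \<sigma> k) k' * pr m k" by (intro ex) (simp add: \<sigma>'_def)
      then have "pr m k = 0" using 0[of k'] neg by (simp add: \<sigma>'_def)
      then have "pr m \<kappa> = 0" if "\<kappa> \<in> \<sigma>" for \<kappa> using 0[of \<kappa>] that by (auto simp: \<sigma>'_def \<tau>_def)
      moreover have "\<rho> \<in> rays X" using \<rho> p cone_rays by blast
      ultimately have "pr m \<rho> = 0" using pr_zero_on_max_cone[OF assms(1)] by blast
      then show False using m \<rho> by simp
    qed
    then show ?thesis using \<sigma>' by (auto simp: max_cones_def)
  qed
  \<comment> \<open>The normals of the two cones give mutually inverse integers; the first is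
    negative, so it is -1.\<close>
  have "1 = pr (dc \<sigma> k) k' * pr (dc \<sigma>' k') k"
  proof -
    have "pr (dc \<sigma>' k') k' = pr (dc \<sigma> k) k' * pr (dc \<sigma>' k') k"
    proof (rule ex)
      fix \<kappa> assume "\<kappa> \<in> \<tau>"
      then show "pr (dc \<sigma>' k') \<kappa> = 0"
        using k'rk pr_dc[OF max, of k' \<kappa>] by (auto simp: \<sigma>'_def \<tau>_def)
    qed
    then show ?thesis using pr_dc[OF max, of k' k'] by (simp add: \<sigma>'_def)
  qed
  then have "pr (dc \<sigma> k) k' = - 1" using neg by (metis zmult_eq_1_iff zero_less_one less_asym)
  then have "adjacent \<sigma> k k'"
    using assms k'r k'rk max by (auto simp: adjacent_def \<sigma>'_def \<tau>_def)
  then show ?thesis by (rule that)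
qed

text \<open>If r lay on the side of k, then \<open>bary \<tau>\<close> taken N times plus the
  generator of r, with N large enough to make the wall coordinates nonnegative, would belong to both
  \<sigma> and \<pi>. It would then lie in their common face \<tau>, although its coordinate at r is
  1.\<close>

lemma wall_side:
  assumes "\<sigma> \<in> max_cones X" "k \<in> \<sigma>" "r \<notin> \<sigma>" "insert r (\<sigma> - {k}) \<in> cones X"
  shows "pr (dc \<sigma> k) r < 0"
proof (rule ccontr)
  assume "\<not> pr (dc \<sigma> k) r < 0"
  then have y: "pr (dc \<sigma> k) r \<ge> 0" by simp
  define \<tau> where "\<tau> = \<sigma> - {k}"
  define \<pi> where "\<pi> = insert r \<tau>"
  have \<sigma>: "\<sigma> \<in> cones X" using assms(1) by (rule max_cone_cone)
  have \<pi>: "\<pi> \<in> cones X" using assms(4) by (simp add: \<pi>_def \<tau>_def)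
  have \<tau>: "\<tau> \<in> cones X" using \<sigma> by (rule cone_face) (auto simp: \<tau>_def)
  have fin: "finite \<tau>" using cone_finite \<tau> by blast
  have r: "r \<in> rays X" "r \<notin> \<tau>" using cone_rays[OF \<pi>] assms(3) by (auto simp: \<pi>_def \<tau>_def)
  define N :: int where "N = (\<Sum>\<kappa>\<in>\<tau>. \<bar>pr (dc \<sigma> \<kappa>) r\<bar>)"
  have N: "N + pr (dc \<sigma> \<kappa>) r \<ge> 0" if "\<kappa> \<in> \<tau>" for \<kappa>
  proof -
    have "\<bar>pr (dc \<sigma> \<kappa>) r\<bar> \<le> N" unfolding N_def using that fin by (intro member_le_sum) auto
    then show ?thesis by linarith
  qed
  have N0: "N \<ge> 0" by (simp add: N_def sum_nonneg)
  define x where "x = (\<lambda>i. of_int N * bary \<tau> i + uR r i)"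
  have rx: "rp m x = of_int N * rp m (bary \<tau>) + of_int (pr m r)" for m
    unfolding x_def by (simp add: rpair_add rpair_scale rp_uR)
  have x0: "\<forall>i\<ge>rk. x i = 0" unfolding x_def bary_def
    using cone_rays[OF \<tau>] r by (auto simp: ray_lattice subset_iff intro!: sum.neutral)
  have "x \<in> cone_of X \<sigma>"
  proof (rule mem_max_cone[OF assms(1) x0])
    fix \<rho> assume \<rho>: "\<rho> \<in> \<sigma>"
    have "rp (dc \<sigma> \<rho>) (bary \<tau>) = (\<Sum>\<kappa>\<in>\<tau>. if \<kappa> = \<rho> then 1 else 0)"
      unfolding rp_bary using \<rho> by (intro sum.cong) (auto simp: pr_dc[OF assms(1)] \<tau>_def)
    also have "\<dots> = (if \<rho> \<in> \<tau> then 1 else 0)" using fin by simp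
    finally have "rp (dc \<sigma> \<rho>) x = of_int ((if \<rho> \<in> \<tau> then N else 0) + pr (dc \<sigma> \<rho>) r)"
      by (simp add: rx)
    moreover have "(if \<rho> \<in> \<tau> then N else 0) + pr (dc \<sigma> \<rho>) r \<ge> 0"
      using N[of \<rho>] y \<rho> by (auto simp: \<tau>_def)
    ultimately show "rp (dc \<sigma> \<rho>) x \<ge> 0" by (metis of_int_0_le_iff)
  qed
  moreover have "x \<in> cone_of X \<pi>"
  proof -
    have "x i = (\<Sum>\<rho>\<in>\<pi>. (if \<rho> = r then 1 else of_int N) * uR \<rho> i)" for i
    proof -
      have "(\<Sum>\<rho>\<in>\<tau>. (if \<rho> = r then 1 else of_int N) * uR \<rho> i) = of_int N * bary \<tau> i"
        unfolding bary_def sum_distrib_left using r by (intro sum.cong) auto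
      then show ?thesis using fin r by (simp add: \<pi>_def x_def)
    qed
    then show ?thesis unfolding cone_of_def using N0
      by (intro CollectI exI[of _ "\<lambda>\<rho>. if \<rho> = r then 1 else of_int N"]) auto
  qed
  ultimately have "x \<in> cone_of X (\<sigma> \<inter> \<pi>)" using cone_inter[OF \<sigma> \<pi>] by blast
  moreover have "\<sigma> \<inter> \<pi> = \<tau>" using assms(2,3) by (auto simp: \<pi>_def \<tau>_def)
  ultimately have x\<tau>: "x \<in> cone_of X \<tau>" by simp
  obtain B M where B: "ug ` \<pi> \<subseteq> B" "dual_basis rk B M" "finite B" using cone_basis[OF \<pi>] by metis
  have nin: "ug r \<notin> ug ` \<tau>" using cone_inj[OF \<pi>] r(2) by (auto simp: inj_on_def \<pi>_def)
  then have "rp (M (ug r)) x = 0"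
    using x\<tau> mem_cone_iff[OF \<tau> _ B(2,3)] B(1) by (auto simp: \<pi>_def)
  moreover have "rp (M (ug r)) (bary \<tau>) = 0"
    unfolding rp_bary using B nin by (intro sum.neutral) (auto simp: pr_dual[OF B(2)] \<pi>_def image_iff)
  moreover have "pr (M (ug r)) r = 1" using pr_dual[OF B(2), of "ug r" r] B(1) by (simp add: \<pi>_def)
  ultimately show False by (simp add: rx)
qed

text \<open>The linear piece on \<sigma> of the support function of the divisor with coefficients D,
  written in the dual basis.\<close>

definition ms :: "'v set \<Rightarrow> ('v \<Rightarrow> int) \<Rightarrow> nat \<Rightarrow> int" where
  "ms \<sigma> D i = (\<Sum>\<kappa>\<in>\<sigma>. - D \<kappa> * dc \<sigma> \<kappa> i)"

lemma pr_ms: "\<sigma> \<in> max_cones X \<Longrightarrow> \<rho> \<in> \<sigma> \<Longrightarrow> pr (ms \<sigma> D) \<rho> = - D \<rho>"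
proof -
  assume a: "\<sigma> \<in> max_cones X" "\<rho> \<in> \<sigma>"
  have "pr (ms \<sigma> D) \<rho> = (\<Sum>\<kappa>\<in>\<sigma>. - D \<kappa> * pr (dc \<sigma> \<kappa>) \<rho>)"
    unfolding ms_def[abs_def] by (rule pr_sum)
  also have "\<dots> = (\<Sum>\<kappa>\<in>\<sigma>. if \<kappa> = \<rho> then - D \<rho> else 0)"
    using a by (intro sum.cong) (auto simp: pr_dc)
  also have "\<dots> = - D \<rho>" using a cone_finite[OF max_cone_cone[OF a(1)]] by simp
  finally show ?thesis .
qed

lemma adjacent_sym_dual:
  assumes "adjacent \<sigma> k k'" "\<rho> \<in> rays X"
  shows "pr (dc (insert k' (\<sigma> - {k})) k') \<rho> = - pr (dc \<sigma> k) \<rho>"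
proof -
  have a: "\<sigma> \<in> max_cones X" "k \<in> \<sigma>" "k' \<notin> \<sigma>" "insert k' (\<sigma> - {k}) \<in> max_cones X"
    "pr (dc \<sigma> k) k' = - 1" using assms(1) by (auto simp: adjacent_def)
  have "pr (dc (insert k' (\<sigma> - {k})) k') \<rho> = pr (\<lambda>i. - dc \<sigma> k i) \<rho>"
    using a by (intro max_cone_agree[OF a(4) assms(2)]) (auto simp: pr_dc pr_uminus)
  then show ?thesis by (simp add: pr_uminus)
qed

text \<open>Characters are determined on the rays of one maximal cone, and both sides agree on those
  of the new cone. The factor in front of \<open>dc \<sigma> k\<close> is the bend of the support
  function across the wall, whose sign is what convexity tests.\<close>

lemma ms_cross:
  assumes "adjacent \<sigma> k k'" "\<rho> \<in> rays X"
  shows "pr (ms (insert k' (\<sigma> - {k})) D) \<rho> = pr (ms \<sigma> D) \<rho> + (pr (ms \<sigma> D) k' + D k') * pr (dc \<sigma> k) \<rho>"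
proof -
  have a: "\<sigma> \<in> max_cones X" "k \<in> \<sigma>" "k' \<notin> \<sigma>" "insert k' (\<sigma> - {k}) \<in> max_cones X"
    "pr (dc \<sigma> k) k' = - 1" using assms(1) by (auto simp: adjacent_def)
  have "pr (ms (insert k' (\<sigma> - {k})) D) \<rho> =
     pr (\<lambda>i. ms \<sigma> D i + (pr (ms \<sigma> D) k' + D k') * dc \<sigma> k i) \<rho>"
    using a by (intro max_cone_agree[OF a(4) assms(2)])
      (auto simp: pr_add pr_scale pr_ms pr_dc)
  then show ?thesis by (simp add: pr_add pr_scale)
qed

lemma ample_ms:
  assumes "ample_divisor X A" "\<sigma> \<in> max_cones X" "\<rho> \<in> rays X - \<sigma>"
  shows "pr (ms \<sigma> (Poly_Mapping.lookup A)) \<rho> > - Poly_Mapping.lookup A \<rho>"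
proof -
  have "\<exists>m. (\<forall>\<rho>\<in>\<sigma>. pr m \<rho> = - Poly_Mapping.lookup A \<rho>) \<and>
      (\<forall>\<rho>\<in>rays X - \<sigma>. pr m \<rho> > - Poly_Mapping.lookup A \<rho>)"
    using assms(1,2) by (simp add: ample_divisor_def)
  then obtain m where m: "(\<forall>\<rho>\<in>\<sigma>. pr m \<rho> = - Poly_Mapping.lookup A \<rho>) \<and>
      (\<forall>\<rho>\<in>rays X - \<sigma>. pr m \<rho> > - Poly_Mapping.lookup A \<rho>)" ..
  have "pr (ms \<sigma> (Poly_Mapping.lookup A)) \<rho> = pr m \<rho>"
    using assms m by (intro max_cone_agree[OF assms(2), of \<rho>]) (auto simp: pr_ms)
  then show ?thesis using m assms(3) by simp
qed

text \<open>Walking from a maximal cone to one that contains \<open>\<rho>\<close>: crossing the wall opposite to a negative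
  coordinate of \<open>\<rho>\<close> lowers the value at \<open>\<rho>\<close> of the linear piece of every wall-nef divisor, and
  strictly so for an ample one, hence the walk ends (this is the simplex method).\<close>

lemma wall_nef_imp_convex:
  assumes wall: "\<And>\<sigma> k k'. adjacent \<sigma> k k' \<Longrightarrow> pr (ms \<sigma> D) k' \<ge> - D k'"
    and "\<sigma> \<in> max_cones X" "\<rho> \<in> rays X"
  shows "pr (ms \<sigma> D) \<rho> \<ge> - D \<rho>"
proof -
  obtain A where A: "ample_divisor X A" using spf by (auto simp: smooth_projective_fan_def)
  let ?A = "Poly_Mapping.lookup A"
  have ge: "pr (ms \<sigma> ?A) \<rho> \<ge> - ?A \<rho>" if "\<sigma> \<in> max_cones X" for \<sigma>
    using ample_ms[OF A that, of \<rho>] pr_ms[OF that, of \<rho> ?A] assms(3) by (cases "\<rho> \<in> \<sigma>") auto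
  show ?thesis using assms(2)
  proof (induction "nat (pr (ms \<sigma> ?A) \<rho> + ?A \<rho>)" arbitrary: \<sigma> rule: less_induct)
    case less
    show ?case
    proof (cases "\<exists>k\<in>\<sigma>. pr (dc \<sigma> k) \<rho> < 0")
      case True
      then obtain k where k: "k \<in> \<sigma>" "pr (dc \<sigma> k) \<rho> < 0" by blast
      obtain k' where adj: "adjacent \<sigma> k k'" using wall_crossing[OF less.prems k(1)] .
      define \<sigma>' where "\<sigma>' = insert k' (\<sigma> - {k})"
      have \<sigma>': "\<sigma>' \<in> max_cones X" and k': "k' \<in> rays X - \<sigma>"
        using adj by (auto simp: adjacent_def \<sigma>'_def)
      have "pr (ms \<sigma> ?A) k' + ?A k' > 0" using ample_ms[OF A less.prems k'] by linarith
      then have "pr (ms \<sigma>' ?A) \<rho> < pr (ms \<sigma> ?A) \<rho>"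
        using ms_cross[OF adj assms(3), of ?A] k(2) unfolding \<sigma>'_def[symmetric]
        by (simp add: mult_pos_neg)
      then have "- D \<rho> \<le> pr (ms \<sigma>' D) \<rho>"
        using ge[OF \<sigma>'] ge[OF less.prems] by (intro less.hyps[OF _ \<sigma>']) auto
      also have "\<dots> \<le> pr (ms \<sigma> D) \<rho>"
        using ms_cross[OF adj assms(3), of D] k(2) wall[OF adj] unfolding \<sigma>'_def[symmetric]
        by (simp add: mult_nonneg_nonpos)
      finally show ?thesis .
    next
      case False
      \<comment> \<open>No negative coordinate is left: \<rho> lies in the cone \<sigma> and is
        therefore one of its rays.\<close>
      then have "uR \<rho> \<in> cone_of X \<sigma>"
        using ray_lattice[OF assms(3)]
        by (intro mem_max_cone[OF less.prems]) (auto simp: rp_uR not_less)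
      then have "{\<rho>} \<subseteq> \<sigma>"
        using bary_in_cone_imp_subset[OF ray_cone[OF assms(3)] max_cone_cone[OF less.prems]]
        by (simp add: bary_def[abs_def])
      then show ?thesis using pr_ms[OF less.prems, of \<rho> D] by simp
    qed
  qed
qed

text \<open>Completeness places the negative of each generator in some cone. The resulting relation
  turns lower bounds on the values of a character into upper bounds.\<close>

lemma ray_opposite:
  assumes "\<rho> \<in> rays X"
  obtains \<pi> c where "\<pi> \<in> cones X" "\<forall>\<kappa>\<in>\<pi>. c \<kappa> \<ge> 0"
    "\<And>m. - real_of_int (pr m \<rho>) = (\<Sum>\<kappa>\<in>\<pi>. c \<kappa> * of_int (pr m \<kappa>))"
proof -
  have "(\<lambda>i. - uR \<rho> i) \<in> {x. \<forall>i\<ge>rk. x i = 0}" using ray_lattice[OF assms] by simp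
  then obtain \<pi> where \<pi>: "\<pi> \<in> cones X" "(\<lambda>i. - uR \<rho> i) \<in> cone_of X \<pi>"
    using complete unfolding complete_fan_def by blast
  obtain c where c: "\<forall>\<kappa>\<in>\<pi>. c \<kappa> \<ge> 0" "(\<lambda>i. - uR \<rho> i) = (\<lambda>i. \<Sum>\<kappa>\<in>\<pi>. c \<kappa> * uR \<kappa> i)"
    using \<pi>(2) by (rule cone_ofE)
  have "- real_of_int (pr m \<rho>) = (\<Sum>\<kappa>\<in>\<pi>. c \<kappa> * of_int (pr m \<kappa>))" for m
  proof -
    have "rp m (\<lambda>i. - 1 * uR \<rho> i) = (\<Sum>\<kappa>\<in>\<pi>. c \<kappa> * rp m (uR \<kappa>))"
      using c(2) rpair_sum[of rk m c uR \<pi>] by simp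
    then show ?thesis unfolding rpair_scale rp_uR by simp
  qed
  then show ?thesis using that \<pi>(1) c(1) by blast
qed

lemma pr_nonneg_zero:
  assumes "\<And>\<rho>. \<rho> \<in> rays X \<Longrightarrow> pr m \<rho> \<ge> 0" "\<rho> \<in> rays X"
  shows "pr m \<rho> = 0"
proof -
  obtain \<pi> c where \<pi>: "\<pi> \<in> cones X" "\<forall>\<kappa>\<in>\<pi>. c \<kappa> \<ge> 0"
    "\<And>m. - real_of_int (pr m \<rho>) = (\<Sum>\<kappa>\<in>\<pi>. c \<kappa> * of_int (pr m \<kappa>))"
    using ray_opposite[OF assms(2)] by metis
  have "(\<Sum>\<kappa>\<in>\<pi>. c \<kappa> * of_int (pr m \<kappa>)) \<ge> 0"
    using \<pi>(2) assms(1) cone_rays[OF \<pi>(1)]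
    by (intro sum_nonneg) (auto intro!: mult_nonneg_nonneg simp: subset_iff)
  then show ?thesis using \<pi>(3)[of m] assms(1)[OF assms(2)] by linarith
qed

end

section \<open>Divisor classes\<close>

locale toric_var = toric_fan X for X :: "'v fan" +
  fixes cl :: "('v \<Rightarrow>\<^sub>0 int) \<Rightarrow> 'p::ab_group_add"
  assumes pic: "picard_group X cl"
begin

lemma cl_add: "D \<in> divisors X \<Longrightarrow> E \<in> divisors X \<Longrightarrow> cl (D + E) = cl D + cl E"
  using pic by (simp add: picard_group_def)

lemma cl_zero [simp]: "cl 0 = 0"
  using cl_add[of 0 0] by simp

lemma cl_diff: "D \<in> divisors X \<Longrightarrow> E \<in> divisors X \<Longrightarrow> cl (D - E) = cl D - cl E"
  using cl_add[of "D - E" E] divisors_diff[of D X E] by (simp add: algebra_simps)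

lemma cl_uminus: "D \<in> divisors X \<Longrightarrow> cl (- D) = - cl D"
  using cl_diff[of 0 D] by simp

lemma cl_sum: "(\<And>x. x \<in> A \<Longrightarrow> f x \<in> divisors X) \<Longrightarrow> cl (sum f A) = (\<Sum>x\<in>A. cl (f x))"
  by (induction A rule: infinite_finite_induct) (simp_all add: cl_add divisors_sum)

lemma cl_nat_mult: "D \<in> divisors X \<Longrightarrow> cl (\<Sum>_<k. D) = k \<odot> cl D"
  by (simp add: cl_sum nat_mult_def)

lemma cl_surj: obtains D where "D \<in> divisors X" "cl D = d"
proof -
  have "d \<in> cl ` divisors X" using pic by (simp add: picard_group_def)
  then show ?thesis using that by blast
qed

definition dv :: "('v \<Rightarrow> int) \<Rightarrow> ('v \<Rightarrow>\<^sub>0 int)" where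
  "dv f = (\<Sum>\<rho>\<in>rays X. Poly_Mapping.single \<rho> (f \<rho>))"

lemma lookup_dv: "lk (dv f) \<rho> = (if \<rho> \<in> rays X then f \<rho> else 0)"
proof -
  have "lk (dv f) \<rho> = (\<Sum>\<kappa>\<in>rays X. if \<kappa> = \<rho> then f \<kappa> else 0)"
    by (simp add: dv_def lookup_sum lookup_single when_def)
  then show ?thesis by simp
qed

lemma dv_divisors: "dv f \<in> divisors X"
  by (auto simp: divisors_def in_keys_iff lookup_dv split: if_splits)

abbreviation chi :: "(nat \<Rightarrow> int) \<Rightarrow> ('v \<Rightarrow>\<^sub>0 int)" where "chi m \<equiv> dv (pr m)"

lemma cl_chi: "cl (chi m) = 0"
  using pic dv_divisors[of "pr m"] unfolding picard_group_def by (auto simp: lookup_dv)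

lemma cl_eq_chi:
  assumes "D \<in> divisors X" "E \<in> divisors X" "cl D = cl E"
  obtains m where "D = E + chi m"
proof -
  have "cl (D - E) = 0" "D - E \<in> divisors X" using assms by (simp_all add: cl_diff divisors_diff)
  then have "\<exists>m. \<forall>\<rho>\<in>rays X. lk (D - E) \<rho> = pr m \<rho>" using pic by (simp add: picard_group_def)
  then obtain m where m: "\<forall>\<rho>\<in>rays X. lk (D - E) \<rho> = pr m \<rho>" ..
  have "D = E + chi m"
  proof (rule poly_mapping_eqI)
    fix \<rho> show "lk D \<rho> = lk (E + chi m) \<rho>"
      using m assms divisors_lookup[of _ X \<rho>]
      by (cases "\<rho> \<in> rays X") (auto simp: lookup_add lookup_dv lookup_minus)
  qed
  then show ?thesis by (rule that)
qed

text \<open>The representative of the class of D without support on the rays of \<sigma> (for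
  maximal \<sigma>). Its other coefficients measure how far the linear piece on \<sigma> lies above
  \<open>- D\<close>, so convexity becomes effectiveness of these representatives.\<close>

definition norm_div :: "'v set \<Rightarrow> ('v \<Rightarrow>\<^sub>0 int) \<Rightarrow> ('v \<Rightarrow>\<^sub>0 int)" where
  "norm_div \<sigma> D = D + chi (ms \<sigma> (lk D))"

lemma norm_div_divisors: "D \<in> divisors X \<Longrightarrow> norm_div \<sigma> D \<in> divisors X"
  by (simp add: norm_div_def divisors_add dv_divisors)

lemma cl_norm_div: "D \<in> divisors X \<Longrightarrow> cl (norm_div \<sigma> D) = cl D"
  by (simp add: norm_div_def cl_add dv_divisors cl_chi)

lemma lookup_norm_div: "\<rho> \<in> rays X \<Longrightarrow> lk (norm_div \<sigma> D) \<rho> = lk D \<rho> + pr (ms \<sigma> (lk D)) \<rho>"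
  by (simp add: norm_div_def lookup_add lookup_dv)

lemma norm_div_zero: "\<sigma> \<in> max_cones X \<Longrightarrow> \<rho> \<in> \<sigma> \<Longrightarrow> lk (norm_div \<sigma> D) \<rho> = 0"
  using cone_rays[OF max_cone_cone, of \<sigma>] by (auto simp: lookup_norm_div pr_ms subset_iff)

lemma norm_div_unique:
  assumes "\<sigma> \<in> max_cones X" "D \<in> divisors X" "E \<in> divisors X" "cl D = cl E"
    and "\<And>\<rho>. \<rho> \<in> \<sigma> \<Longrightarrow> lk D \<rho> = lk E \<rho>"
  shows "D = E"
proof -
  obtain m where m: "D = E + chi m" using cl_eq_chi assms by metis
  have r: "\<sigma> \<subseteq> rays X" using cone_rays[OF max_cone_cone] assms by blast
  have "pr m \<rho> = 0" if "\<rho> \<in> \<sigma>" for \<rho>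
  proof -
    have "lk D \<rho> = lk E \<rho> + pr m \<rho>" using r that by (subst m) (auto simp: lookup_add lookup_dv)
    then show ?thesis using assms(5)[OF that] by simp
  qed
  then have "pr m \<rho> = 0" if "\<rho> \<in> rays X" for \<rho> using pr_zero_on_max_cone[OF assms(1) that] by blast
  then have "chi m = 0" by (intro poly_mapping_eqI) (simp add: lookup_dv)
  then show ?thesis using m by simp
qed

text \<open>Base-point-freeness tested at the torus-fixed points: for each maximal cone some
  monomial of degree d does not vanish at its fixed point.\<close>

definition bpf :: "'p \<Rightarrow> bool" where
  "bpf d \<longleftrightarrow> (\<forall>\<sigma>\<in>max_cones X. \<exists>D\<in>exps X. cl D = d \<and> (\<forall>\<rho>\<in>\<sigma>. lk D \<rho> = 0))"

lemma bpfI_norm: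
  assumes "D \<in> divisors X" "\<And>\<sigma> \<rho>. \<sigma> \<in> max_cones X \<Longrightarrow> \<rho> \<in> rays X \<Longrightarrow> lk (norm_div \<sigma> D) \<rho> \<ge> 0"
  shows "bpf (cl D)"
  unfolding bpf_def
proof
  fix \<sigma> assume \<sigma>: "\<sigma> \<in> max_cones X"
  have "norm_div \<sigma> D \<in> exps X"
    unfolding exps_def
  proof (intro CollectI conjI allI)
    show d: "norm_div \<sigma> D \<in> divisors X" using assms(1) by (rule norm_div_divisors)
    fix \<rho> show "0 \<le> lk (norm_div \<sigma> D) \<rho>"
      using assms(2)[OF \<sigma>] divisors_lookup[OF d] by (cases "\<rho> \<in> rays X") auto
  qed
  then show "\<exists>E\<in>exps X. cl E = cl D \<and> (\<forall>\<rho>\<in>\<sigma>. lk E \<rho> = 0)"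
    using assms(1) by (intro bexI[of _ "norm_div \<sigma> D"]) (auto simp: cl_norm_div norm_div_zero[OF \<sigma>])
qed

lemma wall_nef_bpf:
  assumes "D \<in> divisors X" "\<And>\<sigma> k k'. adjacent \<sigma> k k' \<Longrightarrow> lk (norm_div \<sigma> D) k' \<ge> 0"
  shows "bpf (cl D)"
proof (rule bpfI_norm[OF assms(1)])
  fix \<sigma> \<rho> assume *: "\<sigma> \<in> max_cones X" "\<rho> \<in> rays X"
  have "pr (ms \<sigma> (lk D)) \<rho> \<ge> - lk D \<rho>"
  proof (rule wall_nef_imp_convex[OF _ *])
    fix \<sigma> k k' assume a: "adjacent \<sigma> k k'"
    then have "k' \<in> rays X" by (simp add: adjacent_def)
    then show "pr (ms \<sigma> (lk D)) k' \<ge> - lk D k'" using assms(2)[OF a] by (simp add: lookup_norm_div)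
  qed
  then show "lk (norm_div \<sigma> D) \<rho> \<ge> 0" using * by (simp add: lookup_norm_div)
qed

lemma bpfD:
  assumes "bpf d" "\<sigma> \<in> max_cones X"
  obtains D where "D \<in> exps X" "cl D = d" "\<And>\<rho>. \<rho> \<in> \<sigma> \<Longrightarrow> lk D \<rho> = 0"
  using assms unfolding bpf_def by (elim ballE[of _ _ \<sigma>] bexE conjE) auto

lemma bpf_add:
  assumes "bpf d" "bpf e" shows "bpf (d + e)"
  unfolding bpf_def
proof
  fix \<sigma> assume \<sigma>: "\<sigma> \<in> max_cones X"
  obtain D where D: "D \<in> exps X" "cl D = d" "\<And>\<rho>. \<rho> \<in> \<sigma> \<Longrightarrow> lk D \<rho> = 0"
    using bpfD[OF assms(1) \<sigma>] by metis
  obtain E where E: "E \<in> exps X" "cl E = e" "\<And>\<rho>. \<rho> \<in> \<sigma> \<Longrightarrow> lk E \<rho> = 0"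
    using bpfD[OF assms(2) \<sigma>] by metis
  show "\<exists>D\<in>exps X. cl D = d + e \<and> (\<forall>\<rho>\<in>\<sigma>. lk D \<rho> = 0)"
    using D E by (intro bexI[of _ "D + E"]) (auto simp: cl_add exps_divisors lookup_add exps_add)
qed

lemma ample_ex: obtains A where "ample X cl A"
  using spf that by (auto simp: smooth_projective_fan_def ample_def)

lemma ample_norm_pos:
  assumes "ample_divisor X A" "\<sigma> \<in> max_cones X" "\<rho> \<in> rays X - \<sigma>"
  shows "lk (norm_div \<sigma> A) \<rho> > 0"
  using ample_ms[OF assms] assms(3) by (simp add: lookup_norm_div)

lemma norm_div_add: "norm_div \<sigma> (D + E) = norm_div \<sigma> D + norm_div \<sigma> E"
proof (rule poly_mapping_eqI)
  fix \<rho>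
  have "pr (ms \<sigma> (lk (D + E))) \<rho> = pr (ms \<sigma> (lk D)) \<rho> + pr (ms \<sigma> (lk E)) \<rho>"
    unfolding ms_def[abs_def] pr_sum by (simp add: lookup_add sum.distrib[symmetric] algebra_simps)
  then show "lk (norm_div \<sigma> (D + E)) \<rho> = lk (norm_div \<sigma> D + norm_div \<sigma> E) \<rho>"
    by (simp add: norm_div_def lookup_add lookup_dv)
qed

lemma norm_div_0: "norm_div \<sigma> 0 = 0"
  using norm_div_add[of \<sigma> 0 0] by simp

lemma norm_div_sum: "norm_div \<sigma> (\<Sum>_<j. D) = (\<Sum>_<(j::nat). norm_div \<sigma> D)"
  by (induction j) (simp_all add: norm_div_add norm_div_0)

text \<open>By integrality strict convexity means coefficients at least 1 off \<sigma>; a multiple j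
  that is at least the total \<open>N\<close> of the absolute coefficients of all
  \<open>norm_div \<sigma> E\<close> outweighs them.\<close>

lemma ample_absorbs:
  assumes "ample X cl A"
  shows "\<forall>\<^sub>F j in sequentially. bpf (j \<odot> A + x)"
proof -
  obtain D where D: "ample_divisor X D" "cl D = A" using assms by (auto simp: ample_def)
  have Dd: "D \<in> divisors X" using D by (simp add: ample_divisor_def)
  obtain E where E: "E \<in> divisors X" "cl E = x" by (rule cl_surj)
  define N where "N = (\<Sum>\<sigma>\<in>max_cones X. \<Sum>\<rho>\<in>rays X. \<bar>lk (norm_div \<sigma> E) \<rho>\<bar>)"
  have "bpf (j \<odot> A + x)" if j: "j \<ge> nat N" for j
  proof -
    have "bpf (cl ((\<Sum>_<j. D) + E))"
    proof (rule bpfI_norm)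
      show "(\<Sum>_<j. D) + E \<in> divisors X" by (intro divisors_add divisors_sum Dd E)
      fix \<sigma> \<rho> assume *: "\<sigma> \<in> max_cones X" "\<rho> \<in> rays X"
      have "\<bar>lk (norm_div \<sigma> E) \<rho>\<bar> \<le> (\<Sum>\<rho>\<in>rays X. \<bar>lk (norm_div \<sigma> E) \<rho>\<bar>)"
        using * by (intro member_le_sum) auto
      also have "\<dots> \<le> N" unfolding N_def
        using * by (intro member_le_sum[of \<sigma> _ "\<lambda>\<sigma>. \<Sum>\<rho>\<in>rays X. \<bar>lk (norm_div \<sigma> E) \<rho>\<bar>"])
          (auto intro: sum_nonneg)
      finally have le: "\<bar>lk (norm_div \<sigma> E) \<rho>\<bar> \<le> int j" using j by linarith
      have "lk (norm_div \<sigma> ((\<Sum>_<j. D) + E)) \<rho> = int j * lk (norm_div \<sigma> D) \<rho> + lk (norm_div \<sigma> E) \<rho>"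
        by (simp add: norm_div_add norm_div_sum lookup_add lookup_sum)
      also have "\<dots> \<ge> 0"
      proof (cases "\<rho> \<in> \<sigma>")
        case False
        then have "lk (norm_div \<sigma> D) \<rho> \<ge> 1" using ample_norm_pos[OF D(1) *(1), of \<rho>] * by simp
        then have "int j * lk (norm_div \<sigma> D) \<rho> \<ge> int j * 1" by (intro mult_left_mono) auto
        then show ?thesis using le by linarith
      qed (simp add: norm_div_zero[OF *(1)])
      finally show "lk (norm_div \<sigma> ((\<Sum>_<j. D) + E)) \<rho> \<ge> 0" .
    qed
    moreover have "cl ((\<Sum>_<j. D) + E) = j \<odot> A + x"
      using cl_add[OF divisors_sum E(1), of "{..<j}" "\<lambda>_. D"] Dd D E by (simp add: cl_nat_mult)
    ultimately show ?thesis by simp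
  qed
  then show ?thesis by (auto simp: eventually_sequentially)
qed

lemma effective_class_zero:
  assumes "e \<in> exps X" "cl e = 0" shows "e = 0"
proof -
  obtain m where m: "e = 0 + chi m" using cl_eq_chi[of e 0] assms exps_divisors by auto
  have "pr m \<rho> \<ge> 0" if "\<rho> \<in> rays X" for \<rho>
  proof -
    have "lk e \<rho> = pr m \<rho>" using that by (subst m) (simp add: lookup_dv)
    then show ?thesis using assms(1) by (metis (mono_tags, lifting) exps_def mem_Collect_eq)
  qed
  then have "pr m \<rho> = 0" if "\<rho> \<in> rays X" for \<rho> using pr_nonneg_zero that by blast
  then have "chi m = 0" by (intro poly_mapping_eqI) (simp add: lookup_dv)
  then show ?thesis using m by simp
qed

text \<open>An effective principal divisor is zero on a complete fan, so the sum is zero and both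
  summands with it. This is the positivity of the grading behind the graded Nakayama
  argument.\<close>

lemma effective_classes_opposite:
  assumes "e \<in> exps X" "e' \<in> exps X" "cl e = - cl e'"
  shows "cl e = 0"
proof -
  have "cl (e + e') = 0" using assms by (simp add: cl_add exps_divisors)
  then have "e + e' = 0" using effective_class_zero exps_add assms by blast
  have "lk e \<rho> = 0" for \<rho>
  proof -
    have "lk e \<rho> + lk e' \<rho> = 0" using \<open>e + e' = 0\<close> by (metis lookup_add lookup_zero)
    moreover have "lk e \<rho> \<ge> 0" "lk e' \<rho> \<ge> 0" using assms by (auto simp: exps_def)
    ultimately show ?thesis by linarith
  qed
  then have "e = 0" by (intro poly_mapping_eqI) simp
  then show ?thesis by simp
qed

text \<open>All effective divisors of one class are D plus a principal divisor, with coefficients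
  bounded below by 0. The relation \<open>ray_opposite\<close> at \<rho> converts these lower bounds
  into the upper bound \<open>K\<close> at \<rho>.\<close>

lemma finite_exps_class: "finite {e \<in> exps X. cl e = d}"
proof -
  obtain D where D: "D \<in> divisors X" "cl D = d" by (rule cl_surj)
  have "\<exists>K. \<forall>e. e \<in> exps X \<and> cl e = d \<longrightarrow> lk e \<rho> \<le> K" if \<rho>: "\<rho> \<in> rays X" for \<rho>
  proof -
    obtain \<pi> c where \<pi>: "\<pi> \<in> cones X" "\<forall>\<kappa>\<in>\<pi>. c \<kappa> \<ge> 0"
      "\<And>m. - real_of_int (pr m \<rho>) = (\<Sum>\<kappa>\<in>\<pi>. c \<kappa> * of_int (pr m \<kappa>))"
      using ray_opposite[OF \<rho>] by metis
    define K where "K = lk D \<rho> + \<lceil>\<Sum>\<kappa>\<in>\<pi>. c \<kappa> * of_int (lk D \<kappa>)\<rceil>"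
    have "lk e \<rho> \<le> K" if e: "e \<in> exps X" "cl e = d" for e
    proof -
      obtain m where m: "e = D + chi m" using cl_eq_chi[of e D] D e exps_divisors by metis
      have lke: "lk e \<kappa> = lk D \<kappa> + pr m \<kappa>" if "\<kappa> \<in> rays X" for \<kappa>
        using that by (subst m) (simp add: lookup_add lookup_dv)
      have "pr m \<kappa> \<ge> - lk D \<kappa>" if "\<kappa> \<in> \<pi>" for \<kappa>
      proof -
        have "\<kappa> \<in> rays X" using that cone_rays[OF \<pi>(1)] by blast
        moreover have "lk e \<kappa> \<ge> 0" using e(1) by (simp add: exps_def)
        ultimately show ?thesis using lke[of \<kappa>] by linarith
      qed
      then have "(\<Sum>\<kappa>\<in>\<pi>. c \<kappa> * of_int (- lk D \<kappa>)) \<le> (\<Sum>\<kappa>\<in>\<pi>. c \<kappa> * of_int (pr m \<kappa>))"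
        using \<pi>(2) by (intro sum_mono mult_left_mono) (simp_all only: of_int_le_iff)
      then have "real_of_int (pr m \<rho>) \<le> (\<Sum>\<kappa>\<in>\<pi>. c \<kappa> * of_int (lk D \<kappa>))"
        using \<pi>(3)[of m] by (simp add: sum_negf)
      then have "pr m \<rho> \<le> \<lceil>\<Sum>\<kappa>\<in>\<pi>. c \<kappa> * of_int (lk D \<kappa>)\<rceil>" by linarith
      then show ?thesis using lke[OF \<rho>] by (simp add: K_def)
    qed
    then show ?thesis by blast
  qed
  then obtain K where K: "\<And>\<rho> e. \<rho> \<in> rays X \<Longrightarrow> e \<in> exps X \<Longrightarrow> cl e = d \<Longrightarrow> lk e \<rho> \<le> K \<rho>"
    by metis
  define F where "F = {f. (\<forall>\<rho>. (\<rho> \<in> rays X \<longrightarrow> f \<rho> \<in> {0..K \<rho>}) \<and> (\<rho> \<notin> rays X \<longrightarrow> f \<rho> = 0))}"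
  have "finite F"
    unfolding F_def
    using finite_set_of_finite_funs[OF finite_rays, of "(\<Union>\<rho>\<in>rays X. {0..K \<rho>})" 0]
    by (rule finite_subset[rotated]) auto
  moreover have "lk ` {e \<in> exps X. cl e = d} \<subseteq> F"
    using K divisors_lookup by (auto simp: F_def exps_def)
  moreover have "inj_on lk {e \<in> exps X. cl e = d}" by (simp add: inj_on_def poly_mapping_eqI)
  ultimately show ?thesis by (metis finite_imageD finite_subset)
qed

end

section \<open>Signs\<close>

text \<open>The sign of the Cech coboundary with the enumeration left abstract; the Koszul
  differential uses the same signs and the same exchange rules.\<close>

definition sg :: "('i \<Rightarrow> nat) \<Rightarrow> 'i \<Rightarrow> 'i set \<Rightarrow> 'a::comm_ring_1" where
  "sg ix \<sigma> T = (- 1) ^ card {\<tau> \<in> T. ix \<tau> < ix \<sigma>}"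

lemma sg_square: "sg ix \<sigma> T * sg ix \<sigma> T = 1"
  by (simp add: sg_def flip: power_mult_distrib)

lemma sg_square_left: "sg ix \<sigma> T * (sg ix \<sigma> T * x) = x"
  using sg_square[of ix \<sigma> T] by (metis mult.assoc mult_1)

lemma sg_remove: "sg ix \<sigma> (T - {\<sigma>}) = sg ix \<sigma> T"
proof -
  have "{\<tau> \<in> T - {\<sigma>}. ix \<tau> < ix \<sigma>} = {\<tau> \<in> T. ix \<tau> < ix \<sigma>}" by auto
  then show ?thesis by (simp add: sg_def)
qed

lemma sg_insert_self: "s \<notin> T \<Longrightarrow> sg ix s (insert s T) = sg ix s T"
  by (subst sg_remove[symmetric]) simp

lemma sg_insert:
  assumes "finite T" "s \<notin> T"
  shows "sg ix \<sigma> (insert s T) = (if ix s < ix \<sigma> then - sg ix \<sigma> T else sg ix \<sigma> T)"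
proof -
  have "{\<tau> \<in> insert s T. ix \<tau> < ix \<sigma>} =
      (if ix s < ix \<sigma> then insert s {\<tau> \<in> T. ix \<tau> < ix \<sigma>} else {\<tau> \<in> T. ix \<tau> < ix \<sigma>})" by auto
  then show ?thesis using assms by (simp add: sg_def)
qed

lemma sg_swap:
  assumes "finite T" "s \<notin> T" "\<sigma> \<notin> T" "ix s \<noteq> ix \<sigma>"
  shows "sg ix \<sigma> (insert s T) * sg ix s T = - (sg ix s (insert \<sigma> T) * sg ix \<sigma> T)"
    and "sg ix \<sigma> (insert s T) * sg ix s (insert \<sigma> T) = - (sg ix s T * sg ix \<sigma> T)"
  using assms by (auto simp: sg_insert mult.commute)

text \<open>Pairing off the two orders keeps the argument valid in characteristic two.\<close>

lemma antisym_sum_zero: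
  fixes a :: "'i \<Rightarrow> 'i \<Rightarrow> 'a::ab_group_add" and ix :: "'i \<Rightarrow> nat"
  assumes "finite F" "inj_on ix F"
    and "\<And>\<sigma> s. \<sigma> \<in> F \<Longrightarrow> s \<in> F \<Longrightarrow> \<sigma> \<noteq> s \<Longrightarrow> a s \<sigma> = - a \<sigma> s"
  shows "(\<Sum>\<sigma>\<in>F. \<Sum>s\<in>F - {\<sigma>}. a \<sigma> s) = 0"
proof -
  have "(\<Sum>s\<in>F - {\<sigma>}. a \<sigma> s) = (\<Sum>s\<in>{s\<in>F. ix s < ix \<sigma>}. a \<sigma> s) + (\<Sum>s\<in>{s\<in>F. ix \<sigma> < ix s}. a \<sigma> s)"
    if "\<sigma> \<in> F" for \<sigma>
  proof -
    have "F - {\<sigma>} = {s\<in>F. ix s < ix \<sigma>} \<union> {s\<in>F. ix \<sigma> < ix s}"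
      using assms(2) that by (auto simp: inj_on_def) (metis linorder_neqE_nat)
    then show ?thesis using assms(1) by (simp add: sum.union_disjoint disjoint_iff)
  qed
  then have "(\<Sum>\<sigma>\<in>F. \<Sum>s\<in>F - {\<sigma>}. a \<sigma> s) =
     (\<Sum>\<sigma>\<in>F. \<Sum>s\<in>{s\<in>F. ix s < ix \<sigma>}. a \<sigma> s) + (\<Sum>\<sigma>\<in>F. \<Sum>s\<in>{s\<in>F. ix \<sigma> < ix s}. a \<sigma> s)"
    by (simp add: sum.distrib)
  also have "(\<Sum>\<sigma>\<in>F. \<Sum>s\<in>{s\<in>F. ix \<sigma> < ix s}. a \<sigma> s) = (\<Sum>s\<in>F. \<Sum>\<sigma>\<in>{\<sigma>\<in>F. ix \<sigma> < ix s}. a \<sigma> s)"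
    by (rule sum.swap_restrict) (use assms(1) in auto)
  also have "\<dots> = (\<Sum>s\<in>F. \<Sum>\<sigma>\<in>{\<sigma>\<in>F. ix \<sigma> < ix s}. - a s \<sigma>)"
    using assms(3) by (intro sum.cong refl) auto
  finally show ?thesis by (simp add: sum_negf)
qed

section \<open>The Cech complex\<close>

context toric_var
begin

abbreviation "ix \<equiv> to_nat_on (cones X)"

lemma inj_ix: "inj_on ix (cones X)"
  by (rule inj_on_to_nat_on[OF countable_finite[OF finite_cones]])

lemma inj_ix_sub: "F \<subseteq> cones X \<Longrightarrow> inj_on ix F"
  using inj_ix inj_on_subset by blast

lemma finite_sub_cones: "F \<subseteq> cones X \<Longrightarrow> finite F"
  using finite_cones finite_subset by blast

lemma coboundary_eq:
  "F \<subseteq> cones X \<Longrightarrow> coboundary X \<phi> F = (\<Sum>\<sigma>\<in>F. sg ix \<sigma> F * \<phi> (F - {\<sigma>}))"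
  by (simp add: coboundary_def sg_def)

lemma coboundary_outside: "\<not> F \<subseteq> cones X \<Longrightarrow> coboundary X \<phi> F = 0"
  by (simp add: coboundary_def)

lemma coboundary_coboundary:
  fixes \<phi> :: "'v set set \<Rightarrow> ('v, 'b::field) laurent"
  shows "coboundary X (coboundary X \<phi>) = (\<lambda>_. 0)"
proof
  fix F show "coboundary X (coboundary X \<phi>) F = 0"
  proof (cases "F \<subseteq> cones X")
    case True
    note fin = finite_sub_cones[OF True]
    have "coboundary X (coboundary X \<phi>) F =
        (\<Sum>\<sigma>\<in>F. \<Sum>s\<in>F - {\<sigma>}. sg ix \<sigma> F * sg ix s (F - {\<sigma>}) * \<phi> (F - {\<sigma>} - {s}))"
      using True by (simp add: coboundary_eq subset_iff sum_distrib_left mult.assoc)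
    also have "\<dots> = 0"
    proof (rule antisym_sum_zero[OF fin inj_ix_sub[OF True]])
      fix \<sigma> s assume *: "\<sigma> \<in> F" "s \<in> F" "\<sigma> \<noteq> s"
      define T where "T = F - {\<sigma>} - {s}"
      have T: "finite T" "s \<notin> T" "\<sigma> \<notin> T" using fin by (auto simp: T_def)
      have F: "F - {\<sigma>} = insert s T" "F - {s} = insert \<sigma> T" using * by (auto simp: T_def)
      have i: "ix s \<noteq> ix \<sigma>" using * inj_ix_sub[OF True] by (auto simp: inj_on_def)
      have 1: "sg ix s F = (sg ix s (insert \<sigma> T) :: ('v, 'b) laurent)"
        "sg ix \<sigma> F = (sg ix \<sigma> (insert s T) :: ('v, 'b) laurent)"
        by (simp_all flip: F add: sg_remove)
      have 2: "sg ix \<sigma> (insert \<sigma> T) = (sg ix \<sigma> T :: ('v, 'b) laurent)"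
        "sg ix s (insert s T) = (sg ix s T :: ('v, 'b) laurent)"
        using T by (simp_all add: sg_insert_self)
      have 3: "insert \<sigma> T - {\<sigma>} = T" "insert s T - {s} = T" using T by auto
      have "sg ix s (insert \<sigma> T) * sg ix \<sigma> T = (- (sg ix \<sigma> (insert s T) * sg ix s T) :: ('v, 'b) laurent)"
        unfolding sg_swap(1)[OF T i] by simp
      then show "sg ix s F * sg ix \<sigma> (F - {s}) * \<phi> (F - {s} - {\<sigma>}) =
          - (sg ix \<sigma> F * sg ix s (F - {\<sigma>}) * \<phi> (F - {\<sigma>} - {s}))"
        by (simp only: 1 F 2 3 mult_minus_left)
    qed
    finally show ?thesis .
  qed (simp add: coboundary_outside)
qed

lemma coboundary_lincomb:
  "coboundary X (\<lambda>F. \<Sum>i\<in>A. c i * \<phi> i F) F = (\<Sum>i\<in>A. c i * coboundary X (\<phi> i) F)"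
proof (cases "F \<subseteq> cones X")
  case True
  then show ?thesis
    by (simp add: coboundary_eq sum_distrib_left mult_ac) (rule sum.swap)
qed (simp add: coboundary_outside)

lemma coboundary_diff: "coboundary X (\<lambda>F. \<phi> F - \<psi> F) F = coboundary X \<phi> F - coboundary X \<psi> F"
  by (simp add: coboundary_def right_diff_distrib sum_subtractf)

lemma coboundary_zero: "coboundary X (\<lambda>_. 0) = (\<lambda>_. 0)"
  by (simp add: coboundary_def fun_eq_iff)

section \<open>Localizations and homogeneous cochains\<close>

definition wt :: "'v set set \<Rightarrow> 'v \<Rightarrow>\<^sub>0 int" where
  "wt F = (\<Sum>\<sigma>\<in>F. \<Sum>\<rho>\<in>rays X - \<sigma>. Poly_Mapping.single \<rho> 1)"

lemma irrelevant_gen_mon: "irrelevant_gen X \<sigma> = mon (\<Sum>\<rho>\<in>rays X - \<sigma>. Poly_Mapping.single \<rho> 1)"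
  by (simp add: irrelevant_gen_def mon_prod)

lemma prod_irrelevant_gen: "(\<Prod>\<sigma>\<in>F. irrelevant_gen X \<sigma>) = mon (wt F)"
  by (simp add: irrelevant_gen_mon mon_prod wt_def)

lemma single_exps: "\<rho> \<in> rays X \<Longrightarrow> Poly_Mapping.single \<rho> 1 \<in> exps X"
  by (auto simp: exps_def divisors_def lookup_single when_def)

lemma wt_exps: "wt F \<in> exps X"
  unfolding wt_def by (intro exps_sum) (auto intro: single_exps)

definition loc :: "('v, 'k::field) laurent set \<Rightarrow> 'v set set \<Rightarrow> ('v, 'k) laurent set" where
  "loc M F = localization M (\<Prod>\<sigma>\<in>F. irrelevant_gen X \<sigma>)"

lemma loc_iff: "p \<in> loc M F \<longleftrightarrow> (\<exists>k. mon (\<Sum>_<(k::nat). wt F) * p \<in> M)"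
  unfolding loc_def localization_def prod_irrelevant_gen mon_power by simp

lemma multiple_exps: "v \<in> exps X \<Longrightarrow> (\<Sum>_<(k::nat). v) \<in> exps X"
  by (rule exps_sum)

lemma multiple_add: "(\<Sum>_<(k + l::nat). v) = (\<Sum>_<k. v) + (\<Sum>_<l. v :: 'v \<Rightarrow>\<^sub>0 int)"
  by (induction l) (simp_all add: add.assoc)

lemma submod_mon: "submod X M \<Longrightarrow> v \<in> exps X \<Longrightarrow> p \<in> M \<Longrightarrow> mon v * p \<in> M"
  by (rule submod_smult) (auto intro: cox_single)

lemma submod_mon_le:
  assumes "submod X M" "mon a * p \<in> M" "b - a \<in> exps X"
  shows "mon b * p \<in> M"
proof -
  have "mon b * p = mon (b - a) * (mon a * p)" by (simp add: mult.assoc[symmetric] mult_single)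
  then show ?thesis using submod_mon[OF assms(1,3,2)] by simp
qed

lemma submod_loc:
  fixes M :: "('v, 'k::field) laurent set"
  assumes "submod X M" shows "submod X (loc M F)"
  unfolding submod_def
proof (intro conjI ballI)
  show "0 \<in> loc M F" using assms by (auto simp: loc_iff submod_def)
next
  fix p q assume "p \<in> loc M F" "q \<in> loc M F"
  then obtain k l where kl: "mon (\<Sum>_<(k::nat). wt F) * p \<in> M" "mon (\<Sum>_<(l::nat). wt F) * q \<in> M"
    by (auto simp: loc_iff)
  have "mon (\<Sum>_<k + l. wt F) * p \<in> M"
    by (rule submod_mon_le[OF assms kl(1)]) (unfold multiple_add, simp add: multiple_exps wt_exps)
  moreover have "mon (\<Sum>_<k + l. wt F) * q \<in> M"
    by (rule submod_mon_le[OF assms kl(2)]) (unfold multiple_add, simp add: multiple_exps wt_exps)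
  ultimately have "mon (\<Sum>_<k + l. wt F) * (p + q) \<in> M"
    using assms by (simp add: distrib_left submod_add)
  then show "p + q \<in> loc M F" unfolding loc_iff by blast
next
  fix s p :: "('v, 'k) laurent" assume "s \<in> cox X" "p \<in> loc M F"
  then obtain k where "mon (\<Sum>_<(k::nat). wt F) * p \<in> M" by (auto simp: loc_iff)
  then have "s * (mon (\<Sum>_<k. wt F) * p) \<in> M" using assms \<open>s \<in> cox X\<close> by (rule submod_smult[rotated 2])
  then have "mon (\<Sum>_<k. wt F) * (s * p) \<in> M" by (simp only: mult.left_commute)
  then show "s * p \<in> loc M F" unfolding loc_iff by blast
qed

lemma loc_mono:
  assumes "submod X M" "p \<in> loc M F" "F \<subseteq> G" "finite G"
  shows "p \<in> loc M G"
proof -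
  obtain k where k: "mon (\<Sum>_<(k::nat). wt F) * p \<in> M" using assms(2) by (auto simp: loc_iff)
  have "wt G = wt F + wt (G - F)"
    unfolding wt_def by (subst sum.subset_diff[OF assms(3,4)]) (rule add.commute)
  then have "(\<Sum>_<k. wt G) - (\<Sum>_<k. wt F) = (\<Sum>_<k. wt (G - F))" by (simp add: sum.distrib)
  then have "mon (\<Sum>_<k. wt G) * p \<in> M"
    using submod_mon_le[OF assms(1) k] by (simp add: multiple_exps wt_exps)
  then show ?thesis unfolding loc_iff by blast
qed

text \<open>The generator of \<sigma> contains every ray outside \<sigma>, so the monomial of
  \<open>v\<close> divides a power of it and becomes invertible in the localization at
  \<open>F\<close>.\<close>

lemma wt_absorbs:
  assumes "\<sigma> \<in> F" "finite F" "v \<in> divisors X" "\<And>\<rho>. \<rho> \<in> \<sigma> \<Longrightarrow> lk v \<rho> = 0"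
  shows "\<exists>k::nat. (\<Sum>_<k. wt F) - v \<in> exps X"
proof -
  define k where "k = nat (\<Sum>\<rho>\<in>rays X. \<bar>lk v \<rho>\<bar>)"
  have one: "lk (\<Sum>\<rho>\<in>rays X - \<tau>. Poly_Mapping.single \<rho> (1::int)) \<rho> = (if \<rho> \<in> rays X - \<tau> then 1 else 0)" for \<tau> \<rho>
  proof -
    have "lk (\<Sum>\<rho>\<in>rays X - \<tau>. Poly_Mapping.single \<rho> (1::int)) \<rho> = (\<Sum>\<kappa>\<in>rays X - \<tau>. if \<kappa> = \<rho> then 1 else 0)"
      by (simp add: lookup_sum lookup_single when_def)
    then show ?thesis using finite_rays by simp
  qed
  have "lk ((\<Sum>_<k. wt F) - v) \<rho> \<ge> 0" for \<rho>
  proof (cases "\<rho> \<in> rays X \<and> \<rho> \<notin> \<sigma>")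
    case True
    have "lk (wt F) \<rho> = (\<Sum>\<tau>\<in>F. if \<rho> \<in> rays X - \<tau> then 1 else 0)"
      unfolding wt_def lookup_sum[of _ F] one ..
    also have "\<dots> \<ge> (\<Sum>\<tau>\<in>{\<sigma>}. if \<rho> \<in> rays X - \<tau> then 1 else 0)"
      using assms(1,2) by (intro sum_mono2) auto
    finally have "lk (wt F) \<rho> \<ge> 1" using True by simp
    then have "int k * lk (wt F) \<rho> \<ge> int k * 1" by (intro mult_left_mono) auto
    moreover have "\<bar>lk v \<rho>\<bar> \<le> (\<Sum>\<rho>\<in>rays X. \<bar>lk v \<rho>\<bar>)" using True by (intro member_le_sum) auto
    ultimately show ?thesis by (simp add: lookup_minus lookup_sum k_def)
  next
    case False
    then have "lk v \<rho> = 0" using assms(4) divisors_lookup[OF assms(3)] by (cases "\<rho> \<in> \<sigma>") auto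
    moreover have "lk (wt F) \<rho> \<ge> 0" using wt_exps by (simp add: exps_def)
    ultimately show ?thesis by (simp add: lookup_minus lookup_sum)
  qed
  then have "(\<Sum>_<k. wt F) - v \<in> exps X"
    using assms(3) by (simp add: exps_def divisors_diff divisors_sum exps_divisors[OF wt_exps])
  then show ?thesis by blast
qed

lemma loc_divide:
  assumes "submod X M" "p \<in> loc M F" "(\<Sum>_<(k::nat). wt F) - v \<in> exps X"
  shows "mon (- v) * p \<in> loc M F"
proof -
  obtain l where l: "mon (\<Sum>_<(l::nat). wt F) * p \<in> M" using assms(2) by (auto simp: loc_iff)
  have "mon (\<Sum>_<l + k. wt F) * (mon (- v) * p) = mon ((\<Sum>_<k. wt F) - v) * (mon (\<Sum>_<l. wt F) * p)"
    unfolding multiple_add by (simp add: mult.assoc[symmetric] mult_single algebra_simps)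
  then have "mon (\<Sum>_<l + k. wt F) * (mon (- v) * p) \<in> M" using submod_mon[OF assms(1,3) l] by simp
  then show ?thesis unfolding loc_iff by blast
qed

lemma loc_keys:
  assumes "M \<subseteq> cox X" "p \<in> loc M F" shows "ks p \<subseteq> divisors X"
proof -
  obtain k where "mon (\<Sum>_<(k::nat). wt F) * p \<in> M" using assms(2) by (auto simp: loc_iff)
  then have *: "ks (mon (\<Sum>_<(k::nat). wt F) * p) \<subseteq> exps X" using assms(1) cox_iff by blast
  show ?thesis
  proof
    fix m assume "m \<in> ks p"
    then have "(\<Sum>_<k. wt F) + m \<in> divisors X" using * unfolding keys_mon_times by (auto simp: exps_divisors)
    then have "(\<Sum>_<k. wt F) + m - (\<Sum>_<k. wt F) \<in> divisors X"
      by (rule divisors_diff) (simp add: multiple_exps exps_divisors wt_exps)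
    then show "m \<in> divisors X" by simp
  qed
qed

text \<open>Exponents are required to lie in \<open>divisors X\<close> because the axioms of the
  class map say nothing about other arguments.\<close>

definition homog :: "'p \<Rightarrow> ('v, 'k::field) laurent \<Rightarrow> bool" where
  "homog d p \<longleftrightarrow> (\<forall>m\<in>ks p. m \<in> divisors X \<and> cl m = d)"

lemma homog_zero [simp]: "homog d 0" by (simp add: homog_def)

lemma homog_add: "homog d p \<Longrightarrow> homog d q \<Longrightarrow> homog d (p + q)"
  using keys_add[of p q] by (auto simp: homog_def)

lemma homog_uminus: "homog d p \<Longrightarrow> homog d (- p)" by (simp add: homog_def in_keys_iff)

lemma homog_diff: "homog d p \<Longrightarrow> homog d q \<Longrightarrow> homog d (p - q)"
  using homog_add[of d p "- q"] homog_uminus[of d q] by simp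

lemma homog_sum: "(\<And>x. x \<in> A \<Longrightarrow> homog d (f x)) \<Longrightarrow> homog d (sum f A)"
  by (induction A rule: infinite_finite_induct) (auto intro: homog_add)

lemma homog_mult: "homog d p \<Longrightarrow> homog e q \<Longrightarrow> homog (d + e) (p * q)"
  using keys_mult[of p q] by (fastforce simp: homog_def cl_add divisors_add)

lemma homog_one: "homog 0 1" by (simp add: homog_def)

lemma homog_single: "v \<in> divisors X \<Longrightarrow> homog (cl v) (Poly_Mapping.single v c)"
  by (simp add: homog_def)

lemma homog_sg: "homog 0 (sg ix \<sigma> T :: ('v, 'k::field) laurent)"
proof -
  have "homog 0 ((- 1) ^ k :: ('v, 'k) laurent)" for k
  proof (induction k)
    case (Suc k)
    then show ?case using homog_uminus[OF Suc] by simp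
  qed (simp add: homog_one)
  then show ?thesis by (simp add: sg_def)
qed

lemma cox_sg: "sg ix \<sigma> T \<in> cox X"
  by (simp add: sg_def cox_power cox_uminus)

lemma cochain_iff:
  assumes "M \<subseteq> cox X"
  shows "\<phi> \<in> cochains X cl M i d \<longleftrightarrow>
    (\<forall>F. if F \<subseteq> cones X \<and> card F = i then \<phi> F \<in> loc M F \<and> homog d (\<phi> F) else \<phi> F = 0)"
proof -
  have "p \<in> degree_part cl (loc M F) d \<longleftrightarrow> p \<in> loc M F \<and> homog d p" for p F
    using loc_keys[OF assms, of p F] by (auto simp: degree_part_def homog_def)
  then show ?thesis by (simp only: cochains_def mem_Collect_eq loc_def)
qed

lemma cochainsI:
  assumes "M \<subseteq> cox X"
    and "\<And>F. F \<subseteq> cones X \<Longrightarrow> card F = i \<Longrightarrow> \<phi> F \<in> loc M F"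
    and "\<And>F. F \<subseteq> cones X \<Longrightarrow> card F = i \<Longrightarrow> homog d (\<phi> F)"
    and "\<And>F. \<not> (F \<subseteq> cones X \<and> card F = i) \<Longrightarrow> \<phi> F = 0"
  shows "\<phi> \<in> cochains X cl M i d"
  using assms by (simp add: cochain_iff)

lemma cochainsD:
  assumes "M \<subseteq> cox X" "\<phi> \<in> cochains X cl M i d"
  shows "submod X M \<Longrightarrow> \<phi> F \<in> loc M F" "homog d (\<phi> F)" "\<not> (F \<subseteq> cones X \<and> card F = i) \<Longrightarrow> \<phi> F = 0"
  using assms(2)[unfolded cochain_iff[OF assms(1)], rule_format, of F]
  by (auto split: if_splits intro: submod_zero submod_loc)

lemma coboundary_cochains:
  assumes "submod X M" "M \<subseteq> cox X" "\<phi> \<in> cochains X cl M i d"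
  shows "coboundary X \<phi> \<in> cochains X cl M (Suc i) d"
proof (rule cochainsI[OF assms(2)])
  fix F assume F: "F \<subseteq> cones X" "card F = Suc i"
  note D = cochainsD[OF assms(2,3)]
  have "\<phi> (F - {\<sigma>}) \<in> loc M F" for \<sigma>
    using loc_mono[OF assms(1) D(1)[OF assms(1)]] finite_sub_cones[OF F(1)] by (meson Diff_subset)
  then show "coboundary X \<phi> F \<in> loc M F"
    unfolding coboundary_eq[OF F(1)]
    by (intro submod_sum[OF submod_loc[OF assms(1)]] submod_smult[OF submod_loc[OF assms(1)]] cox_sg)
  have "homog (0 + d) (sg ix \<sigma> F * \<phi> (F - {\<sigma>}))" for \<sigma> by (intro homog_mult homog_sg D(2))
  then show "homog d (coboundary X \<phi> F)"
    unfolding coboundary_eq[OF F(1)] by (intro homog_sum) simp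
next
  fix F assume F: "\<not> (F \<subseteq> cones X \<and> card F = Suc i)"
  show "coboundary X \<phi> F = 0"
  proof (cases "F \<subseteq> cones X")
    case True
    have "\<phi> (F - {\<sigma>}) = 0" if "\<sigma> \<in> F" for \<sigma>
    proof -
      have "card (F - {\<sigma>}) \<noteq> i"
        using F True that finite_sub_cones[OF True] by (metis card.remove)
      then show ?thesis using cochainsD(3)[OF assms(2,3)] by blast
    qed
    then show ?thesis by (simp add: coboundary_eq[OF True])
  qed (rule coboundary_outside)
qed

lemma cochains_lincomb:
  assumes "submod X M" "M \<subseteq> cox X" "\<And>j. j \<in> A \<Longrightarrow> c j \<in> cox X \<and> homog (e j) (c j)"
    and "\<And>j. j \<in> A \<Longrightarrow> \<phi> j \<in> cochains X cl M i (d - e j)"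
  shows "(\<lambda>F. \<Sum>j\<in>A. c j * \<phi> j F) \<in> cochains X cl M i d"
proof (rule cochainsI[OF assms(2)])
  fix F
  show "(\<Sum>j\<in>A. c j * \<phi> j F) \<in> loc M F"
    using assms cochainsD(1)[OF assms(2) assms(4) assms(1)]
    by (intro submod_sum[OF submod_loc[OF assms(1)]] submod_smult[OF submod_loc[OF assms(1)]]) auto
  have "homog d (c j * \<phi> j F)" if "j \<in> A" for j
    using homog_mult[OF conjunct2[OF assms(3)[OF that]] cochainsD(2)[OF assms(2) assms(4)[OF that], of F]]
    by simp
  then show "homog d (\<Sum>j\<in>A. c j * \<phi> j F)" by (rule homog_sum)
next
  fix F assume "\<not> (F \<subseteq> cones X \<and> card F = i)"
  then show "(\<Sum>j\<in>A. c j * \<phi> j F) = 0"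
    using cochainsD(3)[OF assms(2) assms(4)] by (intro sum.neutral) auto
qed

lemma cochains_diff:
  assumes "submod X M" "M \<subseteq> cox X" "\<phi> \<in> cochains X cl M i d" "\<psi> \<in> cochains X cl M i d"
  shows "(\<lambda>F. \<phi> F - \<psi> F) \<in> cochains X cl M i d"
  using cochainsD[OF assms(2,3)] cochainsD[OF assms(2,4)] assms(1)
  by (intro cochainsI[OF assms(2)]) (auto intro: submod_diff[OF submod_loc] homog_diff)

lemma cochains_zero: "submod X M \<Longrightarrow> M \<subseteq> cox X \<Longrightarrow> (\<lambda>_. 0) \<in> cochains X cl M i d"
  by (intro cochainsI) (auto intro: submod_zero submod_loc)

lemma vanishesD:
  assumes "local_cohomology_vanishes X cl M (Suc i) d" "\<phi> \<in> cochains X cl M (Suc i) d"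
    "coboundary X \<phi> = (\<lambda>_. 0)"
  obtains \<psi> where "\<psi> \<in> cochains X cl M i d" "\<phi> = coboundary X \<psi>"
proof -
  have "\<phi> \<in> cocycle_set X cl M (Suc i) d" using assms by (simp add: cocycle_set_def)
  then have "\<phi> \<in> coboundary X ` cochains X cl M i d"
    using assms(1) by (simp add: local_cohomology_vanishes_def coboundary_set_def)
  then show ?thesis using that by blast
qed

lemma vanishesI:
  assumes "submod X M" "M \<subseteq> cox X"
    and "\<And>\<phi>. \<phi> \<in> cochains X cl M (Suc i) d \<Longrightarrow> coboundary X \<phi> = (\<lambda>_. 0) \<Longrightarrow>
      \<exists>\<psi>\<in>cochains X cl M i d. \<phi> = coboundary X \<psi>"
  shows "local_cohomology_vanishes X cl M (Suc i) d"
proof -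
  have "cocycle_set X cl M (Suc i) d \<subseteq> coboundary_set X cl M (Suc i) d"
    using assms(3) by (auto simp: cocycle_set_def coboundary_set_def)
  moreover have "coboundary_set X cl M (Suc i) d \<subseteq> cocycle_set X cl M (Suc i) d"
    using coboundary_cochains[OF assms(1,2)]
    by (auto simp: cocycle_set_def coboundary_set_def coboundary_coboundary)
  ultimately show ?thesis by (auto simp: local_cohomology_vanishes_def)
qed

lemma cochains_large:
  assumes "M \<subseteq> cox X" "i > card (cones X)" "\<phi> \<in> cochains X cl M i d"
  shows "\<phi> = (\<lambda>_. 0)"
proof
  fix F
  have "\<not> (F \<subseteq> cones X \<and> card F = i)" using assms(2) card_mono[OF finite_cones, of F] by auto
  then show "\<phi> F = 0" using cochainsD(3)[OF assms(1,3)] by blast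
qed

lemma vanishes_large:
  assumes "submod X M" "M \<subseteq> cox X" "i > card (cones X)"
  shows "local_cohomology_vanishes X cl M i d"
proof -
  obtain i' where i: "i = Suc i'" using assms(3) by (cases i) auto
  show ?thesis unfolding i
  proof (rule vanishesI[OF assms(1,2)])
    fix \<phi> assume "\<phi> \<in> cochains X cl M (Suc i') d"
    then have "\<phi> = (\<lambda>_. 0)" using cochains_large[OF assms(2,3)] i by blast
    then have "\<phi> = coboundary X (\<lambda>_. 0)" by (simp only: coboundary_zero)
    then show "\<exists>\<psi>\<in>cochains X cl M i' d. \<phi> = coboundary X \<psi>"
      using cochains_zero[OF assms(1,2)] by blast
  qed
qed

text \<open>There is no cohomology in degree 0 because the modules are torsion-free.\<close>

lemma vanishes_0:
  assumes "submod X M" "M \<subseteq> cox X"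
  shows "local_cohomology_vanishes X cl M 0 d"
proof -
  have "\<phi> = (\<lambda>_. 0)" if \<phi>: "\<phi> \<in> cochains X cl M 0 d" "coboundary X \<phi> = (\<lambda>_. 0)" for \<phi>
  proof
    fix F
    \<comment> \<open>The component of the coboundary at the zero cone is the value at the empty
      family up to sign, so the coboundary is injective in degree 0.\<close>
    have "coboundary X \<phi> {{}} = sg ix {} {{}} * \<phi> {}" by (simp add: coboundary_eq)
    then have "sg ix {} {{}} * (sg ix {} {{}} * \<phi> {}) = 0" using \<phi>(2) by simp
    then have 0: "\<phi> {} = 0" by (simp only: sg_square_left)
    show "\<phi> F = 0"
    proof (cases "F = {}")
      case False
      then have "\<not> (F \<subseteq> cones X \<and> card F = 0)" using finite_sub_cones by auto
      then show ?thesis using cochainsD(3)[OF assms(2) \<phi>(1)] by blast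
    qed (simp add: 0)
  qed
  then have "cocycle_set X cl M 0 d = {\<lambda>_. 0}"
    using cochains_zero[OF assms] coboundary_zero by (auto simp: cocycle_set_def)
  then show ?thesis by (simp add: local_cohomology_vanishes_def coboundary_set_def)
qed

section \<open>Regularity and generation\<close>

text \<open>The Koszul differential of the monomials \<open>y \<sigma>\<close>, lowering the size of
  the index set T by one. The coefficients \<open>z\<close> are arbitrary, since it is applied to
  Cech cochains componentwise.\<close>

definition kap :: "('v set \<Rightarrow> 'v \<Rightarrow>\<^sub>0 int) \<Rightarrow> ('v set set \<Rightarrow> ('v, 'k::field) laurent) \<Rightarrow> 'v set set \<Rightarrow> ('v, 'k) laurent" where
  "kap y z T = (\<Sum>\<sigma>\<in>max_cones X - T. sg ix \<sigma> T * mon (y \<sigma>) * z (insert \<sigma> T))"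

lemma max_cones_sub: "max_cones X \<subseteq> cones X"
  using max_cone_cone by blast

lemma kap_kap:
  assumes "T \<subseteq> max_cones X"
  shows "kap y (kap y z) T = 0"
proof -
  have fin: "finite T" using assms finite_max_cones finite_subset by blast
  have e: "max_cones X - insert \<sigma> T = max_cones X - T - {\<sigma>}" for \<sigma> by auto
  have "kap y (kap y z) T = (\<Sum>\<sigma>\<in>max_cones X - T. \<Sum>s\<in>max_cones X - T - {\<sigma>}.
      sg ix \<sigma> T * mon (y \<sigma>) * (sg ix s (insert \<sigma> T) * mon (y s) * z (insert s (insert \<sigma> T))))"
    unfolding kap_def sum_distrib_left by (simp only: e)
  also have "\<dots> = 0"
  proof (rule antisym_sum_zero)
    show "finite (max_cones X - T)" by simp
    show inj: "inj_on ix (max_cones X - T)" using max_cones_sub by (intro inj_ix_sub) auto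
    fix \<sigma> s assume *: "\<sigma> \<in> max_cones X - T" "s \<in> max_cones X - T" "\<sigma> \<noteq> s"
    have i: "ix s \<noteq> ix \<sigma>" using * inj by (auto simp: inj_on_def)
    have "sg ix s T * mon (y s) * (sg ix \<sigma> (insert s T) * mon (y \<sigma>) * z (insert \<sigma> (insert s T)))
      = (sg ix \<sigma> (insert s T) * sg ix s T) * (mon (y s) * mon (y \<sigma>) * z (insert \<sigma> (insert s T)))"
      by (simp add: mult_ac)
    also have "\<dots> = - (sg ix s (insert \<sigma> T) * sg ix \<sigma> T) * (mon (y s) * mon (y \<sigma>) * z (insert \<sigma> (insert s T)))"
      by (subst sg_swap(1)[OF fin _ _ i]) (use * in auto)
    also have "\<dots> = - (sg ix \<sigma> T * mon (y \<sigma>) * (sg ix s (insert \<sigma> T) * mon (y s) * z (insert s (insert \<sigma> T))))"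
      by (simp add: mult_ac insert_commute)
    finally show "sg ix s T * mon (y s) * (sg ix \<sigma> (insert s T) * mon (y \<sigma>) * z (insert \<sigma> (insert s T))) =
      - (sg ix \<sigma> T * mon (y \<sigma>) * (sg ix s (insert \<sigma> T) * mon (y s) * z (insert s (insert \<sigma> T))))" .
  qed
  finally show ?thesis .
qed

text \<open>Once \<open>y s\<close> is inverted, multiplication by its inverse in the direction of s
  is a contracting homotopy of the Koszul complex; applied to a cycle it gives an explicit
  preimage.\<close>

lemma kap_exact:
  fixes z :: "'v set set \<Rightarrow> ('v, 'k::field) laurent"
  assumes s: "s \<in> max_cones X" and T: "T \<subseteq> max_cones X"
    and z: "\<And>T. T \<subseteq> max_cones X \<Longrightarrow> kap y z T = 0"
  shows "kap y (\<lambda>T. if s \<in> T then sg ix s T * mon (- y s) * z (T - {s}) else 0) T = z T"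
proof -
  have fin: "finite T" using T finite_max_cones finite_subset by blast
  let ?h = "\<lambda>T. if s \<in> T then sg ix s T * mon (- y s) * z (T - {s}) else 0"
  show ?thesis
  proof (cases "s \<in> T")
    case False
    have "kap y ?h T = (\<Sum>\<sigma>\<in>max_cones X - T. if \<sigma> = s then sg ix s T * mon (y s) * (sg ix s (insert s T) * mon (- y s) * z T) else 0)"
      unfolding kap_def using False by (intro sum.cong refl) auto
    also have "\<dots> = sg ix s T * mon (y s) * (sg ix s (insert s T) * mon (- y s) * z T)"
      using False s by simp
    also have "sg ix s (insert s T) = (sg ix s T :: ('v, 'k) laurent)"
      using False by (rule sg_insert_self)
    also have "sg ix s T * mon (y s) * (sg ix s T * mon (- y s) * z T) =
        sg ix s T * (sg ix s T * ((mon (y s) * mon (- y s)) * z T))" by (simp only: mult_ac)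
    also have "\<dots> = z T" unfolding sg_square_left mon_inverse by simp
    finally show ?thesis .
  next
    case True
    define T' where "T' = T - {s}"
    have T': "T = insert s T'" "s \<notin> T'" "finite T'" using True fin by (auto simp: T'_def)
    have "kap y ?h T = (\<Sum>\<sigma>\<in>max_cones X - T. sg ix \<sigma> T * mon (y \<sigma>) *
        (sg ix s (insert \<sigma> T') * mon (- y s) * z (insert \<sigma> T')))"
      unfolding kap_def
    proof (intro sum.cong refl)
      fix \<sigma> assume "\<sigma> \<in> max_cones X - T"
      then have "insert \<sigma> T - {s} = insert \<sigma> T'" using True by (auto simp: T'_def)
      moreover have "sg ix s (insert \<sigma> T) = (sg ix s (insert \<sigma> T') :: ('v, 'k) laurent)"
        using sg_remove[of ix s "insert \<sigma> T", symmetric] by (simp only: calculation)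
      ultimately show "sg ix \<sigma> T * mon (y \<sigma>) * ?h (insert \<sigma> T) = sg ix \<sigma> T * mon (y \<sigma>) *
          (sg ix s (insert \<sigma> T') * mon (- y s) * z (insert \<sigma> T'))" using True by simp
    qed
    also have "\<dots> = (\<Sum>\<sigma>\<in>max_cones X - T. - (sg ix s T' * mon (- y s)) * (sg ix \<sigma> T' * mon (y \<sigma>) * z (insert \<sigma> T')))"
    proof (intro sum.cong refl)
      fix \<sigma> assume \<sigma>: "\<sigma> \<in> max_cones X - T"
      have i: "ix s \<noteq> ix \<sigma>" using \<sigma> s inj_ix max_cones_sub True by (auto simp: inj_on_def)
      have "sg ix \<sigma> T * mon (y \<sigma>) * (sg ix s (insert \<sigma> T') * mon (- y s) * z (insert \<sigma> T')) =
         (sg ix \<sigma> (insert s T') * sg ix s (insert \<sigma> T')) * (mon (y \<sigma>) * mon (- y s) * z (insert \<sigma> T'))"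
        by (simp only: mult_ac T'(1))
      also have "sg ix \<sigma> (insert s T') * sg ix s (insert \<sigma> T') = (- (sg ix s T' * sg ix \<sigma> T') :: ('v, 'k) laurent)"
        using \<sigma> T' by (intro sg_swap(2) i) auto
      finally show "sg ix \<sigma> T * mon (y \<sigma>) * (sg ix s (insert \<sigma> T') * mon (- y s) * z (insert \<sigma> T')) =
          - (sg ix s T' * mon (- y s)) * (sg ix \<sigma> T' * mon (y \<sigma>) * z (insert \<sigma> T'))"
        by (simp add: mult_ac)
    qed
    also have "\<dots> = - (sg ix s T' * mon (- y s)) * (\<Sum>\<sigma>\<in>max_cones X - T. sg ix \<sigma> T' * mon (y \<sigma>) * z (insert \<sigma> T'))"
      by (simp add: sum_distrib_left)
    also have "(\<Sum>\<sigma>\<in>max_cones X - T. sg ix \<sigma> T' * mon (y \<sigma>) * z (insert \<sigma> T')) = - (sg ix s T' * mon (y s) * z T)"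
    proof -
      have "kap y z T' = 0" using T by (intro z) (auto simp: T'_def)
      moreover have "max_cones X - T' = insert s (max_cones X - T)" using s True by (auto simp: T'_def)
      moreover have "s \<notin> max_cones X - T" "finite (max_cones X - T)" using True by auto
      ultimately have "sg ix s T' * mon (y s) * z (insert s T') +
          (\<Sum>\<sigma>\<in>max_cones X - T. sg ix \<sigma> T' * mon (y \<sigma>) * z (insert \<sigma> T')) = 0"
        by (simp add: kap_def)
      then show ?thesis using T'(1) by (simp add: eq_neg_iff_add_eq_0 add.commute)
    qed
    also have "- (sg ix s T' * mon (- y s)) * - (sg ix s T' * mon (y s) * z T) =
        sg ix s T' * (sg ix s T' * ((mon (y s) * mon (- y s)) * z T))"
      by (simp add: mult_ac)
    also have "\<dots> = z T" unfolding sg_square_left mon_inverse by simp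
    finally show ?thesis .
  qed
qed

lemma coboundary_kap: "coboundary X (\<lambda>F. kap y (\<lambda>T. a T F) T) F = kap y (\<lambda>T. coboundary X (a T) F) T"
  unfolding kap_def by (rule coboundary_lincomb)

lemma kap_cochains:
  fixes M :: "('v, 'k::field) laurent set"
  assumes "submod X M" "M \<subseteq> cox X" "\<And>\<sigma>. \<sigma> \<in> max_cones X \<Longrightarrow> y \<sigma> \<in> exps X \<and> cl (y \<sigma>) = c"
    and "\<And>T. T \<subseteq> max_cones X \<Longrightarrow> a T \<in> cochains X cl M i (d - c)" and "T \<subseteq> max_cones X"
  shows "(\<lambda>F. kap y (\<lambda>T. a T F) T) \<in> cochains X cl M i d"
  unfolding kap_def
proof (rule cochains_lincomb[OF assms(1,2), where e = "\<lambda>_. c"])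
  fix \<sigma> assume \<sigma>: "\<sigma> \<in> max_cones X - T"
  then have y: "y \<sigma> \<in> exps X" "cl (y \<sigma>) = c" using assms(3) by auto
  have "homog (0 + cl (y \<sigma>)) (sg ix \<sigma> T * mon (y \<sigma>) :: ('v, 'k) laurent)"
    by (intro homog_mult homog_sg homog_single exps_divisors y)
  then show "sg ix \<sigma> T * mon (y \<sigma>) \<in> cox X \<and> homog c (sg ix \<sigma> T * mon (y \<sigma>) :: ('v, 'k) laurent)"
    using y by (simp add: cox_mult cox_sg cox_single)
  show "a (insert \<sigma> T) \<in> cochains X cl M i (d - c)" using \<sigma> assms(4,5) by auto
qed

text \<open>Every component of the Cech complex of positive degree inverts one of the monomials \<open>y \<sigma>\<close>, so the
  Koszul complex on the \<open>y \<sigma>\<close> is exact there; an element of degree \<open>d + c\<close> is lifted through the double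
  complex until the Cech complex ends, and the vanishing of cohomology leads back.\<close>

lemma vanishing_imp_generation:
  fixes M :: "('v, 'k::field) laurent set"
  assumes M: "submod X M" "M \<subseteq> cox X"
    and y: "\<And>\<sigma>. \<sigma> \<in> max_cones X \<Longrightarrow> y \<sigma> \<in> exps X \<and> cl (y \<sigma>) = c \<and> (\<forall>\<rho>\<in>\<sigma>. lk (y \<sigma>) \<rho> = 0)"
    and van: "\<And>i. i > 0 \<Longrightarrow> local_cohomology_vanishes X cl M i (d + c - i \<odot> c)"
    and m: "m \<in> M" "homog (d + c) m"
  shows "\<exists>b. (\<forall>\<sigma>\<in>max_cones X. b \<sigma> \<in> M \<and> homog d (b \<sigma>)) \<and> m = (\<Sum>\<sigma>\<in>max_cones X. mon (y \<sigma>) * b \<sigma>)"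
proof -
  \<comment> \<open>A chart for each component: a maximal cone above some cone of F, whose monomial
    \<open>y\<close> is invertible in the localization at F by \<open>wt_absorbs\<close>.\<close>
  define st where "st F = (SOME s. s \<in> max_cones X \<and> (\<exists>\<sigma>\<in>F. \<sigma> \<subseteq> s))" for F
  have st: "st F \<in> max_cones X" "\<exists>\<sigma>\<in>F. \<sigma> \<subseteq> st F" if "F \<subseteq> cones X" "F \<noteq> {}" for F
  proof -
    from that obtain \<sigma> where "\<sigma> \<in> F" "\<sigma> \<in> cones X" by blast
    then have "\<exists>s. s \<in> max_cones X \<and> (\<exists>\<sigma>\<in>F. \<sigma> \<subseteq> s)" using cone_subset_max[of \<sigma>] by metis
    from someI_ex[OF this] show "st F \<in> max_cones X" "\<exists>\<sigma>\<in>F. \<sigma> \<subseteq> st F" unfolding st_def by auto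
  qed
  \<comment> \<open>Zigzag through the double complex: \<open>a 0\<close> is m, and
    \<open>a (Suc i)\<close> is the Koszul preimage of the Cech coboundary of \<open>a i\<close>
    that \<open>kap_exact\<close> provides.\<close>
  define a :: "nat \<Rightarrow> 'v set set \<Rightarrow> 'v set set \<Rightarrow> ('v, 'k) laurent" where
    "a = rec_nat (\<lambda>T F. if T = {} \<and> F = {} then m else 0)
       (\<lambda>i ai T F. if F = {} \<or> \<not> F \<subseteq> cones X then 0 else
          if st F \<in> T then sg ix (st F) T * mon (- y (st F)) * coboundary X (ai (T - {st F})) F else 0)"
  have a0: "a 0 = (\<lambda>T F. if T = {} \<and> F = {} then m else 0)" by (simp add: a_def)
  have aS: "a (Suc i) T F = (if F = {} \<or> \<not> F \<subseteq> cones X then 0 else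
          if st F \<in> T then sg ix (st F) T * mon (- y (st F)) * coboundary X (a i (T - {st F})) F else 0)" for i T F
    by (simp add: a_def)
  define D where "D i = d + c - i \<odot> c" for i
  have DS: "D (Suc i) = D i - c" for i by (simp add: D_def nat_mult_Suc)
  have inv: "(\<forall>T\<subseteq>max_cones X. a i T \<in> cochains X cl M i (D i)) \<and>
      (\<forall>T\<subseteq>max_cones X. \<forall>F. kap y (\<lambda>T. coboundary X (a i T) F) T = 0)" for i
  proof (induction i)
    case 0
    have "a 0 T \<in> cochains X cl M 0 (D 0)" for T
    proof (rule cochainsI[OF M(2)])
      fix F assume F: "F \<subseteq> cones X" "card F = 0"
      then have "F = {}" using finite_sub_cones by auto
      moreover have "m \<in> loc M {}" unfolding loc_iff wt_def using m(1) by (intro exI[of _ 0]) simp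
      ultimately show "a 0 T F \<in> loc M F" using submod_zero[OF submod_loc[OF M(1)]] by (simp add: a0)
      show "homog (D 0) (a 0 T F)" using m(2) by (simp add: a0 D_def)
    qed (auto simp: a0)
    moreover have "kap y (\<lambda>T. coboundary X (a 0 T) F) T = 0" for T F
      unfolding coboundary_kap[symmetric]
      by (simp add: kap_def a0 coboundary_zero)
    ultimately show ?case by blast
  next
    case (Suc i)
    have IH: "\<And>T. T \<subseteq> max_cones X \<Longrightarrow> a i T \<in> cochains X cl M i (D i)"
      "\<And>T F. T \<subseteq> max_cones X \<Longrightarrow> kap y (\<lambda>T. coboundary X (a i T) F) T = 0" using Suc by auto
    have kap: "kap y (\<lambda>T. a (Suc i) T F) T = coboundary X (a i T) F" if T: "T \<subseteq> max_cones X" for T F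
    proof (cases "F = {} \<or> \<not> F \<subseteq> cones X")
      case True
      then show ?thesis by (elim disjE) (simp_all add: aS kap_def coboundary_outside coboundary_eq)
    next
      case False
      have "(\<lambda>T. a (Suc i) T F) = (\<lambda>T. if st F \<in> T then sg ix (st F) T * mon (- y (st F)) * coboundary X (a i (T - {st F})) F else 0)"
        using False by (auto simp: aS)
      then show ?thesis using kap_exact[OF st(1) T, of F y "\<lambda>T. coboundary X (a i T) F"] False IH(2) by simp
    qed
    have "a (Suc i) T \<in> cochains X cl M (Suc i) (D (Suc i))" if T: "T \<subseteq> max_cones X" for T
    proof (rule cochainsI[OF M(2)])
      fix F assume F: "F \<subseteq> cones X" "card F = Suc i"
      then have ne: "F \<noteq> {}" by auto
      let ?s = "st F"
      have s: "?s \<in> max_cones X" using st(1)[OF F(1) ne] .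
      obtain \<sigma> where \<sigma>: "\<sigma> \<in> F" "\<sigma> \<subseteq> ?s" using st(2)[OF F(1) ne] by blast
      obtain k where k: "(\<Sum>_<(k::nat). wt F) - y ?s \<in> exps X"
        using wt_absorbs[OF \<sigma>(1) finite_sub_cones[OF F(1)], of "y ?s"] y[OF s] \<sigma>(2) exps_divisors by blast
      have "T - {?s} \<subseteq> max_cones X" using T by blast
      note cob = coboundary_cochains[OF M IH(1)[OF this]]
      have "mon (- y ?s) * coboundary X (a i (T - {?s})) F \<in> loc M F"
        using loc_divide[OF M(1) cochainsD(1)[OF M(2) cob M(1)] k] .
      then have "sg ix ?s T * (mon (- y ?s) * coboundary X (a i (T - {?s})) F) \<in> loc M F"
        by (rule submod_smult[OF submod_loc[OF M(1)] cox_sg])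
      then show "a (Suc i) T F \<in> loc M F"
        using F ne submod_zero[OF submod_loc[OF M(1)]] by (simp add: aS mult.assoc)
      have "homog (0 + - cl (y ?s) + D i) (sg ix ?s T * mon (- y ?s) * coboundary X (a i (T - {?s})) F)"
        using y[OF s] homog_single[OF divisors_uminus, of "y ?s" 1]
        by (intro homog_mult homog_sg cochainsD(2)[OF M(2) cob]) (auto simp: cl_uminus exps_divisors)
      then show "homog (D (Suc i)) (a (Suc i) T F)"
        using F ne y[OF s] by (simp add: aS DS)
    next
      fix F assume F: "\<not> (F \<subseteq> cones X \<and> card F = Suc i)"
      have "coboundary X (a i (T - {st F})) F = 0"
        using cochainsD(3)[OF M(2) coboundary_cochains[OF M IH(1)] F] T by blast
      then show "a (Suc i) T F = 0" by (simp add: aS)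
    qed
    moreover have "kap y (\<lambda>T. coboundary X (a (Suc i) T) F) T = 0" if "T \<subseteq> max_cones X" for T F
    proof -
      have "kap y (\<lambda>T. coboundary X (a (Suc i) T) F) T = coboundary X (\<lambda>F. kap y (\<lambda>T. a (Suc i) T F) T) F"
        by (rule coboundary_kap[symmetric])
      also have "\<dots> = coboundary X (coboundary X (a i T)) F" by (simp add: kap[OF that])
      finally show ?thesis by (simp add: coboundary_coboundary)
    qed
    ultimately show ?case by blast
  qed
  have kap: "kap y (\<lambda>T. a (Suc i) T F) T = coboundary X (a i T) F" if T: "T \<subseteq> max_cones X" for i T F
  proof (cases "F = {} \<or> \<not> F \<subseteq> cones X")
    case True
    then show ?thesis by (elim disjE) (simp_all add: aS kap_def coboundary_outside coboundary_eq)
  next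
    case False
    have "(\<lambda>T. a (Suc i) T F) = (\<lambda>T. if st F \<in> T then sg ix (st F) T * mon (- y (st F)) * coboundary X (a i (T - {st F})) F else 0)"
      using False by (auto simp: aS)
    then show ?thesis using kap_exact[OF st(1) T, of F y "\<lambda>T. coboundary X (a i T) F"] False inv[of i] by simp
  qed
  have y': "\<And>\<sigma>. \<sigma> \<in> max_cones X \<Longrightarrow> y \<sigma> \<in> exps X \<and> cl (y \<sigma>) = c" using y by blast
  \<comment> \<open>The way back: the Cech coboundary of \<open>a i\<close> is also that of a Koszul
    boundary. This holds trivially where the complex has ended. It descends from
    \<open>Suc i\<close> to i because \<open>a (Suc i)\<close> minus a Koszul boundary is then a
    cocycle in degree \<open>D (Suc i)\<close>, where cohomology vanishes.\<close>
  define P where "P i \<longleftrightarrow> (\<exists>b. (\<forall>T\<subseteq>max_cones X. b T \<in> cochains X cl M i (D (Suc i))) \<and>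
     (\<forall>T\<subseteq>max_cones X. coboundary X (a i T) = coboundary X (\<lambda>F. kap y (\<lambda>T. b T F) T)))" for i
  have "P i" for i
  proof (induction "card (cones X) - i" arbitrary: i)
    case 0
    then have "Suc i > card (cones X)" by simp
    then have "coboundary X (a i T) = (\<lambda>_. 0)" if "T \<subseteq> max_cones X" for T
      using inv[of i] that by (intro cochains_large[OF M(2) _ coboundary_cochains[OF M]]) auto
    then show ?case unfolding P_def
      by (intro exI[of _ "\<lambda>_ _. 0"]) (simp add: cochains_zero[OF M] kap_def coboundary_zero)
  next
    case (Suc x)
    then have "P (Suc i)" by simp
    then obtain b where b: "\<And>T. T \<subseteq> max_cones X \<Longrightarrow> b T \<in> cochains X cl M (Suc i) (D (Suc (Suc i)))"
      "\<And>T. T \<subseteq> max_cones X \<Longrightarrow> coboundary X (a (Suc i) T) = coboundary X (\<lambda>F. kap y (\<lambda>T. b T F) T)"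
      unfolding P_def by blast
    have "\<exists>\<psi>\<in>cochains X cl M i (D (Suc i)). (\<lambda>F. a (Suc i) T F - kap y (\<lambda>T. b T F) T) = coboundary X \<psi>"
      if T: "T \<subseteq> max_cones X" for T
    proof -
      have 1: "local_cohomology_vanishes X cl M (Suc i) (D (Suc i))"
        unfolding D_def by (rule van) simp
      have 2: "(\<lambda>F. a (Suc i) T F - kap y (\<lambda>T. b T F) T) \<in> cochains X cl M (Suc i) (D (Suc i))"
      proof (rule cochains_diff[OF M])
        show "a (Suc i) T \<in> cochains X cl M (Suc i) (D (Suc i))" using inv[of "Suc i"] T by blast
        show "(\<lambda>F. kap y (\<lambda>T. b T F) T) \<in> cochains X cl M (Suc i) (D (Suc i))"
          using b(1) T by (intro kap_cochains[OF M y']) (auto simp: DS)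
      qed
      have 3: "coboundary X (\<lambda>F. a (Suc i) T F - kap y (\<lambda>T. b T F) T) = (\<lambda>_. 0)"
        by (rule ext) (simp only: coboundary_diff b(2)[OF T] diff_self)
      show ?thesis by (rule vanishesD[OF 1 2 3]) blast
    qed
    then have "\<forall>T. \<exists>\<psi>. T \<subseteq> max_cones X \<longrightarrow> \<psi> \<in> cochains X cl M i (D (Suc i)) \<and>
        (\<lambda>F. a (Suc i) T F - kap y (\<lambda>T. b T F) T) = coboundary X \<psi>" by blast
    from choice[OF this] obtain b' where b0: "\<forall>T. T \<subseteq> max_cones X \<longrightarrow>
        b' T \<in> cochains X cl M i (D (Suc i)) \<and>
        (\<lambda>F. a (Suc i) T F - kap y (\<lambda>T. b T F) T) = coboundary X (b' T)" ..
    have b': "b' T \<in> cochains X cl M i (D (Suc i))"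
      "a (Suc i) T F - kap y (\<lambda>T. b T F) T = coboundary X (b' T) F" if "T \<subseteq> max_cones X" for T F
      using b0[rule_format, OF that] by (auto dest: fun_cong)
    have "coboundary X (a i T) F = coboundary X (\<lambda>F. kap y (\<lambda>T. b' T F) T) F" if T: "T \<subseteq> max_cones X" for T F
    proof -
      have "coboundary X (\<lambda>F. kap y (\<lambda>T. b' T F) T) F = kap y (\<lambda>T. coboundary X (b' T) F) T"
        by (rule coboundary_kap)
      also have "\<dots> = kap y (\<lambda>T. a (Suc i) T F - kap y (\<lambda>T. b T F) T) T"
        unfolding kap_def[of y _ T] using T by (intro sum.cong refl) (auto simp: b'(2))
      also have "\<dots> = kap y (\<lambda>T. a (Suc i) T F) T - kap y (kap y (\<lambda>T. b T F)) T"
        unfolding kap_def[of y _ T] by (simp add: right_diff_distrib sum_subtractf)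
      finally show ?thesis using kap[OF T] kap_kap[OF T] by simp
    qed
    then show ?case unfolding P_def using b'(1) by blast
  qed
  then obtain b where b: "\<And>T. T \<subseteq> max_cones X \<Longrightarrow> b T \<in> cochains X cl M 0 (D (Suc 0))"
    "\<And>T. T \<subseteq> max_cones X \<Longrightarrow> coboundary X (a 0 T) = coboundary X (\<lambda>F. kap y (\<lambda>T. b T F) T)"
    unfolding P_def by blast
  have "(\<lambda>F. a 0 {} F - kap y (\<lambda>T. b T F) {}) \<in> cocycle_set X cl M 0 (D 0)"
    unfolding cocycle_set_def
  proof (intro CollectI conjI)
    show "(\<lambda>F. a 0 {} F - kap y (\<lambda>T. b T F) {}) \<in> cochains X cl M 0 (D 0)"
      using inv[of 0] b(1) by (intro cochains_diff[OF M] kap_cochains[OF M y']) (auto simp: DS)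
    show "coboundary X (\<lambda>F. a 0 {} F - kap y (\<lambda>T. b T F) {}) = (\<lambda>_. 0)"
      by (rule ext) (simp only: coboundary_diff b(2)[OF empty_subsetI] diff_self)
  qed
  then have "(\<lambda>F. a 0 {} F - kap y (\<lambda>T. b T F) {}) = (\<lambda>_. 0)"
    using vanishes_0[OF M, of "D 0"] by (simp add: local_cohomology_vanishes_def coboundary_set_def)
  then have "a 0 {} {} - kap y (\<lambda>T. b T {}) {} = 0" by (rule fun_cong)
  then have "m = kap y (\<lambda>T. b T {}) {}" by (simp add: a0)
  also have "\<dots> = (\<Sum>\<sigma>\<in>max_cones X. mon (y \<sigma>) * b {\<sigma>} {})"
    by (simp add: kap_def sg_def)
  finally have "m = (\<Sum>\<sigma>\<in>max_cones X. mon (y \<sigma>) * b {\<sigma>} {})" .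
  moreover have "b {\<sigma>} {} \<in> M \<and> homog d (b {\<sigma>} {})" if "\<sigma> \<in> max_cones X" for \<sigma>
  proof -
    have bc: "b {\<sigma>} \<in> cochains X cl M 0 (D (Suc 0))" using b(1)[of "{\<sigma>}"] that by simp
    have "b {\<sigma>} {} \<in> loc M {}" using cochainsD(1)[OF M(2) bc M(1)] .
    then have "b {\<sigma>} {} \<in> M" by (simp add: loc_iff wt_def)
    moreover have "homog d (b {\<sigma>} {})" using cochainsD(2)[OF M(2) bc] by (simp add: D_def)
    ultimately show ?thesis by blast
  qed
  ultimately show ?thesis by (intro exI[of _ "\<lambda>\<sigma>. b {\<sigma>} {}"]) simp
qed

end

section \<open>Dimension shifting\<close>

context toric_var
begin

definition hc :: "'p \<Rightarrow> ('v, 'k::field) laurent \<Rightarrow> ('v, 'k) laurent" where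
  "hc d p = rst {m. cl m = d} p"

lemma hc_zero [simp]: "hc d 0 = 0" by (simp add: hc_def)

lemma hc_sum: "hc d (sum f A) = (\<Sum>x\<in>A. hc d (f x))" by (simp add: hc_def rst_sum)

lemma hc_add: "hc d (p + q) = hc d p + hc d q" by (simp add: hc_def rst_add)

lemma hc_cox: "p \<in> cox X \<Longrightarrow> hc d p \<in> cox X" by (simp add: hc_def cox_rst)

lemma homog_hc: "ks p \<subseteq> divisors X \<Longrightarrow> homog d (hc d p)"
  by (auto simp: hc_def homog_def keys_rst)

lemma cox_divisors: "p \<in> cox X \<Longrightarrow> ks p \<subseteq> divisors X"
  by (auto simp: cox_iff exps_def)

lemma hc_homog: "homog d p \<Longrightarrow> hc d p = p"
  unfolding hc_def by (rule rst_id) (auto simp: homog_def)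

lemma hc_mult:
  assumes "ks p \<subseteq> divisors X" "homog a q"
  shows "hc (b + a) (p * q) = hc b p * q"
proof -
  let ?r = "rst (- {m. cl m = b}) p"
  have "p * q = hc b p * q + ?r * q"
    by (subst rst_compl[of p "{m. cl m = b}"]) (simp add: hc_def distrib_right)
  then have "hc (b + a) (p * q) = hc (b + a) (hc b p * q) + hc (b + a) (?r * q)"
    by (simp add: hc_add)
  moreover have "hc (b + a) (hc b p * q) = hc b p * q"
    using assms by (intro hc_homog homog_mult homog_hc)
  moreover have "hc (b + a) (?r * q) = 0"
    unfolding hc_def
  proof (rule rst_none)
    have "cl m \<noteq> b + a" if m: "m \<in> ks (?r * q)" for m
    proof -
      obtain x y where xy: "m = x + y" "x \<in> ks ?r" "y \<in> ks q" using keys_mult[of ?r q] m by blast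
      then have "x \<in> divisors X" "cl x \<noteq> b" "y \<in> divisors X" "cl y = a"
        using assms by (auto simp: keys_rst homog_def)
      then show ?thesis using xy(1) by (simp add: cl_add)
    qed
    then show "ks (?r * q) \<inter> {m. cl m = b + a} = {}" by blast
  qed
  ultimately show ?thesis by simp
qed

text \<open>Counterparts for submodules M of a free module with basis indexed by \<open>'l\<close>,
  as syzygy modules are not ideals. The basis element l carries the degree
  \<open>dg l\<close>.\<close>

definition vloc :: "('l \<Rightarrow> ('v, 'k::field) laurent) set \<Rightarrow> 'v set set \<Rightarrow> ('l \<Rightarrow> ('v, 'k) laurent) set" where
  "vloc M F = {v. \<exists>k. (\<lambda>l. mon (\<Sum>_<(k::nat). wt F) * v l) \<in> M}"

definition vcochains :: "('l \<Rightarrow> ('v, 'k::field) laurent) set \<Rightarrow> nat \<Rightarrow> ('l \<Rightarrow> 'p) \<Rightarrow> 'p \<Rightarrow>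
    ('l \<Rightarrow> 'v set set \<Rightarrow> ('v, 'k) laurent) set" where
  "vcochains M i dg d = {\<phi>. \<forall>F. if F \<subseteq> cones X \<and> card F = i
     then (\<lambda>l. \<phi> l F) \<in> vloc M F \<and> (\<forall>l. homog (d - dg l) (\<phi> l F)) else (\<forall>l. \<phi> l F = 0)}"

text \<open>The index is shifted: \<open>vvanishes M i\<close> concerns cohomology in degree
  \<open>Suc i\<close>, so that no case distinction for degree 0 arises.\<close>

definition vvanishes :: "('l \<Rightarrow> ('v, 'k::field) laurent) set \<Rightarrow> nat \<Rightarrow> ('l \<Rightarrow> 'p) \<Rightarrow> 'p \<Rightarrow> bool" where
  "vvanishes M i dg d \<longleftrightarrow> (\<forall>\<phi>\<in>vcochains M (Suc i) dg d. (\<forall>l. coboundary X (\<phi> l) = (\<lambda>_. 0)) \<longrightarrow>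
     (\<exists>\<psi>\<in>vcochains M i dg d. \<forall>l. \<phi> l = coboundary X (\<psi> l)))"

lemma vcochainsI:
  assumes "\<And>F. F \<subseteq> cones X \<Longrightarrow> card F = i \<Longrightarrow> (\<lambda>l. \<phi> l F) \<in> vloc M F"
    and "\<And>F l. F \<subseteq> cones X \<Longrightarrow> card F = i \<Longrightarrow> homog (d - dg l) (\<phi> l F)"
    and "\<And>F l. \<not> (F \<subseteq> cones X \<and> card F = i) \<Longrightarrow> \<phi> l F = 0"
  shows "\<phi> \<in> vcochains M i dg d"
  using assms by (simp add: vcochains_def)

lemma vcochainsD:
  assumes "\<phi> \<in> vcochains M i dg d"
  shows "F \<subseteq> cones X \<Longrightarrow> card F = i \<Longrightarrow> (\<lambda>l. \<phi> l F) \<in> vloc M F"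
    and "homog (d - dg l) (\<phi> l F)"
    and "\<not> (F \<subseteq> cones X \<and> card F = i) \<Longrightarrow> \<phi> l F = 0"
proof -
  have *: "if F \<subseteq> cones X \<and> card F = i then (\<lambda>l. \<phi> l F) \<in> vloc M F \<and>
      (\<forall>l. homog (d - dg l) (\<phi> l F)) else (\<forall>l. \<phi> l F = 0)"
    using assms by (simp add: vcochains_def)
  show "F \<subseteq> cones X \<Longrightarrow> card F = i \<Longrightarrow> (\<lambda>l. \<phi> l F) \<in> vloc M F"
    "homog (d - dg l) (\<phi> l F)" "\<not> (F \<subseteq> cones X \<and> card F = i) \<Longrightarrow> \<phi> l F = 0"
    using * by (auto split: if_splits)
qed

lemma vvanishes_large:
  assumes "Suc i > card (cones X)" "(\<lambda>_. 0) \<in> M"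
  shows "vvanishes M i dg d"
  unfolding vvanishes_def
proof (intro ballI impI)
  fix \<phi> assume \<phi>: "\<phi> \<in> vcochains M (Suc i) dg d"
  have z: "\<phi> l F = 0" for l F
  proof -
    have "\<not> (F \<subseteq> cones X \<and> card F = Suc i)" using assms(1) card_mono[OF finite_cones, of F] by auto
    then show ?thesis by (rule vcochainsD(3)[OF \<phi>])
  qed
  have "\<phi> l = coboundary X (\<lambda>_. 0)" for l unfolding coboundary_zero by (rule ext) (rule z)
  moreover have "(\<lambda>_ _. 0) \<in> vcochains M i dg d"
    using assms(2) by (intro vcochainsI) (auto simp: vloc_def)
  ultimately show "\<exists>\<psi>\<in>vcochains M i dg d. \<forall>l. \<phi> l = coboundary X (\<psi> l)"
    by (intro bexI[of _ "\<lambda>_ _. 0"]) auto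
qed

definition vspan :: "'e set \<Rightarrow> ('e \<Rightarrow> 'l \<Rightarrow> ('v, 'k::field) laurent) \<Rightarrow> ('l \<Rightarrow> ('v, 'k) laurent) set" where
  "vspan E w = {v. \<exists>s. (\<forall>e\<in>E. s e \<in> cox X) \<and> v = (\<lambda>l. \<Sum>e\<in>E. s e * w e l)}"

definition syz :: "'e set \<Rightarrow> ('e \<Rightarrow> 'l \<Rightarrow> ('v, 'k::field) laurent) \<Rightarrow> ('e \<Rightarrow> ('v, 'k) laurent) set" where
  "syz E w = {s. (\<forall>e. s e \<in> cox X) \<and> (\<forall>e. e \<notin> E \<longrightarrow> s e = 0) \<and> (\<forall>l. (\<Sum>e\<in>E. s e * w e l) = 0)}"

lemma loc_common_denominator:
  assumes "finite E" "\<And>e. e \<in> E \<Longrightarrow> \<psi> e \<in> loc (cox X) F"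
  obtains k where "\<And>e. e \<in> E \<Longrightarrow> mon (\<Sum>_<(k::nat). wt F) * \<psi> e \<in> cox X"
proof -
  have "\<exists>k. \<forall>e\<in>E. mon (\<Sum>_<(k::nat). wt F) * \<psi> e \<in> cox X"
    using assms
  proof (induction E rule: finite_induct)
    case (insert x E)
    obtain k where k: "\<forall>e\<in>E. mon (\<Sum>_<(k::nat). wt F) * \<psi> e \<in> cox X" using insert by auto
    obtain l where l: "mon (\<Sum>_<(l::nat). wt F) * \<psi> x \<in> cox X" using insert.prems[of x] by (auto simp: loc_iff)
    have "mon (\<Sum>_<k + l. wt F) * \<psi> e \<in> cox X" if e: "e \<in> insert x E" for e
    proof (cases "e = x")
      case True
      show ?thesis unfolding True
        by (rule submod_mon_le[OF submod_cox l]) (unfold multiple_add, simp add: multiple_exps wt_exps)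
    next
      case False
      then have "mon (\<Sum>_<k. wt F) * \<psi> e \<in> cox X" using k e by blast
      then show ?thesis
        by (rule submod_mon_le[OF submod_cox]) (unfold multiple_add, simp add: multiple_exps wt_exps)
    qed
    then show ?case by blast
  qed simp
  then show ?thesis using that by blast
qed

text \<open>Localization is exact, so the free module on E still maps onto the localized span;
  passing to homogeneous components with \<open>hc\<close> corrects the degrees of the
  coefficients.\<close>

lemma vcochain_lift:
  assumes "finite E"
    and w: "\<And>e l. e \<in> E \<Longrightarrow> w e l \<in> cox X \<and> homog (wd e - dg l) (w e l)"
    and \<phi>: "\<phi> \<in> vcochains (vspan E w) i dg d"
  shows "\<exists>\<psi>. (\<forall>e\<in>E. \<psi> e \<in> cochains X cl (cox X) i (d - wd e)) \<and>
    (\<forall>l F. \<phi> l F = (\<Sum>e\<in>E. \<psi> e F * w e l))"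
proof -
  have "\<exists>\<psi>. (\<forall>e\<in>E. \<psi> e \<in> loc (cox X) F \<and> homog (d - wd e) (\<psi> e)) \<and> (\<forall>l. \<phi> l F = (\<Sum>e\<in>E. \<psi> e * w e l))"
    if F: "F \<subseteq> cones X" "card F = i" for F
  proof -
    obtain k where "(\<lambda>l. mon (\<Sum>_<(k::nat). wt F) * \<phi> l F) \<in> vspan E w"
      using vcochainsD(1)[OF \<phi> F] by (auto simp: vloc_def)
    then obtain s where s: "\<And>e. e \<in> E \<Longrightarrow> s e \<in> cox X"
      "\<And>l. mon (\<Sum>_<k. wt F) * \<phi> l F = (\<Sum>e\<in>E. s e * w e l)"
      unfolding vspan_def by (auto dest: fun_cong)
    define W where "W = (\<Sum>_<k. wt F)"
    have W: "W \<in> exps X" unfolding W_def by (rule multiple_exps[OF wt_exps])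
    define \<psi> where "\<psi> e = mon (- W) * hc (d + cl W - wd e) (s e)" for e
    have "\<phi> l F = (\<Sum>e\<in>E. \<psi> e * w e l)" for l
    proof -
      have "homog (cl W + (d - dg l)) (mon W * \<phi> l F)"
        using W by (intro homog_mult homog_single vcochainsD(2)[OF \<phi>] exps_divisors)
      then have "mon W * \<phi> l F = hc (d + cl W - dg l) (mon W * \<phi> l F)"
        by (subst hc_homog) (simp_all add: algebra_simps)
      also have "\<dots> = (\<Sum>e\<in>E. hc (d + cl W - dg l) (s e * w e l))"
        unfolding W_def s(2) by (rule hc_sum)
      also have "\<dots> = (\<Sum>e\<in>E. hc (d + cl W - wd e) (s e) * w e l)"
      proof (rule sum.cong[OF refl])
        fix e assume e: "e \<in> E"
        show "hc (d + cl W - dg l) (s e * w e l) = hc (d + cl W - wd e) (s e) * w e l"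
          using hc_mult[OF cox_divisors[OF s(1)[OF e]], of "wd e - dg l" "w e l" "d + cl W - wd e"] w[OF e]
          by simp
      qed
      also have "\<dots> = mon W * (\<Sum>e\<in>E. \<psi> e * w e l)"
        unfolding sum_distrib_left \<psi>_def by (simp add: mult.assoc[symmetric] mon_inverse)
      finally show ?thesis by (rule mon_times_cancel)
    qed
    moreover have "\<psi> e \<in> loc (cox X) F \<and> homog (d - wd e) (\<psi> e)" if e: "e \<in> E" for e
    proof
      have "mon W * \<psi> e = hc (d + cl W - wd e) (s e)"
        unfolding \<psi>_def by (simp add: mult.assoc[symmetric] mon_inverse)
      then show "\<psi> e \<in> loc (cox X) F" using s(1)[OF e] unfolding loc_iff W_def by (metis hc_cox)
      have "homog (- cl W + (d + cl W - wd e)) (\<psi> e)"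
        unfolding \<psi>_def using W homog_single[OF divisors_uminus, of W 1]
        by (intro homog_mult homog_hc cox_divisors s(1)[OF e]) (simp add: cl_uminus exps_divisors)
      then show "homog (d - wd e) (\<psi> e)" by simp
    qed
    ultimately show ?thesis by (intro exI[of _ \<psi>]) simp
  qed
  then have "\<forall>F. \<exists>\<psi>. F \<subseteq> cones X \<and> card F = i \<longrightarrow> (\<forall>e\<in>E. \<psi> e \<in> loc (cox X) F \<and> homog (d - wd e) (\<psi> e)) \<and>
      (\<forall>l. \<phi> l F = (\<Sum>e\<in>E. \<psi> e * w e l))" by blast
  from choice[OF this] obtain \<psi> where \<psi>: "\<forall>F. F \<subseteq> cones X \<and> card F = i \<longrightarrow>
      (\<forall>e\<in>E. \<psi> F e \<in> loc (cox X) F \<and> homog (d - wd e) (\<psi> F e)) \<and>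
      (\<forall>l. \<phi> l F = (\<Sum>e\<in>E. \<psi> F e * w e l))" ..
  define \<psi>' where "\<psi>' e F = (if F \<subseteq> cones X \<and> card F = i then \<psi> F e else 0)" for e F
  have "\<psi>' e \<in> cochains X cl (cox X) i (d - wd e)" if "e \<in> E" for e
    using \<psi> that by (intro cochainsI) (auto simp: \<psi>'_def)
  moreover have "\<phi> l F = (\<Sum>e\<in>E. \<psi>' e F * w e l)" for l F
  proof (cases "F \<subseteq> cones X \<and> card F = i")
    case True
    then show ?thesis using \<psi> by (simp add: \<psi>'_def)
  next
    case False
    then show ?thesis using vcochainsD(3)[OF \<phi> False] by (simp only: \<psi>'_def if_not_P) simp
  qed
  ultimately show ?thesis by blast
qed

lemma vcochain_span:
  assumes "finite E"
    and w: "\<And>e l. e \<in> E \<Longrightarrow> w e l \<in> cox X \<and> homog (wd e - dg l) (w e l)"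
    and \<eta>: "\<And>e. e \<in> E \<Longrightarrow> \<eta> e \<in> cochains X cl (cox X) i (d - wd e)"
  shows "(\<lambda>l F. \<Sum>e\<in>E. \<eta> e F * w e l) \<in> vcochains (vspan E w) i dg d"
proof (rule vcochainsI)
  fix F assume F: "F \<subseteq> cones X" "card F = i"
  have "\<eta> e F \<in> loc (cox X) F" if "e \<in> E" for e
    using cochainsD(1)[OF subset_refl \<eta>[OF that] submod_cox] .
  then obtain k where k: "\<And>e. e \<in> E \<Longrightarrow> mon (\<Sum>_<(k::nat). wt F) * \<eta> e F \<in> cox X"
    using loc_common_denominator[OF assms(1), of "\<lambda>e. \<eta> e F" F] by metis
  have "(\<lambda>l. mon (\<Sum>_<k. wt F) * (\<Sum>e\<in>E. \<eta> e F * w e l)) \<in> vspan E w"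
    unfolding vspan_def using k
    by (intro CollectI exI[of _ "\<lambda>e. mon (\<Sum>_<k. wt F) * \<eta> e F"]) (auto simp: sum_distrib_left mult.assoc)
  then show "(\<lambda>l. \<Sum>e\<in>E. \<eta> e F * w e l) \<in> vloc (vspan E w) F" unfolding vloc_def by blast
next
  fix F l
  have "homog (d - wd e + (wd e - dg l)) (\<eta> e F * w e l)" if "e \<in> E" for e
    using w[OF that] by (intro homog_mult cochainsD(2)[OF subset_refl \<eta>[OF that]]) auto
  then show "homog (d - dg l) (\<Sum>e\<in>E. \<eta> e F * w e l)" by (intro homog_sum) simp
next
  fix F l assume "\<not> (F \<subseteq> cones X \<and> card F = i)"
  then show "(\<Sum>e\<in>E. \<eta> e F * w e l) = 0"
    using cochainsD(3)[OF subset_refl \<eta>] by (intro sum.neutral) auto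
qed

lemma coboundary_comb:
  "coboundary X (\<lambda>F. \<Sum>e\<in>E. \<psi> e F * c e) F = (\<Sum>e\<in>E. coboundary X (\<psi> e) F * c e)"
  using coboundary_lincomb[of c \<psi> E F] by (simp only: mult.commute)

text \<open>The long exact sequence of 0 -> syz -> free module on E -> vspan -> 0: a class in degree
  i + 1 is sent to degree i + 2 of the syzygies, where it dies by \<open>Z\<close>, so it comes from
  the free module, where it dies by \<open>S\<close>.\<close>

lemma dimension_shift:
  fixes w :: "'e \<Rightarrow> 'l \<Rightarrow> ('v, 'k::field) laurent"
  assumes fin: "finite E"
    and w: "\<And>e l. e \<in> E \<Longrightarrow> w e l \<in> cox X \<and> homog (wd e - dg l) (w e l)"
    and S: "\<And>e. e \<in> E \<Longrightarrow> local_cohomology_vanishes X cl (cox X :: ('v, 'k) laurent set) (Suc i) (d - wd e)"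
    and Z: "vvanishes (syz E w) (Suc i) wd d"
  shows "vvanishes (vspan E w) i dg d"
  unfolding vvanishes_def
proof (intro ballI impI)
  fix \<phi> assume \<phi>: "\<phi> \<in> vcochains (vspan E w) (Suc i) dg d" and cyc: "\<forall>l. coboundary X (\<phi> l) = (\<lambda>_. 0)"
  obtain \<psi>0 where \<psi>0: "\<And>e. e \<in> E \<Longrightarrow> \<psi>0 e \<in> cochains X cl (cox X) (Suc i) (d - wd e)"
    "\<And>l F. \<phi> l F = (\<Sum>e\<in>E. \<psi>0 e F * w e l)"
    using vcochain_lift[OF fin w \<phi>] by blast
  define \<psi> where "\<psi> e = (if e \<in> E then \<psi>0 e else (\<lambda>_. 0))" for e
  have \<psi>: "\<psi> e \<in> cochains X cl (cox X) (Suc i) (d - wd e)" for e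
    by (cases "e \<in> E") (auto simp: \<psi>_def \<psi>0(1) intro: cochains_zero[OF submod_cox subset_refl])
  have \<phi>_eq: "\<phi> l = (\<lambda>F. \<Sum>e\<in>E. \<psi> e F * w e l)" for l
    by (rule ext) (simp add: \<psi>0(2) \<psi>_def)
  \<comment> \<open>The connecting homomorphism: the coboundary of a lift of \<phi> consists of
    syzygies because \<phi> is a cocycle.\<close>
  define \<chi> where "\<chi> e = coboundary X (\<psi> e)" for e
  have \<chi>: "\<chi> e \<in> cochains X cl (cox X) (Suc (Suc i)) (d - wd e)" for e
    unfolding \<chi>_def by (rule coboundary_cochains[OF submod_cox subset_refl \<psi>])
  have \<chi>out: "\<chi> e = (\<lambda>_. 0)" if "e \<notin> E" for e using that by (simp add: \<chi>_def \<psi>_def coboundary_zero)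
  have \<chi>sum: "(\<Sum>e\<in>E. \<chi> e F * w e l) = 0" for l F
  proof -
    have "(\<Sum>e\<in>E. \<chi> e F * w e l) = coboundary X (\<phi> l) F"
      unfolding \<phi>_eq coboundary_comb \<chi>_def ..
    then show ?thesis using cyc by simp
  qed
  have "\<chi> \<in> vcochains (syz E w) (Suc (Suc i)) wd d"
  proof (rule vcochainsI)
    fix F
    have "\<chi> e F \<in> loc (cox X) F" for e
      using cochainsD(1)[OF subset_refl \<chi> submod_cox] .
    then obtain k where k: "\<And>e. e \<in> E \<Longrightarrow> mon (\<Sum>_<(k::nat). wt F) * \<chi> e F \<in> cox X"
      using loc_common_denominator[OF fin, of "\<lambda>e. \<chi> e F" F] by metis
    have "mon (\<Sum>_<k. wt F) * \<chi> e F \<in> cox X" for e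
      using k \<chi>out by (cases "e \<in> E") auto
    moreover have "(\<Sum>e\<in>E. mon (\<Sum>_<k. wt F) * \<chi> e F * w e l) = 0" for l
      using \<chi>sum[of F l] by (simp add: mult.assoc sum_distrib_left[symmetric])
    ultimately have "(\<lambda>e. mon (\<Sum>_<k. wt F) * \<chi> e F) \<in> syz E w"
      unfolding syz_def using \<chi>out by simp
    then show "(\<lambda>e. \<chi> e F) \<in> vloc (syz E w) F" unfolding vloc_def by blast
  qed (use cochainsD(2,3)[OF subset_refl \<chi>] in auto)
  moreover have "\<forall>e. coboundary X (\<chi> e) = (\<lambda>_. 0)" by (simp add: \<chi>_def coboundary_coboundary)
  ultimately obtain \<xi> where \<xi>: "\<xi> \<in> vcochains (syz E w) (Suc i) wd d" "\<And>e. \<chi> e = coboundary X (\<xi> e)"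
    using Z unfolding vvanishes_def by blast
  have \<xi>c: "\<xi> e \<in> cochains X cl (cox X) (Suc i) (d - wd e)" for e
  proof (rule cochainsI)
    fix F assume F: "F \<subseteq> cones X" "card F = Suc i"
    show "\<xi> e F \<in> loc (cox X) F"
      using vcochainsD(1)[OF \<xi>(1) F] unfolding vloc_def syz_def loc_iff by auto
  qed (use vcochainsD(2,3)[OF \<xi>(1)] in auto)
  have \<xi>sum: "(\<Sum>e\<in>E. \<xi> e F * w e l) = 0" for l F
  proof (cases "F \<subseteq> cones X \<and> card F = Suc i")
    case True
    then have "(\<lambda>e. \<xi> e F) \<in> vloc (syz E w) F" using vcochainsD(1)[OF \<xi>(1)] by blast
    then obtain k where "(\<Sum>e\<in>E. mon (\<Sum>_<(k::nat). wt F) * \<xi> e F * w e l) = 0"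
      by (auto simp: vloc_def syz_def)
    then have "mon (\<Sum>_<k. wt F) * (\<Sum>e\<in>E. \<xi> e F * w e l) = mon (\<Sum>_<k. wt F) * 0"
      by (simp add: sum_distrib_left mult.assoc)
    then show ?thesis by (rule mon_times_cancel)
  next
    case False
    then show ?thesis using vcochainsD(3)[OF \<xi>(1)] by (intro sum.neutral) auto
  qed
  \<comment> \<open>Correcting the lift by \<xi> leaves \<phi> unchanged and makes every component a
    cocycle over the Cox ring.\<close>
  have "\<exists>\<eta>. \<eta> \<in> cochains X cl (cox X) i (d - wd e) \<and> (\<lambda>F. \<psi> e F - \<xi> e F) = coboundary X \<eta>" if e: "e \<in> E" for e
  proof -
    have 1: "(\<lambda>F. \<psi> e F - \<xi> e F) \<in> cochains X cl (cox X) (Suc i) (d - wd e)"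
      by (rule cochains_diff[OF submod_cox subset_refl \<psi> \<xi>c])
    have 2: "coboundary X (\<lambda>F. \<psi> e F - \<xi> e F) = (\<lambda>_. 0)"
      by (rule ext) (simp only: coboundary_diff \<xi>(2)[symmetric] \<chi>_def[symmetric] diff_self)
    show ?thesis by (rule vanishesD[OF S[OF e] 1 2]) blast
  qed
  then have "\<forall>e. \<exists>\<eta>. e \<in> E \<longrightarrow> \<eta> \<in> cochains X cl (cox X) i (d - wd e) \<and> (\<lambda>F. \<psi> e F - \<xi> e F) = coboundary X \<eta>"
    by blast
  from choice[OF this] obtain \<eta> where \<eta>: "\<forall>e. e \<in> E \<longrightarrow>
      \<eta> e \<in> cochains X cl (cox X) i (d - wd e) \<and> (\<lambda>F. \<psi> e F - \<xi> e F) = coboundary X (\<eta> e)" ..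
  let ?\<theta> = "\<lambda>l F. \<Sum>e\<in>E. \<eta> e F * w e l"
  have "?\<theta> \<in> vcochains (vspan E w) i dg d"
    using \<eta> by (intro vcochain_span[OF fin w]) auto
  moreover have "\<phi> l = coboundary X (?\<theta> l)" for l
  proof
    fix F
    have "coboundary X (?\<theta> l) F = (\<Sum>e\<in>E. coboundary X (\<eta> e) F * w e l)" by (rule coboundary_comb)
    also have "\<dots> = (\<Sum>e\<in>E. (\<psi> e F - \<xi> e F) * w e l)"
    proof (rule sum.cong[OF refl])
      fix e assume "e \<in> E"
      then have "(\<lambda>F. \<psi> e F - \<xi> e F) = coboundary X (\<eta> e)" using \<eta> by blast
      then show "coboundary X (\<eta> e) F * w e l = (\<psi> e F - \<xi> e F) * w e l" by (metis (mono_tags))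
    qed
    also have "\<dots> = (\<Sum>e\<in>E. \<psi> e F * w e l) - (\<Sum>e\<in>E. \<xi> e F * w e l)"
      by (simp add: left_diff_distrib sum_subtractf)
    also have "\<dots> = \<phi> l F" by (simp add: \<phi>_eq \<xi>sum)
    finally show "\<phi> l F = coboundary X (?\<theta> l) F" ..
  qed
  ultimately show "\<exists>\<theta>\<in>vcochains (vspan E w) i dg d. \<forall>l. \<phi> l = coboundary X (\<theta> l)"
    by (intro bexI[of _ ?\<theta>] allI)
qed

lemma vanishes_of_vvanishes:
  fixes M :: "('v, 'k::field) laurent set"
  assumes "submod X M" "M \<subseteq> cox X" "vvanishes {v. v () \<in> M} i (\<lambda>_ :: unit. 0) d"
  shows "local_cohomology_vanishes X cl M (Suc i) d"
proof (rule vanishesI[OF assms(1,2)])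
  fix \<phi> assume \<phi>: "\<phi> \<in> cochains X cl M (Suc i) d" "coboundary X \<phi> = (\<lambda>_. 0)"
  have vl: "(\<lambda>_. p) \<in> vloc {v. v () \<in> M} F \<longleftrightarrow> p \<in> loc M F" for p F
    by (simp add: vloc_def loc_iff)
  have "(\<lambda>_. \<phi>) \<in> vcochains {v. v () \<in> M} (Suc i) (\<lambda>_. 0) d"
    using cochainsD[OF assms(2) \<phi>(1)] assms(1) by (intro vcochainsI) (auto simp: vl)
  then obtain \<psi> where \<psi>: "\<psi> \<in> vcochains {v. v () \<in> M} i (\<lambda>_. 0) d" "\<phi> = coboundary X (\<psi> ())"
    using assms(3)[unfolded vvanishes_def, rule_format, of "\<lambda>_. \<phi>"] \<phi>(2) by blast
  have "\<psi> () \<in> cochains X cl M i d"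
  proof (rule cochainsI[OF assms(2)])
    fix F assume "F \<subseteq> cones X" "card F = i"
    from vcochainsD(1)[OF \<psi>(1) this] show "\<psi> () F \<in> loc M F" by (simp add: vloc_def loc_iff)
  qed (use vcochainsD(2,3)[OF \<psi>(1)] in auto)
  then show "\<exists>\<psi>\<in>cochains X cl M i d. \<phi> = coboundary X \<psi>" using \<psi>(2) by blast
qed

end

section \<open>Hilbert functions\<close>

lemma laurent_vector_space:
  "vector_space (\<lambda>(c::'k::field) (p::('v, 'k) laurent). Poly_Mapping.single 0 c * p)"
  by unfold_locales
    (simp_all add: distrib_left distrib_right single_add mult_single mult.assoc[symmetric])

lemma dim_keys:
  fixes E :: "('v \<Rightarrow>\<^sub>0 int) set"
  assumes "finite E"
  shows "dim_over_field {p :: ('v, 'k::field) laurent. ks p \<subseteq> E} = card E"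
proof -
  interpret vector_space "\<lambda>(c::'k) (p::('v, 'k) laurent). Poly_Mapping.single 0 c * p"
    by (rule laurent_vector_space)
  let ?m = "mon :: _ \<Rightarrow> ('v, 'k) laurent"
  have inj: "inj_on ?m E" by (auto simp: inj_on_def dest!: arg_cong[of _ _ ks])
  have "dim {p :: ('v, 'k) laurent. ks p \<subseteq> E} = card E"
  proof (rule dim_unique[where B = "?m ` E"])
    show "?m ` E \<subseteq> {p. ks p \<subseteq> E}" by auto
    show "{p :: ('v, 'k) laurent. ks p \<subseteq> E} \<subseteq> span (?m ` E)"
    proof
      fix p :: "('v, 'k) laurent" assume "p \<in> {p. ks p \<subseteq> E}"
      then have "p = (\<Sum>m\<in>ks p. Poly_Mapping.single 0 (lk p m) * mon m)" "ks p \<subseteq> E"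
        using poly_mapping_sum_singles[of p] by (auto simp: mult_single)
      moreover have "(\<Sum>m\<in>ks p. Poly_Mapping.single 0 (lk p m) * mon m) \<in> span (?m ` E)"
        using calculation(2) by (intro span_sum span_scale span_base) auto
      ultimately show "p \<in> span (?m ` E)" by metis
    qed
    show "independent (?m ` E)"
    proof (rule independent_if_scalars_zero)
      fix f x assume f: "(\<Sum>x\<in>?m ` E. Poly_Mapping.single 0 (f x) * x) = 0" and x: "x \<in> ?m ` E"
      then obtain m where m: "m \<in> E" "x = mon m" by blast
      have "0 = lk (\<Sum>x\<in>?m ` E. Poly_Mapping.single 0 (f x) * x) m" using f by simp
      also have "\<dots> = (\<Sum>e\<in>E. if e = m then f (mon e) else 0)"
        by (subst sum.reindex[OF inj]) (simp add: lookup_sum mult_single lookup_single when_def)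
      also have "\<dots> = f x" using m assms by simp
      finally show "f x = 0" ..
    qed (use assms in simp)
    show "card (?m ` E) = card E" by (rule card_image[OF inj])
  qed
  then show ?thesis by (simp add: dim_over_field_def)
qed

text \<open>The kernel of the map V -> V'/W' given by f lies in W, so dim V/W is at most dim V'/W';
  the inequality is rearranged to avoid subtraction. Concretely, the image of a basis
  \<open>C\<close> of a complement of W is independent modulo W'.\<close>

lemma (in vector_space) dim_quotient_le:
  assumes sub: "subspace V" "subspace W" "W \<subseteq> V" "subspace V'" "subspace W'" "W' \<subseteq> V'"
    and fin: "finite F" "V \<subseteq> span F" "finite F'" "V' \<subseteq> span F'"
    and f: "Vector_Spaces.linear scale scale f" "\<And>x. x \<in> V \<Longrightarrow> f x \<in> V'" "\<And>x. x \<in> V \<Longrightarrow> f x \<in> W' \<Longrightarrow> x \<in> W"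
      "inj_on f V"
  shows "dim V + dim W' \<le> dim V' + dim W"
proof -
  interpret f: Vector_Spaces.linear scale scale f by (rule f(1))
  obtain BW where BW: "BW \<subseteq> W" "independent BW" "W \<subseteq> span BW" "card BW = dim W"
    using basis_exists by metis
  obtain BV where BV: "BW \<subseteq> BV" "BV \<subseteq> V" "independent BV" "V \<subseteq> span BV"
    using maximal_independent_subset_extend[of BW V] BW sub(3) by (metis order_trans)
  obtain BW' where BW': "BW' \<subseteq> W'" "independent BW'" "W' \<subseteq> span BW'" "card BW' = dim W'"
    using basis_exists by metis
  obtain B' where B': "B' \<subseteq> V'" "independent B'" "V' \<subseteq> span B'" "card B' = dim V'"
    using basis_exists by metis
  have finV: "finite BV" using independent_span_bound[OF fin(1) BV(3)] BV(2) fin(2) by blast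
  have finW': "finite BW'" using independent_span_bound[OF fin(3) BW'(2)] BW'(1) sub(6) fin(4) by blast
  have finB': "finite B'" using independent_span_bound[OF fin(3) B'(2)] B'(1) fin(4) by blast
  have cV: "card BV = dim V" by (rule basis_card_eq_dim[OF BV(2,4,3)])
  define C where "C = BV - BW"
  have C: "finite C" "C \<subseteq> V" "BV = C \<union> BW" "C \<inter> BW = {}" "finite BW"
    using finV BV by (auto simp: C_def intro: finite_subset)
  have injC: "inj_on f C" using f(4) C(2) by (rule inj_on_subset)
  have key: "u c = 0" if y: "(\<Sum>c\<in>C. scale (u c) c) \<in> W" and c: "c \<in> C" for u c
  proof -
    have "(\<Sum>c\<in>C. scale (u c) c) \<in> span BW" using y BW(3) by blast
    then obtain v where v: "(\<Sum>c\<in>C. scale (u c) c) = (\<Sum>b\<in>BW. scale (v b) b)"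
      using span_finite[OF C(5)] by auto
    have "(\<Sum>x\<in>C \<union> BW. scale (if x \<in> C then u x else - v x) x) =
        (\<Sum>x\<in>C. scale (u x) x) + (\<Sum>x\<in>BW. scale (- v x) x)"
      unfolding sum.union_disjoint[OF C(1,5,4)]
      using C(4) by (intro arg_cong2[where f = "(+)"] sum.cong) auto
    also have "\<dots> = 0" by (simp add: v scale_minus_left sum_negf)
    finally have "(if c \<in> C then u c else - v c) = 0"
      using independentD[OF BV(3), of "C \<union> BW" "\<lambda>x. if x \<in> C then u x else - v x" c] C c by auto
    then show ?thesis using c by simp
  qed
  have disj: "f ` C \<inter> BW' = {}"
  proof (rule ccontr)
    assume "f ` C \<inter> BW' \<noteq> {}"
    then obtain c where c: "c \<in> C" "f c \<in> BW'" by blast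
    then have "c \<in> W" using f(3)[of c] C(2) BW'(1) by blast
    moreover have "(\<Sum>x\<in>C. scale (if x = c then 1 else 0) x) = (\<Sum>x\<in>C. if x = c then c else 0)"
      by (rule sum.cong) auto
    ultimately have "(\<Sum>x\<in>C. scale (if x = c then 1 else 0) x) \<in> W" using c C(1) by simp
    from key[OF this c(1)] show False by simp
  qed
  have indep: "independent (f ` C \<union> BW')"
  proof (rule independent_if_scalars_zero)
    fix u x assume u: "(\<Sum>x\<in>f ` C \<union> BW'. scale (u x) x) = 0" and x: "x \<in> f ` C \<union> BW'"
    let ?y = "\<Sum>c\<in>C. scale (u (f c)) c"
    have "f ?y + (\<Sum>w\<in>BW'. scale (u w) w) = 0"
      using u C(1) finW' disj by (simp add: sum.union_disjoint sum.reindex[OF injC] f.sum f.scale)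
    then have "f ?y = - (\<Sum>w\<in>BW'. scale (u w) w)" by (simp add: eq_neg_iff_add_eq_0)
    moreover have "- (\<Sum>w\<in>BW'. scale (u w) w) \<in> W'"
      using sub(5) BW'(1) by (intro subspace_neg subspace_sum subspace_scale) auto
    moreover have "?y \<in> V" using sub(1) C(2) by (intro subspace_sum subspace_scale) auto
    ultimately have "?y \<in> W" using f(3) by metis
    then have uC: "u (f c) = 0" if "c \<in> C" for c using key[of "\<lambda>c. u (f c)"] that by blast
    then have "?y = 0" by (intro sum.neutral) simp
    then have "(\<Sum>w\<in>BW'. scale (u w) w) = 0" using \<open>f ?y + _ = 0\<close> f.zero by simp
    then have "u w = 0" if "w \<in> BW'" for w
      using independentD[OF BW'(2) finW' subset_refl _ that, of u] by blast
    then show "u x = 0" using x uC by blast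
  qed (use C(1) finW' in simp)
  have "f ` C \<union> BW' \<subseteq> span B'" using f(2) C(2) BW'(1) sub(6) B'(3) by blast
  then have "card (f ` C \<union> BW') \<le> card B'" using independent_span_bound[OF finB' indep] by blast
  moreover have "card (f ` C \<union> BW') = card C + card BW'"
    using C(1) finW' disj injC by (simp add: card_Un_disjoint card_image)
  moreover have "card BV = card C + card BW" unfolding C(3) using C by (simp add: card_Un_disjoint)
  ultimately show ?thesis using cV BW(4) BW'(4) B'(4) by linarith
qed

context toric_var
begin

section \<open>Primes of subvarieties and their Hilbert functions\<close>

lemma cox_degree_part: "degree_part cl (cox X) d = {p. ks p \<subseteq> {m \<in> exps X. cl m = d}}"
  by (auto simp: degree_part_def cox_iff)

lemma subvarietyD:
  assumes "subvariety X cl (P :: ('v, 'k::field) laurent set)"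
  shows "submod X P" "P \<subseteq> cox X" "1 \<notin> P"
    "\<And>a b. a \<in> cox X \<Longrightarrow> b \<in> cox X \<Longrightarrow> a * b \<in> P \<Longrightarrow> a \<in> P \<or> b \<in> P"
    "\<exists>\<sigma>\<in>cones X. irrelevant_gen X \<sigma> \<notin> P"
    "P = genideal (cox_ring X) (\<Union>d. degree_part cl P d)"
proof -
  have P: "primeideal P (cox_ring X)" "homogeneous_ideal X cl P" "\<not> irrelevant_ideal X \<subseteq> P"
    using assms by (auto simp: subvariety_def)
  interpret primeideal P "cox_ring X" by (rule P(1))
  show sm: "submod X P" "P \<subseteq> cox X" using is_ideal ideal_cox_iff by blast+
  show "1 \<notin> P" using I_notcarr one_imp_carrier by auto
  show "\<And>a b. a \<in> cox X \<Longrightarrow> b \<in> cox X \<Longrightarrow> a * b \<in> P \<Longrightarrow> a \<in> P \<or> b \<in> P"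
    using I_prime by simp
  show "\<exists>\<sigma>\<in>cones X. irrelevant_gen X \<sigma> \<notin> P"
    using P(3) genideal_minimal_cox[OF sm] unfolding irrelevant_ideal_def by blast
  show "P = genideal (cox_ring X) (\<Union>d. degree_part cl P d)"
    using P(2) by (simp add: homogeneous_ideal_def)
qed

lemma prime_power_notin:
  assumes "subvariety X cl P" "a \<in> cox X" "a \<notin> P"
  shows "a ^ k \<notin> P"
proof (induction k)
  case (Suc k)
  then show ?case using subvarietyD(4)[OF assms(1,2) cox_power[OF assms(2)]] assms(3) by auto
qed (use subvarietyD(3)[OF assms(1)] in simp)

text \<open>Such a monomial divides a power of the generator of \<pi>, and the prime P does not
  contain that generator.\<close>

lemma mon_notin_prime:
  assumes P: "subvariety X cl (P :: ('v, 'k::field) laurent set)"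
    and \<pi>: "irrelevant_gen X \<pi> \<notin> P"
    and v: "v \<in> exps X" "\<And>\<rho>. \<rho> \<in> \<pi> \<Longrightarrow> lk v \<rho> = 0"
  shows "mon v \<notin> P"
proof
  assume "mon v \<in> P"
  obtain k where k: "(\<Sum>_<(k::nat). wt {\<pi>}) - v \<in> exps X"
    using wt_absorbs[of \<pi> "{\<pi>}" v] v exps_divisors by auto
  have "mon ((\<Sum>_<k. wt {\<pi>}) - v) * mon v \<in> P"
    using submod_mon[OF subvarietyD(1)[OF P] k \<open>mon v \<in> P\<close>] .
  then have "(mon (wt {\<pi>}) :: ('v, 'k) laurent) ^ k \<in> P"
    unfolding mon_power by (simp add: mult_single)
  moreover have "(mon (wt {\<pi>}) :: ('v, 'k) laurent) = irrelevant_gen X \<pi>"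
    by (simp add: irrelevant_gen_mon wt_def)
  moreover have "(mon (wt {\<pi>}) :: ('v, 'k) laurent) \<in> cox X" by (rule cox_single[OF wt_exps])
  ultimately show False using prime_power_notin[OF P, of "irrelevant_gen X \<pi>" k] \<pi> by simp
qed

text \<open>Since P is prime, multiplication by g is injective on the quotient by P;
  \<open>dim_quotient_le\<close> compares the graded parts.\<close>

lemma hilbert_function_mono:
  assumes P: "subvariety X cl (P :: ('v, 'k::field) laurent set)"
    and g: "g \<in> cox X" "homog e g" "g \<notin> P"
  shows "hilbert_function X cl P b \<le> hilbert_function X cl P (b + e)"
proof -
  interpret vector_space "\<lambda>(c::'k) (p::('v, 'k) laurent). Poly_Mapping.single 0 c * p"
    by (rule laurent_vector_space)
  note sm = subvarietyD(1)[OF P] and Pc = subvarietyD(2)[OF P]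
  have c0: "Poly_Mapping.single 0 c \<in> cox X" for c :: 'k by (rule cox_single) simp
  have ks0: "ks (Poly_Mapping.single 0 c * p) \<subseteq> ks p" for c :: 'k and p :: "('v, 'k) laurent"
    by (auto simp: in_keys_iff lookup_single_times)
  have sub: "subspace (degree_part cl M d)" if "submod X M" for M :: "('v, 'k) laurent set" and d
    unfolding subspace_def degree_part_def
    using that submod_zero submod_add submod_smult[OF that c0] ks0 keys_add by fastforce
  have span: "degree_part cl (cox X) d \<subseteq> span ((mon :: _ \<Rightarrow> ('v, 'k) laurent) ` {m \<in> exps X. cl m = d})" for d
  proof
    fix p :: "('v, 'k) laurent" assume "p \<in> degree_part cl (cox X) d"
    then have "p = (\<Sum>m\<in>ks p. Poly_Mapping.single 0 (lk p m) * mon m)" "ks p \<subseteq> {m \<in> exps X. cl m = d}"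
      using poly_mapping_sum_singles[of p] by (auto simp: mult_single cox_degree_part)
    moreover have "(\<Sum>m\<in>ks p. Poly_Mapping.single 0 (lk p m) * mon m) \<in> span ((mon :: _ \<Rightarrow> ('v, 'k) laurent) ` {m \<in> exps X. cl m = d})"
      using calculation(2) by (intro span_sum span_scale span_base) auto
    ultimately show "p \<in> span ((mon :: _ \<Rightarrow> ('v, 'k) laurent) ` {m \<in> exps X. cl m = d})" by metis
  qed
  have "g \<noteq> 0" using g(3) submod_zero[OF sm] by auto
  have "dim (degree_part cl (cox X :: ('v, 'k) laurent set) b) + dim (degree_part cl P (b + e)) \<le>
      dim (degree_part cl (cox X :: ('v, 'k) laurent set) (b + e)) + dim (degree_part cl P b)"
  proof (rule dim_quotient_le[where f = "\<lambda>p. g * p" and F = "mon ` {m \<in> exps X. cl m = b}"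
        and F' = "mon ` {m \<in> exps X. cl m = b + e}"])
    show "Vector_Spaces.linear (\<lambda>(c::'k) (p::('v, 'k) laurent). Poly_Mapping.single 0 c * p)
        (\<lambda>c p. Poly_Mapping.single 0 c * p) ((*) g)"
      by unfold_locales (simp_all add: distrib_left mult.left_commute)
    show "finite ((mon :: _ \<Rightarrow> ('v, 'k) laurent) ` {m \<in> exps X. cl m = b})"
      "finite ((mon :: _ \<Rightarrow> ('v, 'k) laurent) ` {m \<in> exps X. cl m = b + e})"
      using finite_exps_class by blast+
    show "subspace (degree_part cl (cox X :: ('v, 'k) laurent set) b)" "subspace (degree_part cl P b)"
      "subspace (degree_part cl (cox X :: ('v, 'k) laurent set) (b + e))" "subspace (degree_part cl P (b + e))"
      by (intro sub sm submod_cox)+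
    show "g * x \<in> degree_part cl (cox X) (b + e)" if "x \<in> degree_part cl (cox X) b" for x
    proof -
      have "x \<in> cox X" "homog b x" using that cox_divisors by (auto simp: degree_part_def homog_def)
      then show ?thesis using g(1) homog_mult[OF _ g(2), of b x]
        by (auto simp: degree_part_def homog_def cox_mult mult.commute)
    qed
    show "x \<in> degree_part cl P b" if "x \<in> degree_part cl (cox X) b" "g * x \<in> degree_part cl P (b + e)" for x
      using that subvarietyD(4)[OF P g(1), of x] g(3) by (auto simp: degree_part_def)
    show "inj_on ((*) g) (degree_part cl (cox X) b)"
    proof (rule inj_onI)
      fix x y assume "g * x = g * y"
      then have "g * (x - y) = 0" by (simp add: right_diff_distrib)
      then show "x = y" using laurent_mult_nonzero[OF \<open>g \<noteq> 0\<close>, of "x - y"] by auto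
    qed
  qed (use Pc span in \<open>auto simp only: degree_part_def\<close>)
  then show ?thesis unfolding hilbert_function_def dim_over_field_def by linarith
qed

text \<open>A section that does not vanish on the subvariety makes the Hilbert function grow. As an
  ample class exists, the eventual equality can be evaluated at some j.\<close>

lemma intersection_nonneg:
  assumes P: "subvariety X cl (P :: ('v, 'k::field) laurent set)"
    and g: "g \<in> cox X" "homog e g" "g \<notin> P" and i: "intersection_number X cl P e k"
  shows "k \<ge> 0"
proof -
  obtain A where "ample X cl A" using ample_ex .
  then have "\<forall>\<^sub>F j in sequentially. hilbert_function X cl P (j \<odot> A + e) - hilbert_function X cl P (j \<odot> A) = k"
    using i by (simp add: intersection_number_def)
  then obtain j where "hilbert_function X cl P (j \<odot> A + e) - hilbert_function X cl P (j \<odot> A) = k"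
    using eventually_happens'[OF sequentially_bot] by blast
  then show ?thesis using hilbert_function_mono[OF P g, of "j \<odot> A"] by linarith
qed

text \<open>P omits the generator of some cone \<pi>, so the subvariety meets that chart; the
  section chosen at a maximal cone above \<pi> has no zeros there.\<close>

lemma bpf_section:
  assumes P: "subvariety X cl (P :: ('v, 'k::field) laurent set)" and "bpf d"
  obtains D where "D \<in> exps X" "cl D = d" "(mon D :: ('v, 'k) laurent) \<notin> P"
proof -
  obtain \<pi> where \<pi>: "\<pi> \<in> cones X" "irrelevant_gen X \<pi> \<notin> P" using subvarietyD(5)[OF P] by blast
  obtain \<mu> where \<mu>: "\<mu> \<in> max_cones X" "\<pi> \<subseteq> \<mu>" using cone_subset_max[OF \<pi>(1)] .
  obtain D where D: "D \<in> exps X" "cl D = d" "\<And>\<rho>. \<rho> \<in> \<mu> \<Longrightarrow> lk D \<rho> = 0" using bpfD[OF assms(2) \<mu>(1)] by metis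
  have "(mon D :: ('v, 'k) laurent) \<notin> P" using D \<mu>(2) by (intro mon_notin_prime[OF P \<pi>(2)]) auto
  then show ?thesis using that D by blast
qed

lemma bpf_Nef: "bpf d \<Longrightarrow> d \<in> Nef TYPE('k::field) X cl"
  unfolding Nef_def
proof (intro CollectI allI impI)
  fix P :: "('v, 'k) laurent set" and k
  assume d: "bpf d" and "curve X cl P \<and> intersection_number X cl P d k"
  then have P: "subvariety X cl P" and i: "intersection_number X cl P d k" by (auto simp: curve_def)
  obtain D where D: "D \<in> exps X" "cl D = d" "(mon D :: ('v, 'k) laurent) \<notin> P" using bpf_section[OF P d] .
  then show "k \<ge> 0" using homog_single[of D 1] by (intro intersection_nonneg[OF P _ _ D(3) i] cox_single) (auto simp: exps_divisors)
qed

section \<open>Torus-invariant curves\<close>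

text \<open>The ideal generated by the variables of \<pi>, described by exponents. For a cone \<pi>
  it is the prime of the closure of the torus orbit of \<pi>.\<close>

definition mp :: "'v set \<Rightarrow> ('v, 'k::field) laurent set" where
  "mp \<pi> = {p \<in> cox X. \<forall>m\<in>ks p. \<exists>\<rho>\<in>\<pi>. lk m \<rho> > 0}"

text \<open>The exponents that survive modulo \<open>mp \<pi>\<close>; their monomials are a basis
  of the quotient.\<close>

definition off :: "'v set \<Rightarrow> ('v \<Rightarrow>\<^sub>0 int) set" where
  "off \<pi> = {m \<in> exps X. \<forall>\<rho>\<in>\<pi>. lk m \<rho> = 0}"

lemma off_exps: "m \<in> off \<pi> \<Longrightarrow> m \<in> exps X" by (simp add: off_def)

lemma off_add: "m \<in> off \<pi> \<Longrightarrow> m' \<in> off \<pi> \<Longrightarrow> m + m' \<in> off \<pi>"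
  by (simp add: off_def exps_add lookup_add)

lemma mp_iff: "p \<in> mp \<pi> \<longleftrightarrow> p \<in> cox X \<and> ks p \<inter> off \<pi> = {}"
proof -
  have *: "(\<exists>\<rho>\<in>\<pi>. lk m \<rho> > 0) \<longleftrightarrow> m \<notin> off \<pi>" if "m \<in> exps X" for m
  proof -
    have "(lk m \<rho> > 0) = (lk m \<rho> \<noteq> 0)" for \<rho> using that unfolding exps_def by (auto simp: less_le)
    then show ?thesis using that by (simp add: off_def)
  qed
  have "(\<forall>m\<in>ks p. \<exists>\<rho>\<in>\<pi>. lk m \<rho> > 0) \<longleftrightarrow> (\<forall>m\<in>ks p. m \<notin> off \<pi>)" if "p \<in> cox X"
    using that unfolding cox_iff by (intro ball_cong refl *) blast
  then show ?thesis by (auto simp: mp_def disjoint_iff)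
qed

lemma mp_submod: "submod X (mp \<pi> :: ('v, 'k::field) laurent set)"
  unfolding submod_def
proof (intro conjI ballI)
  show "0 \<in> mp \<pi>" by (simp add: mp_def)
next
  fix p q :: "('v, 'k) laurent" assume "p \<in> mp \<pi>" "q \<in> mp \<pi>"
  then show "p + q \<in> mp \<pi>" using keys_add[of p q] by (auto simp: mp_def cox_add)
next
  fix s p :: "('v, 'k) laurent" assume s: "s \<in> cox X" and p: "p \<in> mp \<pi>"
  have "\<exists>\<rho>\<in>\<pi>. lk m \<rho> > 0" if "m \<in> ks (s * p)" for m
  proof -
    from that keys_mult[of s p] obtain a b where ab: "m = a + b" "a \<in> ks s" "b \<in> ks p" by blast
    obtain \<rho> where \<rho>: "\<rho> \<in> \<pi>" "lk b \<rho> > 0" using p ab by (auto simp: mp_def)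
    have "lk a \<rho> \<ge> 0" using s ab by (auto simp: cox_iff exps_def)
    then show ?thesis using \<rho> ab(1) by (intro bexI[of _ \<rho>]) (auto simp: lookup_add)
  qed
  then show "s * p \<in> mp \<pi>" using s p by (auto simp: mp_def cox_mult)
qed

lemma mp_cox: "mp \<pi> \<subseteq> cox X" by (auto simp: mp_def)

text \<open>Modulo the ideal both factors may be replaced by their parts with exponents in
  \<open>off \<pi>\<close>. The product of these parts is nonzero with all exponents in
  \<open>off \<pi>\<close>, so it cannot lie in the ideal.\<close>

lemma mp_prime:
  fixes a b :: "('v, 'k::field) laurent"
  assumes "a \<in> cox X" "b \<in> cox X" "a * b \<in> mp \<pi>" shows "a \<in> mp \<pi> \<or> b \<in> mp \<pi>"
proof (rule ccontr)
  assume n: "\<not> (a \<in> mp \<pi> \<or> b \<in> mp \<pi>)"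
  define a' where "a' = rst (off \<pi>) a"
  define b' where "b' = rst (off \<pi>) b"
  have mem: "c - rst (off \<pi>) c \<in> mp \<pi>" if "c \<in> cox X" for c :: "('v, 'k) laurent"
    using that by (auto simp: mp_iff cox_diff cox_rst in_keys_iff lookup_minus lookup_rst)
  have nz: "rst (off \<pi>) c \<noteq> 0" if "c \<in> cox X" "c \<notin> mp \<pi>" for c :: "('v, 'k) laurent"
    using mem[OF that(1)] that(2) by auto
  have "a' \<noteq> 0" "b' \<noteq> 0" using n nz assms by (auto simp: a'_def b'_def)
  then have nz': "a' * b' \<noteq> 0" by (rule laurent_mult_nonzero)
  have c: "a' \<in> cox X" "b' \<in> cox X" using assms by (auto simp: a'_def b'_def cox_rst)
  have "a' * b' = a * b - b * (a - a') - a' * (b - b')" by (simp add: algebra_simps)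
  then have "a' * b' \<in> mp \<pi>"
    using assms(3) mem[OF assms(1)] mem[OF assms(2)] assms c
    by (simp add: a'_def[symmetric] b'_def[symmetric] submod_diff[OF mp_submod] submod_smult[OF mp_submod])
  moreover have "ks (a' * b') \<subseteq> off \<pi>"
    using keys_mult[of a' b'] by (auto simp: a'_def b'_def keys_rst intro: off_add)
  moreover have "ks (a' * b') \<inter> off \<pi> = {}" using calculation(1) by (simp only: mp_iff)
  ultimately have "ks (a' * b') = {}" by blast
  then have "a' * b' = 0" by (intro poly_mapping_eqI) (auto simp: in_keys_iff)
  then show False using nz' by simp
qed

lemma mp_gen_notin: "(irrelevant_gen X \<pi> :: ('v, 'k::field) laurent) \<notin> mp \<pi>"
proof -
  have "lk (\<Sum>\<rho>\<in>rays X - \<pi>. Poly_Mapping.single \<rho> (1::int)) \<rho> = 0" if "\<rho> \<in> \<pi>" for \<rho>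
    using that by (auto simp: lookup_sum lookup_single when_def intro!: sum.neutral)
  then show ?thesis by (auto simp: mp_def irrelevant_gen_mon)
qed

lemma mp_subvariety:
  assumes "\<pi> \<in> cones X"
  shows "subvariety X cl (mp \<pi> :: ('v, 'k::field) laurent set)"
  unfolding subvariety_def homogeneous_ideal_def
proof (intro conjI)
  show id: "ideal (mp \<pi> :: ('v, 'k) laurent set) (cox_ring X)" 
    unfolding ideal_cox_iff by (intro conjI mp_submod mp_cox)
  have ir: "irrelevant_gen X \<sigma> \<in> (cox X :: ('v, 'k) laurent set)" for \<sigma>
    unfolding irrelevant_gen_def by (intro cox_prod cox_single single_exps) auto
  show "primeideal (mp \<pi> :: ('v, 'k) laurent set) (cox_ring X)"
  proof (rule primeidealI[OF id cring_cox])
    show "cox X \<noteq> (mp \<pi> :: ('v, 'k) laurent set)" using mp_gen_notin ir by blast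
  qed (use mp_prime in auto)
  show "\<not> irrelevant_ideal X \<subseteq> (mp \<pi> :: ('v, 'k) laurent set)"
    using mp_gen_notin assms genideal_self_cox unfolding irrelevant_ideal_def by blast
  let ?G = "\<Union>d. degree_part cl (mp \<pi> :: ('v, 'k) laurent set) d"
  have G: "?G \<subseteq> mp \<pi>" by (auto simp: degree_part_def)
  show "mp \<pi> = genideal (cox_ring X) ?G"
  proof
    show "genideal (cox_ring X) ?G \<subseteq> mp \<pi>" by (rule genideal_minimal_cox[OF mp_submod mp_cox G])
    show "mp \<pi> \<subseteq> genideal (cox_ring X) ?G"
    proof
      fix p :: "('v, 'k) laurent" assume p: "p \<in> mp \<pi>"
      have sm: "submod X (genideal (cox_ring X) ?G)" using G mp_cox by (intro genideal_submod) blast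
      have "Poly_Mapping.single m (lk p m) \<in> ?G" if "m \<in> ks p" for m
        using that p by (auto simp: degree_part_def mp_def cox_iff)
      then have "(\<Sum>m\<in>ks p. Poly_Mapping.single m (lk p m)) \<in> genideal (cox_ring X) ?G"
        using genideal_self_cox by (intro submod_sum[OF sm]) blast
      then show "p \<in> genideal (cox_ring X) ?G" by (metis poly_mapping_sum_singles)
    qed
  qed
qed

lemma hilbert_function_mp:
  "hilbert_function X cl (mp \<pi> :: ('v, 'k::field) laurent set) d = int (card {m \<in> off \<pi>. cl m = d})"
proof -
  let ?E = "{m \<in> exps X. cl m = d}" and ?O = "{m \<in> off \<pi>. cl m = d}"
  have fin: "finite ?E" by (rule finite_exps_class)
  have sub: "?O \<subseteq> ?E" by (auto simp: off_exps)
  have "degree_part cl (mp \<pi>) d = {p :: ('v, 'k) laurent. ks p \<subseteq> ?E - ?O}"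
    by (auto simp: degree_part_def mp_iff cox_iff)
  then have "dim_over_field (degree_part cl (mp \<pi> :: ('v, 'k) laurent set) d) = card (?E - ?O)"
    using dim_keys[of "?E - ?O"] fin by simp
  moreover have "dim_over_field (degree_part cl (cox X :: ('v, 'k) laurent set) d) = card ?E"
    unfolding cox_degree_part using dim_keys[OF fin] by simp
  moreover have "card ?E = card ?O + card (?E - ?O)"
    using card_Diff_subset[OF finite_subset[OF sub fin] sub] card_mono[OF fin sub] by linarith
  ultimately show ?thesis by (simp add: hilbert_function_def)
qed

text \<open>The principal divisor of the character normal to the wall: the direction in which
  monomials of one class vary on the curve of the wall.\<close>

definition wdir :: "'v set \<Rightarrow> 'v \<Rightarrow> 'v \<Rightarrow>\<^sub>0 int" where "wdir \<sigma> k = chi (dc \<sigma> k)"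

lemma frag_cmul_chi: "frag_cmul t (chi m) = chi (\<lambda>i. t * m i)"
  by (rule poly_mapping_eqI) (simp add: lookup_dv pr_scale)

lemma cmul_wdir: "frag_cmul t (wdir \<sigma> k) \<in> divisors X" "cl (frag_cmul t (wdir \<sigma> k)) = 0"
  by (simp_all add: wdir_def frag_cmul_chi dv_divisors cl_chi)

lemma lookup_wdir: "\<sigma> \<in> max_cones X \<Longrightarrow> k \<in> \<sigma> \<Longrightarrow> \<rho> \<in> \<sigma> \<Longrightarrow> lk (wdir \<sigma> k) \<rho> = (if \<rho> = k then 1 else 0)"
  using cone_rays[OF max_cone_cone, of \<sigma>] by (auto simp: wdir_def lookup_dv pr_dc)

text \<open>A divisor of known class is determined by its coefficients on a maximal cone
  (\<open>norm_div_unique\<close>); when those on the wall are zero, only the coefficient at k is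
  free.\<close>

lemma off_wall_form:
  assumes \<sigma>: "\<sigma> \<in> max_cones X" "k \<in> \<sigma>" and D: "D \<in> divisors X"
    and m: "m \<in> divisors X" "cl m = cl D" "\<And>\<rho>. \<rho> \<in> \<sigma> - {k} \<Longrightarrow> lk m \<rho> = 0"
  shows "m = norm_div \<sigma> D + frag_cmul (lk m k) (wdir \<sigma> k)"
proof (rule norm_div_unique[OF \<sigma>(1) m(1)])
  show "norm_div \<sigma> D + frag_cmul (lk m k) (wdir \<sigma> k) \<in> divisors X"
    by (intro divisors_add norm_div_divisors D cmul_wdir)
  show "cl m = cl (norm_div \<sigma> D + frag_cmul (lk m k) (wdir \<sigma> k))"
    using D by (simp add: cl_add norm_div_divisors cmul_wdir cl_norm_div m(2))
  show "lk m \<rho> = lk (norm_div \<sigma> D + frag_cmul (lk m k) (wdir \<sigma> k)) \<rho>" if "\<rho> \<in> \<sigma>" for \<rho>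
    using that m(3)[of \<rho>] by (auto simp: lookup_add norm_div_zero[OF \<sigma>(1)] lookup_wdir[OF \<sigma>])
qed

lemma bpf_norm_exps:
  assumes "\<sigma> \<in> max_cones X" "D \<in> divisors X" "bpf (cl D)" shows "norm_div \<sigma> D \<in> exps X"
proof -
  obtain E where E: "E \<in> exps X" "cl E = cl D" "\<And>\<rho>. \<rho> \<in> \<sigma> \<Longrightarrow> lk E \<rho> = 0" using bpfD[OF assms(3,1)] by metis
  have "norm_div \<sigma> D = E"
    using E assms by (intro norm_div_unique[OF assms(1)]) (auto simp: norm_div_divisors exps_divisors cl_norm_div norm_div_zero)
  then show ?thesis using E by simp
qed

text \<open>The curve of a wall is a projective line, and the monomials of a base-point-free class
  on it are the lattice points of a segment of length \<open>T\<close>, hence T + 1 in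
  number.\<close>

lemma wall_count:
  assumes adj: "adjacent \<sigma> k k'" and D: "D \<in> divisors X" "bpf (cl D)"
  shows "int (card {m \<in> off (\<sigma> - {k}). cl m = cl D}) = lk (norm_div \<sigma> D) k' + 1"
proof -
  have \<sigma>: "\<sigma> \<in> max_cones X" "k \<in> \<sigma>" and k': "k' \<in> rays X" "k' \<notin> \<sigma>"
    and \<sigma>': "insert k' (\<sigma> - {k}) \<in> max_cones X" and pk': "pr (dc \<sigma> k) k' = - 1"
    using adj by (auto simp: adjacent_def)
  define E where "E = norm_div \<sigma> D"
  define w where "w = wdir \<sigma> k"
  define T where "T = lk E k'"
  have E: "E \<in> exps X" "cl E = cl D" using bpf_norm_exps[OF \<sigma>(1) D] D by (auto simp: E_def cl_norm_div)
  have T0: "T \<ge> 0" using E by (simp add: T_def exps_def)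
  have wk': "lk w k' = - 1" using k' pk' by (simp add: w_def wdir_def lookup_dv)
  have wk: "lk w k = 1" and Ek: "lk E k = 0" using \<sigma> by (auto simp: w_def lookup_wdir E_def norm_div_zero)
  \<comment> \<open>The other end of the segment is the representative for the neighbouring cone.
    Coefficients are affine along the segment, so effectiveness at both ends gives it
    throughout.\<close>
  have far: "E + frag_cmul T w \<in> exps X"
  proof -
    have "norm_div (insert k' (\<sigma> - {k})) D = E + frag_cmul T w"
    proof (rule norm_div_unique[OF \<sigma>'])
      show "lk (norm_div (insert k' (\<sigma> - {k})) D) \<rho> = lk (E + frag_cmul T w) \<rho>" if "\<rho> \<in> insert k' (\<sigma> - {k})" for \<rho>
        using that wk' by (auto simp: norm_div_zero[OF \<sigma>'] lookup_add T_def E_def w_def norm_div_zero[OF \<sigma>(1)] lookup_wdir[OF \<sigma>])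
    qed (use D in \<open>auto simp: E_def w_def norm_div_divisors divisors_add cmul_wdir cl_add cl_norm_div\<close>)
    then show ?thesis using bpf_norm_exps[OF \<sigma>' D] by simp
  qed
  have "{m \<in> off (\<sigma> - {k}). cl m = cl D} = (\<lambda>t. E + frag_cmul t w) ` {0..T}"
  proof (intro equalityI subsetI)
    fix m assume m: "m \<in> {m \<in> off (\<sigma> - {k}). cl m = cl D}"
    then have me: "m \<in> exps X" by (simp add: off_def)
    have eq: "m = E + frag_cmul (lk m k) w" unfolding E_def w_def
      using m by (intro off_wall_form \<sigma> D) (auto simp: off_def exps_divisors)
    have "lk m k' = T - lk m k" by (subst eq) (simp add: lookup_add wk' T_def)
    moreover have "lk m k' \<ge> 0" "lk m k \<ge> 0" using me by (auto simp: exps_def)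
    ultimately show "m \<in> (\<lambda>t. E + frag_cmul t w) ` {0..T}" using eq by (intro image_eqI[of _ _ "lk m k"]) auto
  next
    fix m assume "m \<in> (\<lambda>t. E + frag_cmul t w) ` {0..T}"
    then obtain t where t: "m = E + frag_cmul t w" "0 \<le> t" "t \<le> T" by auto
    have "lk m \<rho> \<ge> 0" for \<rho>
    proof (cases "lk w \<rho> \<ge> 0")
      case True
      then show ?thesis using E t by (simp add: lookup_add exps_def)
    next
      case False
      then have "t * lk w \<rho> \<ge> T * lk w \<rho>" using t(3) by (intro mult_right_mono_neg) auto
      moreover have "lk E \<rho> + T * lk w \<rho> \<ge> 0" using far by (auto simp: exps_def lookup_add)
      ultimately show ?thesis using t by (simp add: lookup_add)
    qed
    moreover have "m \<in> divisors X" unfolding t w_def by (intro divisors_add exps_divisors E cmul_wdir)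
    moreover have "lk m \<rho> = 0" if "\<rho> \<in> \<sigma> - {k}" for \<rho>
      using that \<sigma> by (auto simp: t lookup_add E_def norm_div_zero w_def lookup_wdir)
    moreover have "cl m = cl D" using E by (simp add: t w_def cl_add exps_divisors cmul_wdir)
    ultimately show "m \<in> {m \<in> off (\<sigma> - {k}). cl m = cl D}" by (simp add: off_def exps_def)
  qed
  moreover have "inj_on (\<lambda>t. E + frag_cmul t w) {0..T}"
  proof (rule inj_onI)
    fix s t assume "E + frag_cmul s w = E + frag_cmul t w"
    then have "lk (frag_cmul s w) k = lk (frag_cmul t w) k" by simp
    then show "s = t" by (simp add: wk)
  qed
  ultimately show ?thesis using T0 by (simp add: card_image T_def E_def)
qed

text \<open>For large j both classes are base-point-free and \<open>wall_count\<close> applies; by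
  additivity of \<open>norm_div\<close> the part from A and the summand 1 cancel in the
  difference.\<close>

lemma wall_intersection_number:
  assumes adj: "adjacent \<sigma> k k'" and D: "D \<in> divisors X"
  shows "intersection_number X cl (mp (\<sigma> - {k}) :: ('v, 'k::field) laurent set) (cl D) (lk (norm_div \<sigma> D) k')"
  unfolding intersection_number_def
proof (intro allI impI)
  fix A assume A: "ample X cl A"
  then obtain DA where DA: "ample_divisor X DA" "cl DA = A" by (auto simp: ample_def)
  have DAd: "DA \<in> divisors X" using DA by (simp add: ample_divisor_def)
  have H: "hilbert_function X cl (mp (\<sigma> - {k}) :: ('v, 'k) laurent set) (j \<odot> A + cl E) = int j * lk (norm_div \<sigma> DA) k' + lk (norm_div \<sigma> E) k' + 1"
    if "bpf (j \<odot> A + cl E)" "E \<in> divisors X" for j E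
  proof -
    have c: "cl ((\<Sum>_<j. DA) + E) = j \<odot> A + cl E" "(\<Sum>_<j. DA) + E \<in> divisors X"
      using cl_add[OF divisors_sum that(2), of "{..<j}" "\<lambda>_. DA"] DAd DA that(2)
      by (simp_all add: cl_nat_mult divisors_add divisors_sum)
    have "lk (norm_div \<sigma> ((\<Sum>_<j. DA) + E)) k' = int j * lk (norm_div \<sigma> DA) k' + lk (norm_div \<sigma> E) k'"
      by (simp add: norm_div_add norm_div_sum lookup_add lookup_sum)
    then show ?thesis using wall_count[OF adj c(2)] that(1) c(1) by (simp add: hilbert_function_mp)
  qed
  have e1: "\<forall>\<^sub>F j in sequentially. bpf (j \<odot> A + cl D)" by (rule ample_absorbs[OF A])
  have e2: "\<forall>\<^sub>F j in sequentially. bpf (j \<odot> A + 0)" by (rule ample_absorbs[OF A])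
  show "\<forall>\<^sub>F j in sequentially. hilbert_function X cl (mp (\<sigma> - {k}) :: ('v, 'k) laurent set) (j \<odot> A + cl D) -
      hilbert_function X cl (mp (\<sigma> - {k}) :: ('v, 'k) laurent set) (j \<odot> A) = lk (norm_div \<sigma> D) k'"
    using e1 e2
  proof eventually_elim
    case (elim j)
    then show ?case using H[of j D] H[of j 0] D by (simp add: norm_div_0)
  qed
qed

text \<open>Substitutes the Laurent monomial of \<open>w\<close> for the variable of a polynomial
  over the field. With \<open>w = wdir \<sigma> k\<close> that variable becomes the coordinate on
  the chart of \<sigma> in the curve of the wall, an affine line.\<close>

definition theta :: "('v \<Rightarrow>\<^sub>0 int) \<Rightarrow> 'k::field poly \<Rightarrow> ('v, 'k) laurent" where
  "theta w h = poly (map_poly (Poly_Mapping.single 0) h) (mon w)"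

lemma theta_0 [simp]: "theta w 0 = 0" by (simp add: theta_def)

lemma theta_pCons: "theta w (pCons a p) = Poly_Mapping.single 0 a + mon w * theta w p"
  by (simp add: theta_def map_poly_pCons)

lemma theta_add: "theta w (p + q) = theta w p + theta w q"
  by (induction p q rule: poly_induct2) (simp_all add: theta_pCons single_add algebra_simps)

lemma theta_smult: "theta w (smult a p) = Poly_Mapping.single 0 a * theta w p"
  by (induction p) (simp_all add: theta_pCons mult_single distrib_left mult.left_commute)

lemma theta_mult: "theta w (p * q) = theta w p * theta w q"
  by (induction p) (simp_all add: theta_pCons theta_add theta_smult distrib_right mult.assoc)

lemma theta_sum: "theta w (sum f A) = (\<Sum>x\<in>A. theta w (f x))"
  by (induction A rule: infinite_finite_induct) (simp_all add: theta_add)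

lemma theta_1: "theta w 1 = 1"
  by (simp add: one_pCons theta_pCons)

lemma theta_monom: "theta w (monom c i) = Poly_Mapping.single (frag_cmul (int i) w) c"
proof (induction i)
  case (Suc i)
  then show ?case by (simp add: monom_Suc theta_pCons mult_single frag_cmul_distrib)
qed (simp add: monom_0 theta_pCons)

lemma off_shift:
  assumes "v \<in> divisors X" "\<And>\<rho>. \<rho> \<in> \<sigma> \<Longrightarrow> lk v \<rho> \<ge> 0"
  obtains x where "x \<in> off \<sigma>" "x + v \<in> exps X"
proof -
  define x where "x = dv (\<lambda>\<rho>. if \<rho> \<in> \<sigma> then 0 else \<bar>lk v \<rho>\<bar>)"
  have "x \<in> off \<sigma>" by (auto simp: off_def exps_def x_def dv_divisors lookup_dv)
  moreover have "lk (x + v) \<rho> \<ge> 0" for \<rho>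
    using assms divisors_lookup[OF assms(1)] by (auto simp: x_def lookup_dv lookup_add)
  then have "x + v \<in> exps X" using assms(1) by (simp add: exps_def divisors_add x_def dv_divisors)
  ultimately show ?thesis by (rule that)
qed

lemma theta_clear:
  fixes h :: "'k::field poly"
  assumes "w \<in> divisors X" "\<And>\<rho>. \<rho> \<in> \<sigma> \<Longrightarrow> lk w \<rho> \<ge> 0"
  obtains x where "x \<in> off \<sigma>" "mon x * theta w h \<in> cox X"
proof -
  obtain y where y: "y \<in> off \<sigma>" "y + w \<in> exps X" using off_shift[OF assms] by metis
  have "\<exists>x\<in>off \<sigma>. mon x * theta w h \<in> cox X"
  proof (induction h)
    case 0
    show ?case using y by auto
  next
    case (pCons a p)
    then obtain x where x: "x \<in> off \<sigma>" "mon x * theta w p \<in> cox X" by blast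
    have "mon (x + y) * theta w (pCons a p) = mon (x + y) * Poly_Mapping.single 0 a + mon (y + w) * (mon x * theta w p)"
      by (simp add: theta_pCons distrib_left mult.assoc[symmetric] mult_single add_ac)
    also have "\<dots> \<in> cox X"
      using y(2) x(2) off_exps[OF off_add[OF x(1) y(1)]]
      by (intro cox_add cox_mult[of "mon (x + y)"] cox_mult[of "mon (y + w)"] cox_single) auto
    finally show ?case using off_add[OF x(1) y(1)] by blast
  qed
  then show ?thesis using that by blast
qed

text \<open>On the chart of \<sigma> the curve is an affine line. The chain would give proper ideals
  \<open>pre Q\<close> strictly inside \<open>pre R\<close> of a polynomial ring in one variable
  over a field, the smaller one a nonzero prime; but nonzero primes there are maximal.\<close>

lemma no_long_chain:
  fixes Q R :: "('v, 'k::field) laurent set"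
  assumes \<sigma>: "\<sigma> \<in> max_cones X" "k \<in> \<sigma>"
    and Q: "subvariety X cl Q" and R: "subvariety X cl R"
    and sub: "mp (\<sigma> - {k}) \<subset> Q" "Q \<subset> R"
    and \<pi>: "\<pi> \<subseteq> \<sigma>" "irrelevant_gen X \<pi> \<notin> R"
  shows False
proof -
  define w where "w = wdir \<sigma> k"
  have w: "w \<in> divisors X" "\<And>\<rho>. \<rho> \<in> \<sigma> \<Longrightarrow> lk w \<rho> \<ge> 0"
    using \<sigma> by (auto simp: w_def wdir_def dv_divisors) (simp add: lookup_wdir wdir_def[symmetric])
  have monR: "(mon x :: ('v, 'k) laurent) \<notin> R" if "x \<in> off \<sigma>" for x
    using that \<pi> by (intro mon_notin_prime[OF R \<pi>(2)]) (auto simp: off_def)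
  have monJ: "(mon x :: ('v, 'k) laurent) \<notin> J" if "x \<in> off \<sigma>" "J \<in> {Q, R}" for x J
    using that monR sub(2) by blast
  have J: "subvariety X cl J" "mp (\<sigma> - {k}) \<subseteq> J" if "J \<in> {Q, R}" for J using that Q R sub by auto
  \<comment> \<open>Contraction to the polynomial ring; the monomials with exponents in
    \<open>off \<sigma>\<close> are units on the chart and serve as denominators.\<close>
  define pre where "pre J = {h. \<exists>x\<in>off \<sigma>. mon x * theta w h \<in> J}" for J :: "('v, 'k) laurent set"
  have mon_cox: "(mon x :: ('v, 'k) laurent) \<in> cox X" if "x \<in> off \<sigma>" for x
    using that by (intro cox_single off_exps)
  have pre_mult: "p * h \<in> pre J" if JQR: "J \<in> {Q, R}" and "h \<in> pre J" for J h p
  proof -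
    obtain x where x: "x \<in> off \<sigma>" "mon x * theta w h \<in> J" using \<open>h \<in> pre J\<close> by (auto simp: pre_def)
    obtain y where y: "y \<in> off \<sigma>" "mon y * theta w p \<in> cox X" using theta_clear[OF w, where h = p] by metis
    have "(mon y * theta w p) * (mon x * theta w h) \<in> J"
      by (rule submod_smult[OF subvarietyD(1)[OF J(1)[OF JQR]] y(2) x(2)])
    moreover have "(mon y * theta w p) * (mon x * theta w h) = mon (y + x) * theta w (p * h)"
      by (simp add: theta_mult mon_mult_mon[symmetric] mult_ac)
    ultimately show ?thesis using off_add[OF y(1) x(1)] by (auto simp: pre_def)
  qed
  have pre_add: "h + h' \<in> pre J" if JQR: "J \<in> {Q, R}" and "h \<in> pre J" "h' \<in> pre J" for J h h'
  proof -
    obtain x where x: "x \<in> off \<sigma>" "mon x * theta w h \<in> J" using \<open>h \<in> pre J\<close> by (auto simp: pre_def)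
    obtain y where y: "y \<in> off \<sigma>" "mon y * theta w h' \<in> J" using \<open>h' \<in> pre J\<close> by (auto simp: pre_def)
    note sm = subvarietyD(1)[OF J(1)[OF JQR]]
    have "mon y * (mon x * theta w h) + mon x * (mon y * theta w h') \<in> J"
      by (intro submod_add[OF sm] submod_smult[OF sm] mon_cox x y)
    moreover have "mon y * (mon x * theta w h) + mon x * (mon y * theta w h') = mon (x + y) * theta w (h + h')"
      by (simp add: theta_add mon_mult_mon[symmetric] distrib_left mult_ac)
    ultimately show ?thesis using off_add[OF x(1) y(1)] by (auto simp: pre_def)
  qed
  have pre_prime: "p \<in> pre Q \<or> h \<in> pre Q" if "p * h \<in> pre Q" for p h
  proof -
    from that obtain z where z: "z \<in> off \<sigma>" "mon z * theta w (p * h) \<in> Q" by (auto simp: pre_def)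
    obtain x where x: "x \<in> off \<sigma>" "mon x * theta w p \<in> cox X" using theta_clear[OF w, where h = p] by metis
    obtain y where y: "y \<in> off \<sigma>" "mon y * theta w h \<in> cox X" using theta_clear[OF w, where h = h] by metis
    have "mon (x + y) * (mon z * theta w (p * h)) \<in> Q"
      by (rule submod_smult[OF subvarietyD(1)[OF Q] mon_cox[OF off_add[OF x(1) y(1)]] z(2)])
    moreover have "mon (x + y) * (mon z * theta w (p * h)) = (mon z * (mon x * theta w p)) * (mon y * theta w h)"
      by (simp add: theta_mult mon_mult_mon[symmetric] mult_ac)
    moreover have "mon z * (mon x * theta w p) \<in> cox X" by (intro cox_mult mon_cox z x)
    ultimately have "mon z * (mon x * theta w p) \<in> Q \<or> mon y * theta w h \<in> Q"
      using subvarietyD(4)[OF Q _ y(2)] by metis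
    moreover have "mon z * (mon x * theta w p) = mon (z + x) * theta w p"
      by (simp add: mon_mult_mon[symmetric] mult.assoc)
    ultimately show ?thesis using off_add[OF z(1) x(1)] y(1) by (auto simp: pre_def)
  qed
  have one: "1 \<notin> pre R" using monR by (auto simp: pre_def theta_1)
  \<comment> \<open>Dehomogenization: modulo the ideal of the curve a homogeneous element is a
    Laurent monomial times a polynomial in the coordinate (\<open>off_wall_form\<close>), and
    membership in Q and R can be read off that polynomial.\<close>
  have dehom: "\<exists>h. (f \<in> Q \<longleftrightarrow> h \<in> pre Q) \<and> (f \<in> R \<longleftrightarrow> h \<in> pre R) \<and> (f \<notin> mp (\<sigma> - {k}) \<longrightarrow> h \<noteq> 0)"
    if f: "f \<in> cox X" "homog b f" for f b
  proof -
    define f' where "f' = rst (off (\<sigma> - {k})) f"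
    have f'c: "f' \<in> cox X" using f by (simp add: f'_def cox_rst)
    have diff: "f - f' \<in> mp (\<sigma> - {k})"
      using f by (auto simp: f'_def mp_iff cox_diff cox_rst in_keys_iff lookup_minus lookup_rst)
    obtain D where D: "D \<in> divisors X" "cl D = b" by (rule cl_surj)
    define E where "E = norm_div \<sigma> D"
    have E: "E \<in> divisors X" "\<And>\<rho>. \<rho> \<in> \<sigma> \<Longrightarrow> lk E \<rho> = 0"
      using D \<sigma> by (auto simp: E_def norm_div_divisors norm_div_zero)
    define h where "h = (\<Sum>m\<in>ks f'. monom (lk f' m) (nat (lk m k)))"
    have "mon E * theta w h = f'"
    proof -
      have "mon E * theta w h = (\<Sum>m\<in>ks f'. Poly_Mapping.single (E + frag_cmul (int (nat (lk m k))) w) (lk f' m))"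
        by (simp add: h_def theta_sum theta_monom sum_distrib_left mult_single)
      also have "\<dots> = (\<Sum>m\<in>ks f'. Poly_Mapping.single m (lk f' m))"
      proof (rule sum.cong[OF refl])
        fix m assume "m \<in> ks f'"
        then have m: "m \<in> off (\<sigma> - {k})" "cl m = b" using f(2) by (auto simp: f'_def keys_rst homog_def)
        then have "m = E + frag_cmul (lk m k) w" unfolding E_def w_def
          using D by (intro off_wall_form \<sigma>) (auto simp: off_def exps_divisors)
        moreover have "lk m k \<ge> 0" using m by (simp add: off_def exps_def)
        ultimately show "Poly_Mapping.single (E + frag_cmul (int (nat (lk m k))) w) (lk f' m) = Poly_Mapping.single m (lk f' m)"
          by simp
      qed
      finally show ?thesis by (simp flip: poly_mapping_sum_singles)
    qed
    then have fh: "mon E * theta w h = f'" .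
    obtain x where x: "x \<in> off \<sigma>" "x + E \<in> exps X" using off_shift[OF E(1), of \<sigma>] E(2) by (metis order_refl)
    have xE: "x + E \<in> off \<sigma>" using x E(2) by (auto simp: off_def lookup_add)
    have eq: "mon x * f' = mon (x + E) * theta w h"
      unfolding fh[symmetric] by (simp add: mon_mult_mon[symmetric] mult.assoc)
    have "f \<in> J \<longleftrightarrow> h \<in> pre J" if JQR: "J \<in> {Q, R}" for J
    proof -
      note sm = subvarietyD(1)[OF J(1)[OF JQR]]
      have "f \<in> J \<longleftrightarrow> f' \<in> J"
      proof
        assume "f \<in> J"
        moreover have "f - f' \<in> J" using diff J(2)[OF JQR] by blast
        ultimately have "f - (f - f') \<in> J" by (rule submod_diff[OF sm])
        then show "f' \<in> J" by simp
      next
        assume "f' \<in> J"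
        then have "f' + (f - f') \<in> J" using diff J(2)[OF JQR] by (intro submod_add[OF sm]) auto
        then show "f \<in> J" by simp
      qed
      also have "\<dots> \<longleftrightarrow> h \<in> pre J"
      proof
        assume "f' \<in> J"
        then have "mon x * f' \<in> J" by (rule submod_smult[OF sm mon_cox[OF x(1)]])
        then show "h \<in> pre J" using xE eq by (auto simp: pre_def)
      next
        assume "h \<in> pre J"
        then obtain y where y: "y \<in> off \<sigma>" "mon y * theta w h \<in> J" by (auto simp: pre_def)
        have "mon (x + E) * (mon y * theta w h) \<in> J" by (rule submod_smult[OF sm mon_cox[OF xE] y(2)])
        then have "mon y * (mon x * f') \<in> J" unfolding eq by (simp only: mult.left_commute)
        then have "mon (y + x) * f' \<in> J" by (simp add: mon_mult_mon[symmetric] mult.assoc)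
        then show "f' \<in> J"
          using subvarietyD(4)[OF J(1)[OF JQR] mon_cox f'c] monJ off_add[OF y(1) x(1)] JQR by blast
      qed
      finally show ?thesis .
    qed
    moreover have "h \<noteq> 0" if "f \<notin> mp (\<sigma> - {k})"
    proof
      assume "h = 0"
      then have "f' = 0" using fh by simp
      then show False using diff that by simp
    qed
    ultimately show ?thesis by (intro exI[of _ h]) simp
  qed
  have hom_elem: "\<exists>f b. f \<in> J \<and> homog b f \<and> f \<notin> J0" if "subvariety X cl J" "J0 \<subset> J" "submod X J0" "J0 \<subseteq> cox X" for J J0 :: "('v, 'k) laurent set"
  proof (rule ccontr)
    assume n: "\<nexists>f b. f \<in> J \<and> homog b f \<and> f \<notin> J0"
    have "(\<Union>d. degree_part cl J d) \<subseteq> J0"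
    proof
      fix f assume "f \<in> (\<Union>d. degree_part cl J d)"
      then obtain d where "f \<in> J" "\<forall>m\<in>ks f. cl m = d" by (auto simp: degree_part_def)
      moreover have "ks f \<subseteq> divisors X" using subvarietyD(2)[OF that(1)] calculation(1) cox_divisors by blast
      ultimately have "f \<in> J" "homog d f" by (auto simp: homog_def)
      then show "f \<in> J0" using n by blast
    qed
    then have "J \<subseteq> J0" using genideal_minimal_cox[OF that(3,4)] subvarietyD(6)[OF that(1)] by blast
    then show False using that(2) by blast
  qed
  obtain f b where f: "f \<in> Q" "homog b f" "f \<notin> mp (\<sigma> - {k})" using hom_elem[OF Q sub(1) mp_submod mp_cox] by blast
  obtain h1 where h1: "h1 \<in> pre Q" "h1 \<noteq> 0"
    using dehom[OF _ f(2)] f subvarietyD(2)[OF Q] by blast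
  obtain g c where g: "g \<in> R" "homog c g" "g \<notin> Q" using hom_elem[OF R sub(2) subvarietyD(1,2)[OF Q]] by blast
  obtain h2 where h2: "h2 \<in> pre R" "h2 \<notin> pre Q"
    using dehom[OF _ g(2)] g subvarietyD(2)[OF R] by blast
  have preQR: "pre Q \<subseteq> pre R" using sub(2) by (auto simp: pre_def)
  \<comment> \<open>A nonzero element of least degree, which generates \<open>pre R\<close>.\<close>
  define h0 where "h0 = arg_min degree (\<lambda>h. h \<in> pre R \<and> h \<noteq> 0)"
  have h0: "h0 \<in> pre R" "h0 \<noteq> 0" "\<And>h. h \<in> pre R \<Longrightarrow> h \<noteq> 0 \<Longrightarrow> degree h0 \<le> degree h"
    using arg_min_natI[of "\<lambda>h. h \<in> pre R \<and> h \<noteq> 0" h1 degree]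
      arg_min_nat_le[of "\<lambda>h. h \<in> pre R \<and> h \<noteq> 0" _ degree] h1 preQR by (auto simp: h0_def)
  have dvd: "h0 dvd h" if "h \<in> pre R" for h
  proof (rule ccontr)
    assume "\<not> h0 dvd h"
    then have nz: "h mod h0 \<noteq> 0" by (simp add: dvd_eq_mod_eq_0)
    have "h + (- (h div h0)) * h0 \<in> pre R" by (intro pre_add pre_mult that h0(1)) auto
    moreover have "h + (- (h div h0)) * h0 = h mod h0" by (simp add: minus_div_mult_eq_mod[symmetric])
    ultimately have "degree h0 \<le> degree (h mod h0)" using h0(3) nz by simp
    then show False using degree_mod_less[OF h0(2), of h] nz by simp
  qed
  have deg0: "degree h0 > 0"
  proof (rule ccontr)
    assume "\<not> degree h0 > 0"
    then have "is_unit h0" using h0(2) by (simp add: is_unit_iff_degree)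
    then obtain p where "1 = p * h0" by (metis dvdE mult.commute)
    then have "1 \<in> pre R" using pre_mult[of R h0 p] h0(1) by simp
    then show False using one by simp
  qed
  \<comment> \<open>Here h3 = h0 * q with q of smaller degree, so minimality of h3 keeps q out of
    \<open>pre Q\<close>. Primality then puts h0 into \<open>pre Q\<close>, and \<open>pre R\<close>
    collapses into it.\<close>
  define h3 where "h3 = arg_min degree (\<lambda>h. h \<in> pre Q \<and> h \<noteq> 0)"
  have h3: "h3 \<in> pre Q" "h3 \<noteq> 0" "\<And>h. h \<in> pre Q \<Longrightarrow> h \<noteq> 0 \<Longrightarrow> degree h3 \<le> degree h"
    using arg_min_natI[of "\<lambda>h. h \<in> pre Q \<and> h \<noteq> 0" h1 degree]
      arg_min_nat_le[of "\<lambda>h. h \<in> pre Q \<and> h \<noteq> 0" _ degree] h1 by (auto simp: h3_def)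
  obtain q where q: "h3 = h0 * q" using dvd h3(1) preQR by blast
  have "q \<notin> pre Q"
  proof
    assume "q \<in> pre Q"
    moreover have "q \<noteq> 0" using q h3(2) by auto
    ultimately show False using h3(3)[of q] deg0 h0(2) by (simp add: q degree_mult_eq)
  qed
  then have "h0 \<in> pre Q" using pre_prime[of h0 q] h3(1) q by blast
  moreover obtain p where "h2 = p * h0" using dvd[OF h2(1)] by (metis dvdE mult.commute)
  ultimately show False using pre_mult[of Q h0 p] h2(2) by simp
qed

text \<open>A further ray of \<pi> would lie beyond the wall as seen from each of the two adjacent
  cones (\<open>wall_side\<close>), but their normals at the wall are opposite. By maximality k and
  k' do not occur together.\<close>

lemma wall_star:
  assumes adj: "adjacent \<sigma> k k'" and \<pi>: "\<pi> \<in> cones X" "\<sigma> - {k} \<subseteq> \<pi>"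
  shows "\<pi> \<subseteq> \<sigma> \<or> \<pi> \<subseteq> insert k' (\<sigma> - {k})"
proof -
  let ?s = "insert k' (\<sigma> - {k})"
  have \<sigma>: "\<sigma> \<in> max_cones X" "k \<in> \<sigma>" "k' \<notin> \<sigma>" "?s \<in> max_cones X" using adj by (auto simp: adjacent_def)
  have s': "?s - {k'} = \<sigma> - {k}" using \<sigma> by auto
  have mem: "\<rho> \<in> insert k \<sigma> \<union> ?s" if \<rho>: "\<rho> \<in> \<pi>" for \<rho>
  proof (rule ccontr)
    assume n: "\<rho> \<notin> insert k \<sigma> \<union> ?s"
    have c: "insert \<rho> (\<sigma> - {k}) \<in> cones X" using \<rho> \<pi> by (intro cone_face[OF \<pi>(1)]) auto
    have r: "\<rho> \<in> rays X" using cone_rays[OF \<pi>(1)] \<rho> by blast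
    have "pr (dc \<sigma> k) \<rho> < 0" using n c by (intro wall_side[OF \<sigma>(1,2)]) auto
    moreover have "pr (dc ?s k') \<rho> < 0" using n c s' by (intro wall_side[OF \<sigma>(4)]) auto
    ultimately show False using adjacent_sym_dual[OF adj r] by simp
  qed
  have not_both: "\<not> (k \<in> \<pi> \<and> k' \<in> \<pi>)"
  proof
    assume "k \<in> \<pi> \<and> k' \<in> \<pi>"
    then have "\<sigma> \<subset> \<pi>" using \<pi>(2) \<sigma> by blast
    then show False using \<sigma>(1) \<pi>(1) by (auto simp: max_cones_def)
  qed
  show ?thesis
  proof (cases "k' \<in> \<pi>")
    case True
    then have "\<rho> \<in> ?s" if "\<rho> \<in> \<pi>" for \<rho> using mem[OF that] not_both that by auto
    then show ?thesis by (intro disjI2 subsetI)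
  next
    case False
    then have "\<rho> \<in> \<sigma>" if "\<rho> \<in> \<pi>" for \<rho> using mem[OF that] \<sigma>(2) that by auto
    then show ?thesis by (intro disjI1 subsetI)
  qed
qed

text \<open>The largest prime R of a chain omits the generator of some cone \<pi>, and \<pi>
  contains the wall because the variables of the wall lie in R. By \<open>wall_star\<close> the
  chain is visible on one of two charts, where \<open>no_long_chain\<close> excludes it.\<close>

lemma wall_curve:
  assumes adj: "adjacent \<sigma> k k'"
  shows "curve X cl (mp (\<sigma> - {k}) :: ('v, 'k::field) laurent set)"
  unfolding curve_def
proof (intro conjI)
  have \<sigma>: "\<sigma> \<in> max_cones X" "k \<in> \<sigma>" "k' \<notin> \<sigma>" "insert k' (\<sigma> - {k}) \<in> max_cones X"
    using adj by (auto simp: adjacent_def)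
  have c: "\<sigma> \<in> cones X" "\<sigma> - {k} \<in> cones X" using \<sigma> max_cone_cone cone_face by blast+
  show "subvariety X cl (mp (\<sigma> - {k}) :: ('v, 'k) laurent set)" by (rule mp_subvariety[OF c(2)])
  have x: "(mon (Poly_Mapping.single \<rho> 1) :: ('v, 'k) laurent) \<in> mp \<pi> \<longleftrightarrow> \<rho> \<in> \<pi>" if "\<rho> \<in> rays X" for \<rho> \<pi>
    using single_exps[OF that] by (auto simp: mp_def cox_iff lookup_single when_def)
  have "mp (\<sigma> - {k}) \<subseteq> (mp \<sigma> :: ('v, 'k) laurent set)" by (auto simp: mp_def)
  moreover have "(mp (\<sigma> - {k}) :: ('v, 'k) laurent set) \<noteq> mp \<sigma>"
    using x[of k \<sigma>] x[of k "\<sigma> - {k}"] cone_rays[OF c(1)] \<sigma>(2) by blast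
  ultimately show "\<exists>Q. subvariety X cl Q \<and> (mp (\<sigma> - {k}) :: ('v, 'k) laurent set) \<subset> Q"
    using mp_subvariety[OF c(1)] by blast
  show "\<nexists>Q R. subvariety X cl Q \<and> subvariety X cl R \<and> (mp (\<sigma> - {k}) :: ('v, 'k) laurent set) \<subset> Q \<and> Q \<subset> R"
  proof
    assume "\<exists>Q R. subvariety X cl Q \<and> subvariety X cl R \<and> (mp (\<sigma> - {k}) :: ('v, 'k) laurent set) \<subset> Q \<and> Q \<subset> R"
    then obtain Q R :: "('v, 'k) laurent set" where Q: "subvariety X cl Q" and R: "subvariety X cl R"
      and sub: "mp (\<sigma> - {k}) \<subset> Q" "Q \<subset> R" by blast
    obtain \<pi> where \<pi>: "\<pi> \<in> cones X" "irrelevant_gen X \<pi> \<notin> R" using subvarietyD(5)[OF R] by blast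
    have "\<rho> \<in> \<pi>" if \<rho>: "\<rho> \<in> \<sigma> - {k}" for \<rho>
    proof (rule ccontr)
      assume n: "\<rho> \<notin> \<pi>"
      have r: "\<rho> \<in> rays X" using \<rho> cone_rays[OF c(1)] by blast
      have "(mon (Poly_Mapping.single \<rho> 1) :: ('v, 'k) laurent) \<notin> R"
        using n by (intro mon_notin_prime[OF R \<pi>(2) single_exps[OF r]]) (auto simp: lookup_single when_def)
      then show False using x[OF r, of "\<sigma> - {k}"] \<rho> sub by blast
    qed
    then have "\<pi> \<subseteq> \<sigma> \<or> \<pi> \<subseteq> insert k' (\<sigma> - {k})" by (intro wall_star[OF adj \<pi>(1)]) blast
    moreover have "insert k' (\<sigma> - {k}) - {k'} = \<sigma> - {k}" using \<sigma> by auto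
    ultimately show False
      using no_long_chain[OF \<sigma>(1,2) Q R sub _ \<pi>(2)] no_long_chain[OF \<sigma>(4) _ Q R _ sub(2) _ \<pi>(2), of k'] sub(1)
      by auto
  qed
qed

lemma Nef_bpf:
  assumes "d \<in> Nef TYPE('k::field) X cl" shows "bpf d"
proof -
  obtain D where D: "D \<in> divisors X" "cl D = d" by (rule cl_surj)
  have "lk (norm_div \<sigma> D) k' \<ge> 0" if adj: "adjacent \<sigma> k k'" for \<sigma> k k'
    using assms wall_curve[OF adj, where 'k = 'k] wall_intersection_number[OF adj D(1), where 'k = 'k] D(2)
    unfolding Nef_def by blast
  then show ?thesis using wall_nef_bpf[OF D(1)] D(2) by blast
qed

lemma Nef_iff_bpf: "d \<in> Nef TYPE('k::field) X cl \<longleftrightarrow> bpf d"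
  using Nef_bpf bpf_Nef by blast

end

section \<open>Finite generation by leading monomials\<close>

text \<open>Beyond any index there is one whose value is minimal among all later ones; iterating
  this choice gives a nondecreasing subsequence.\<close>

lemma nat_incseq_subseq:
  fixes f :: "nat \<Rightarrow> nat"
  shows "\<exists>r :: nat \<Rightarrow> nat. strict_mono r \<and> (\<forall>i j. i \<le> j \<longrightarrow> f (r i) \<le> f (r j))"
proof -
  define m where "m k = (ARG_MIN f i. i \<ge> k)" for k
  have m: "m k \<ge> k" "\<And>i. i \<ge> k \<Longrightarrow> f (m k) \<le> f i" for k
    using arg_min_natI[of "\<lambda>i. i \<ge> k" k f] arg_min_nat_le[of "\<lambda>i. i \<ge> k" _ f]
    by (auto simp: m_def)
  define r where "r = rec_nat (m 0) (\<lambda>_ x. m (Suc x))"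
  have r0: "r 0 = m 0" and rS: "r (Suc i) = m (Suc (r i))" for i by (simp_all add: r_def)
  have lt: "r i < r (Suc i)" for i using m(1)[of "Suc (r i)"] by (simp add: rS)
  have min: "\<exists>k. r i = m k" for i by (cases i) (auto simp: r0 rS)
  have "f (r i) \<le> f (r (Suc i))" for i
  proof -
    obtain k where k: "r i = m k" using min by blast
    then have "k \<le> r (Suc i)" using m(1)[of k] lt[of i] by simp
    then show ?thesis using m(2)[of k] k by simp
  qed
  then have "f (r i) \<le> f (r j)" if "i \<le> j" for i j by (rule lift_Suc_mono_le) (rule that)
  then show ?thesis using lt by (intro exI[of _ r]) (auto simp: strict_mono_Suc_iff)
qed

lemma dickson:
  fixes s :: "nat \<Rightarrow> nat \<Rightarrow> nat"
  shows "\<exists>r :: nat \<Rightarrow> nat. strict_mono r \<and> (\<forall>l<K. \<forall>i j. i \<le> j \<longrightarrow> s (r i) l \<le> s (r j) l)"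
proof (induction K)
  case 0
  show ?case by (rule exI[of _ "\<lambda>i. i"]) (simp add: strict_mono_def)
next
  case (Suc K)
  then obtain r :: "nat \<Rightarrow> nat" where r: "strict_mono r" "\<And>l i j. l < K \<Longrightarrow> i \<le> j \<Longrightarrow> s (r i) l \<le> s (r j) l" by blast
  obtain r' :: "nat \<Rightarrow> nat" where r': "strict_mono r'" "\<And>i j. i \<le> j \<Longrightarrow> s (r (r' i)) K \<le> s (r (r' j)) K"
    using nat_incseq_subseq[of "\<lambda>i. s (r i) K"] by blast
  have "strict_mono (\<lambda>i. r (r' i))" using r(1) r'(1) by (simp add: strict_mono_def)
  moreover have "s (r (r' i)) l \<le> s (r (r' j)) l" if "l < Suc K" "i \<le> j" for l i j
    using that r(2)[of l "r' i" "r' j"] r'(2) strict_mono_less_eq[OF r'(1)]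
    by (cases "l = K") auto
  ultimately show ?case by blast
qed

definition lexlt :: "('e \<Rightarrow> nat \<Rightarrow> nat) \<Rightarrow> nat \<Rightarrow> 'e \<Rightarrow> 'e \<Rightarrow> bool" where
  "lexlt enc K x y \<longleftrightarrow> (\<exists>i<K. enc x i < enc y i \<and> (\<forall>j<i. enc x j = enc y j))"

lemma lexlt_total:
  assumes "\<exists>i<K. enc x i \<noteq> enc y i" shows "lexlt enc K x y \<or> lexlt enc K y x"
proof -
  define i where "i = (LEAST i. enc x i \<noteq> enc y i)"
  obtain i0 where i0: "i0 < K" "enc x i0 \<noteq> enc y i0" using assms by blast
  have "enc x i \<noteq> enc y i" unfolding i_def by (rule LeastI[of _ i0]) (rule i0)
  moreover have "i < K" using Least_le[of "\<lambda>i. enc x i \<noteq> enc y i" i0] i0 by (simp add: i_def)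
  moreover have "\<forall>j<i. enc x j = enc y j" using not_less_Least unfolding i_def by blast
  ultimately show ?thesis unfolding lexlt_def by (metis linorder_neqE_nat)
qed

text \<open>Among the elements that agree with a minimal one in the first K coordinates, one
  minimizes the next coordinate.\<close>

lemma lexlt_minimal: "Q \<noteq> {} \<Longrightarrow> \<exists>z\<in>Q. \<forall>y\<in>Q. \<not> lexlt enc K y z"
proof (induction K)
  case 0
  then show ?case by (auto simp: lexlt_def)
next
  case (Suc K)
  then obtain z where z: "z \<in> Q" "\<And>y. y \<in> Q \<Longrightarrow> \<not> lexlt enc K y z" by blast
  define Q' where "Q' = {x \<in> Q. \<forall>i<K. enc x i = enc z i}"
  define w where "w = arg_min (\<lambda>x. enc x K) (\<lambda>x. x \<in> Q')"
  have "z \<in> Q'" using z by (simp add: Q'_def)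
  then have w: "w \<in> Q'" "\<And>y. y \<in> Q' \<Longrightarrow> enc w K \<le> enc y K"
    unfolding w_def by (auto intro: arg_min_natI arg_min_nat_le)
  have "\<not> lexlt enc (Suc K) y w" if y: "y \<in> Q" for y
  proof
    assume "lexlt enc (Suc K) y w"
    then obtain i where i: "i < Suc K" "enc y i < enc w i" "\<forall>j<i. enc y j = enc w j"
      unfolding lexlt_def by blast
    show False
    proof (cases "i = K")
      case True
      then have "y \<in> Q'" using i y w(1) by (simp add: Q'_def)
      then show False using w(2) i True by fastforce
    next
      case False
      then have "lexlt enc K y z" unfolding lexlt_def using i w(1) by (intro exI[of _ i]) (simp add: Q'_def)
      then show False using z y by blast
    qed
  qed
  then show ?case using w(1) by (auto simp: Q'_def)
qed

definition leading :: "('e \<Rightarrow> 'e \<Rightarrow> bool) \<Rightarrow> ('e \<Rightarrow> 'k::zero) \<Rightarrow> 'e \<Rightarrow> bool" where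
  "leading lt v e \<longleftrightarrow> v e \<noteq> 0 \<and> (\<forall>e'. v e' \<noteq> 0 \<longrightarrow> e' \<noteq> e \<longrightarrow> lt e' e)"

text \<open>Groebner bases in the abstract: elements are coefficient functions on a set E of terms,
  and monomials act by \<open>act\<close> on terms and by \<open>sh\<close> on elements. Dickson's
  property \<open>wqo\<close> makes finitely many leading terms suffice, and reduction ends by
  \<open>min\<close>. Generation is expressed by closed sets Q, which avoids fixing a form of linear
  combinations.\<close>

theorem monomial_module_finitely_generated:
  fixes E :: "'e set" and lt :: "'e \<Rightarrow> 'e \<Rightarrow> bool" and act :: "'m \<Rightarrow> 'e \<Rightarrow> 'e"
    and N :: "('e \<Rightarrow> 'k::field) set" and sh :: "'m \<Rightarrow> ('e \<Rightarrow> 'k) \<Rightarrow> 'e \<Rightarrow> 'k"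
  assumes min: "\<And>Q. Q \<noteq> {} \<Longrightarrow> \<exists>z\<in>Q. \<forall>y\<in>Q. \<not> lt y z"
    and trans: "\<And>x y z. lt x y \<Longrightarrow> lt y z \<Longrightarrow> lt x z"
    and total: "\<And>x y. x \<in> E \<Longrightarrow> y \<in> E \<Longrightarrow> x \<noteq> y \<Longrightarrow> lt x y \<or> lt y x"
    and mono: "\<And>m x y. m \<in> Mn \<Longrightarrow> lt x y \<Longrightarrow> lt (act m x) (act m y)"
    and wqo: "\<And>s. (\<And>i. s i \<in> E) \<Longrightarrow> \<exists>(i::nat) j m. i < j \<and> m \<in> Mn \<and> s j = act m (s i)"
    and supp: "\<And>v e. v \<in> N \<Longrightarrow> v e \<noteq> 0 \<Longrightarrow> e \<in> E" "\<And>v. v \<in> N \<Longrightarrow> finite {e. v e \<noteq> 0}"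
    and N: "\<And>v w. v \<in> N \<Longrightarrow> w \<in> N \<Longrightarrow> (\<lambda>e. v e + w e) \<in> N"
      "\<And>c v. v \<in> N \<Longrightarrow> (\<lambda>e. c * v e) \<in> N" "\<And>m v. m \<in> Mn \<Longrightarrow> v \<in> N \<Longrightarrow> sh m v \<in> N"
    and sh: "\<And>m v e. m \<in> Mn \<Longrightarrow> v \<in> N \<Longrightarrow> e \<in> E \<Longrightarrow> sh m v (act m e) = v e"
      "\<And>m v e. m \<in> Mn \<Longrightarrow> v \<in> N \<Longrightarrow> sh m v e \<noteq> 0 \<Longrightarrow> e \<in> act m ` E"
  shows "\<exists>G. finite G \<and> G \<subseteq> N \<and> (\<forall>Q. (\<lambda>_. 0) \<in> Q \<longrightarrow> (\<forall>v\<in>Q. \<forall>w\<in>Q. (\<lambda>e. v e + w e) \<in> Q) \<longrightarrow>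
     (\<forall>c. \<forall>m\<in>Mn. \<forall>g\<in>G. (\<lambda>e. c * sh m g e) \<in> Q) \<longrightarrow> N \<subseteq> Q)"
proof -
  have irr: "\<not> lt x x" for x using min[of "{x}"] by simp
  have ex_lead: "\<exists>e. leading lt v e" if v: "v \<in> N" "v \<noteq> (\<lambda>_. 0)" for v
  proof -
    have "\<exists>e\<in>A. \<forall>e'\<in>A. e' \<noteq> e \<longrightarrow> lt e' e" if "finite A" "A \<noteq> {}" "A \<subseteq> E" for A
      using that
    proof (induction A rule: finite_ne_induct)
      case (insert x F)
      then obtain e where e: "e \<in> F" "\<forall>e'\<in>F. e' \<noteq> e \<longrightarrow> lt e' e" by blast
      have "x \<in> E" "e \<in> E" "x \<noteq> e" using insert e by auto
      then consider "lt x e" | "lt e x" using total by blast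
      then show ?case
      proof cases
        case 1
        then show ?thesis using e by auto
      next
        case 2
        then show ?thesis using e trans by (intro bexI[of _ x]) auto
      qed
    qed simp
    from this[of "{e. v e \<noteq> 0}"] supp v show ?thesis
      unfolding leading_def by (auto simp: fun_eq_iff subset_iff)
  qed
  have uniq: "e = e'" if "leading lt v e" "leading lt v e'" for v :: "'e \<Rightarrow> 'k" and e e'
  proof (rule ccontr)
    assume "e \<noteq> e'"
    then have "lt e e'" "lt e' e" using that unfolding leading_def by auto
    then have "lt e e" by (rule trans)
    then show False using irr by blast
  qed
  define N0 where "N0 = N - {\<lambda>_. 0}"
  define dvd_by where "dvd_by G v \<longleftrightarrow> (\<exists>g\<in>G. \<exists>m\<in>Mn. \<exists>e. leading lt g e \<and> leading lt v (act m e))"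
    for G :: "('e \<Rightarrow> 'k) set" and v :: "'e \<Rightarrow> 'k"
  have "\<exists>G. finite G \<and> G \<subseteq> N \<and> (\<forall>v\<in>N0. dvd_by G v)"
  proof (rule ccontr)
    assume neg: "\<nexists>G. finite G \<and> G \<subseteq> N \<and> (\<forall>v\<in>N0. dvd_by G v)"
    \<comment> \<open>Otherwise there is a sequence of elements, none with a leading term divisible
      by that of an earlier one, against \<open>wqo\<close>.\<close>
    define bad where "bad G v \<longleftrightarrow> v \<in> N0 \<and> \<not> dvd_by G v" for G v
    have bad: "\<exists>v. bad G v" if "finite G" "G \<subseteq> N" for G
      using neg that unfolding bad_def by blast
    have bad_N: "v \<in> N" if "bad G v" for G v using that by (simp add: bad_def N0_def)
    have "\<exists>f. \<forall>n. (finite (fst (f n)) \<and> fst (f n) \<subseteq> N \<and> bad (fst (f n)) (snd (f n))) \<and>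
        fst (f (Suc n)) = insert (snd (f n)) (fst (f n))"
    proof (rule dependent_nat_choice)
      show "\<exists>x. finite (fst x) \<and> fst x \<subseteq> N \<and> bad (fst x) (snd x)" using bad[of "{}"] by auto
      fix x :: "('e \<Rightarrow> 'k) set \<times> ('e \<Rightarrow> 'k)"
      assume x: "finite (fst x) \<and> fst x \<subseteq> N \<and> bad (fst x) (snd x)"
      then have "\<exists>v. bad (insert (snd x) (fst x)) v" by (intro bad) (auto dest: bad_N)
      then obtain v where "bad (insert (snd x) (fst x)) v" ..
      then show "\<exists>y. (finite (fst y) \<and> fst y \<subseteq> N \<and> bad (fst y) (snd y)) \<and> fst y = insert (snd x) (fst x)"
        using x by (intro exI[of _ "(insert (snd x) (fst x), v)"]) (auto dest: bad_N)
    qed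
    then obtain f where f: "\<And>n. bad (fst (f n)) (snd (f n))"
      "\<And>n. fst (f (Suc n)) = insert (snd (f n)) (fst (f n))" by blast
    have mem: "snd (f i) \<in> fst (f j)" if "i < j" for i j
      using that by (induction j) (auto simp: f(2) less_Suc_eq)
    have "\<exists>e. leading lt (snd (f n)) e" for n using f(1)[of n] ex_lead by (auto simp: bad_def N0_def)
    then obtain s where s: "\<And>n. leading lt (snd (f n)) (s n)" by metis
    have "s n \<in> E" for n using s[of n] supp(1)[OF bad_N[OF f(1)]] unfolding leading_def by blast
    then obtain i j m where ijm: "i < j" "m \<in> Mn" "s j = act m (s i)" using wqo by blast
    then have "dvd_by (fst (f j)) (snd (f j))"
      unfolding dvd_by_def using mem[OF ijm(1)] s[of i] s[of j] by metis
    then show False using f(1)[of j] unfolding bad_def by blast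
  qed
  then obtain G where G: "finite G" "G \<subseteq> N" "\<And>v. v \<in> N0 \<Longrightarrow> dvd_by G v" by blast
  have "N \<subseteq> Q" if Q: "(\<lambda>_. 0) \<in> Q" "\<forall>v\<in>Q. \<forall>w\<in>Q. (\<lambda>e. v e + w e) \<in> Q"
      "\<forall>c. \<forall>m\<in>Mn. \<forall>g\<in>G. (\<lambda>e. c * sh m g e) \<in> Q" for Q
  proof (rule ccontr)
    assume "\<not> N \<subseteq> Q"
    then obtain v0 where v0: "v0 \<in> N" "v0 \<notin> Q" by blast
    then obtain e0 where "leading lt v0 e0" using ex_lead Q(1) by blast
    then have "{e. \<exists>v\<in>N - Q. leading lt v e} \<noteq> {}" using v0 by blast
    from min[OF this] obtain e v where v: "v \<in> N" "v \<notin> Q" "leading lt v e"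
      and least: "\<And>y w. w \<in> N \<Longrightarrow> w \<notin> Q \<Longrightarrow> leading lt w y \<Longrightarrow> \<not> lt y e" by blast
    have "v \<in> N0" using v Q(1) by (auto simp: N0_def)
    then obtain g m e1 where g: "g \<in> G" "m \<in> Mn" "leading lt g e1" "leading lt v (act m e1)"
      using G(3) unfolding dvd_by_def by blast
    have gN: "g \<in> N" using g G by blast
    have e: "e = act m e1" using uniq v(3) g(4) by blast
    have e1: "e1 \<in> E" "g e1 \<noteq> 0" using supp(1)[OF gN] g(3) by (auto simp: leading_def)
    have lead: "sh m g e = g e1" unfolding e by (rule sh(1)[OF g(2) gN e1(1)])
    have below: "lt e' e" if "sh m g e' \<noteq> 0" "e' \<noteq> e" for e'
    proof -
      from sh(2)[OF g(2) gN that(1)] obtain x where x: "e' = act m x" "x \<in> E" by blast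
      then have "g x \<noteq> 0" "x \<noteq> e1" using sh(1)[OF g(2) gN x(2)] that e by auto
      then have "lt x e1" using g(3) by (simp add: leading_def)
      then show ?thesis using mono[OF g(2)] x e by blast
    qed
    define c where "c = v e / g e1"
    \<comment> \<open>Subtracting a multiple of the shifted g cancels the leading term of v, so v'
      is zero or has a smaller leading term; in both cases it lies in Q, by minimality of e.\<close>
    define v' where "v' = (\<lambda>x. v x + (- c) * sh m g x)"
    have v'N: "v' \<in> N" unfolding v'_def by (intro N v gN g)
    have v'e: "v' e = 0" using e1 by (simp add: v'_def lead c_def)
    have "v' \<in> Q"
    proof (rule ccontr)
      assume nQ: "v' \<notin> Q"
      then have "v' \<noteq> (\<lambda>_. 0)" using Q(1) by auto
      then obtain y where y: "leading lt v' y" using ex_lead v'N by blast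
      then have "v' y \<noteq> 0" "y \<noteq> e" using v'e by (auto simp: leading_def)
      then have "v y \<noteq> 0 \<or> sh m g y \<noteq> 0" by (auto simp: v'_def)
      then have "lt y e" using v(3) below \<open>y \<noteq> e\<close> by (auto simp: leading_def)
      then show False using least[OF v'N nQ y] by blast
    qed
    moreover have "(\<lambda>x. c * sh m g x) \<in> Q" using Q(3) g by blast
    ultimately have "(\<lambda>x. v' x + c * sh m g x) \<in> Q"
      using Q(2)[rule_format, of v' "\<lambda>x. c * sh m g x"] by simp
    moreover have "(\<lambda>x. v' x + c * sh m g x) = v" by (simp add: v'_def)
    ultimately show False using v(2) by simp
  qed
  then show ?thesis using G(1,2) by (intro exI[of _ G]) blast
qed

section \<open>Modules over the Rees presentation\<close>

text \<open>Elements of a free module over \<open>S[T\<^sub>0, \<dots>, T\<^sub>t\<^sub>-\<^sub>1]\<close> are functions from labels to the Cox ring \<open>S\<close>: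
  the label \<open>(\<alpha>, j)\<close> stands for the monomial \<open>T\<^sup>\<alpha>\<close> times the \<open>j\<close>-th basis element.\<close>

type_synonym label = "nat multiset \<times> nat"

definition tlab :: "nat \<Rightarrow> nat \<Rightarrow> label set" where
  "tlab t r = {(\<alpha>, j). set_mset \<alpha> \<subseteq> {..<t} \<and> j < r}"

text \<open>Multiplication by the monomial in the variables T with exponent multiset
  \<beta>.\<close>

definition tsh :: "nat multiset \<Rightarrow> (label \<Rightarrow> 'a::zero) \<Rightarrow> label \<Rightarrow> 'a" where
  "tsh \<beta> v l = (if \<beta> \<subseteq># fst l then v (fst l - \<beta>, snd l) else 0)"

lemma tsh_shift: "tsh \<beta> v (\<alpha> + \<beta>, j) = v (\<alpha>, j)"
  by (simp add: tsh_def)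

lemma tsh_tsh: "tsh \<beta> (tsh \<gamma> v) = tsh (\<beta> + \<gamma>) v"
proof
  fix l :: label
  show "tsh \<beta> (tsh \<gamma> v) l = tsh (\<beta> + \<gamma>) v l"
  proof (cases "\<beta> \<subseteq># fst l")
    case True
    then show ?thesis by (simp add: tsh_def subset_mset.le_diff_conv2 add.commute)
  next
    case False
    then have "\<not> \<beta> + \<gamma> \<subseteq># fst l" by (meson mset_subset_eq_add_left subset_mset.order_trans)
    then show ?thesis using False by (simp add: tsh_def)
  qed
qed

lemma lexlt_trans: "lexlt enc K x y \<Longrightarrow> lexlt enc K y z \<Longrightarrow> lexlt enc K x z"
proof -
  assume "lexlt enc K x y" "lexlt enc K y z"
  then obtain i j where i: "i < K" "enc x i < enc y i" "\<forall>k<i. enc x k = enc y k"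
    and j: "j < K" "enc y j < enc z j" "\<forall>k<j. enc y k = enc z k" unfolding lexlt_def by blast
  consider "i < j" | "i = j" | "j < i" by linarith
  then show ?thesis
  proof cases
    case 1
    then show ?thesis unfolding lexlt_def using i j by (intro exI[of _ i]) auto
  next
    case 2
    then show ?thesis unfolding lexlt_def using i j by (intro exI[of _ i]) auto
  next
    case 3
    then show ?thesis unfolding lexlt_def using i j by (intro exI[of _ j]) auto
  qed
qed

context toric_fan
begin

definition tmod :: "nat \<Rightarrow> nat \<Rightarrow> (label \<Rightarrow> ('v, 'k::field) laurent) set \<Rightarrow> bool" where
  "tmod t r N \<longleftrightarrow> (\<forall>v\<in>N. finite {l. v l \<noteq> 0} \<and> (\<forall>l. v l \<in> cox X) \<and> {l. v l \<noteq> 0} \<subseteq> tlab t r) \<and>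
     (\<lambda>_. 0) \<in> N \<and> (\<forall>v\<in>N. \<forall>w\<in>N. (\<lambda>l. v l + w l) \<in> N) \<and> (\<forall>s\<in>cox X. \<forall>v\<in>N. (\<lambda>l. s * v l) \<in> N) \<and>
     (\<forall>\<beta>. set_mset \<beta> \<subseteq> {..<t} \<longrightarrow> (\<forall>v\<in>N. tsh \<beta> v \<in> N))"

lemma tmodD:
  assumes "tmod t r N"
  shows "v \<in> N \<Longrightarrow> finite {l. v l \<noteq> 0}" "v \<in> N \<Longrightarrow> v l \<in> cox X" "v \<in> N \<Longrightarrow> v l \<noteq> 0 \<Longrightarrow> l \<in> tlab t r"
    "(\<lambda>_. 0) \<in> N" "v \<in> N \<Longrightarrow> w \<in> N \<Longrightarrow> (\<lambda>l. v l + w l) \<in> N"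
    "s \<in> cox X \<Longrightarrow> v \<in> N \<Longrightarrow> (\<lambda>l. s * v l) \<in> N"
    "set_mset \<beta> \<subseteq> {..<t} \<Longrightarrow> v \<in> N \<Longrightarrow> tsh \<beta> v \<in> N"
  using assms unfolding tmod_def by (blast, blast, blast, blast, blast, blast, blast)

text \<open>Noetherianity: \<open>fl\<close> spreads a vector of Laurent polynomials into one
  coefficient function on pairs of label and exponent, to which the leading-term theorem
  applies.\<close>

lemma tmod_finitely_generated:
  fixes N :: "(label \<Rightarrow> ('v, 'k::field) laurent) set"
  assumes N: "tmod t r N"
  shows "\<exists>G. finite G \<and> G \<subseteq> N \<and> (\<forall>Q. (\<lambda>_. 0) \<in> Q \<longrightarrow> (\<forall>v\<in>Q. \<forall>w\<in>Q. (\<lambda>l. v l + w l) \<in> Q) \<longrightarrow>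
    (\<forall>s \<beta> g. s \<in> cox X \<longrightarrow> set_mset \<beta> \<subseteq> {..<t} \<longrightarrow> g \<in> G \<longrightarrow> (\<lambda>l. s * tsh \<beta> g l) \<in> Q) \<longrightarrow> N \<subseteq> Q)"
proof -
  note ND = tmodD[OF N]
  obtain rs where rs: "set rs = rays X" "distinct rs" using finite_distinct_list[OF finite_rays] by blast
  define R where "R = length rs"
  define fl :: "(label \<Rightarrow> ('v, 'k) laurent) \<Rightarrow> label \<times> ('v \<Rightarrow>\<^sub>0 int) \<Rightarrow> 'k" where
    "fl v = (\<lambda>(l, u). lk (v l) u)" for v
  define E where "E = tlab t r \<times> exps X"
  define Mn where "Mn = {\<beta>::nat multiset. set_mset \<beta> \<subseteq> {..<t}} \<times> exps X"
  define act :: "nat multiset \<times> ('v \<Rightarrow>\<^sub>0 int) \<Rightarrow> label \<times> ('v \<Rightarrow>\<^sub>0 int) \<Rightarrow> label \<times> ('v \<Rightarrow>\<^sub>0 int)" where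
    "act m e = ((fst (fst e) + fst m, snd (fst e)), snd e + snd m)" for m e
  define sh :: "nat multiset \<times> ('v \<Rightarrow>\<^sub>0 int) \<Rightarrow> (label \<times> ('v \<Rightarrow>\<^sub>0 int) \<Rightarrow> 'k) \<Rightarrow> label \<times> ('v \<Rightarrow>\<^sub>0 int) \<Rightarrow> 'k" where
    "sh m x e = (if fst m \<subseteq># fst (fst e) then x ((fst (fst e) - fst m, snd (fst e)), snd e - snd m) else 0)" for m x e
  \<comment> \<open>Coordinates for the term order: exponents of T, then exponents of the rays, and
    last the basis index, which is compared but never changed by a monomial.\<close>
  define enc :: "label \<times> ('v \<Rightarrow>\<^sub>0 int) \<Rightarrow> nat \<Rightarrow> nat" where
    "enc e i = (if i < t then count (fst (fst e)) i else if i < t + R then nat (lk (snd e) (rs ! (i - t)))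
       else snd (fst e))" for e i
  define K where "K = Suc (t + R)"
  define lt where "lt x y \<longleftrightarrow> x \<in> E \<and> y \<in> E \<and> lexlt enc K x y" for x y
  have enc_lt: "enc e i = count (fst (fst e)) i" if "i < t" for e i using that by (simp add: enc_def)
  have enc_ray: "enc e (t + i) = nat (lk (snd e) (rs ! i))" if "i < R" for e i using that by (simp add: enc_def)
  have enc_last: "enc e (t + R) = snd (fst e)" for e by (simp add: enc_def)
  have E: "set_mset (fst (fst e)) \<subseteq> {..<t}" "snd (fst e) < r" "snd e \<in> exps X" if "e \<in> E" for e
    using that by (auto simp: E_def tlab_def)
  have lk0: "lk w \<rho> \<ge> 0" if "w \<in> exps X" for w \<rho> using that by (simp add: exps_def)
  have mset_le: "\<alpha> \<subseteq># \<beta>" if "set_mset \<alpha> \<subseteq> {..<t}" "\<And>i. i < t \<Longrightarrow> count \<alpha> i \<le> count \<beta> i" for \<alpha> \<beta> :: "nat multiset"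
    unfolding subseteq_mset_def
  proof
    fix i show "count \<alpha> i \<le> count \<beta> i"
    proof (cases "i < t")
      case False
      then have "i \<notin># \<alpha>" using that(1) by auto
      then show ?thesis by (simp add: not_in_iff)
    qed (rule that(2))
  qed
  have act_E: "act m e \<in> E" if "m \<in> Mn" "e \<in> E" for m e
    using that by (auto simp: Mn_def E_def act_def tlab_def exps_add)
  have enc_act: "enc (act m e) i = enc e i + (if i < t then count (fst m) i else if i < t + R then nat (lk (snd m) (rs ! (i - t))) else 0)"
    if "m \<in> Mn" "e \<in> E" for m e i
    using that lk0 E(3)[OF that(2)] by (auto simp: enc_def act_def Mn_def lookup_add nat_add_distrib)
  have "\<exists>G'. finite G' \<and> G' \<subseteq> fl ` N \<and> (\<forall>Q. (\<lambda>_. 0) \<in> Q \<longrightarrow> (\<forall>v\<in>Q. \<forall>w\<in>Q. (\<lambda>e. v e + w e) \<in> Q) \<longrightarrow>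
     (\<forall>c. \<forall>m\<in>Mn. \<forall>g\<in>G'. (\<lambda>e. c * sh m g e) \<in> Q) \<longrightarrow> fl ` N \<subseteq> Q)"
  proof (rule monomial_module_finitely_generated[where E = E and lt = lt and act = act])
    fix Q :: "(label \<times> ('v \<Rightarrow>\<^sub>0 int)) set" assume "Q \<noteq> {}"
    show "\<exists>z\<in>Q. \<forall>y\<in>Q. \<not> lt y z"
    proof (cases "Q \<inter> E = {}")
      case True
      then show ?thesis using \<open>Q \<noteq> {}\<close> by (auto simp: lt_def)
    next
      case False
      from lexlt_minimal[OF this, of enc K] show ?thesis by (auto simp: lt_def)
    qed
  next
    fix x y z assume "lt x y" "lt y z" then show "lt x z" using lexlt_trans by (auto simp: lt_def)
  next
    fix x y assume xy: "x \<in> E" "y \<in> E" "x \<noteq> y"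
    have "\<exists>i<K. enc x i \<noteq> enc y i"
    proof (rule ccontr)
      assume "\<not> (\<exists>i<K. enc x i \<noteq> enc y i)"
      then have eq: "enc x i = enc y i" if "i < K" for i using that by blast
      have 1: "fst (fst x) = fst (fst y)"
      proof (rule subset_mset.antisym)
        have c: "count (fst (fst x)) i = count (fst (fst y)) i" if "i < t" for i
          using eq[of i] that by (simp add: enc_lt K_def)
        show "fst (fst x) \<subseteq># fst (fst y)" by (rule mset_le[OF E(1)[OF xy(1)]]) (simp add: c)
        show "fst (fst y) \<subseteq># fst (fst x)" by (rule mset_le[OF E(1)[OF xy(2)]]) (simp add: c)
      qed
      have 2: "snd (fst x) = snd (fst y)" using eq[of "t + R"] by (simp add: enc_last K_def)
      have 3: "snd x = snd y"
      proof (rule poly_mapping_eqI)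
        fix \<rho> show "lk (snd x) \<rho> = lk (snd y) \<rho>"
        proof (cases "\<rho> \<in> rays X")
          case True
          then obtain i where i: "i < R" "\<rho> = rs ! i" using rs(1) R_def by (metis in_set_conv_nth)
          have "nat (lk (snd x) \<rho>) = nat (lk (snd y) \<rho>)"
            using eq[of "t + i"] i by (simp add: enc_ray K_def)
          then show ?thesis using lk0[OF E(3)[OF xy(1)], of \<rho>] lk0[OF E(3)[OF xy(2)], of \<rho>] by simp
        next
          case False
          then show ?thesis
            using divisors_lookup[OF exps_divisors[OF E(3)[OF xy(1)]]] divisors_lookup[OF exps_divisors[OF E(3)[OF xy(2)]]] by simp
        qed
      qed
      show False using xy(3) 1 2 3 by (simp add: prod_eq_iff)
    qed
    then show "lt x y \<or> lt y x" using lexlt_total[of K enc x y] xy by (simp add: lt_def)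
  next
    fix m x y assume m: "m \<in> Mn" "lt x y"
    then have xy: "x \<in> E" "y \<in> E" "lexlt enc K x y" by (auto simp: lt_def)
    have "lexlt enc K (act m x) (act m y)"
      using xy(3) unfolding lexlt_def by (simp add: enc_act[OF m(1) xy(1)] enc_act[OF m(1) xy(2)])
    then show "lt (act m x) (act m y)" using act_E m(1) xy by (simp add: lt_def)
  next
    fix s :: "nat \<Rightarrow> label \<times> ('v \<Rightarrow>\<^sub>0 int)" assume s: "\<And>i. s i \<in> E"
    obtain f :: "nat \<Rightarrow> nat" where f: "strict_mono f"
      "\<And>l i j. l < K \<Longrightarrow> i \<le> j \<Longrightarrow> enc (s (f i)) l \<le> enc (s (f j)) l"
      using dickson[of K "\<lambda>i. enc (s i)"] by blast
    \<comment> \<open>Divisibility of terms requires equal basis indices. Along the subsequence the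
      index is nondecreasing and below r, so two neighbours share it.\<close>
    have "\<exists>i. snd (fst (s (f i))) = snd (fst (s (f (Suc i))))"
    proof (rule ccontr)
      assume "\<not> ?thesis"
      then have "snd (fst (s (f i))) < snd (fst (s (f (Suc i))))" for i
        using f(2)[of "t + R" i "Suc i"] by (simp add: enc_last K_def le_neq_implies_less)
      then have "strict_mono (\<lambda>i. snd (fst (s (f i))))" by (simp add: strict_mono_Suc_iff)
      then have "r \<le> snd (fst (s (f r)))" by (rule strict_mono_imp_increasing)
      then show False using E(2)[OF s, of "f r"] by simp
    qed
    then obtain i where i: "snd (fst (s (f i))) = snd (fst (s (f (Suc i))))" ..
    define x where "x = s (f i)"
    define y where "y = s (f (Suc i))"
    have xy: "x \<in> E" "y \<in> E" using s by (auto simp: x_def y_def)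
    have le: "enc x l \<le> enc y l" if "l < K" for l using f(2)[OF that, of i "Suc i"] by (simp add: x_def y_def)
    have sub: "fst (fst x) \<subseteq># fst (fst y)"
    proof (rule mset_le[OF E(1)[OF xy(1)]])
      fix l assume "l < t"
      then show "count (fst (fst x)) l \<le> count (fst (fst y)) l" using le[of l] by (simp add: enc_lt K_def)
    qed
    have "snd y - snd x \<in> exps X"
    proof -
      have "lk (snd y - snd x) \<rho> \<ge> 0" for \<rho>
      proof (cases "\<rho> \<in> rays X")
        case True
        then obtain l where l: "l < R" "\<rho> = rs ! l" using rs(1) R_def by (metis in_set_conv_nth)
        have "nat (lk (snd x) \<rho>) \<le> nat (lk (snd y) \<rho>)" using le[of "t + l"] l by (simp add: enc_ray K_def)
        then show ?thesis using lk0[OF E(3)[OF xy(2)], of \<rho>] by (simp add: lookup_minus)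
      next
        case False
        then show ?thesis using divisors_lookup[OF exps_divisors[OF E(3)[OF xy(1)]]]
          divisors_lookup[OF exps_divisors[OF E(3)[OF xy(2)]]] by (simp add: lookup_minus)
      qed
      then show ?thesis using E(3)[OF xy(1)] E(3)[OF xy(2)] by (simp add: exps_def divisors_diff)
    qed
    moreover have "set_mset (fst (fst y) - fst (fst x)) \<subseteq> {..<t}"
      using E(1)[OF xy(2)] by (meson in_diffD subset_iff)
    ultimately have "(fst (fst y) - fst (fst x), snd y - snd x) \<in> Mn" by (simp add: Mn_def)
    moreover have "y = act (fst (fst y) - fst (fst x), snd y - snd x) x"
      using sub i by (simp add: act_def prod_eq_iff x_def y_def)
    moreover have "f i < f (Suc i)" using f(1) by (simp add: strict_mono_def)
    ultimately show "\<exists>i j m. i < j \<and> m \<in> Mn \<and> s j = act m (s i)"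
      unfolding x_def y_def by blast
  next
    fix v e assume "v \<in> fl ` N" "v e \<noteq> 0"
    then obtain q where q: "q \<in> N" "lk (q (fst e)) (snd e) \<noteq> 0" by (auto simp: fl_def case_prod_beta)
    then have "snd e \<in> exps X" "q (fst e) \<noteq> 0"
      using ND(2)[OF q(1), of "fst e"] by (auto simp: cox_iff in_keys_iff)
    then show "e \<in> E" using ND(3)[OF q(1), of "fst e"] by (simp add: E_def mem_Times_iff)
  next
    fix v assume "v \<in> fl ` N"
    then obtain q where q: "q \<in> N" "v = fl q" by blast
    have "{e. v e \<noteq> 0} \<subseteq> (SIGMA l:{l. q l \<noteq> 0}. ks (q l))"
      by (auto simp: q(2) fl_def in_keys_iff)
    then show "finite {e. v e \<noteq> 0}" by (rule finite_subset) (use ND(1)[OF q(1)] in auto)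
  next
    fix v w assume "v \<in> fl ` N" "w \<in> fl ` N"
    then obtain p q where pq: "p \<in> N" "v = fl p" "q \<in> N" "w = fl q" by blast
    then have "(\<lambda>e. v e + w e) = fl (\<lambda>l. p l + q l)" by (auto simp: fl_def lookup_add)
    then show "(\<lambda>e. v e + w e) \<in> fl ` N" using ND(5) pq by blast
  next
    fix c v assume "v \<in> fl ` N"
    then obtain p where p: "p \<in> N" "v = fl p" by blast
    then have "(\<lambda>e. c * v e) = fl (\<lambda>l. Poly_Mapping.single 0 c * p l)" by (auto simp: fl_def lookup_single_times)
    then show "(\<lambda>e. c * v e) \<in> fl ` N" using ND(6)[OF cox_single[OF exps_zero]] p by blast
  next
    fix m v assume "m \<in> Mn" "v \<in> fl ` N"
    then obtain p where p: "p \<in> N" "v = fl p" by blast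
    have m: "set_mset (fst m) \<subseteq> {..<t}" "snd m \<in> exps X" using \<open>m \<in> Mn\<close> by (auto simp: Mn_def)
    have "sh m v = fl (\<lambda>l. mon (snd m) * tsh (fst m) p l)"
      using p by (auto simp: fl_def sh_def tsh_def lookup_mon_times fun_eq_iff)
    then show "sh m v \<in> fl ` N" using ND(6)[OF cox_single[OF m(2)] ND(7)[OF m(1) p(1)]] by blast
  next
    fix m v e show "sh m v (act m e) = v e" by (simp add: sh_def act_def)
  next
    fix m v e assume m: "m \<in> Mn" "v \<in> fl ` N" "sh m v e \<noteq> 0"
    then obtain p where p: "p \<in> N" "v = fl p" by blast
    let ?e = "((fst (fst e) - fst m, snd (fst e)), snd e - snd m)"
    have sub: "fst m \<subseteq># fst (fst e)" and nz: "v ?e \<noteq> 0" using m(3) by (auto simp: sh_def split: if_splits)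
    then have "lk (p (fst ?e)) (snd ?e) \<noteq> 0" using p by (simp add: fl_def)
    then have "snd ?e \<in> exps X" "p (fst ?e) \<noteq> 0"
      using ND(2)[OF p(1), of "fst ?e"] by (auto simp: cox_iff in_keys_iff)
    then have "?e \<in> E" using ND(3)[OF p(1), of "fst ?e"] by (simp add: E_def)
    moreover have "e = act m ?e" using sub by (simp add: act_def prod_eq_iff)
    ultimately show "e \<in> act m ` E" by blast
  qed
  then obtain G' where G': "finite G'" "G' \<subseteq> fl ` N" and gen: "\<And>Q. (\<lambda>_. 0) \<in> Q \<Longrightarrow>
     (\<forall>v\<in>Q. \<forall>w\<in>Q. (\<lambda>e. v e + w e) \<in> Q) \<Longrightarrow> (\<forall>c. \<forall>m\<in>Mn. \<forall>g\<in>G'. (\<lambda>e. c * sh m g e) \<in> Q) \<Longrightarrow> fl ` N \<subseteq> Q"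
    by (elim exE conjE) blast
  obtain G where G: "G \<subseteq> N" "finite G" "G' = fl ` G" using finite_subset_image[OF G'] by blast
  have inj: "p = q" if "fl p = fl q" for p q
  proof
    fix l show "p l = q l"
    proof (rule poly_mapping_eqI)
      fix u show "lk (p l) u = lk (q l) u" using fun_cong[OF that, of "(l, u)"] by (simp add: fl_def)
    qed
  qed
  have "N \<subseteq> Q" if Q: "(\<lambda>_. 0) \<in> Q" "\<forall>v\<in>Q. \<forall>w\<in>Q. (\<lambda>l. v l + w l) \<in> Q"
    "\<forall>s \<beta> g. s \<in> cox X \<longrightarrow> set_mset \<beta> \<subseteq> {..<t} \<longrightarrow> g \<in> G \<longrightarrow> (\<lambda>l. s * tsh \<beta> g l) \<in> Q" for Q
  proof -
    have "fl ` N \<subseteq> fl ` Q"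
    proof (rule gen)
      have "(\<lambda>_. 0) = fl (\<lambda>_. 0)" by (auto simp: fl_def)
      then show "(\<lambda>_. 0) \<in> fl ` Q" using Q(1) by blast
      show "\<forall>v\<in>fl ` Q. \<forall>w\<in>fl ` Q. (\<lambda>e. v e + w e) \<in> fl ` Q"
      proof (intro ballI)
        fix v w assume "v \<in> fl ` Q" "w \<in> fl ` Q"
        then obtain p q where pq: "p \<in> Q" "v = fl p" "q \<in> Q" "w = fl q" by blast
        then have "(\<lambda>e. v e + w e) = fl (\<lambda>l. p l + q l)" by (auto simp: fl_def lookup_add)
        then show "(\<lambda>e. v e + w e) \<in> fl ` Q" using Q(2) pq by blast
      qed
      show "\<forall>c. \<forall>m\<in>Mn. \<forall>g\<in>G'. (\<lambda>e. c * sh m g e) \<in> fl ` Q"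
      proof (intro allI ballI)
        fix c m g assume m: "m \<in> Mn" "g \<in> G'"
        then obtain p where p: "p \<in> G" "g = fl p" using G by blast
        have "(\<lambda>e. c * sh m g e) = fl (\<lambda>l. Poly_Mapping.single (snd m) c * tsh (fst m) p l)"
          using p by (auto simp: fl_def sh_def tsh_def lookup_single_times fun_eq_iff)
        moreover have "Poly_Mapping.single (snd m) c \<in> cox X" "set_mset (fst m) \<subseteq> {..<t}"
          using m by (auto simp: Mn_def intro: cox_single)
        ultimately show "(\<lambda>e. c * sh m g e) \<in> fl ` Q" using Q(3) p by blast
      qed
    qed
    then show ?thesis using inj by blast
  qed
  then show ?thesis using G by (intro exI[of _ G]) blast
qed

end

section \<open>Uniform vanishing\<close>

context toric_var
begin

section \<open>The two gradings of free modules over S[T]\<close>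

definition mdeg :: "(nat \<Rightarrow> 'p) \<Rightarrow> nat multiset \<Rightarrow> 'p" where
  "mdeg pf \<alpha> = (\<Sum>i\<in>#\<alpha>. pf i)"

lemma mdeg_add: "mdeg pf (\<alpha> + \<beta>) = mdeg pf \<alpha> + mdeg pf \<beta>"
  by (simp add: mdeg_def)

text \<open>\<open>pf\<close> gives the class of each variable T, and \<delta> that of the basis
  elements; in \<open>tdeg\<close> each variable counts 1 and \<open>b\<close> gives the T-degree of
  the basis elements.\<close>

definition pdeg :: "(nat \<Rightarrow> 'p) \<Rightarrow> (nat \<Rightarrow> 'p) \<Rightarrow> label \<Rightarrow> 'p" where
  "pdeg pf \<delta> l = mdeg pf (fst l) + \<delta> (snd l)"

definition tdeg :: "(nat \<Rightarrow> nat) \<Rightarrow> label \<Rightarrow> nat" where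
  "tdeg b l = size (fst l) + b (snd l)"

definition hcomp :: "(nat \<Rightarrow> 'p) \<Rightarrow> (nat \<Rightarrow> 'p) \<Rightarrow> (nat \<Rightarrow> nat) \<Rightarrow> nat \<Rightarrow> 'p \<Rightarrow>
    (label \<Rightarrow> ('v, 'k::field) laurent) \<Rightarrow> label \<Rightarrow> ('v, 'k) laurent" where
  "hcomp pf \<delta> b n d v = (\<lambda>l. if tdeg b l = n then hc (d - pdeg pf \<delta> l) (v l) else 0)"

definition tgraded :: "(nat \<Rightarrow> 'p) \<Rightarrow> (nat \<Rightarrow> 'p) \<Rightarrow> (nat \<Rightarrow> nat) \<Rightarrow> (label \<Rightarrow> ('v, 'k::field) laurent) set \<Rightarrow> bool" where
  "tgraded pf \<delta> b N \<longleftrightarrow> (\<forall>v\<in>N. \<forall>n d. hcomp pf \<delta> b n d v \<in> N)"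

definition bihom :: "(nat \<Rightarrow> 'p) \<Rightarrow> (nat \<Rightarrow> 'p) \<Rightarrow> (nat \<Rightarrow> nat) \<Rightarrow> nat \<Rightarrow> 'p \<Rightarrow>
    (label \<Rightarrow> ('v, 'k::field) laurent) \<Rightarrow> bool" where
  "bihom pf \<delta> b n d v \<longleftrightarrow> (\<forall>l. homog (d - pdeg pf \<delta> l) (v l) \<and> (v l \<noteq> 0 \<longrightarrow> tdeg b l = n))"

definition tpart :: "(nat \<Rightarrow> nat) \<Rightarrow> nat \<Rightarrow> (label \<Rightarrow> ('v, 'k::field) laurent) set \<Rightarrow> (label \<Rightarrow> ('v, 'k) laurent) set" where
  "tpart b n N = {v \<in> N. \<forall>l. v l \<noteq> 0 \<longrightarrow> tdeg b l = n}"

lemma bihom_hcomp: "tmod t r N \<Longrightarrow> v \<in> N \<Longrightarrow> bihom pf \<delta> b n d (hcomp pf \<delta> b n d v)"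
proof -
  assume "tmod t r N" "v \<in> N"
  then have "homog (d - pdeg pf \<delta> l) (hc (d - pdeg pf \<delta> l) (v l))" for l
    by (intro homog_hc cox_divisors tmodD(2))
  then show ?thesis unfolding bihom_def hcomp_def by (simp del: split_paired_All)
qed

lemma bihom_tsh:
  assumes "bihom pf \<delta> b n d v"
  shows "bihom pf \<delta> b (n + size \<beta>) (d + mdeg pf \<beta>) (tsh \<beta> v)"
  unfolding bihom_def
proof (intro allI conjI impI)
  fix l :: label
  show "homog (d + mdeg pf \<beta> - pdeg pf \<delta> l) (tsh \<beta> v l)"
  proof (cases "\<beta> \<subseteq># fst l")
    case True
    then obtain \<gamma> where \<gamma>: "fst l = \<beta> + \<gamma>" by (metis mset_subset_eq_exists_conv)
    have "homog (d - pdeg pf \<delta> (\<gamma>, snd l)) (v (\<gamma>, snd l))" using assms by (simp add: bihom_def)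
    then show ?thesis by (simp add: tsh_def \<gamma> pdeg_def mdeg_add algebra_simps)
  qed (simp add: tsh_def)
  assume nz: "tsh \<beta> v l \<noteq> 0"
  then have sub: "\<beta> \<subseteq># fst l" by (auto simp: tsh_def split: if_splits)
  then obtain \<gamma> where \<gamma>: "fst l = \<beta> + \<gamma>" by (metis mset_subset_eq_exists_conv)
  then have "v (\<gamma>, snd l) \<noteq> 0" using nz by (simp add: tsh_def)
  then have "tdeg b (\<gamma>, snd l) = n" using assms by (simp add: bihom_def)
  then show "tdeg b l = n + size \<beta>" by (simp add: tdeg_def \<gamma>)
qed

lemma sum_hc:
  assumes "finite D" "\<And>m. m \<in> ks p \<Longrightarrow> a + cl m \<in> D"
  shows "(\<Sum>d\<in>D. hc (d - a) p) = p"
proof (rule poly_mapping_eqI)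
  fix m
  have "lk (\<Sum>d\<in>D. hc (d - a) p) m = (\<Sum>d\<in>D. if d = a + cl m then lk p m else 0)"
    unfolding lookup_sum hc_def by (intro sum.cong) (auto simp: lookup_rst algebra_simps)
  also have "\<dots> = lk p m" using assms by (auto simp: sum.delta in_keys_iff)
  finally show "lk (\<Sum>d\<in>D. hc (d - a) p) m = lk p m" .
qed

lemma sum_hcomp:
  assumes N: "tmod t r N" "v \<in> N"
  obtains A D where "finite A" "finite D" "\<And>l. v l = (\<Sum>n\<in>A. \<Sum>d\<in>D. hcomp pf \<delta> b n d v l)"
proof -
  define L where "L = {l. v l \<noteq> 0}"
  have L: "finite L" unfolding L_def using tmodD(1)[OF N] .
  define A where "A = tdeg b ` L"
  define D where "D = (\<Union>l\<in>L. (\<lambda>m. pdeg pf \<delta> l + cl m) ` ks (v l))"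
  have fin: "finite A" "finite D" using L by (auto simp: A_def D_def)
  have "v l = (\<Sum>n\<in>A. \<Sum>d\<in>D. hcomp pf \<delta> b n d v l)" for l
  proof (cases "l \<in> L")
    case True
    have "(\<Sum>n\<in>A. \<Sum>d\<in>D. hcomp pf \<delta> b n d v l) = (\<Sum>n\<in>A. if n = tdeg b l then \<Sum>d\<in>D. hc (d - pdeg pf \<delta> l) (v l) else 0)"
      by (intro sum.cong) (auto simp: hcomp_def)
    also have "\<dots> = (\<Sum>d\<in>D. hc (d - pdeg pf \<delta> l) (v l))" using True fin by (simp add: A_def)
    also have "\<dots> = v l" using True by (intro sum_hc fin) (auto simp: D_def)
    finally show ?thesis ..
  next
    case False
    then have "v l = 0" by (simp add: L_def)
    then have "hcomp pf \<delta> b n d v l = 0" for n d by (simp add: hcomp_def)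
    then show ?thesis using \<open>v l = 0\<close> by simp
  qed
  then show ?thesis using that fin by blast
qed

inductive_set tspan :: "nat \<Rightarrow> (label \<Rightarrow> ('v, 'k::field) laurent) set \<Rightarrow> (label \<Rightarrow> ('v, 'k) laurent) set"
  for t G where
    tspan_zero: "(\<lambda>_. 0) \<in> tspan t G"
  | tspan_add: "v \<in> tspan t G \<Longrightarrow> w \<in> tspan t G \<Longrightarrow> (\<lambda>l. v l + w l) \<in> tspan t G"
  | tspan_gen: "s \<in> cox X \<Longrightarrow> set_mset \<beta> \<subseteq> {..<t} \<Longrightarrow> g \<in> G \<Longrightarrow> (\<lambda>l. s * tsh \<beta> g l) \<in> tspan t G"

lemma tspan_sum: "(\<And>x. x \<in> A \<Longrightarrow> f x \<in> tspan t G) \<Longrightarrow> (\<lambda>l. \<Sum>x\<in>A. f x l) \<in> tspan t G"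
proof (induction A rule: infinite_finite_induct)
  case (insert x A)
  then have "(\<lambda>l. f x l + (\<Sum>x\<in>A. f x l)) \<in> tspan t G" by (intro tspan_add) auto
  then show ?case using insert by simp
qed (auto intro: tspan_zero)

lemma tspan_tsh:
  fixes G :: "(label \<Rightarrow> ('v, 'k::field) laurent) set"
  assumes "v \<in> tspan t G" "s \<in> cox X" "set_mset \<beta> \<subseteq> {..<t}"
  shows "(\<lambda>l. s * tsh \<beta> v l) \<in> tspan t G"
  using assms(1)
proof induction
  case tspan_zero
  have "(\<lambda>l. s * tsh \<beta> (\<lambda>_. 0) l) = (\<lambda>_. 0 :: ('v, 'k) laurent)" by (auto simp: tsh_def)
  then show ?case using tspan.tspan_zero by simp
next
  case (tspan_add v w)
  have "(\<lambda>l. s * tsh \<beta> (\<lambda>l. v l + w l) l) = (\<lambda>l. s * tsh \<beta> v l + s * tsh \<beta> w l)"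
    by (auto simp: tsh_def distrib_left)
  then show ?case using tspan.tspan_add tspan_add by simp
next
  case (tspan_gen s' \<gamma> g)
  have "s * tsh \<beta> (\<lambda>l. s' * tsh \<gamma> g l) l = (s * s') * tsh (\<beta> + \<gamma>) g l" for l
    unfolding tsh_tsh[symmetric] by (simp add: tsh_def[of \<beta>] mult.assoc)
  then show ?case using assms tspan_gen by (simp add: tspan.tspan_gen cox_mult)
qed

lemma tspan_representation:
  assumes "v \<in> tspan t (g ` {..<q})"
  shows "\<exists>s. finite {e. s e \<noteq> 0} \<and> {e. s e \<noteq> 0} \<subseteq> tlab t q \<and> (\<forall>e. s e \<in> cox X) \<and>
    (\<forall>l. v l = (\<Sum>e | s e \<noteq> 0. s e * tsh (fst e) (g (snd e)) l))"
  using assms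
proof induction
  case tspan_zero
  show ?case by (rule exI[of _ "\<lambda>_. 0"]) simp
next
  case (tspan_add v w)
  then obtain s s' where s: "finite {e. s e \<noteq> 0}" "{e. s e \<noteq> 0} \<subseteq> tlab t q" "\<And>e. s e \<in> cox X"
    "\<And>l. v l = (\<Sum>e | s e \<noteq> 0. s e * tsh (fst e) (g (snd e)) l)"
    and s': "finite {e. s' e \<noteq> 0}" "{e. s' e \<noteq> 0} \<subseteq> tlab t q" "\<And>e. s' e \<in> cox X"
    "\<And>l. w l = (\<Sum>e | s' e \<noteq> 0. s' e * tsh (fst e) (g (snd e)) l)" by (elim exE conjE) blast
  let ?A = "{e. s e \<noteq> 0} \<union> {e. s' e \<noteq> 0}"
  have sub: "{e. s e + s' e \<noteq> 0} \<subseteq> ?A" by auto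
  have fin: "finite ?A" using s s' by blast
  have "v l + w l = (\<Sum>e | s e + s' e \<noteq> 0. (s e + s' e) * tsh (fst e) (g (snd e)) l)" for l
  proof -
    have "v l = (\<Sum>e\<in>?A. s e * tsh (fst e) (g (snd e)) l)"
      unfolding s(4) by (rule sum.mono_neutral_left) (use fin in auto)
    moreover have "w l = (\<Sum>e\<in>?A. s' e * tsh (fst e) (g (snd e)) l)"
      unfolding s'(4) by (rule sum.mono_neutral_left) (use fin in auto)
    moreover have "(\<Sum>e | s e + s' e \<noteq> 0. (s e + s' e) * tsh (fst e) (g (snd e)) l) =
        (\<Sum>e\<in>?A. (s e + s' e) * tsh (fst e) (g (snd e)) l)"
      by (rule sum.mono_neutral_left[OF fin sub]) auto
    ultimately show ?thesis by (simp add: distrib_right sum.distrib)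
  qed
  moreover have "finite {e. s e + s' e \<noteq> 0}" using fin sub finite_subset by blast
  ultimately show ?case using s s' sub by (intro exI[of _ "\<lambda>e. s e + s' e"]) (auto intro: cox_add)
next
  case (tspan_gen c \<beta> h)
  then obtain k where k: "k < q" "h = g k" by blast
  let ?s = "\<lambda>e. if e = (\<beta>, k) then c else 0"
  have sub: "{e. ?s e \<noteq> 0} \<subseteq> {(\<beta>, k)}" by auto
  have "c * tsh \<beta> h l = (\<Sum>e | ?s e \<noteq> 0. ?s e * tsh (fst e) (g (snd e)) l)" for l
  proof -
    have "(\<Sum>e | ?s e \<noteq> 0. ?s e * tsh (fst e) (g (snd e)) l) = (\<Sum>e\<in>{(\<beta>, k)}. ?s e * tsh (fst e) (g (snd e)) l)"
      by (rule sum.mono_neutral_left[OF _ sub]) auto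
    then show ?thesis by (simp add: k)
  qed
  moreover have "finite {e. ?s e \<noteq> 0}" using sub finite_subset by blast
  ultimately show ?case using tspan_gen k by (intro exI[of _ ?s]) (auto simp: tlab_def)
qed

text \<open>The finitely many homogeneous components of a finite generating set remain in N by
  \<open>tgraded\<close> and generate as well.\<close>

lemma homogeneous_generators:
  fixes N :: "(label \<Rightarrow> ('v, 'k::field) laurent) set"
  assumes N: "tmod t r N" and gr: "tgraded pf \<delta> b N"
  obtains q g nn dd where "\<And>k. k < q \<Longrightarrow> g k \<in> N" "\<And>k. k < (q::nat) \<Longrightarrow> bihom pf \<delta> b (nn k) (dd k) (g k)"
    "N \<subseteq> tspan t (g ` {..<q})"
proof -
  obtain G where G: "finite G" "G \<subseteq> N" and gen: "\<And>Q. (\<lambda>_. 0) \<in> Q \<Longrightarrow> (\<forall>v\<in>Q. \<forall>w\<in>Q. (\<lambda>l. v l + w l) \<in> Q) \<Longrightarrow>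
    (\<forall>s \<beta> g. s \<in> cox X \<longrightarrow> set_mset \<beta> \<subseteq> {..<t} \<longrightarrow> g \<in> G \<longrightarrow> (\<lambda>l. s * tsh \<beta> g l) \<in> Q) \<Longrightarrow> N \<subseteq> Q"
    using tmod_finitely_generated[OF N] by (elim exE conjE) blast
  have "\<forall>g\<in>G. \<exists>A D. finite A \<and> finite D \<and> (\<forall>l. g l = (\<Sum>n\<in>A. \<Sum>d\<in>D. hcomp pf \<delta> b n d g l))"
  proof
    fix g assume "g \<in> G"
    then have "g \<in> N" using G by blast
    from sum_hcomp[OF N this, of pf \<delta> b] show "\<exists>A D. finite A \<and> finite D \<and>
      (\<forall>l. g l = (\<Sum>n\<in>A. \<Sum>d\<in>D. hcomp pf \<delta> b n d g l))" by metis
  qed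
  then obtain A D where AD: "\<And>g. g \<in> G \<Longrightarrow> finite (A g)" "\<And>g. g \<in> G \<Longrightarrow> finite (D g)"
    "\<And>g l. g \<in> G \<Longrightarrow> g l = (\<Sum>n\<in>A g. \<Sum>d\<in>D g. hcomp pf \<delta> b n d g l)" by metis
  define I where "I = (SIGMA g:G. A g \<times> D g)"
  have "finite I" unfolding I_def using G AD by auto
  then obtain q h where h: "I = h ` {..<(q::nat)}" by (metis finite_imp_nat_seg_image_inj_on lessThan_def)
  define g where "g k = hcomp pf \<delta> b (fst (snd (h k))) (snd (snd (h k))) (fst (h k))" for k
  have hk: "fst (h k) \<in> N" if "k < q" for k
  proof -
    have "h k \<in> I" using h that by blast
    then show ?thesis using G(2) by (auto simp: I_def)
  qed
  have "g ` {..<q} = (\<lambda>x. hcomp pf \<delta> b (fst (snd x)) (snd (snd x)) (fst x)) ` I"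
    unfolding h by (auto simp: g_def)
  then have gI: "hcomp pf \<delta> b n d x \<in> g ` {..<q}" if "x \<in> G" "n \<in> A x" "d \<in> D x" for x n d
    using that by (force simp: I_def)
  have one: "x \<in> tspan t (g ` {..<q})" if "x \<in> g ` {..<q}" for x
  proof -
    have "(\<lambda>l. 1 * tsh {#} x l) \<in> tspan t (g ` {..<q})" using that by (intro tspan_gen) auto
    then show ?thesis by (simp add: tsh_def)
  qed
  have "x \<in> tspan t (g ` {..<q})" if x: "x \<in> G" for x
  proof -
    have "x = (\<lambda>l. \<Sum>n\<in>A x. \<Sum>d\<in>D x. hcomp pf \<delta> b n d x l)" using AD(3)[OF x] by (rule ext)
    moreover have "(\<lambda>l. \<Sum>n\<in>A x. \<Sum>d\<in>D x. hcomp pf \<delta> b n d x l) \<in> tspan t (g ` {..<q})"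
      by (intro tspan_sum one gI x)
    ultimately show ?thesis by simp
  qed
  then have 3: "N \<subseteq> tspan t (g ` {..<q})"
    by (intro gen) (auto intro: tspan_zero tspan_add tspan_tsh)
  have 1: "g k \<in> N" if "k < q" for k
    using gr hk[OF that] by (simp add: g_def tgraded_def)
  have 2: "bihom pf \<delta> b (fst (snd (h k))) (snd (snd (h k))) (g k)" if "k < q" for k
    unfolding g_def by (rule bihom_hcomp[OF N hk[OF that]])
  show ?thesis by (rule that[OF 1 2 3])
qed

section \<open>Syzygy modules over S[T]\<close>

definition tsyz :: "nat \<Rightarrow> nat \<Rightarrow> (label \<Rightarrow> 'l \<Rightarrow> ('v, 'k::field) laurent) \<Rightarrow> (label \<Rightarrow> ('v, 'k) laurent) set" where
  "tsyz t q w = {s. finite {e. s e \<noteq> 0} \<and> {e. s e \<noteq> 0} \<subseteq> tlab t q \<and> (\<forall>e. s e \<in> cox X) \<and>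
     (\<forall>l. (\<Sum>e | s e \<noteq> 0. s e * w e l) = 0)}"

lemma sum_over_support:
  fixes s :: "'e \<Rightarrow> 'a::semiring_0"
  assumes "finite A" "{e. s e \<noteq> 0} \<subseteq> A"
  shows "(\<Sum>e | s e \<noteq> 0. s e * f e) = (\<Sum>e\<in>A. s e * f e)"
  by (rule sum.mono_neutral_left[OF assms]) auto

text \<open>\<open>shift\<close> is linearity in T: multiplying all terms of a relation by one
  monomial gives a relation. It is kept abstract because \<open>w\<close> is once a family of
  shifted vectors and once a family of products of ideal generators.\<close>

lemma tsyz_tmod:
  fixes w :: "label \<Rightarrow> 'l \<Rightarrow> ('v, 'k::field) laurent"
  assumes shift: "\<And>A s \<beta>. finite A \<Longrightarrow> (\<forall>l. (\<Sum>e\<in>A. s e * w e l) = 0) \<Longrightarrow>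
      (\<forall>l. (\<Sum>e\<in>A. s e * w (fst e + \<beta>, snd e) l) = 0)"
  shows "tmod t q (tsyz t q w)"
  unfolding tmod_def
proof (intro conjI ballI allI impI)
  fix s assume "s \<in> tsyz t q w"
  then show "finite {l. s l \<noteq> 0}" "s l \<in> cox X" "{l. s l \<noteq> 0} \<subseteq> tlab t q" for l unfolding tsyz_def by blast+
next
  show "(\<lambda>_. 0) \<in> tsyz t q w" by (simp add: tsyz_def)
next
  fix v v' assume v: "v \<in> tsyz t q w" "v' \<in> tsyz t q w"
  let ?A = "{e. v e \<noteq> 0} \<union> {e. v' e \<noteq> 0}"
  have fin: "finite ?A" using v by (auto simp: tsyz_def)
  have sub: "{e. v e + v' e \<noteq> 0} \<subseteq> ?A" by auto
  have 1: "(\<Sum>e | v e \<noteq> 0. v e * w e l) = 0" "(\<Sum>e | v' e \<noteq> 0. v' e * w e l) = 0" for l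
    using v by (auto simp: tsyz_def)
  have 2: "(\<Sum>e\<in>?A. v e * w e l) = 0" for l
    using sum_over_support[OF fin, of v "\<lambda>e. w e l"] 1(1)[of l] by auto
  have 3: "(\<Sum>e\<in>?A. v' e * w e l) = 0" for l
    using sum_over_support[OF fin, of v' "\<lambda>e. w e l"] 1(2)[of l] by auto
  have "(\<Sum>e | v e + v' e \<noteq> 0. (v e + v' e) * w e l) = 0" for l
    unfolding sum_over_support[OF fin sub, of "\<lambda>e. w e l"]
    using 2[of l] 3[of l] by (simp add: distrib_right sum.distrib)
  moreover have "finite {e. v e + v' e \<noteq> 0}" using fin sub finite_subset by blast
  ultimately show "(\<lambda>l. v l + v' l) \<in> tsyz t q w"
    using v sub by (auto simp: tsyz_def intro: cox_add)
next
  fix s :: "('v, 'k) laurent" and v assume s: "s \<in> cox X" and v: "v \<in> tsyz t q w"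
  have fin: "finite {e. v e \<noteq> 0}" using v by (simp add: tsyz_def)
  have sub: "{e. s * v e \<noteq> 0} \<subseteq> {e. v e \<noteq> 0}" by auto
  have "(\<Sum>e | s * v e \<noteq> 0. (s * v e) * w e l) = s * (\<Sum>e | v e \<noteq> 0. v e * w e l)" for l
    unfolding sum_over_support[OF fin sub, of "\<lambda>e. w e l"] by (simp add: sum_distrib_left mult.assoc)
  then have "(\<Sum>e | s * v e \<noteq> 0. (s * v e) * w e l) = 0" for l using v by (simp add: tsyz_def)
  moreover have "finite {e. s * v e \<noteq> 0}" using fin sub finite_subset by blast
  ultimately show "(\<lambda>l. s * v l) \<in> tsyz t q w"
    using v s sub by (auto simp: tsyz_def intro: cox_mult)
next
  fix \<beta> v assume \<beta>: "set_mset \<beta> \<subseteq> {..<t}" and v: "v \<in> tsyz t q w"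
  let ?A = "{e. v e \<noteq> 0}"
  let ?h = "\<lambda>e. (fst e + \<beta>, snd e)"
  have fin: "finite ?A" using v by (simp add: tsyz_def)
  have inj: "inj_on ?h ?A" by (auto simp: inj_on_def prod_eq_iff)
  have supp: "{e. tsh \<beta> v e \<noteq> 0} = ?h ` ?A"
  proof
    show "{e. tsh \<beta> v e \<noteq> 0} \<subseteq> ?h ` ?A"
    proof
      fix e assume "e \<in> {e. tsh \<beta> v e \<noteq> 0}"
      then have "\<beta> \<subseteq># fst e" "v (fst e - \<beta>, snd e) \<noteq> 0" by (auto simp: tsh_def split: if_splits)
      then show "e \<in> ?h ` ?A" by (intro image_eqI[of _ _ "(fst e - \<beta>, snd e)"]) (auto simp: prod_eq_iff)
    qed
  qed (auto simp: tsh_shift)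
  have "(\<Sum>e | tsh \<beta> v e \<noteq> 0. tsh \<beta> v e * w e l) = (\<Sum>e\<in>?A. v e * w (?h e) l)" for l
    unfolding supp by (subst sum.reindex[OF inj]) (simp add: tsh_shift)
  moreover have "(\<Sum>e\<in>?A. v e * w (?h e) l) = 0" for l
    using shift[OF fin, of v \<beta>] v by (simp add: tsyz_def)
  moreover have "tsh \<beta> v l \<in> cox X" for l using v by (auto simp: tsh_def tsyz_def)
  moreover have "?h ` ?A \<subseteq> tlab t q"
  proof -
    have "?A \<subseteq> tlab t q" using v by (simp add: tsyz_def)
    moreover have "?h e \<in> tlab t q" if "e \<in> tlab t q" for e
      using that \<beta> by (cases e) (simp add: tlab_def)
    ultimately show ?thesis by blast
  qed
  ultimately show "tsh \<beta> v \<in> tsyz t q w" unfolding tsyz_def using supp fin by simp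
qed

lemma tsyz_tgraded:
  fixes w :: "label \<Rightarrow> 'l \<Rightarrow> ('v, 'k::field) laurent"
  assumes w: "\<And>e l. e \<in> tlab t q \<Longrightarrow> homog (pdeg pf dd e - ld l) (w e l)"
    "\<And>e l. e \<in> tlab t q \<Longrightarrow> w e l \<noteq> 0 \<Longrightarrow> lt l = tdeg nn e"
  shows "tgraded pf dd nn (tsyz t q w)"
  unfolding tgraded_def
proof (intro ballI allI)
  fix s n d assume s: "s \<in> tsyz t q w"
  let ?A = "{e. s e \<noteq> 0}" and ?s = "hcomp pf dd nn n d s"
  have A: "finite ?A" "?A \<subseteq> tlab t q" using s by (auto simp: tsyz_def)
  have sub: "{e. ?s e \<noteq> 0} \<subseteq> ?A" by (auto simp: hcomp_def split: if_splits)
  have scox: "s e \<in> cox X" for e using s unfolding tsyz_def by blast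
  have "(\<Sum>e\<in>?A. ?s e * w e l) = 0" for l
  proof (cases "lt l = n")
    case True
    have "?s e * w e l = hc (d - ld l) (s e * w e l)" if e: "e \<in> ?A" for e
    proof (cases "w e l = 0")
      case False
      have et: "e \<in> tlab t q" using e A by blast
      have "tdeg nn e = n" using w(2)[OF et False] True by simp
      moreover have "hc (d - pdeg pf dd e + (pdeg pf dd e - ld l)) (s e * w e l) = hc (d - pdeg pf dd e) (s e) * w e l"
        by (intro hc_mult w(1)[OF et] cox_divisors scox)
      ultimately show ?thesis by (simp add: hcomp_def)
    qed simp
    then have "(\<Sum>e\<in>?A. ?s e * w e l) = hc (d - ld l) (\<Sum>e\<in>?A. s e * w e l)" by (simp add: hc_sum)
    then show ?thesis using s by (simp add: tsyz_def)
  next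
    case False
    have "?s e * w e l = 0" if e: "e \<in> ?A" for e
    proof (cases "w e l = 0")
      case nz: False
      have et: "e \<in> tlab t q" using e A by blast
      have "tdeg nn e \<noteq> n" using w(2)[OF et nz] False by simp
      then show ?thesis by (simp add: hcomp_def)
    qed simp
    then show ?thesis by simp
  qed
  then have "(\<Sum>e | ?s e \<noteq> 0. ?s e * w e l) = 0" for l
    unfolding sum_over_support[OF A(1) sub, of "\<lambda>e. w e l"] .
  moreover have "?s e \<in> cox X" for e by (simp add: hcomp_def hc_cox scox)
  ultimately show "?s \<in> tsyz t q w"
    unfolding tsyz_def using finite_subset[OF sub A(1)] sub A(2) by blast
qed

lemma finite_tlab_part: "finite {e \<in> tlab t q. tdeg nn e = n}"
proof -
  have "{e \<in> tlab t q. tdeg nn e = n} \<subseteq> (\<Union>k\<le>n. multisets_of_size {..<t} k) \<times> {..<q}"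
    by (auto simp: tlab_def tdeg_def multisets_of_size_def)
  then show ?thesis by (rule finite_subset) (auto intro!: finite_multisets_of_size)
qed

text \<open>In a fixed T-degree only finitely many labels occur, and the relations over S[T] in that
  degree are the relations over S among the corresponding multiples of the generators. This links
  S[T] to the dimension shift over S.\<close>

lemma tpart_tsyz:
  assumes w: "\<And>e l. e \<in> tlab t q \<Longrightarrow> w e l \<noteq> 0 \<Longrightarrow> lt l = tdeg nn e"
  shows "syz {e \<in> tlab t q. tdeg nn e = n} w = tpart nn n (tsyz t q w)"
proof -
  let ?E = "{e \<in> tlab t q. tdeg nn e = n}"
  have fin: "finite ?E" by (rule finite_tlab_part)
  show ?thesis
  proof (intro equalityI subsetI)
    fix s assume s: "s \<in> syz ?E w"
    then have sub: "{e. s e \<noteq> 0} \<subseteq> ?E" by (auto simp: syz_def)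
    have "(\<Sum>e | s e \<noteq> 0. s e * w e l) = 0" for l
      unfolding sum_over_support[OF fin sub, of "\<lambda>e. w e l"] using s by (simp add: syz_def)
    then show "s \<in> tpart nn n (tsyz t q w)"
      using s sub finite_subset[OF sub fin] unfolding tpart_def tsyz_def by (auto simp: syz_def)
  next
    fix s assume s: "s \<in> tpart nn n (tsyz t q w)"
    then have sub: "{e. s e \<noteq> 0} \<subseteq> ?E" by (auto simp: tpart_def tsyz_def)
    have "(\<Sum>e\<in>?E. s e * w e l) = 0" for l
      unfolding sum_over_support[OF fin sub, of "\<lambda>e. w e l", symmetric] using s by (simp add: tpart_def tsyz_def)
    then show "s \<in> syz ?E w" using s sub by (auto simp: syz_def tpart_def tsyz_def)
  qed
qed

lemma tsh_sum_zero:
  assumes "\<forall>l. (\<Sum>e\<in>A. s e * tsh (fst e) (g (snd e)) l) = (0 :: 'a::semiring_0)"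
  shows "\<forall>l. (\<Sum>e\<in>A. s e * tsh (fst e + \<beta>) (g (snd e)) l) = 0"
proof
  fix l :: label
  have "(\<Sum>e\<in>A. s e * tsh (fst e + \<beta>) (g (snd e)) l) = tsh \<beta> (\<lambda>l. \<Sum>e\<in>A. s e * tsh (fst e) (g (snd e)) l) l"
    unfolding add.commute[of _ \<beta>] tsh_tsh[symmetric] by (simp add: tsh_def[of \<beta>])
  also have "\<dots> = 0" using assms by (simp add: tsh_def)
  finally show "(\<Sum>e\<in>A. s e * tsh (fst e + \<beta>) (g (snd e)) l) = 0" .
qed

text \<open>Induction on syzygies over \<open>S[T]\<close>: the degrees of the generators of all syzygy modules that matter
  form a finite set, and every \<open>T\<close>-degree is treated by the same set.\<close>

lemma uniform_vanishing:
  fixes N :: "(label \<Rightarrow> ('v, 'k::field) laurent) set"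
  assumes "tmod t r N" "tgraded pf \<delta> b N"
  shows "\<exists>\<Delta>. finite \<Delta> \<and> (\<forall>x\<in>\<Delta>. fst x > i) \<and> (\<forall>n d.
    (\<forall>(j, e, c)\<in>\<Delta>. \<forall>\<alpha>. set_mset \<alpha> \<subseteq> {..<t} \<longrightarrow> size \<alpha> + c = n \<longrightarrow>
       local_cohomology_vanishes X cl (cox X :: ('v, 'k) laurent set) j (d - e - mdeg pf \<alpha>)) \<longrightarrow>
    vvanishes (tpart b n N) i (pdeg pf \<delta>) d)"
  using assms
proof (induction "card (cones X) - i" arbitrary: i r N \<delta> b)
  case 0
  \<comment> \<open>The Cech complex has ended, so the empty set of conditions suffices.\<close>
  have "vvanishes (tpart b n N) i (pdeg pf \<delta>) d" for n d
    using 0 tmodD(4) by (intro vvanishes_large) (auto simp: tpart_def)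
  then show ?case by (intro exI[of _ "{}"]) auto
next
  case (Suc x)
  note N = Suc.prems(1)
  obtain q g nn dd where g: "\<And>k. k < q \<Longrightarrow> g k \<in> N" "\<And>k. k < (q::nat) \<Longrightarrow> bihom pf \<delta> b (nn k) (dd k) (g k)"
    "N \<subseteq> tspan t (g ` {..<q})" using homogeneous_generators[OF Suc.prems] by metis
  \<comment> \<open>All T-monomial multiples of the generators; those of T-degree n generate the
    part of T-degree n over S.\<close>
  define w where "w e = tsh (fst e) (g (snd e))" for e
  have w_bihom: "bihom pf \<delta> b (tdeg nn e) (pdeg pf dd e) (w e)" if "e \<in> tlab t q" for e
    using bihom_tsh[OF g(2), of "snd e" "fst e"] that by (auto simp: w_def tlab_def tdeg_def pdeg_def add.commute)
  have w_N: "w e \<in> N" if "e \<in> tlab t q" for e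
    unfolding w_def using that g(1) by (intro tmodD(7)[OF N]) (auto simp: tlab_def)
  have w1: "homog (pdeg pf dd e - pdeg pf \<delta> l) (w e l)" "w e l \<noteq> 0 \<Longrightarrow> tdeg b l = tdeg nn e"
    if "e \<in> tlab t q" for e l using w_bihom[OF that] unfolding bihom_def by (blast, blast)
  have T: "tmod t q (tsyz t q w)"
  proof (rule tsyz_tmod)
    fix A :: "label set" and s :: "label \<Rightarrow> ('v, 'k) laurent" and \<beta>
    assume "\<forall>l. (\<Sum>e\<in>A. s e * w e l) = 0"
    then show "\<forall>l. (\<Sum>e\<in>A. s e * w (fst e + \<beta>, snd e) l) = 0"
      unfolding w_def fst_conv snd_conv by (rule tsh_sum_zero)
  qed
  have Gr: "tgraded pf dd nn (tsyz t q w)"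
    by (rule tsyz_tgraded[where ld = "pdeg pf \<delta>" and lt = "tdeg b"]) (use w1 in auto)
  have "x = card (cones X) - Suc i" using Suc.hyps(2) by simp
  from Suc.hyps(1)[OF this T Gr] obtain \<Delta> where \<Delta>: "finite \<Delta>" "\<forall>x\<in>\<Delta>. fst x > Suc i"
    and van: "\<And>n d. (\<forall>(j, e, c)\<in>\<Delta>. \<forall>\<alpha>. set_mset \<alpha> \<subseteq> {..<t} \<longrightarrow> size \<alpha> + c = n \<longrightarrow>
       local_cohomology_vanishes X cl (cox X :: ('v, 'k) laurent set) j (d - e - mdeg pf \<alpha>)) \<Longrightarrow>
      vvanishes (tpart nn n (tsyz t q w)) (Suc i) (pdeg pf dd) d" by (elim exE conjE) blast
  \<comment> \<open>One new condition per generator: vanishing for S in cohomological degree i + 1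
    at its class, with \<alpha> filling its T-degree up to n.\<close>
  define \<Delta>' where "\<Delta>' = \<Delta> \<union> (\<lambda>k. (Suc i, dd k, nn k)) ` {..<q}"
  have "vvanishes (tpart b n N) i (pdeg pf \<delta>) d"
    if H: "\<forall>(j, e, c)\<in>\<Delta>'. \<forall>\<alpha>. set_mset \<alpha> \<subseteq> {..<t} \<longrightarrow> size \<alpha> + c = n \<longrightarrow>
       local_cohomology_vanishes X cl (cox X :: ('v, 'k) laurent set) j (d - e - mdeg pf \<alpha>)" for n d
  proof -
    let ?E = "{e \<in> tlab t q. tdeg nn e = n}"
    have fin: "finite ?E" by (rule finite_tlab_part)
    have "vvanishes (vspan ?E w) i (pdeg pf \<delta>) d"
    proof (rule dimension_shift[OF fin])
      fix e l assume "e \<in> ?E"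
      then show "w e l \<in> cox X \<and> homog (pdeg pf dd e - pdeg pf \<delta> l) (w e l)"
        using w1(1) tmodD(2)[OF N w_N] by auto
    next
      fix e assume e: "e \<in> ?E"
      then have "(Suc i, dd (snd e), nn (snd e)) \<in> \<Delta>'" by (auto simp: \<Delta>'_def tlab_def)
      then have "local_cohomology_vanishes X cl (cox X :: ('v, 'k) laurent set) (Suc i) (d - dd (snd e) - mdeg pf (fst e))"
        using H e by (auto simp: tlab_def tdeg_def)
      then show "local_cohomology_vanishes X cl (cox X :: ('v, 'k) laurent set) (Suc i) (d - pdeg pf dd e)"
        by (simp add: pdeg_def algebra_simps)
    next
      have "vvanishes (tpart nn n (tsyz t q w)) (Suc i) (pdeg pf dd) d"
        using H by (intro van) (auto simp: \<Delta>'_def)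
      moreover have "syz ?E w = tpart nn n (tsyz t q w)" by (rule tpart_tsyz[where lt = "tdeg b"]) (rule w1(2))
      ultimately show "vvanishes (syz ?E w) (Suc i) (pdeg pf dd) d" by simp
    qed
    moreover have "vspan ?E w = tpart b n N"
    proof (intro equalityI subsetI)
      fix v assume "v \<in> vspan ?E w"
      then obtain s where s: "\<forall>e\<in>?E. s e \<in> cox X" "v = (\<lambda>l. \<Sum>e\<in>?E. s e * w e l)" by (auto simp: vspan_def)
      have "(\<lambda>l. \<Sum>e\<in>A. s e * w e l) \<in> N" if "finite A" "A \<subseteq> ?E" for A
        using that
      proof (induction A rule: finite_induct)
        case empty
        then show ?case using tmodD(4)[OF N] by simp
      next
        case (insert y A)
        have "y \<in> ?E" using insert by blast
        then have "s y \<in> cox X" "y \<in> tlab t q" using s(1) by blast+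
        then have "(\<lambda>l. s y * w y l) \<in> N" by (intro tmodD(6)[OF N] w_N)
        then have "(\<lambda>l. s y * w y l + (\<Sum>e\<in>A. s e * w e l)) \<in> N"
          using insert tmodD(5)[OF N, of "\<lambda>l. s y * w y l"] by auto
        then show ?case using insert by simp
      qed
      then have "v \<in> N" using fin s(2) by blast
      moreover have "tdeg b l = n" if "v l \<noteq> 0" for l
      proof -
        obtain e where "e \<in> ?E" "s e * w e l \<noteq> 0" using \<open>v l \<noteq> 0\<close> unfolding s(2) by (meson sum.neutral)
        moreover from this have "w e l \<noteq> 0" by (metis mult_zero_right)
        ultimately show ?thesis using w1(2)[of e l] by auto
      qed
      ultimately show "v \<in> tpart b n N" by (simp add: tpart_def)
    next
      fix v assume v: "v \<in> tpart b n N"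
      then have "v \<in> tspan t (g ` {..<q})" using g(3) by (auto simp: tpart_def)
      then obtain s where s: "finite {e. s e \<noteq> 0}" "{e. s e \<noteq> 0} \<subseteq> tlab t q" "\<forall>e. s e \<in> cox X"
        "\<And>l. v l = (\<Sum>e | s e \<noteq> 0. s e * w e l)"
        using tspan_representation[of v t g q] unfolding w_def by blast
      have "v l = (\<Sum>e\<in>?E. s e * w e l)" for l
      proof (cases "tdeg b l = n")
        case True
        have "v l = (\<Sum>e\<in>{e. s e \<noteq> 0} \<inter> ?E. s e * w e l)"
          unfolding s(4)
        proof (rule sum.mono_neutral_right)
          show "\<forall>e\<in>{e. s e \<noteq> 0} - {e. s e \<noteq> 0} \<inter> ?E. s e * w e l = 0"
          proof
            fix e assume e: "e \<in> {e. s e \<noteq> 0} - {e. s e \<noteq> 0} \<inter> ?E"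
            then have "e \<in> tlab t q" "tdeg nn e \<noteq> n" using s(2) by auto
            then have "w e l = 0" using w1(2)[of e l] True by auto
            then show "s e * w e l = 0" by simp
          qed
        qed (use s(1) in auto)
        also have "\<dots> = (\<Sum>e\<in>?E. s e * w e l)"
          by (rule sum.mono_neutral_left[OF fin]) auto
        finally show ?thesis .
      next
        case False
        then have "v l = 0" using v unfolding tpart_def by blast
        moreover have "s e * w e l = 0" if "e \<in> ?E" for e
        proof -
          have "w e l = 0" using w1(2)[of e l] that False by auto
          then show ?thesis by simp
        qed
        ultimately show ?thesis by simp
      qed
      then have "v = (\<lambda>l. \<Sum>e\<in>?E. s e * w e l)" by (rule ext)
      moreover have "\<forall>e\<in>?E. s e \<in> cox X" using s(3) by blast
      ultimately show "v \<in> vspan ?E w" unfolding vspan_def by (intro CollectI exI[of _ s] conjI)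
    qed
    ultimately show ?thesis by simp
  qed
  moreover have "finite \<Delta>'" "\<forall>x\<in>\<Delta>'. fst x > i" using \<Delta> by (auto simp: \<Delta>'_def)
  ultimately show ?case by (intro exI[of _ \<Delta>']) blast
qed

section \<open>Products of generators and the Rees presentation of the powers\<close>

definition mprod :: "(nat \<Rightarrow> ('v, 'k::field) laurent) \<Rightarrow> nat multiset \<Rightarrow> ('v, 'k) laurent" where
  "mprod f \<alpha> = (\<Prod>i\<in>#\<alpha>. f i)"

lemma mprod_add: "mprod f (\<alpha> + \<beta>) = mprod f \<alpha> * mprod f \<beta>"
  by (simp add: mprod_def)

lemma mprod_cox: "(\<And>i. i < t \<Longrightarrow> f i \<in> cox X) \<Longrightarrow> set_mset \<alpha> \<subseteq> {..<t} \<Longrightarrow> mprod f \<alpha> \<in> cox X"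
  by (induction \<alpha>) (auto simp: mprod_def intro: cox_mult)

lemma mprod_homog: "(\<And>i. i < t \<Longrightarrow> homog (pf i) (f i)) \<Longrightarrow> set_mset \<alpha> \<subseteq> {..<t} \<Longrightarrow> homog (mdeg pf \<alpha>) (mprod f \<alpha>)"
  by (induction \<alpha>) (auto simp: mprod_def mdeg_def intro: homog_mult homog_one)

text \<open>The first dimension shift is made separately: the powers are ideals of S spanned by the
  products \<open>mprod f \<alpha>\<close>, and the relations among these products are the ideal of
  S[T] that defines the Rees ring, to which \<open>uniform_vanishing\<close> applies.\<close>

lemma uniform_vanishing_powers:
  fixes f :: "nat \<Rightarrow> ('v, 'k::field) laurent"
  assumes f: "\<And>i. i < t \<Longrightarrow> f i \<in> cox X \<and> homog (pf i) (f i)"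
  shows "\<exists>\<Delta>. finite \<Delta> \<and> (\<forall>x\<in>\<Delta>. fst x > i) \<and> (\<forall>n d.
    (\<forall>(j, e, c)\<in>\<Delta>. \<forall>\<alpha>. set_mset \<alpha> \<subseteq> {..<t} \<longrightarrow> size \<alpha> + c = n \<longrightarrow>
       local_cohomology_vanishes X cl (cox X :: ('v, 'k) laurent set) j (d - e - mdeg pf \<alpha>)) \<longrightarrow>
    local_cohomology_vanishes X cl (scomb X (multisets_of_size {..<t} n) (mprod f)) (Suc i) d)"
proof -
  define dd :: "nat \<Rightarrow> 'p" where "dd = (\<lambda>_. 0)"
  define nn :: "nat \<Rightarrow> nat" where "nn = (\<lambda>_. 0)"
  \<comment> \<open>The position l keeps different powers apart, so that a relation among products
    of all sizes is a relation in each size.\<close>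
  define w :: "label \<Rightarrow> nat \<Rightarrow> ('v, 'k) laurent" where
    "w e l = (if size (fst e) = l then mprod f (fst e) else 0)" for e l
  have w0: "homog (pdeg pf dd e) (mprod f (fst e))" "mprod f (fst e) \<in> cox X" if "e \<in> tlab t 1" for e
    using that f mprod_homog[of t pf f "fst e"] mprod_cox[of t f "fst e"]
    by (auto simp: tlab_def pdeg_def dd_def)
  have w1: "homog (pdeg pf dd e - 0) (w e l)" "w e l \<noteq> 0 \<Longrightarrow> l = tdeg nn e" if "e \<in> tlab t 1" for e l
    using w0[OF that] by (auto simp: w_def tdeg_def nn_def split: if_splits)
  have T: "tmod t 1 (tsyz t 1 w)"
  proof (rule tsyz_tmod)
    fix A s \<beta> assume A: "finite (A :: label set)" "\<forall>l. (\<Sum>e\<in>A. s e * w e l) = 0"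
    show "\<forall>l. (\<Sum>e\<in>A. s e * w (fst e + \<beta>, snd e) l) = 0"
    proof
      fix l
      show "(\<Sum>e\<in>A. s e * w (fst e + \<beta>, snd e) l) = 0"
      proof (cases "size \<beta> \<le> l")
        case True
        have "(\<Sum>e\<in>A. s e * w (fst e + \<beta>, snd e) l) = mprod f \<beta> * (\<Sum>e\<in>A. s e * w e (l - size \<beta>))"
          unfolding sum_distrib_left using True by (intro sum.cong) (auto simp: w_def mprod_add)
        then show ?thesis using A(2) by simp
      next
        case False
        then show ?thesis by (intro sum.neutral) (auto simp: w_def)
      qed
    qed
  qed
  have Gr: "tgraded pf dd nn (tsyz t 1 w)"
    by (rule tsyz_tgraded[where ld = "\<lambda>_. 0" and lt = "\<lambda>l. l"]) (use w1 in auto)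
  obtain \<Delta> where \<Delta>: "finite \<Delta>" "\<forall>x\<in>\<Delta>. fst x > Suc i"
    and van: "\<And>n d. (\<forall>(j, e, c)\<in>\<Delta>. \<forall>\<alpha>. set_mset \<alpha> \<subseteq> {..<t} \<longrightarrow> size \<alpha> + c = n \<longrightarrow>
       local_cohomology_vanishes X cl (cox X :: ('v, 'k) laurent set) j (d - e - mdeg pf \<alpha>)) \<Longrightarrow>
      vvanishes (tpart nn n (tsyz t 1 w)) (Suc i) (pdeg pf dd) d"
    using uniform_vanishing[OF T Gr, of "Suc i"] by (elim exE conjE) blast
  \<comment> \<open>The added triple stands for the free module on the products themselves: the
    basis element of S[T] has class 0 and T-degree 0.\<close>
  define \<Delta>' where "\<Delta>' = insert (Suc i, 0, 0) \<Delta>"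
  have "local_cohomology_vanishes X cl (scomb X (multisets_of_size {..<t} n) (mprod f)) (Suc i) d"
    if H: "\<forall>(j, e, c)\<in>\<Delta>'. \<forall>\<alpha>. set_mset \<alpha> \<subseteq> {..<t} \<longrightarrow> size \<alpha> + c = n \<longrightarrow>
       local_cohomology_vanishes X cl (cox X :: ('v, 'k) laurent set) j (d - e - mdeg pf \<alpha>)" for n d
  proof -
    let ?E = "{e \<in> tlab t 1. tdeg nn e = n}"
    let ?A = "multisets_of_size {..<t} n"
    have E: "?E = (\<lambda>\<alpha>. (\<alpha>, 0)) ` ?A"
      by (auto simp: tlab_def tdeg_def nn_def multisets_of_size_def)
    define w' :: "label \<Rightarrow> unit \<Rightarrow> ('v, 'k) laurent" where "w' e l = mprod f (fst e)" for e l
    have "vvanishes (vspan ?E w') i (\<lambda>_. 0) d"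
    proof (rule dimension_shift[OF finite_tlab_part])
      fix e l assume "e \<in> ?E"
      then show "w' e l \<in> cox X \<and> homog (pdeg pf dd e - 0) (w' e l)" using w0 by (simp add: w'_def)
    next
      fix e assume e: "e \<in> ?E"
      then have "local_cohomology_vanishes X cl (cox X :: ('v, 'k) laurent set) (Suc i) (d - 0 - mdeg pf (fst e))"
        using H by (auto simp: \<Delta>'_def tlab_def tdeg_def nn_def)
      then show "local_cohomology_vanishes X cl (cox X :: ('v, 'k) laurent set) (Suc i) (d - pdeg pf dd e)"
        by (simp add: pdeg_def dd_def)
    next
      have "vvanishes (tpart nn n (tsyz t 1 w)) (Suc i) (pdeg pf dd) d"
        using H by (intro van) (auto simp: \<Delta>'_def)
      moreover have "syz ?E w = tpart nn n (tsyz t 1 w)" by (rule tpart_tsyz[where lt = "\<lambda>l. l"]) (rule w1(2))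
      moreover have "syz ?E w' = syz ?E w"
      proof -
        have "(\<Sum>e\<in>?E. s e * w e l) = (if l = n then \<Sum>e\<in>?E. s e * w' e () else 0)" for s l
          by (auto simp: w_def w'_def tdeg_def nn_def intro!: sum.cong sum.neutral)
        then show ?thesis unfolding syz_def by auto
      qed
      ultimately show "vvanishes (syz ?E w') (Suc i) (pdeg pf dd) d" by simp
    qed
    moreover have "vspan ?E w' = {v. v () \<in> scomb X ?A (mprod f)}"
    proof -
      have inj: "inj_on (\<lambda>\<alpha>. (\<alpha>, 0::nat)) ?A" by (auto simp: inj_on_def)
      have sm: "(\<Sum>e\<in>?E. s e * w' e l) = (\<Sum>\<alpha>\<in>?A. s (\<alpha>, 0) * mprod f \<alpha>)" for s l
        unfolding E by (subst sum.reindex[OF inj]) (simp add: w'_def)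
      show ?thesis
      proof (intro equalityI subsetI)
        fix v assume "v \<in> vspan ?E w'"
        then obtain s where s: "\<forall>e\<in>?E. s e \<in> cox X" "v = (\<lambda>l. \<Sum>e\<in>?E. s e * w' e l)" by (auto simp: vspan_def)
        have "v () = (\<Sum>\<alpha>\<in>?A. s (\<alpha>, 0) * mprod f \<alpha>)" unfolding s(2) sm ..
        moreover have "\<forall>\<alpha>\<in>?A. s (\<alpha>, 0) \<in> cox X" using s(1) unfolding E by blast
        ultimately show "v \<in> {v. v () \<in> scomb X ?A (mprod f)}"
          unfolding scomb_def by (intro CollectI exI[of _ "\<lambda>\<alpha>. s (\<alpha>, 0)"]) simp
      next
        fix v assume "v \<in> {v. v () \<in> scomb X ?A (mprod f)}"
        then obtain s where s: "\<forall>\<alpha>\<in>?A. s \<alpha> \<in> cox X" "v () = (\<Sum>\<alpha>\<in>?A. s \<alpha> * mprod f \<alpha>)" by (auto simp: scomb_def)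
        have "v = (\<lambda>l. \<Sum>e\<in>?E. s (fst e) * w' e l)"
          unfolding sm[of "\<lambda>e. s (fst e)"] using s(2) by (simp add: fun_eq_iff)
        moreover have "\<forall>e\<in>?E. s (fst e) \<in> cox X" using s(1) unfolding E by auto
        ultimately show "v \<in> vspan ?E w'" unfolding vspan_def by (intro CollectI exI[of _ "\<lambda>e. s (fst e)"]) simp
      qed
    qed
    moreover have "mprod f ` ?A \<subseteq> cox X"
      using f by (auto simp: multisets_of_size_def intro!: mprod_cox[of t])
    ultimately show ?thesis
      by (intro vanishes_of_vvanishes submod_scomb scomb_subset_cox) simp_all
  qed
  moreover have "finite \<Delta>'" "\<forall>x\<in>\<Delta>'. fst x > i" using \<Delta> by (auto simp: \<Delta>'_def)
  ultimately show ?thesis by (intro exI[of _ \<Delta>']) blast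
qed

end

section \<open>Powers of ideals\<close>

context toric_var
begin

lemma scomb_bilinear:
  fixes v :: "'i \<Rightarrow> ('v, 'k::field) laurent"
  assumes "submod X T" "\<And>i j. i \<in> A \<Longrightarrow> j \<in> B \<Longrightarrow> v i * w j \<in> T" "x \<in> scomb X A v" "y \<in> scomb X B w"
  shows "x * y \<in> T"
proof -
  have "submod X {y. v i * y \<in> T}" for i
    using assms(1) unfolding submod_def by (auto simp: distrib_left mult.left_commute)
  then have 1: "v i * y \<in> T" if "i \<in> A" for i
    using scomb_minimal[of X "{y. v i * y \<in> T}" w B] assms(2,4) that by blast
  have "submod X {x. x * y \<in> T}"
    using assms(1) unfolding submod_def by (auto simp: distrib_right mult.assoc)
  then show ?thesis using scomb_minimal[of X "{x. x * y \<in> T}" v A] assms(3) 1 by blast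
qed

lemma ideal_power_eq_scomb:
  fixes f :: "nat \<Rightarrow> ('v, 'k::field) laurent"
  assumes f: "\<And>i. i < s \<Longrightarrow> f i \<in> cox X" and I: "I = genideal (cox_ring X) (f ` {..<s})"
  shows "I [^]\<^bsub>ideals_set (cox_ring X)\<^esub> n = scomb X (multisets_of_size {..<s} n) (mprod f)"
proof -
  interpret R: cring "cox_ring X :: ('v, 'k) laurent ring" by (rule cring_cox)
  interpret M: comm_monoid "ideals_set (cox_ring X :: ('v, 'k) laurent ring)"
    by (rule R.ideals_set_is_comm_monoid)
  have I': "I = scomb X {..<s} f" unfolding I using f by (intro genideal_eq_scomb) auto
  have mp: "mprod f ` multisets_of_size {..<s} n \<subseteq> cox X" for n
    using f by (auto simp: multisets_of_size_def intro!: mprod_cox[of s])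
  have id: "ideal (scomb X (multisets_of_size {..<s} n) (mprod f)) (cox_ring X)" for n
    unfolding ideal_cox_iff by (intro conjI submod_scomb scomb_subset_cox mp)
  have idI: "ideal I (cox_ring X)"
    unfolding ideal_cox_iff I' using f by (intro conjI submod_scomb scomb_subset_cox) auto
  show ?thesis
  proof (induction n)
    case 0
    have "(cox X :: ('v, 'k) laurent set) = scomb X {{#}} (mprod f)"
      by (auto simp: scomb_def mprod_def)
    then show ?case by (simp add: ideals_set_def)
  next
    case (Suc n)
    let ?J = "scomb X (multisets_of_size {..<s} n) (mprod f)" and ?T = "scomb X (multisets_of_size {..<s} (Suc n)) (mprod f)"
    have fin: "finite (multisets_of_size {..<s} n)" for n by (intro finite_multisets_of_size) simp
    have "I [^]\<^bsub>ideals_set (cox_ring X)\<^esub> Suc n = ideal_prod (cox_ring X) ?J I"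
      unfolding M.nat_pow_Suc Suc by (simp add: ideals_set_def)
    also have "\<dots> = ?T"
    proof
      show "ideal_prod (cox_ring X) ?J I \<subseteq> ?T"
      proof
        fix x assume "x \<in> ideal_prod (cox_ring X) ?J I"
        then show "x \<in> ?T"
        proof (induction rule: ideal_prod.induct)
          case (prod i j)
          have "i * j \<in> ?T"
          proof (rule scomb_bilinear[OF submod_scomb _ prod(1)])
            show "j \<in> scomb X {..<s} f" using prod(2) I' by simp
            fix \<alpha> k assume a: "\<alpha> \<in> multisets_of_size {..<s} n" "k \<in> {..<s}"
            then have "add_mset k \<alpha> \<in> multisets_of_size {..<s} (Suc n)" by (auto simp: multisets_of_size_def)
            then have "mprod f (add_mset k \<alpha>) \<in> ?T" by (rule scomb_gen[OF fin])
            then show "mprod f \<alpha> * f k \<in> ?T" by (simp add: mprod_def mult.commute)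
          qed
          then show ?case by simp
        next
          case (sum x y)
          then show ?case using submod_add[OF submod_scomb] by simp
        qed
      qed
      have ip: "ideal (ideal_prod (cox_ring X) ?J I) (cox_ring X)"
        by (rule R.ideal_prod_is_ideal[OF id idI])
      show "?T \<subseteq> ideal_prod (cox_ring X) ?J I"
      proof (rule scomb_minimal)
        show "submod X (ideal_prod (cox_ring X) ?J I)" using ip by (simp add: ideal_cox_iff)
        show "mprod f ` multisets_of_size {..<s} (Suc n) \<subseteq> ideal_prod (cox_ring X) ?J I"
        proof
          fix x assume "x \<in> mprod f ` multisets_of_size {..<s} (Suc n)"
          then obtain \<beta> where \<beta>: "x = mprod f \<beta>" "set_mset \<beta> \<subseteq> {..<s}" "size \<beta> = Suc n"
            by (auto simp: multisets_of_size_def)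
          then obtain k \<alpha> where k: "\<beta> = add_mset k \<alpha>" by (metis size_eq_Suc_imp_eq_union)
          have "mprod f \<alpha> \<in> ?J" using \<beta> k by (intro scomb_gen[OF fin]) (auto simp: multisets_of_size_def)
          moreover have "f k \<in> I" unfolding I' using \<beta> k by (intro scomb_gen) auto
          ultimately have "mprod f \<alpha> \<otimes>\<^bsub>cox_ring X\<^esub> f k \<in> ideal_prod (cox_ring X) ?J I"
            by (rule ideal_prod.prod)
          then show "x \<in> ideal_prod (cox_ring X) ?J I" by (simp add: \<beta>(1) k mprod_def mult.commute)
        qed
      qed
    qed
    finally show ?case .
  qed
qed

text \<open>Nakayama's lemma at the prime \<open>P\<close>, by elimination of one generator at a time.\<close>

lemma nakayama:
  fixes w :: "'i \<Rightarrow> ('v, 'k::field) laurent"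
  assumes P: "subvariety X cl P" and "finite E"
    and "\<And>e. e \<in> E \<Longrightarrow> \<exists>s p. s \<in> cox X \<and> s \<notin> P \<and> (\<forall>x\<in>E. p x \<in> P) \<and> s * w e = (\<Sum>x\<in>E. p x * w x)"
  shows "\<forall>e\<in>E. w e = 0"
  using assms(2,3)
proof (induction E rule: finite_induct)
  case (insert y E)
  note sm = subvarietyD(1)[OF P] and Pc = subvarietyD(2)[OF P]
  have prime: "a * b \<notin> P" if "a \<in> cox X" "b \<in> cox X" "a \<notin> P" "b \<notin> P" for a b
    using subvarietyD(4)[OF P that(1,2)] that(3,4) by blast
  have nz: "a \<noteq> 0" if "a \<notin> P" for a using that submod_zero[OF sm] by auto
  obtain s p where s: "s \<in> cox X" "s \<notin> P" "\<forall>x\<in>insert y E. p x \<in> P" "s * w y = (\<Sum>x\<in>insert y E. p x * w x)"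
    using insert.prems[of y] by blast
  \<comment> \<open>t lies outside P, and t times \<open>w y\<close> is a combination of the other
    generators with coefficients in P; after multiplication by t, \<open>w y\<close> can be
    eliminated from their relations.\<close>
  define t where "t = s - p y"
  have tc: "t \<in> cox X" using s Pc by (auto simp: t_def intro: cox_diff)
  have tP: "t \<notin> P"
  proof
    assume "t \<in> P"
    then have "t + p y \<in> P" using s by (intro submod_add[OF sm]) auto
    then show False using s by (simp add: t_def)
  qed
  have ty: "t * w y = (\<Sum>x\<in>E. p x * w x)"
    using s(4) insert.hyps by (simp add: t_def left_diff_distrib)
  have 0: "\<forall>e\<in>E. w e = 0"
  proof (rule insert.IH)
    fix e assume e: "e \<in> E"
    obtain s' q where s': "s' \<in> cox X" "s' \<notin> P" "\<forall>x\<in>insert y E. q x \<in> P" "s' * w e = (\<Sum>x\<in>insert y E. q x * w x)"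
      using insert.prems[of e] e by blast
    have "(t * s') * w e = t * (q y * w y + (\<Sum>x\<in>E. q x * w x))"
      using s'(4) insert.hyps by (simp add: mult.assoc)
    also have "\<dots> = q y * (t * w y) + t * (\<Sum>x\<in>E. q x * w x)" by (simp add: distrib_left mult.left_commute)
    also have "\<dots> = (\<Sum>x\<in>E. (q y * p x + t * q x) * w x)"
      unfolding ty by (simp add: sum_distrib_left sum.distrib distrib_right mult.assoc)
    finally have "(t * s') * w e = (\<Sum>x\<in>E. (q y * p x + t * q x) * w x)" .
    moreover have "\<forall>x\<in>E. q y * p x + t * q x \<in> P"
      using s s' tc Pc by (auto intro!: submod_add[OF sm] submod_smult[OF sm])
    ultimately show "\<exists>s p. s \<in> cox X \<and> s \<notin> P \<and> (\<forall>x\<in>E. p x \<in> P) \<and> s * w e = (\<Sum>x\<in>E. p x * w x)"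
      using prime[OF tc s'(1) tP s'(2)] cox_mult[OF tc s'(1)]
      by (intro exI[of _ "t * s'"] exI[of _ "\<lambda>x. q y * p x + t * q x"]) simp
  qed
  then have "t * w y = 0" unfolding ty by simp
  then have "w y = 0" using laurent_mult_nonzero[OF nz[OF tP], of "w y"] by blast
  then show ?case using 0 by simp
qed simp

lemma Nef_add: "d \<in> Nef TYPE('k::field) X cl \<Longrightarrow> e \<in> Nef TYPE('k) X cl \<Longrightarrow> d + e \<in> Nef TYPE('k) X cl"
  by (simp add: Nef_iff_bpf bpf_add)

lemma Nef_0: "0 \<in> Nef TYPE('k::field) X cl"
  unfolding Nef_iff_bpf bpf_def by (intro ballI bexI[of _ 0]) auto

lemma Nef_nat_mult: "d \<in> Nef TYPE('k::field) X cl \<Longrightarrow> n \<odot> d \<in> Nef TYPE('k) X cl"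
  by (induction n) (simp_all add: Nef_0 nat_mult_Suc Nef_add)

lemma mdeg_diff_Nef:
  assumes "set_mset \<alpha> \<subseteq> A" "\<And>i. i \<in> A \<Longrightarrow> p i - q \<in> Nef TYPE('k::field) X cl"
  shows "mdeg p \<alpha> - size \<alpha> \<odot> q \<in> Nef TYPE('k) X cl"
  using assms(1)
proof (induction \<alpha>)
  case (add x \<alpha>)
  then have "(p x - q) + (mdeg p \<alpha> - size \<alpha> \<odot> q) \<in> Nef TYPE('k) X cl"
    using assms(2) by (intro Nef_add) auto
  then show ?case by (simp add: mdeg_def nat_mult_Suc algebra_simps)
qed (simp add: mdeg_def Nef_0)

lemma mdeg_diff_Nef':
  assumes "set_mset \<alpha> \<subseteq> A" "\<And>i. i \<in> A \<Longrightarrow> q - p i \<in> Nef TYPE('k::field) X cl"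
  shows "size \<alpha> \<odot> q - mdeg p \<alpha> \<in> Nef TYPE('k) X cl"
  using assms(1)
proof (induction \<alpha>)
  case (add x \<alpha>)
  then have "(q - p x) + (size \<alpha> \<odot> q - mdeg p \<alpha>) \<in> Nef TYPE('k) X cl"
    using assms(2) by (intro Nef_add) auto
  then show ?case by (simp add: mdeg_def nat_mult_Suc algebra_simps)
qed (simp add: mdeg_def Nef_0)

section \<open>The outer bound\<close>

lemma generated_monoid_induct:
  assumes "finite C" "x \<in> generated_monoid C" "P 0" "\<And>c y. c \<in> C \<Longrightarrow> P y \<Longrightarrow> P (c + y)"
  shows "P x"
proof -
  obtain \<mu> where x: "x = (\<Sum>c\<in>C. \<mu> c \<odot> c)" using assms(2) by (auto simp: generated_monoid_def)
  have step: "P (n \<odot> c + y)" if "c \<in> C" "P y" for n c y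
    using that by (induction n) (auto simp: nat_mult_Suc add.assoc intro: assms(4))
  have "P (\<Sum>c\<in>D. \<mu> c \<odot> c)" if "D \<subseteq> C" for D
    using finite_subset[OF that assms(1)] that
    by (induction D rule: finite_induct) (auto intro: assms(3) step)
  then show ?thesis using x by simp
qed

lemma generator_Nef:
  assumes "minimal_generators cs (Nef TYPE('k::field) X cl)" "c \<in> set cs"
  shows "c \<in> Nef TYPE('k) X cl"
proof -
  have "(\<Sum>x\<in>set cs. (if x = c then 1 else 0) \<odot> x) = (\<Sum>x\<in>set cs. if x = c then c else 0)"
    by (intro sum.cong) auto
  then have "c = (\<Sum>x\<in>set cs. (if x = c then 1 else 0) \<odot> x)" using assms(2) by simp
  then have "c \<in> generated_monoid (set cs)"
    unfolding generated_monoid_def by (intro CollectI exI[of _ "\<lambda>x. if x = c then 1 else 0"]) simp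
  then show ?thesis using assms(1) by (simp add: minimal_generators_def)
qed

lemma regularD:
  assumes "regular X cl cs (M :: ('v, 'k::field) laurent set) d"
    "i > 0" "(\<Sum>j<length cs. l j) = i - 1" "e \<in> Nef TYPE('k) X cl"
  shows "local_cohomology_vanishes X cl M i (d - (\<Sum>j<length cs. l j \<odot> cs ! j) + e)"
  using assms unfolding regular_def by blast

lemma regular_add_Nef:
  assumes "regular X cl cs (M :: ('v, 'k::field) laurent set) d" "x \<in> Nef TYPE('k) X cl"
  shows "regular X cl cs M (d + x)"
  unfolding regular_def
proof (intro conjI allI impI ballI)
  fix i :: nat and l :: "nat \<Rightarrow> nat" and e
  assume "i > 0" "(\<Sum>j<length cs. l j) = i - 1" "e \<in> Nef TYPE('k) X cl"
  from regularD[OF assms(1) this(1,2) Nef_add[OF assms(2) this(3)]]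
  show "local_cohomology_vanishes X cl M i (d + x - (\<Sum>j<length cs. l j \<odot> cs ! j) + e)"
    by (simp add: algebra_simps)
next
  fix j e assume "j < length cs" "e \<in> Nef TYPE('k) X cl"
  then have "local_cohomology_vanishes X cl M 0 (d + cs ! j + (x + e))"
    using assms Nef_add unfolding regular_def by blast
  then show "local_cohomology_vanishes X cl M 0 (d + x + cs ! j + e)" by (simp add: algebra_simps)
qed

lemma regular_generation_step:
  fixes M :: "('v, 'k::field) laurent set"
  assumes mg: "minimal_generators cs (Nef TYPE('k) X cl)"
    and M: "submod X M" "M \<subseteq> cox X" and reg: "regular X cl cs M d" and c: "c \<in> set cs"
    and m: "m \<in> M" "homog (d + c) m" and T: "submod X T" "\<And>b. b \<in> M \<Longrightarrow> homog d b \<Longrightarrow> b \<in> T"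
  shows "m \<in> T"
proof -
  obtain j where j: "j < length cs" "c = cs ! j" using c by (metis in_set_conv_nth)
  have "bpf c" using generator_Nef[OF mg c] Nef_iff_bpf by blast
  then have "\<forall>\<sigma>. \<exists>D. \<sigma> \<in> max_cones X \<longrightarrow> D \<in> exps X \<and> cl D = c \<and> (\<forall>\<rho>\<in>\<sigma>. lk D \<rho> = 0)"
    unfolding bpf_def by blast
  from choice[OF this] obtain y where y: "\<forall>\<sigma>. \<sigma> \<in> max_cones X \<longrightarrow> y \<sigma> \<in> exps X \<and> cl (y \<sigma>) = c \<and> (\<forall>\<rho>\<in>\<sigma>. lk (y \<sigma>) \<rho> = 0)" ..
  \<comment> \<open>Regularity is used with \<lambda> concentrated at j: twisting by (i - 1) c is
    exactly what the Koszul complex on sections of c requires.\<close>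
  have van: "local_cohomology_vanishes X cl M i (d + c - i \<odot> c)" if i: "i > 0" for i
  proof -
    let ?l = "\<lambda>k. if k = j then i - 1 else 0"
    have "(\<Sum>k<length cs. ?l k) = i - 1" using j by simp
    from regularD[OF reg i this Nef_0]
    have "local_cohomology_vanishes X cl M i (d - (\<Sum>k<length cs. ?l k \<odot> cs ! k) + 0)" .
    moreover have "(\<Sum>k<length cs. ?l k \<odot> cs ! k) = (\<Sum>k<length cs. if k = j then (i - 1) \<odot> c else 0)"
      using j by (intro sum.cong) auto
    moreover have "i \<odot> c = c + (i - 1) \<odot> c" using i nat_mult_Suc[of "i - 1" c] by simp
    ultimately show ?thesis using j by (simp add: algebra_simps)
  qed
  obtain b where b: "\<forall>\<sigma>\<in>max_cones X. b \<sigma> \<in> M \<and> homog d (b \<sigma>)" "m = (\<Sum>\<sigma>\<in>max_cones X. mon (y \<sigma>) * b \<sigma>)"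
    using vanishing_imp_generation[OF M _ van m, of y] y by blast
  show ?thesis unfolding b(2)
    using b(1) T(2) y by (intro submod_sum[OF T(1)] submod_mon[OF T(1)]) auto
qed

text \<open>The class e is built up from generators one at a time; since regularity persists when a
  nef class is added to d, each addition is a case of the previous lemma. T is any submodule
  containing the elements of degree d, so that it can later be P times the power.\<close>

lemma regular_generation:
  fixes M :: "('v, 'k::field) laurent set"
  assumes mg: "minimal_generators cs (Nef TYPE('k) X cl)"
    and M: "submod X M" "M \<subseteq> cox X" and reg: "regular X cl cs M d" and e: "e \<in> Nef TYPE('k) X cl"
    and m: "m \<in> M" "homog (d + e) m" and T: "submod X T" "\<And>b. b \<in> M \<Longrightarrow> homog d b \<Longrightarrow> b \<in> T"
  shows "m \<in> T"
proof -
  have e': "e \<in> generated_monoid (set cs)" using e mg by (simp add: minimal_generators_def)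
  define Q where "Q y \<longleftrightarrow> y \<in> Nef TYPE('k) X cl \<and> (\<forall>m\<in>M. homog (d + y) m \<longrightarrow> m \<in> T)" for y
  have "Q e"
  proof (rule generated_monoid_induct[of "set cs" e Q, OF _ e'])
    show "Q 0" using T(2) by (simp add: Q_def Nef_0)
    fix c y assume c: "c \<in> set cs" and "Q y"
    then have y: "y \<in> Nef TYPE('k) X cl" "\<And>m. m \<in> M \<Longrightarrow> homog (d + y) m \<Longrightarrow> m \<in> T" by (auto simp: Q_def)
    have "c + y \<in> Nef TYPE('k) X cl" by (intro Nef_add generator_Nef[OF mg c] y(1))
    moreover have "m \<in> T" if "m \<in> M" "homog (d + (c + y)) m" for m
    proof (rule regular_generation_step[OF mg M regular_add_Nef[OF reg y(1)] c that(1) _ T(1) y(2)])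
      show "homog (d + y + c) m" using that(2) by (simp add: add_ac)
    qed
    ultimately show "Q (c + y)" by (simp add: Q_def)
  qed simp
  then show ?thesis using m by (simp add: Q_def)
qed

lemma outer_bound:
  fixes f :: "nat \<Rightarrow> ('v, 'k::field) laurent"
  assumes mg: "minimal_generators cs (Nef TYPE('k) X cl)"
    and f: "\<And>i. i < s \<Longrightarrow> f i \<noteq> 0 \<and> f i \<in> cox X \<and> homog (p i) (f i)" and s: "s > 0"
    and q: "\<And>i. i < s \<Longrightarrow> p i - q \<in> Nef TYPE('k) X cl"
    and reg: "regular X cl cs (scomb X (multisets_of_size {..<s} n) (mprod f)) d"
  shows "d - n \<odot> q \<in> Nef TYPE('k) X cl"
proof -
  let ?A = "multisets_of_size {..<s} n"
  let ?M = "scomb X ?A (mprod f)"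
  have finA: "finite ?A" by (intro finite_multisets_of_size) simp
  have A: "set_mset \<alpha> \<subseteq> {..<s}" "size \<alpha> = n" if "\<alpha> \<in> ?A" for \<alpha> using that by (auto simp: multisets_of_size_def)
  have mc: "mprod f \<alpha> \<in> cox X" "homog (mdeg p \<alpha>) (mprod f \<alpha>)" if "\<alpha> \<in> ?A" for \<alpha>
    using A[OF that] f mprod_cox[of s f \<alpha>] mprod_homog[of s p f \<alpha>] by auto
  have M: "submod X ?M" "?M \<subseteq> cox X" using mc by (auto intro!: submod_scomb scomb_subset_cox)
  have nonzero: "\<exists>\<alpha>\<in>?A. mprod f \<alpha> \<noteq> 0"
  proof
    have "mprod f (replicate_mset k 0) \<noteq> 0" for k
    proof (induction k)
      case (Suc k)
      then show ?case using laurent_mult_nonzero[of "f 0" "mprod f (replicate_mset k 0)"] f[of 0] s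
        by (simp add: mprod_def)
    qed (simp add: mprod_def)
    then show "mprod f (replicate_mset n 0) \<noteq> 0" .
    show "replicate_mset n 0 \<in> ?A" using s by (auto simp: multisets_of_size_def)
  qed
  show ?thesis
    unfolding Nef_def
  proof (intro CollectI allI impI)
    fix P :: "('v, 'k) laurent set" and k
    assume "curve X cl P \<and> intersection_number X cl P (d - n \<odot> q) k"
    then have P: "subvariety X cl P" and i: "intersection_number X cl P (d - n \<odot> q) k" by (auto simp: curve_def)
    note sm = subvarietyD(1)[OF P] and Pc = subvarietyD(2)[OF P]
    \<comment> \<open>The product of P with the power. If it contained all elements of degree d of
      the power, Nakayama would make the power zero.\<close>
    define T where "T = {\<Sum>\<alpha>\<in>?A. g \<alpha> * mprod f \<alpha> | g. \<forall>\<alpha>\<in>?A. g \<alpha> \<in> P}"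
    have T: "submod X T"
      unfolding submod_def
    proof (intro conjI ballI)
      show "0 \<in> T" unfolding T_def using submod_zero[OF sm] by (intro CollectI exI[of _ "\<lambda>_. 0"]) simp
    next
      fix a b assume "a \<in> T" "b \<in> T"
      then obtain g h where "\<forall>\<alpha>\<in>?A. g \<alpha> \<in> P" "\<forall>\<alpha>\<in>?A. h \<alpha> \<in> P"
        "a = (\<Sum>\<alpha>\<in>?A. g \<alpha> * mprod f \<alpha>)" "b = (\<Sum>\<alpha>\<in>?A. h \<alpha> * mprod f \<alpha>)" unfolding T_def by blast
      then show "a + b \<in> T" unfolding T_def
        by (intro CollectI exI[of _ "\<lambda>\<alpha>. g \<alpha> + h \<alpha>"]) (auto simp: distrib_right sum.distrib intro: submod_add[OF sm])
    next
      fix c a :: "('v, 'k) laurent" assume c: "c \<in> cox X" and "a \<in> T"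
      then obtain g where "\<forall>\<alpha>\<in>?A. g \<alpha> \<in> P" "a = (\<Sum>\<alpha>\<in>?A. g \<alpha> * mprod f \<alpha>)" unfolding T_def by blast
      then show "c * a \<in> T" unfolding T_def
        using c by (intro CollectI exI[of _ "\<lambda>\<alpha>. c * g \<alpha>"]) (auto simp: mult.assoc sum_distrib_left intro: submod_smult[OF sm])
    qed
    have "\<exists>m. m \<in> ?M \<and> homog d m \<and> m \<notin> T"
    proof (rule ccontr)
      assume "\<nexists>m. m \<in> ?M \<and> homog d m \<and> m \<notin> T"
      then have MT: "\<And>m. m \<in> ?M \<Longrightarrow> homog d m \<Longrightarrow> m \<in> T" by blast
      have "\<forall>\<alpha>\<in>?A. mprod f \<alpha> = 0"
      proof (rule nakayama[OF P finA])
        fix \<alpha> assume \<alpha>: "\<alpha> \<in> ?A"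
        \<comment> \<open>A large multiple of A has a section not vanishing on the curve, and
          multiplication by it raises the degree of the product to d plus a nef class, where
          \<open>regular_generation\<close> applies.\<close>
        obtain A where "ample X cl A" using ample_ex .
        then have "\<forall>\<^sub>F j in sequentially. bpf (j \<odot> A + 0) \<and> bpf (j \<odot> A + (mdeg p \<alpha> - d))"
          by (intro eventually_conj ample_absorbs)
        then obtain j where j: "bpf (j \<odot> A)" "bpf (j \<odot> A + (mdeg p \<alpha> - d))"
          using eventually_happens'[OF sequentially_bot] by (metis (no_types, lifting) add.right_neutral)
        obtain D where D: "D \<in> exps X" "cl D = j \<odot> A" "(mon D :: ('v, 'k) laurent) \<notin> P"
          using bpf_section[OF P j(1)] .
        have "mon D * mprod f \<alpha> \<in> T"
        proof (rule regular_generation[OF mg M reg _ _ _ T MT])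
          show "j \<odot> A + (mdeg p \<alpha> - d) \<in> Nef TYPE('k) X cl" using j(2) by (simp add: Nef_iff_bpf)
          show "mon D * mprod f \<alpha> \<in> ?M"
            by (intro submod_mon[OF M(1) D(1)] scomb_gen finA \<alpha>)
          have "homog (cl D + mdeg p \<alpha>) (mon D * mprod f \<alpha>)"
            using D mc[OF \<alpha>] by (intro homog_mult homog_single exps_divisors) auto
          then show "homog (d + (j \<odot> A + (mdeg p \<alpha> - d))) (mon D * mprod f \<alpha>)" using D by simp
        qed
        then obtain g where "\<forall>\<alpha>\<in>?A. g \<alpha> \<in> P" "mon D * mprod f \<alpha> = (\<Sum>\<alpha>\<in>?A. g \<alpha> * mprod f \<alpha>)"
          unfolding T_def by blast
        then show "\<exists>s g. s \<in> cox X \<and> s \<notin> P \<and> (\<forall>x\<in>?A. g x \<in> P) \<and> s * mprod f \<alpha> = (\<Sum>x\<in>?A. g x * mprod f x)"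
          using D cox_single[OF D(1), of 1] by (intro exI[of _ "mon D"] exI[of _ g]) simp
      qed
      then show False using nonzero by blast
    qed
    then obtain m where m: "m \<in> ?M" "homog d m" "m \<notin> T" by blast
    then obtain g where g: "\<forall>\<alpha>\<in>?A. g \<alpha> \<in> cox X" "m = (\<Sum>\<alpha>\<in>?A. g \<alpha> * mprod f \<alpha>)" by (auto simp: scomb_def)
    define g' where "g' \<alpha> = hc (d - mdeg p \<alpha>) (g \<alpha>)" for \<alpha>
    have "m = hc d m" using m(2) by (simp add: hc_homog)
    also have "\<dots> = (\<Sum>\<alpha>\<in>?A. hc d (g \<alpha> * mprod f \<alpha>))" unfolding g(2) by (rule hc_sum)
    also have "\<dots> = (\<Sum>\<alpha>\<in>?A. g' \<alpha> * mprod f \<alpha>)"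
    proof (rule sum.cong[OF refl])
      fix \<alpha> assume \<alpha>: "\<alpha> \<in> ?A"
      show "hc d (g \<alpha> * mprod f \<alpha>) = g' \<alpha> * mprod f \<alpha>"
        using hc_mult[OF cox_divisors mc(2)[OF \<alpha>], of "g \<alpha>" "d - mdeg p \<alpha>"] g(1) \<alpha> by (simp add: g'_def)
    qed
    finally have "m = (\<Sum>\<alpha>\<in>?A. g' \<alpha> * mprod f \<alpha>)" .
    then have "\<not> (\<forall>\<alpha>\<in>?A. g' \<alpha> \<in> P)" using m(3) unfolding T_def by blast
    then obtain \<alpha> where \<alpha>: "\<alpha> \<in> ?A" "g' \<alpha> \<notin> P" by blast
    have "g \<alpha> \<in> cox X" using g(1) \<alpha>(1) by blast
    then have g'c: "g' \<alpha> \<in> cox X" "homog (d - mdeg p \<alpha>) (g' \<alpha>)"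
      unfolding g'_def by (rule hc_cox, intro homog_hc cox_divisors)
    \<comment> \<open>The coefficient has degree \<open>d - mdeg p \<alpha>\<close>; a section of
      the nef class \<open>mdeg p \<alpha> - n \<odot> q\<close> outside P corrects this to the
      degree in question.\<close>
    have "mdeg p \<alpha> - n \<odot> q \<in> Nef TYPE('k) X cl"
      using mdeg_diff_Nef[of \<alpha> "{..<s}" p q] A[OF \<alpha>(1)] q by auto
    then have "bpf (mdeg p \<alpha> - n \<odot> q)" by (simp add: Nef_iff_bpf)
    then obtain D where D: "D \<in> exps X" "cl D = mdeg p \<alpha> - n \<odot> q" "(mon D :: ('v, 'k) laurent) \<notin> P"
      using bpf_section[OF P] by metis
    have Dc: "(mon D :: ('v, 'k) laurent) \<in> cox X" "homog (mdeg p \<alpha> - n \<odot> q) (mon D :: ('v, 'k) laurent)"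
      using D homog_single[of D 1] by (auto intro: cox_single exps_divisors)
    show "k \<ge> 0"
    proof (rule intersection_nonneg[OF P _ _ _ i])
      show "g' \<alpha> * mon D \<in> cox X" by (intro cox_mult g'c Dc)
      show "homog (d - n \<odot> q) (g' \<alpha> * mon D)" using homog_mult[OF g'c(2) Dc(2)] by simp
      show "g' \<alpha> * mon D \<notin> P" using subvarietyD(4)[OF P g'c(1) Dc(1)] \<alpha>(2) D(3) by blast
    qed
  qed
qed

section \<open>The inner bound\<close>

text \<open>Without generators 0 is the only nef class. Ample multiples absorb every class, so the
  class of each ray would be 0, which is impossible for a nonzero effective divisor. The inner bound
  treats this case apart, as there is no generator to pad \<lambda> with.\<close>

lemma no_generators_imp_no_rays:
  assumes "minimal_generators [] (Nef TYPE('k::field) X cl)" shows "rays X = {}"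
proof (rule ccontr)
  assume "rays X \<noteq> {}"
  then obtain \<rho> where \<rho>: "\<rho> \<in> rays X" by blast
  have N: "d = 0" if "bpf d" for d
  proof -
    have "d \<in> Nef TYPE('k) X cl" using that by (simp add: Nef_iff_bpf)
    moreover have "Nef TYPE('k) X cl = {0}"
      using assms by (auto simp: minimal_generators_def generated_monoid_def)
    ultimately show ?thesis by blast
  qed
  let ?D = "Poly_Mapping.single \<rho> (1::int)"
  obtain A where "ample X cl A" using ample_ex .
  then have "\<forall>\<^sub>F j in sequentially. bpf (j \<odot> A + 0) \<and> bpf (j \<odot> A + cl ?D)"
    by (intro eventually_conj ample_absorbs)
  then obtain j where "bpf (j \<odot> A + 0)" "bpf (j \<odot> A + cl ?D)"
    using eventually_happens'[OF sequentially_bot] by blast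
  then have "j \<odot> A + 0 = 0" "j \<odot> A + cl ?D = 0" using N by blast+
  then have "cl ?D = 0" by simp
  then have "?D = 0" using effective_class_zero[OF single_exps[OF \<rho>]] by blast
  then have "lk ?D \<rho> = 0" by simp
  then show False by simp
qed

lemma Nef_absorbs_finite:
  assumes "finite F" shows "\<exists>a. \<forall>x\<in>F. a + x \<in> Nef TYPE('k::field) X cl"
proof -
  obtain A where "ample X cl A" using ample_ex .
  then have "\<forall>\<^sub>F j in sequentially. \<forall>x\<in>F. bpf (j \<odot> A + x)"
    by (intro eventually_ball_finite assms ballI ample_absorbs)
  then obtain j where "\<forall>x\<in>F. bpf (j \<odot> A + x)"
    using eventually_happens'[OF sequentially_bot] by blast
  then show ?thesis by (auto simp: Nef_iff_bpf)
qed

lemma inner_bound: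
  fixes f :: "nat \<Rightarrow> ('v, 'k::field) laurent"
  assumes mg: "minimal_generators cs (Nef TYPE('k) X cl)"
    and f: "\<And>i. i < s \<Longrightarrow> f i \<in> cox X \<and> homog (p i) (f i)" and s: "s > 0"
  shows "\<exists>a. \<forall>n q d. (\<forall>i<s. q - p i \<in> Nef TYPE('k) X cl) \<longrightarrow> regular X cl cs (cox X :: ('v, 'k) laurent set) d \<longrightarrow>
    regular X cl cs (scomb X (multisets_of_size {..<s} n) (mprod f)) (n \<odot> q + a + d)"
proof -
  let ?I = "\<lambda>n. scomb X (multisets_of_size {..<s} n) (mprod f)"
  let ?N = "Nef TYPE('k) X cl"
  let ?S = "cox X :: ('v, 'k) laurent set"
  have I: "submod X (?I n)" "?I n \<subseteq> cox X" for n
    using f by (auto simp: multisets_of_size_def intro!: submod_scomb scomb_subset_cox mprod_cox[of s])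
  define good where "good i \<Delta> \<longleftrightarrow> (\<forall>n d.
    (\<forall>(j, e, c)\<in>\<Delta>. \<forall>\<alpha>. set_mset \<alpha> \<subseteq> {..<s} \<longrightarrow> size \<alpha> + c = n \<longrightarrow>
       local_cohomology_vanishes X cl ?S j (d - e - mdeg p \<alpha>)) \<longrightarrow>
    local_cohomology_vanishes X cl (?I n) (Suc i) d)" for i and \<Delta> :: "(nat \<times> 'p \<times> nat) set"
  have "\<forall>i. \<exists>\<Delta>. finite \<Delta> \<and> (\<forall>x\<in>\<Delta>. fst x > i) \<and> good i \<Delta>"
    unfolding good_def by (rule allI, rule uniform_vanishing_powers[OF f])
  from choice[OF this] obtain \<Delta> where \<Delta>0: "\<forall>i. finite (\<Delta> i) \<and> (\<forall>x\<in>\<Delta> i. fst x > i) \<and> good i (\<Delta> i)" ..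
  have \<Delta>: "finite (\<Delta> i)" "\<And>j e c. (j, e, c) \<in> \<Delta> i \<Longrightarrow> j > i" "good i (\<Delta> i)" for i
    using \<Delta>0[rule_format, of i] by (blast, fastforce, blast)
  have van: "local_cohomology_vanishes X cl (?I n) (Suc i) d"
    if "\<And>j e c \<alpha>. (j, e, c) \<in> \<Delta> i \<Longrightarrow> set_mset \<alpha> \<subseteq> {..<s} \<Longrightarrow> size \<alpha> + c = n \<Longrightarrow>
       local_cohomology_vanishes X cl ?S j (d - e - mdeg p \<alpha>)" for i n d
  proof (rule \<Delta>(3)[of i, unfolded good_def, rule_format])
    fix x assume x: "x \<in> \<Delta> i"
    obtain j e c where jec: "x = (j, e, c)" by (cases x)
    show "case x of (j, e, c) \<Rightarrow> \<forall>\<alpha>. set_mset \<alpha> \<subseteq> {..<s} \<longrightarrow> size \<alpha> + c = n \<longrightarrow>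
       local_cohomology_vanishes X cl ?S j (d - e - mdeg p \<alpha>)"
      unfolding jec prod.case using x jec by (intro allI impI that) simp_all
  qed
  \<comment> \<open>All corrections that can occur in cohomological degrees up to the number of
    cones; \<open>c \<odot> p 0\<close> compensates for the c copies of q that are not matched by an
    element of \<alpha>.\<close>
  define F where "F = (\<Union>i\<le>card (cones X). (\<lambda>(j, e, c). c \<odot> p 0 - e) ` \<Delta> i)"
  have "finite F" unfolding F_def by (intro finite_UN_I finite_imageI \<Delta>(1)) simp
  then obtain a where a: "\<And>x. x \<in> F \<Longrightarrow> a + x \<in> ?N" using Nef_absorbs_finite by blast
  have "regular X cl cs (?I n) (n \<odot> q + a + d)"
    if q: "\<forall>i<s. q - p i \<in> ?N" and d: "regular X cl cs ?S d" for n q d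
    unfolding regular_def
  proof (intro conjI allI impI ballI)
    fix j e show "local_cohomology_vanishes X cl (?I n) 0 (n \<odot> q + a + d + cs ! j + e)"
      by (rule vanishes_0[OF I])
  next
    fix i :: nat and l :: "nat \<Rightarrow> nat" and e
    assume i: "i > 0" "(\<Sum>j<length cs. l j) = i - 1" and e: "e \<in> ?N"
    obtain i' where i': "i = Suc i'" using i(1) by (cases i) auto
    let ?C = "\<Sum>j<length cs. l j \<odot> cs ! j"
    show "local_cohomology_vanishes X cl (?I n) i (n \<odot> q + a + d - ?C + e)"
    proof (cases "i > card (cones X)")
      case True
      then show ?thesis by (rule vanishes_large[OF I])
    next
      case False
      show ?thesis unfolding i'
      proof (rule van)
        fix j \<delta> c \<alpha> assume x: "(j, \<delta>, c) \<in> \<Delta> i'" and \<alpha>: "set_mset \<alpha> \<subseteq> {..<s}" "size \<alpha> + c = n"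
        have ji: "j \<ge> i" using \<Delta>(2)[OF x] i' by simp
        show "local_cohomology_vanishes X cl ?S j (n \<odot> q + a + d - ?C + e - \<delta> - mdeg p \<alpha>)"
        proof (cases "j > card (cones X)")
          case True
          then show ?thesis by (rule vanishes_large[OF submod_cox subset_refl])
        next
          case jle: False
          have "c \<odot> p 0 - \<delta> \<in> F" unfolding F_def using x False i' by force
          then have 1: "a + (c \<odot> p 0 - \<delta>) \<in> ?N" by (rule a)
          have 2: "size \<alpha> \<odot> q - mdeg p \<alpha> \<in> ?N" using mdeg_diff_Nef'[OF \<alpha>(1), of q p] q by auto
          have 3: "c \<odot> (q - p 0) \<in> ?N" using q s by (intro Nef_nat_mult) auto
          have nq: "n \<odot> q = size \<alpha> \<odot> q + c \<odot> q" by (simp flip: \<alpha>(2) add: nat_mult_add)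
          \<comment> \<open>\<open>n \<odot> q\<close> splits into the part compared with the
            degrees in \<alpha> and c copies compared with \<open>p 0\<close>; every summand is
            nef.\<close>
          define y where "y = e + (a + (c \<odot> p 0 - \<delta>)) + (size \<alpha> \<odot> q - mdeg p \<alpha>) + c \<odot> (q - p 0)"
          have y: "y \<in> ?N" unfolding y_def by (intro Nef_add e 1 2 3)
          have eq: "n \<odot> q + a + d - ?C + e - \<delta> - mdeg p \<alpha> = d - ?C + y"
            unfolding y_def nq by (simp add: nat_mult_diff_right algebra_simps)
          show ?thesis
          proof (cases "cs = []")
            case True
            \<comment> \<open>The variety is a point: the zero cone is the only one, so the complex
              has length at most one and j = i.\<close>
            have "rays X = {}" using no_generators_imp_no_rays mg True by simp
            then have "cones X \<subseteq> {{}}" using cone_rays by blast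
            then have "card (cones X) \<le> 1" using card_mono[of "{{}}" "cones X"] by simp
            then have "j = i" using ji jle i(1) by linarith
            then show ?thesis unfolding eq using regularD[OF d i y] by simp
          next
            case False
            \<comment> \<open>\<lambda> is padded at the first generator to reach total j - 1; the
              multiple \<open>(j - i) \<odot> cs ! 0\<close> subtracted in this way is nef and is
              added back through \<open>c0\<close>.\<close>
            let ?l = "\<lambda>k. l k + (if k = 0 then j - i else 0)"
            have len: "0 < length cs" using False by simp
            have "(\<Sum>k<length cs. ?l k) = (i - 1) + (j - i)"
              unfolding sum.distrib i(2) using len by (simp add: sum.delta)
            then have sl: "(\<Sum>k<length cs. ?l k) = j - 1" using ji i(1) by simp
            have "(\<Sum>k<length cs. ?l k \<odot> cs ! k) = ?C + (\<Sum>k<length cs. if k = 0 then (j - i) \<odot> cs ! 0 else 0)"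
              unfolding sum.distrib[symmetric] by (intro sum.cong) (auto simp: nat_mult_add)
            then have C: "(\<Sum>k<length cs. ?l k \<odot> cs ! k) = ?C + (j - i) \<odot> cs ! 0" using len by (simp add: sum.delta)
            have c0: "(j - i) \<odot> cs ! 0 \<in> ?N"
              using generator_Nef[OF mg, of "cs ! 0"] len by (intro Nef_nat_mult) simp
            have j0: "j > 0" using ji i(1) by simp
            show ?thesis unfolding eq using regularD[OF d j0 sl Nef_add[OF c0 y]]
              unfolding C by (simp add: algebra_simps)
          qed
        qed
      qed
    qed
  qed
  then show ?thesis by (intro exI[of _ a]) blast
qed

lemma scomb_homog_coefficients:
  assumes "x \<in> scomb X E w" "homog d x" "\<And>e. e \<in> E \<Longrightarrow> homog (wd e) (w e)"
  obtains g where "\<And>e. e \<in> E \<Longrightarrow> g e \<in> cox X" "\<And>e. e \<in> E \<Longrightarrow> homog (d - wd e) (g e)" "x = (\<Sum>e\<in>E. g e * w e)"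
proof -
  obtain g where g: "\<forall>e\<in>E. g e \<in> cox X" "x = (\<Sum>e\<in>E. g e * w e)" using assms(1) by (auto simp: scomb_def)
  have "x = hc d x" using assms(2) by (simp add: hc_homog)
  also have "\<dots> = (\<Sum>e\<in>E. hc d (g e * w e))" unfolding g(2) by (rule hc_sum)
  also have "\<dots> = (\<Sum>e\<in>E. hc (d - wd e) (g e) * w e)"
  proof (rule sum.cong[OF refl])
    fix e assume e: "e \<in> E"
    show "hc d (g e * w e) = hc (d - wd e) (g e) * w e"
      using hc_mult[OF cox_divisors assms(3)[OF e], of "g e" "d - wd e"] g(1) e by simp
  qed
  finally show ?thesis using that[of "\<lambda>e. hc (d - wd e) (g e)"] g(1)
    by (simp add: hc_cox homog_hc cox_divisors)
qed

text \<open>Exponents of nonzero factors would be effective divisors of opposite nonzero classes,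
  against \<open>effective_classes_opposite\<close>.\<close>

lemma product_of_opposite_degrees:
  fixes a b :: "('v, 'k::field) laurent"
  assumes "a \<in> cox X" "b \<in> cox X" "homog d a" "homog (- d) b" "d \<noteq> 0"
  shows "a * b = 0"
proof (rule ccontr)
  assume "a * b \<noteq> 0"
  then have "ks a \<noteq> {}" "ks b \<noteq> {}"
    by (metis in_keys_iff lookup_zero poly_mapping_eqI empty_iff mult_zero_left mult_zero_right)+
  then obtain x y where xy: "x \<in> ks a" "y \<in> ks b" by blast
  then have "x \<in> exps X" "y \<in> exps X" "cl x = d" "cl y = - d" using assms by (auto simp: cox_iff homog_def)
  then show False using effective_classes_opposite[of x y] assms(5) by simp
qed

definition homog_gens :: "('v, 'k::field) laurent set \<Rightarrow> nat \<Rightarrow> (nat \<Rightarrow> ('v, 'k) laurent) \<Rightarrow> (nat \<Rightarrow> 'p) \<Rightarrow> bool" where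
  "homog_gens I s f p \<longleftrightarrow> (\<forall>i<s. f i \<noteq> 0 \<and> f i \<in> cox X \<and> homog (p i) (f i)) \<and> I = scomb X {..<s} f"

text \<open>If the degree of \<open>f0 k\<close> did not occur in p, then on expressing
  \<open>f0 k\<close> by f and back by f0 the coefficients \<open>a i\<close> and \<open>b k\<close>
  would have opposite nonzero degrees and product 0. So \<open>f0 k\<close> would be redundant,
  against the minimal number s0. This transfers the hypothesis on the degrees of any generators to
  those of f0.\<close>

lemma minimal_generator_degrees:
  fixes f :: "nat \<Rightarrow> ('v, 'k::field) laurent"
  assumes min: "homog_gens I s0 f0 p0" "\<And>s f p. homog_gens I s f p \<Longrightarrow> s0 \<le> s"
    and f: "homog_gens I s f p" and k: "k < s0"
  shows "\<exists>i<s. p i = p0 k"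
proof (rule ccontr)
  assume "\<not> (\<exists>i<s. p i = p0 k)"
  then have ne: "p i \<noteq> p0 k" if "i < s" for i using that by blast
  have f0: "\<And>i. i < s0 \<Longrightarrow> f0 i \<noteq> 0 \<and> f0 i \<in> cox X \<and> homog (p0 i) (f0 i)" "I = scomb X {..<s0} f0"
    and f': "\<And>i. i < s \<Longrightarrow> f i \<noteq> 0 \<and> f i \<in> cox X \<and> homog (p i) (f i)" "I = scomb X {..<s} f"
    using min(1) f by (auto simp: homog_gens_def)
  let ?E = "{..<s0} - {k}"
  let ?T = "scomb X ?E f0"
  have fE: "f0 l \<in> ?T" if "l \<in> ?E" for l by (rule scomb_gen[OF _ that]) simp
  have sm: "submod X ?T" by (rule submod_scomb)
  have "f0 k \<in> scomb X {..<s} f" unfolding f'(2)[symmetric] f0(2) using k by (intro scomb_gen) auto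
  then obtain a where a: "\<And>i. i \<in> {..<s} \<Longrightarrow> a i \<in> cox X" "\<And>i. i \<in> {..<s} \<Longrightarrow> homog (p0 k - p i) (a i)"
    "f0 k = (\<Sum>i<s. a i * f i)"
    by (rule scomb_homog_coefficients[of "f0 k" "{..<s}" f "p0 k" p]) (use f0(1)[OF k] f'(1) in auto)
  have "a i * f i \<in> ?T" if i: "i < s" for i
  proof -
    have "f i \<in> scomb X {..<s0} f0" unfolding f0(2)[symmetric] f'(2) using i by (intro scomb_gen) auto
    then obtain b where b: "\<And>l. l \<in> {..<s0} \<Longrightarrow> b l \<in> cox X" "\<And>l. l \<in> {..<s0} \<Longrightarrow> homog (p i - p0 l) (b l)"
      "f i = (\<Sum>l<s0. b l * f0 l)"
      by (rule scomb_homog_coefficients[of "f i" "{..<s0}" f0 "p i" p0]) (use f'(1)[OF i] f0(1) in auto)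
    have "a i * b k = 0"
    proof (rule product_of_opposite_degrees)
      show "homog (p0 k - p i) (a i)" "a i \<in> cox X" using a i by auto
      show "homog (- (p0 k - p i)) (b k)" "b k \<in> cox X" using b(1,2)[of k] k by auto
      show "p0 k - p i \<noteq> 0" using ne[OF i] by simp
    qed
    have "a i * f i = (\<Sum>l<s0. a i * b l * f0 l)" unfolding b(3) by (simp add: sum_distrib_left mult.assoc)
    also have "\<dots> = a i * b k * f0 k + (\<Sum>l\<in>?E. a i * b l * f0 l)" using k by (intro sum.remove) auto
    also have "\<dots> = (\<Sum>l\<in>?E. a i * b l * f0 l)" by (simp add: \<open>a i * b k = 0\<close>)
    also have "\<dots> \<in> ?T"
      using a(1) b(1) i by (intro submod_sum[OF sm] submod_smult[OF sm] cox_mult fE) auto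
    finally show ?thesis .
  qed
  then have "f0 k \<in> ?T" unfolding a(3) by (intro submod_sum[OF sm]) auto
  then have "scomb X {..<s0} f0 \<subseteq> ?T" using fE by (intro scomb_minimal[OF sm]) auto
  moreover have "?T \<subseteq> scomb X {..<s0} f0" by (intro scomb_minimal submod_scomb) (auto intro: scomb_gen)
  ultimately have IT: "I = ?T" using f0(2) by blast
  \<comment> \<open>Renumbers the indices other than k, since families of generators are indexed by
    initial segments.\<close>
  define g where "g l = (if l < k then l else Suc l)" for l
  have gE: "g ` {..<s0 - 1} = ?E"
  proof (intro equalityI subsetI)
    fix x assume x: "x \<in> ?E"
    then consider "x < k" | "x > k" by fastforce
    then show "x \<in> g ` {..<s0 - 1}"
    proof cases
      case 1
      then show ?thesis using k by (intro image_eqI[of _ _ x]) (auto simp: g_def)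
    next
      case 2
      then show ?thesis using x by (intro image_eqI[of _ _ "x - 1"]) (auto simp: g_def)
    qed
  qed (use k in \<open>auto simp: g_def split: if_splits\<close>)
  have "scomb X {..<s0 - 1} (\<lambda>l. f0 (g l)) = ?T"
  proof
    show "scomb X {..<s0 - 1} (\<lambda>l. f0 (g l)) \<subseteq> ?T"
      using gE fE by (intro scomb_minimal[OF sm]) auto
    show "?T \<subseteq> scomb X {..<s0 - 1} (\<lambda>l. f0 (g l))"
    proof (rule scomb_minimal[OF submod_scomb])
      show "f0 ` ?E \<subseteq> scomb X {..<s0 - 1} (\<lambda>l. f0 (g l))"
        unfolding gE[symmetric] using scomb_gen[of "{..<s0 - 1}" _ "\<lambda>l. f0 (g l)"] by auto
    qed
  qed
  moreover have "g l < s0" if "l < s0 - 1" for l using that by (auto simp: g_def)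
  ultimately have "homog_gens I (s0 - 1) (\<lambda>l. f0 (g l)) (\<lambda>l. p0 (g l))"
    using f0(1) IT unfolding homog_gens_def by auto
  then have "s0 \<le> s0 - 1" by (rule min(2))
  then show False using k by simp
qed

end

theorem theorem5p1:
  fixes X :: "'v fan"
    and cl :: "('v \<Rightarrow>\<^sub>0 int) \<Rightarrow> 'p::ab_group_add"
    and cs :: "'p list"
    and I :: "('v, 'k::field) laurent set"
  assumes "smooth_projective_fan X"
    and "picard_group X cl"
    and "minimal_generators cs (Nef TYPE('k) X cl)"
    and "homogeneous_ideal X cl I"
    and "I \<noteq> {0}"
  shows "\<exists>a :: 'p. \<forall>(s :: nat) (f :: nat \<Rightarrow> ('v, 'k) laurent) (p :: nat \<Rightarrow> 'p).
           (\<forall>i<s. f i \<noteq> 0 \<and> f i \<in> degree_part cl (carrier (cox_ring X)) (p i)) \<and>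
           I = genideal (cox_ring X) (f ` {..<s}) \<longrightarrow>
           (\<forall>(n :: nat) (q1 :: 'p) (q2 :: 'p).
              n > 0 \<and>
              (\<forall>i<s. q1 - p i \<in> Nef TYPE('k) X cl \<and> p i - q2 \<in> Nef TYPE('k) X cl) \<longrightarrow>
              {n \<odot> q1 + a + d | d. d \<in> reg X cl cs (carrier (cox_ring X) :: ('v, 'k) laurent set)}
                \<subseteq> reg X cl cs (I [^]\<^bsub>ideals_set (cox_ring X)\<^esub> n) \<and>
              reg X cl cs (I [^]\<^bsub>ideals_set (cox_ring X)\<^esub> n)
                \<subseteq> {n \<odot> q2 + e | e. e \<in> Nef TYPE('k) X cl})"
proof -
  interpret toric_var X cl by unfold_locales (rule assms(1), rule assms(2))
  note mg = assms(3)
  have gens: "homog_gens I s f p"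
    if g1: "\<forall>i<s. f i \<noteq> 0 \<and> f i \<in> degree_part cl (carrier (cox_ring X)) (p i)"
      and g2: "I = genideal (cox_ring X) (f ` {..<s})" for s f p
  proof -
    have fc: "f i \<in> cox X" "homog (p i) (f i)" if i: "i < s" for i
    proof -
      have "f i \<in> degree_part cl (cox X) (p i)" using g1 i by blast
      then show "f i \<in> cox X" "homog (p i) (f i)"
        using cox_divisors[of "f i"] by (auto simp: degree_part_def homog_def)
    qed
    then have "I = scomb X {..<s} f" unfolding g2 by (intro genideal_eq_scomb) auto
    then show ?thesis using fc g1 by (simp add: homog_gens_def)
  qed
  have pow: "I [^]\<^bsub>ideals_set (cox_ring X)\<^esub> n = scomb X (multisets_of_size {..<s} n) (mprod f)"
    if "homog_gens I s f p" for s f p n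
  proof (rule ideal_power_eq_scomb)
    show fc: "\<And>i. i < s \<Longrightarrow> f i \<in> cox X" using that by (simp add: homog_gens_def)
    show "I = genideal (cox_ring X) (f ` {..<s})"
      using that genideal_eq_scomb[of "{..<s}" f X] fc by (auto simp: homog_gens_def)
  qed
  have pos: "s > 0" if "homog_gens I s f p" for s f p
    using that assms(5) by (cases "s = 0") (auto simp: homog_gens_def scomb_def)
  show ?thesis
  proof (cases "\<exists>s f p. homog_gens I s f p")
    case False
    \<comment> \<open>No admissible family of generators exists, so any \<open>a\<close>
      serves.\<close>
    show ?thesis using False gens by blast
  next
    case True
    \<comment> \<open>f0 is chosen from I alone, before s, f, p, n and the classes q are introduced,
      and \<open>a\<close> inherits this independence.\<close>
    define s0 where "s0 = (LEAST s. \<exists>f p. homog_gens I s f p)"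
    have "\<exists>f p. homog_gens I s0 f p" unfolding s0_def using True by (rule LeastI_ex)
    then obtain f0 p0 where g0: "homog_gens I s0 f0 p0" by blast
    have min: "s0 \<le> s" if "homog_gens I s f p" for s f p
      unfolding s0_def using that by (intro Least_le) blast
    have f0: "\<And>i. i < s0 \<Longrightarrow> f0 i \<in> cox X \<and> homog (p0 i) (f0 i)" using g0 by (simp add: homog_gens_def)
    from inner_bound[OF mg f0 pos[OF g0]] obtain a where
      a: "\<forall>n q d. (\<forall>i<s0. q - p0 i \<in> Nef TYPE('k) X cl) \<longrightarrow> regular X cl cs (cox X :: ('v, 'k) laurent set) d \<longrightarrow>
      regular X cl cs (scomb X (multisets_of_size {..<s0} n) (mprod f0)) (n \<odot> q + a + d)" ..
    show ?thesis
    proof (intro exI[of _ a] allI impI)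
      fix s :: nat and f :: "nat \<Rightarrow> ('v, 'k) laurent" and p :: "nat \<Rightarrow> 'p" and n :: nat and q1 q2 :: 'p
      assume "(\<forall>i<s. f i \<noteq> 0 \<and> f i \<in> degree_part cl (carrier (cox_ring X)) (p i)) \<and>
           I = genideal (cox_ring X) (f ` {..<s})"
        and q: "n > 0 \<and> (\<forall>i<s. q1 - p i \<in> Nef TYPE('k) X cl \<and> p i - q2 \<in> Nef TYPE('k) X cl)"
      then have g: "homog_gens I s f p" using gens by blast
      \<comment> \<open>The hypothesis bounds the degrees of f; those of f0 occur among
        them.\<close>
      have q0: "\<forall>i<s0. q1 - p0 i \<in> Nef TYPE('k) X cl"
      proof (intro allI impI)
        fix k assume "k < s0"
        then have "\<exists>i<s. p i = p0 k" by (rule minimal_generator_degrees[OF g0 _ g, rotated]) (rule min)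
        then obtain i where "i < s" "p i = p0 k" by blast
        then show "q1 - p0 k \<in> Nef TYPE('k) X cl" using q by metis
      qed
      show "{n \<odot> q1 + a + d | d. d \<in> reg X cl cs (carrier (cox_ring X) :: ('v, 'k) laurent set)}
                \<subseteq> reg X cl cs (I [^]\<^bsub>ideals_set (cox_ring X)\<^esub> n) \<and>
              reg X cl cs (I [^]\<^bsub>ideals_set (cox_ring X)\<^esub> n)
                \<subseteq> {n \<odot> q2 + e | e. e \<in> Nef TYPE('k) X cl}"
      proof
        show "{n \<odot> q1 + a + d | d. d \<in> reg X cl cs (carrier (cox_ring X) :: ('v, 'k) laurent set)}
                \<subseteq> reg X cl cs (I [^]\<^bsub>ideals_set (cox_ring X)\<^esub> n)"
          unfolding pow[OF g0] reg_def
        proof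
          fix x assume "x \<in> {n \<odot> q1 + a + d | d. d \<in> {d. regular X cl cs (cox X :: ('v, 'k) laurent set) d}}"
          then obtain d where d: "x = n \<odot> q1 + a + d" "regular X cl cs (cox X :: ('v, 'k) laurent set) d" by blast
          show "x \<in> {d. regular X cl cs (scomb X (multisets_of_size {..<s0} n) (mprod f0)) d}"
            unfolding d(1) using a[rule_format, OF q0[rule_format] d(2)] by simp
        qed
        show "reg X cl cs (I [^]\<^bsub>ideals_set (cox_ring X)\<^esub> n)
                \<subseteq> {n \<odot> q2 + e | e. e \<in> Nef TYPE('k) X cl}"
        proof
          fix d assume "d \<in> reg X cl cs (I [^]\<^bsub>ideals_set (cox_ring X)\<^esub> n)"
          then have d: "regular X cl cs (scomb X (multisets_of_size {..<s} n) (mprod f)) d"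
            unfolding pow[OF g] reg_def by simp
          have "d - n \<odot> q2 \<in> Nef TYPE('k) X cl"
            by (rule outer_bound[OF mg _ pos[OF g] _ d, where p = p]) (use g q in \<open>auto simp: homog_gens_def\<close>)
          then show "d \<in> {n \<odot> q2 + e | e. e \<in> Nef TYPE('k) X cl}"
            by (intro CollectI exI[of _ "d - n \<odot> q2"]) simp
        qed
      qed
    qed
  qed
qed

end
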